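(* Let $p$ be a fixed point on a complex manifold $M$. Let $\chi_1,\dots,\chi_m\in\mathcal{O}_p$ be non-constant germs of holomorphic functions at $p$ and write $\chi=(\chi_1,\dots,\chi_m)$. The following statements hold. (i) If $\chi_1,\dots,\chi_m\in\tilde{\mathcal{O}}_p$ are germs of holomorphic polynomials (in some local holomorphic coordinates near $p$), $a_1,\dots,a_m$ are non-zero real numbers and $\alpha<0$ is a real number, then $$\Bigl(1+\sum_{i=1}^m a_i|\chi_i|^2\Bigr)^{\alpha}\notin \Lambda_p\setminus\mathbb{R}_p .$$ (ii) Let $\chi_1,\dots,\chi_m\in\tilde{\mathcal{O}}_p$ and let $$H(z,\overline w)=R\Bigl(\prod_{j=1}^{\kappa_1}H_j^{\mu_j}(z,\overline w)\Bigr)\prod_{j=\kappa_1+1}^{\kappa_1+\kappa_2}H_j^{\mu_j}(z,\overline w),$$ where $H_1(z,\overline w),\dots,H_{\kappa_1+\kappa_2}(z,\overline w)$ are Hermitian symmetric, Nash algebraic functions that do not have non-constant pluriharmonic terms, $R(\cdot)$ is a rational function with real coefficients, and $\mu_1,\dots,\mu_{\kappa_1+\kappa_2}\in\mathbb{R}$. Then for every $\mu\in\mathbb{R}$, $$\exp\bigl(H(\chi,\overline\chi)\bigr)\notin\Lambda_p^{\mu}\setminus\mathbb{R}_p\qquad\text{and}\qquad \log\bigl(H(\chi,\overline\chi)\bigr)\notin\tilde\Lambda_p^{\mu}\setminus\mathbb{R}_p .$$ (iii) Let $H(z,\overline w)$ be a Hermitian symmetric, Nash algebraic function. Then for every $\mu\in\mathbb{R}$,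 $$\exp\bigl(H(\chi,\overline\chi)\bigr)\notin\tilde\Lambda_p^{\mu}\setminus\mathbb{R}_p\qquad\text{and}\qquad \log H(\chi,\overline\chi)\notin\tilde\Lambda_p^{\mu}\setminus\mathbb{R}_p .$$ If, in addition, $H(z,\overline w)$ does not have non-constant pluriharmonic terms and $\chi_1,\dots,\chi_m\in\tilde{\mathcal{O}}_p$, then for every $\kappa\ge 1$ and all $\nu_1,\dots,\nu_\kappa\in\mathbb{R}$, $$\exp\bigl(H(\chi,\overline\chi)\bigr)\notin\prod_{j=1}^{\kappa}\Lambda_p^{\nu_j}\setminus\mathbb{R}_p\qquad\text{and}\qquad \log H(\chi,\overline\chi)\notin\prod_{j=1}^{\kappa}\tilde\Lambda_p^{\nu_j}\setminus\mathbb{R}_p .$$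
   Context: Notation. For a complex manifold $M$ and $p\in M$, $\mathcal{O}_p$ is the local ring of germs of holomorphic functions at $p$, and $\tilde{\mathcal{O}}_p=\{\chi\in\mathcal{O}_p : \chi(p)=0\}$. Define sets of germs at $p$ of real-valued real-analytic functions by $$\Lambda_p=\Bigl\{\sum_{j=1}^{k}a_j|\chi_j|^2 : k\in\mathbb{N},\ \chi_j\in\mathcal{O}_p,\ a_j\in\mathbb{R}\Bigr\},\qquad \tilde\Lambda_p=\Bigl\{a_0+\sum_{j=1}^{k}a_j|\chi_j|^2 : k\in\mathbb{N},\ \chi_j\in\tilde{\mathcal{O}}_p,\ a_0,a_j\in\mathbb{R}\Bigr\}.$$ $\mathbb{R}_p$ denotes the germs at $p$ of real constant functions. For real numbers $\nu_1,\dots,\nu_\kappa$, $$\prod_{j=1}^{\kappa}\Lambda_p^{\nu_j}=\Bigl\{\prod_{j=1}^{\kappa}h_j^{\nu_j} : h_1,\dots,h_\kappa\in\Lambda_p\Bigr\},$$ and $\prod_{j=1}^\kappa\tilde\Lambda_p^{\nu_j}$ is defined in the same way with $h_j\in\tilde\Lambda_p$; $\Lambda_p^\mu$ and $\tilde\Lambda_p^\mu$ are the case $\kappa=1$. A holomorphic function $f$ on a domain of $\mathbb{C}^n$ is Nash algebraic if it is algebraic over the field of rational functions, i.e. there is a non-zero polynomial $P(x,y)$ in $(x,y)\in\mathbb{C}^n\times\mathbb{C}$ with $P(x,f(x))\equiv0$. A function $H(z,\overline w)$, $z,w\in\mathbb{C}^m$, is Nash algebraic if it is holomorphic and Nash algebraic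 as a function of the $2m$ independent variables $(z,\overline w)$; it is defined near $(\chi(p),\overline{\chi(p)})$ (near $(0,0)$ when $\chi_1,\dots,\chi_m\in\tilde{\mathcal O}_p$). It is Hermitian symmetric if $\overline{H(z,\overline w)}=H(w,\overline z)$. It does not have non-constant pluriharmonic terms if in its Taylor expansion at $(0,0)$ there are no non-constant terms purely in $z$ or purely in $\overline w$, i.e. $H(z,0)$ and $H(0,\overline w)$ are constant. $H(\chi,\overline\chi)$ is the germ at $p$ obtained by substituting $z=w=\chi$. Convention: the expressions involving real powers, quotients, the rational function $R$ and logarithms are considered only when they are well defined as germs at $p$ of real-analytic functions. *)

theory Defs
  imports "HOL-Analysis.Analysis" "HOL-Computational_Algebra.Polynomial"
begin

section \<open>Holomorphic and real-analytic functions of several variables\<close>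

text \<open>Complex differentiability: real (total) differentiability with a complex-linear derivative;
  only used for open sets.\<close>

definition cholomorphic_on :: "(complex ^ 'k \<Rightarrow> complex) \<Rightarrow> (complex ^ 'k) set \<Rightarrow> bool"
    (infix \<open>cholomorphic'_on\<close> 50) where
  "f cholomorphic_on S \<longleftrightarrow>
     (\<forall>z\<in>S. \<exists>f'. (f has_derivative f') (at z within S) \<and> (\<forall>c v. f' (c *s v) = c * f' v))"

text \<open>Local expansion into a convergent power series in the real coordinates; the multi-indices
  are the extensional functions from the basis to the natural numbers.\<close>

definition real_analytic_at :: "('e::euclidean_space \<Rightarrow> real) \<Rightarrow> 'e \<Rightarrow> bool" where
  "real_analytic_at f a \<longleftrightarrow>
     (\<exists>c r. r > 0 \<and>
        (\<forall>x\<in>ball a r.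
           ((\<lambda>k. c k * (\<Prod>b\<in>Basis. ((x - a) \<bullet> b) ^ k b)) has_sum f x) (Basis \<rightarrow>\<^sub>E UNIV)))"

definition monomial_fun :: "('k::finite \<Rightarrow> nat) \<Rightarrow> complex ^ 'k \<Rightarrow> complex" where
  "monomial_fun k z = (\<Prod>i\<in>UNIV. (z $ i) ^ k i)"

definition holomorphic_polynomial :: "(complex ^ 'k::finite \<Rightarrow> complex) \<Rightarrow> bool" where
  "holomorphic_polynomial f \<longleftrightarrow>
     (\<exists>S c. finite S \<and> (\<forall>z. f z = (\<Sum>k\<in>S. c k * monomial_fun k z)))"

section \<open>Complex manifolds and germs\<close>

text \<open>A complex manifold is given by a holomorphic atlas on a Hausdorff, second countable space
  (these two properties are sort constraints); its points are those covered by the charts.\<close>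

type_synonym ('a, 'n) chart = "'a set \<times> ('a \<Rightarrow> complex ^ 'n)"

definition is_chart :: "('a::topological_space, 'n::finite) chart \<Rightarrow> bool" where
  "is_chart = (\<lambda>(U, \<phi>). open U \<and> open (\<phi> ` U) \<and> homeomorphism U (\<phi> ` U) \<phi> (inv_into U \<phi>))"

definition holomorphic_transition :: "('a, 'n::finite) chart \<Rightarrow> ('a, 'n::finite) chart \<Rightarrow> bool" where
  "holomorphic_transition = (\<lambda>(U, \<phi>) (V, \<psi>).
     \<forall>i. (\<lambda>z. \<psi> (inv_into U \<phi> z) $ i) cholomorphic_on (\<phi> ` (U \<inter> V)))"

definition complex_manifold ::
    "('a::{second_countable_topology,t2_space}, 'n::finite) chart set \<Rightarrow> bool" where
  "complex_manifold A \<longleftrightarrow>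
     (\<forall>c\<in>A. is_chart c) \<and> (\<forall>c\<in>A. \<forall>d\<in>A. holomorphic_transition c d)"

definition manifold_points :: "('a, 'n::finite) chart set \<Rightarrow> 'a set" where
  "manifold_points A = (\<Union>(U, \<phi>)\<in>A. U)"

text \<open>Local holomorphic coordinates near a point: any chart around it that is compatible with
  the atlas, not only those in the atlas.\<close>

definition local_coordinates ::
    "('a::topological_space, 'n::finite) chart set \<Rightarrow> 'a \<Rightarrow> ('a, 'n::finite) chart \<Rightarrow> bool" where
  "local_coordinates A p c \<longleftrightarrow> p \<in> fst c \<and> is_chart c \<and>
     (\<forall>d\<in>A. holomorphic_transition c d \<and> holomorphic_transition d c)"

definition germ_at :: "'a::topological_space \<Rightarrow> ('a \<Rightarrow> 'b) \<Rightarrow> ('a \<Rightarrow> 'b) set" where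
  "germ_at p f = {g. \<forall>\<^sub>F x in nhds p. g x = f x}"

lemma germ_at_eq_iff: "germ_at p f = germ_at p g \<longleftrightarrow> (\<forall>\<^sub>F x in nhds p. f x = g x)"
proof
  assume "germ_at p f = germ_at p g"
  moreover have "f \<in> germ_at p f" by (simp add: germ_at_def)
  ultimately show "\<forall>\<^sub>F x in nhds p. f x = g x" by (simp add: germ_at_def)
next
  assume eq: "\<forall>\<^sub>F x in nhds p. f x = g x"
  have "(\<forall>\<^sub>F x in nhds p. h x = f x) \<longleftrightarrow> (\<forall>\<^sub>F x in nhds p. h x = g x)" for h
    by (rule eventually_cong[OF eq]) simp
  then show "germ_at p f = germ_at p g" by (simp add: germ_at_def)
qed

definition const_germs :: "'a::topological_space \<Rightarrow> ('a \<Rightarrow> 'b) set set" where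
  "const_germs p = {germ_at p (\<lambda>x. c) | c. True}"

definition holomorphic_near ::
    "('a::topological_space, 'n::finite) chart set \<Rightarrow> 'a \<Rightarrow> ('a \<Rightarrow> complex) \<Rightarrow> bool" where
  "holomorphic_near A p f \<longleftrightarrow>
     (\<exists>(U, \<phi>)\<in>A. \<exists>V. open V \<and> p \<in> V \<and> V \<subseteq> U \<and> (f \<circ> inv_into U \<phi>) cholomorphic_on (\<phi> ` V))"

definition real_analytic_near ::
    "('a::topological_space, 'n::finite) chart set \<Rightarrow> 'a \<Rightarrow> ('a \<Rightarrow> real) \<Rightarrow> bool" where
  "real_analytic_near A p f \<longleftrightarrow>
     (\<exists>(U, \<phi>)\<in>A. p \<in> U \<and> real_analytic_at (f \<circ> inv_into U \<phi>) (\<phi> p))"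

definition hol_germs ::
    "('a::topological_space, 'n::finite) chart set \<Rightarrow> 'a \<Rightarrow> ('a \<Rightarrow> complex) set set" where
  "hol_germs A p = {germ_at p f | f. holomorphic_near A p f}"

definition hol_germs0 ::
    "('a::topological_space, 'n::finite) chart set \<Rightarrow> 'a \<Rightarrow> ('a \<Rightarrow> complex) set set" where
  "hol_germs0 A p = {germ_at p f | f. holomorphic_near A p f \<and> f p = 0}"

section \<open>The sets of germs \<open>\<Lambda>\<^sub>p\<close>, \<open>\<Lambda>\<^sub>p\<close> tilde and their products of powers\<close>

definition Lambda ::
    "('a::topological_space, 'n::finite) chart set \<Rightarrow> 'a \<Rightarrow> ('a \<Rightarrow> real) set set" where
  "Lambda A p =
     {germ_at p (\<lambda>x. \<Sum>j<k. a j * (cmod (f j x))\<^sup>2) | (k::nat) a f.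
        \<forall>j<k. germ_at p (f j) \<in> hol_germs A p}"

definition Lambda0 ::
    "('a::topological_space, 'n::finite) chart set \<Rightarrow> 'a \<Rightarrow> ('a \<Rightarrow> real) set set" where
  "Lambda0 A p =
     {germ_at p (\<lambda>x. a\<^sub>0 + (\<Sum>j<k. a j * (cmod (f j x))\<^sup>2)) | (k::nat) a\<^sub>0 a f.
        \<forall>j<k. germ_at p (f j) \<in> hol_germs0 A p}"

text \<open>The real power of a real number: an arbitrary exponent for a positive base, a non-negative
  exponent for base 0, an integer exponent for a negative base. Outside of this range the value
  of \<open>real_power\<close> is irrelevant. (The library's \<open>powr\<close> alone is wrong for negative bases
  and for the exponent 0 at 0.)\<close>

definition power_defined :: "real \<Rightarrow> real \<Rightarrow> bool" where
  "power_defined x \<nu> \<longleftrightarrow> x > 0 \<or> (x = 0 \<and> \<nu> \<ge> 0) \<or> (x < 0 \<and> \<nu> \<in> \<int>)"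

definition real_power :: "real \<Rightarrow> real \<Rightarrow> real" where
  "real_power x \<nu> = (if \<nu> \<in> \<int> then x powi \<lfloor>\<nu>\<rfloor> else x powr \<nu>)"

text \<open>The products of powers of elements of \<open>L\<close> that are well defined as germs of real-analytic
  functions: all powers make sense at every point near \<open>p\<close>, and the product is real-analytic.\<close>

definition power_products ::
    "('a::topological_space, 'n::finite) chart set \<Rightarrow> 'a \<Rightarrow> ('a \<Rightarrow> real) set set
      \<Rightarrow> nat \<Rightarrow> (nat \<Rightarrow> real) \<Rightarrow> ('a \<Rightarrow> real) set set" where
  "power_products A p L \<kappa> \<nu> =
     {germ_at p (\<lambda>x. \<Prod>j<\<kappa>. real_power (h j x) (\<nu> j)) | h.
        (\<forall>j<\<kappa>. germ_at p (h j) \<in> L \<and> (\<forall>\<^sub>F x in nhds p. power_defined (h j x) (\<nu> j))) \<and>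
        real_analytic_near A p (\<lambda>x. \<Prod>j<\<kappa>. real_power (h j x) (\<nu> j))}"

definition powers ::
    "('a::topological_space, 'n::finite) chart set \<Rightarrow> 'a \<Rightarrow> ('a \<Rightarrow> real) set set
      \<Rightarrow> real \<Rightarrow> ('a \<Rightarrow> real) set set" where
  "powers A p L \<mu> = power_products A p L 1 (\<lambda>_. \<mu>)"

section \<open>Nash algebraic functions\<close>

text \<open>A polynomial in \<open>(x, y)\<close> is given by finitely many coefficients \<open>c (k, d)\<close>, for the
  monomials \<open>x^k y^d\<close>, not all zero.\<close>

definition nash_algebraic_on :: "(complex ^ 'k::finite \<Rightarrow> complex) \<Rightarrow> (complex ^ 'k) set \<Rightarrow> bool" where
  "nash_algebraic_on f D \<longleftrightarrow> f cholomorphic_on D \<and>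
     (\<exists>S c. finite S \<and> (\<exists>s\<in>S. c s \<noteq> 0) \<and>
        (\<forall>x\<in>D. (\<Sum>(k, d)\<in>S. c (k, d) * monomial_fun k x * f x ^ d) = 0))"

definition nash_algebraic_at :: "(complex ^ 'k::finite \<Rightarrow> complex) \<Rightarrow> complex ^ 'k \<Rightarrow> bool" where
  "nash_algebraic_at f a \<longleftrightarrow> (\<exists>D. open D \<and> connected D \<and> a \<in> D \<and> nash_algebraic_on f D)"

text \<open>Functions \<open>H(z, w)\<close> of \<open>2m\<close> variables have domain \<open>complex ^ ('m + 'm)\<close>; the value
  of \<open>H\<close> at \<open>z\<close> and the conjugate of \<open>w\<close> is \<open>H (join z (cnj_vec w))\<close>.\<close>

definition join :: "complex ^ 'm \<Rightarrow> complex ^ 'm \<Rightarrow> complex ^ ('m + 'm)" where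
  "join z w = (\<chi> s. case s of Inl i \<Rightarrow> z $ i | Inr i \<Rightarrow> w $ i)"

definition cnj_vec :: "complex ^ 'm \<Rightarrow> complex ^ 'm" where
  "cnj_vec w = (\<chi> i. cnj (w $ i))"

definition hermitian_symmetric_at :: "(complex ^ ('m + 'm) \<Rightarrow> complex) \<Rightarrow> complex ^ 'm::finite \<Rightarrow> bool"
  where
  "hermitian_symmetric_at H a \<longleftrightarrow>
     (\<forall>\<^sub>F (z, w) in nhds (a, a). cnj (H (join z (cnj_vec w))) = H (join w (cnj_vec z)))"

definition no_pluriharmonic_terms :: "(complex ^ ('m::finite + 'm) \<Rightarrow> complex) \<Rightarrow> bool" where
  "no_pluriharmonic_terms H \<longleftrightarrow>
     (\<forall>\<^sub>F z in nhds 0. H (join z 0) = H (join 0 0)) \<and>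
     (\<forall>\<^sub>F w in nhds 0. H (join 0 (cnj_vec w)) = H (join 0 0))"

text \<open>The value of \<open>H\<close> on the diagonal \<open>w = z\<close>, which is real for Hermitian symmetric \<open>H\<close>;
  the real part only adjusts the type.\<close>

definition diag_value :: "(complex ^ ('m + 'm) \<Rightarrow> complex) \<Rightarrow> complex ^ 'm \<Rightarrow> real" where
  "diag_value H z = Re (H (join z (cnj_vec z)))"

section \<open>Rational functions and products of powers\<close>

text \<open>The diagonal value of \<open>R(\<Prod>H\<^sub>j^\<mu>\<^sub>j) \<Prod>H\<^sub>j^\<mu>\<^sub>j\<close>, where the rational function \<open>R\<close> is \<open>P/Q\<close>
  and the indices \<open>j\<close> start from 0.\<close>

definition ratpow ::
    "real poly \<Rightarrow> real poly \<Rightarrow> nat \<Rightarrow> nat \<Rightarrow> (nat \<Rightarrow> real)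
      \<Rightarrow> (nat \<Rightarrow> complex ^ ('m + 'm) \<Rightarrow> complex) \<Rightarrow> complex ^ 'm \<Rightarrow> real" where
  "ratpow P Q \<kappa>\<^sub>1 \<kappa>\<^sub>2 \<mu> H z =
     (let u = (\<Prod>j\<in>{0..<\<kappa>\<^sub>1}. real_power (diag_value (H j) z) (\<mu> j))
      in poly P u / poly Q u *
         (\<Prod>j\<in>{\<kappa>\<^sub>1..<\<kappa>\<^sub>1 + \<kappa>\<^sub>2}. real_power (diag_value (H j) z) (\<mu> j)))"

definition ratpow_defined ::
    "real poly \<Rightarrow> nat \<Rightarrow> nat \<Rightarrow> (nat \<Rightarrow> real)
      \<Rightarrow> (nat \<Rightarrow> complex ^ ('m + 'm) \<Rightarrow> complex) \<Rightarrow> complex ^ 'm \<Rightarrow> bool" where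
  "ratpow_defined Q \<kappa>\<^sub>1 \<kappa>\<^sub>2 \<mu> H z \<longleftrightarrow>
     (\<forall>j<\<kappa>\<^sub>1 + \<kappa>\<^sub>2. power_defined (diag_value (H j) z) (\<mu> j)) \<and>
     poly Q (\<Prod>j\<in>{0..<\<kappa>\<^sub>1}. real_power (diag_value (H j) z) (\<mu> j)) \<noteq> 0"

end

theory Submission
  imports Defs "HOL-Complex_Analysis.Complex_Analysis" "Jordan_Normal_Form.Determinant"
    "HOL-Computational_Algebra.Fundamental_Theorem_Algebra"
begin

text \<open>Everything is tested on complex lines through \<open>p\<close>. In a chart the curve \<open>z \<mapsto> \<phi>\<^sup>-\<^sup>1 (\<phi> p + z v)\<close> pulls every
germ back to a function on a disc, and a germ that takes its value at \<open>p\<close> at the ends of all short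
lines is constant (\<open>const_germ_if_const_on_lines\<close>). On a disc, a real-analytic function of
\<open>z\<close> is the restriction to \<open>w = cnj z\<close> of a holomorphic function \<open>F z w\<close>, and identities on this diagonal
hold for all \<open>(z, w)\<close> (\<open>polarization\<close>). An element of \<open>\<Lambda>\<close> becomes a finite sum of products
\<open>f z * g w\<close>, and a Nash algebraic function of \<open>(\<chi>, cnj \<chi>)\<close> becomes algebraic over the field that is
generated by the functions of \<open>z\<close> alone and those of \<open>w\<close> alone (\<open>nash_algebraic_composition\<close>). Let
\<open>A\<close> be the algebraic closure of this field inside the Laurent series in \<open>w\<close>.

The core is a statement in the spirit of Liouville and Ax (\<open>log_derivative_identity\<close>): if \<open>f\<close> and
\<open>g\<^sub>j\<close> lie in \<open>A\<close> and \<open>\<partial>f/\<partial>w = \<Sum>\<nu>\<^sub>j (\<partial>g\<^sub>j/\<partial>w) / g\<^sub>j\<close>, then all coefficients of \<open>f\<close> except that of \<open>w\<^sup>0\<close> are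
constants, so that \<open>f z w = f z 0 + f 0 w - f 0 0\<close>. Otherwise some coefficient \<open>t\<close> is transcendental
and there is a derivation \<open>D\<close> of the coefficient field with \<open>D t = 1\<close>. Applied coefficientwise it
commutes with \<open>\<partial>/\<partial>w\<close>, and after a normalization of \<open>f\<close> and \<open>g\<^sub>j\<close> it produces a derivation \<open>\<delta>\<close> with
\<open>\<Sum>\<nu>\<^sub>j \<delta>g\<^sub>j / g\<^sub>j = 1 = \<delta> s\<close>, where the \<open>g\<^sub>j\<close> are algebraic over \<open>k(s)\<close> for a field \<open>k\<close> of constants.
The trace turns the left side into logarithmic derivatives of elements of \<open>k(s)\<close>, which are proper
fractions in \<open>s\<close> and cannot add up to \<open>1\<close> (\<open>log_derivative_sum_neq_1\<close>).

If \<open>exp T\<close> or \<open>log T\<close> equals \<open>\<Prod>h\<^sub>j\<^sup>\<nu>\<^sup>j\<close>, the logarithmic derivative of this product lies in \<open>A\<close>. The powers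
in \<open>T = R(U) V\<close> need not be in \<open>A\<close>, but \<open>U\<close> has its logarithmic derivative there; either
\<open>U\<close> is in \<open>A\<close>, or comparison of powers of the transcendental \<open>U\<close> reduces the relation to one inside
\<open>A\<close> (locale \<open>hyperexponential\<close>). In all cases the function in question, \<open>T\<close> or \<open>log T\<close>, is separated
(\<open>separated_on_disc\<close>). Pluriharmonic terms are absent from \<open>H\<close> in \<open>exp H\<close> or from the elements
of the smaller set \<open>\<Lambda>\<close> tilde, so the function does not depend on \<open>z\<close> for \<open>w = 0\<close>
(\<open>constant_on_axis\<close>), nor by symmetry on \<open>w\<close> for \<open>z = 0\<close>; being separated, it is constant.

For a negative power \<open>h\<^sup>\<alpha>\<close> of a polynomial \<open>h = 1 + \<Sum>a\<^sub>i |\<chi>\<^sub>i|\<^sup>2\<close> the coefficients of the powers of \<open>w\<close> are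
polynomials in \<open>z\<close>. If \<open>h\<^sup>\<alpha>\<close> has finite rank their degrees are bounded, so it is a polynomial \<open>G\<close> in \<open>z\<close>, and
\<open>G' h = \<alpha> h' G\<close> forces \<open>deg G = \<alpha> deg h\<close>, which is impossible unless \<open>h\<close> is constant
(\<open>negative_power_on_disc\<close>).\<close>

hide_const (open) Lattice.join
hide_const (open) module.smult

section \<open>Subfields, algebraic elements and finite extensions\<close>

text \<open>Subrings and subfields are sets, because all the fields that follow live inside one big field and are compared there.\<close>

definition sub_ring :: "'a::comm_ring_1 set => bool" where
  "sub_ring R \<longleftrightarrow> 0 \<in> R \<and> 1 \<in> R \<and> (\<forall>x\<in>R. \<forall>y\<in>R. x + y \<in> R \<and> x * y \<in> R) \<and> (\<forall>x\<in>R. - x \<in> R)"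

definition sub_field :: "'a::field set => bool" where
  "sub_field k \<longleftrightarrow> sub_ring k \<and> (\<forall>x\<in>k. inverse x \<in> k)"

definition polys_over :: "'a::comm_ring_1 set => 'a poly set" where
  "polys_over R = {p. \<forall>i. coeff p i \<in> R}"

definition algebraic_over :: "'a::field set => 'a => bool" where
  "algebraic_over k y \<longleftrightarrow> (\<exists>p\<in>polys_over k. p ~= 0 \<and> poly p y = 0)"

text \<open>The coefficient function is constrained everywhere, so that sums over different finite sets can be combined without case distinctions.\<close>

definition lin_span :: "'a::comm_ring_1 set => 'a set => 'a set" where
  "lin_span k S = {(\<Sum>s\<in>S. c s * s) | c. \<forall>s. c s \<in> k}"

definition adjoin :: "'a::field set => 'a => 'a set" where
  "adjoin k x = {poly p x / poly q x | p q. p \<in> polys_over k \<and> q \<in> polys_over k}"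

lemma sub_ringD:
  assumes "sub_ring R"
  shows "0 \<in> R" "1 \<in> R" "x \<in> R ==> y \<in> R ==> x + y \<in> R" "x \<in> R ==> y \<in> R ==> x * y \<in> R"
    "x \<in> R ==> - x \<in> R" "x \<in> R ==> y \<in> R ==> x - y \<in> R"
proof -
  show "x \<in> R ==> y \<in> R ==> x - y \<in> R"
    using assms unfolding sub_ring_def by (metis add_uminus_conv_diff)
qed (use assms in \<open>auto simp: sub_ring_def\<close>)

lemma sub_ring_sum: "sub_ring R ==> (!!i. i \<in> I ==> f i \<in> R) ==> sum f I \<in> R"
  by (induction I rule: infinite_finite_induct) (auto simp: sub_ringD)

lemma sub_ring_prod: "sub_ring R ==> (!!i. i \<in> I ==> f i \<in> R) ==> prod f I \<in> R"
  by (induction I rule: infinite_finite_induct) (auto simp: sub_ringD)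

lemma sub_ring_power: "sub_ring R ==> x \<in> R ==> x ^ n \<in> R"
  by (induction n) (auto simp: sub_ringD)

lemma sub_ring_of_nat: "sub_ring R ==> of_nat n \<in> R"
  by (induction n) (auto simp: sub_ringD)

lemma sub_ring_of_int: "sub_ring R ==> of_int n \<in> R"
  by (cases n rule: int_cases2) (auto simp: sub_ring_of_nat sub_ringD)

lemma sub_fieldD:
  assumes "sub_field k"
  shows "sub_ring k" "x \<in> k ==> inverse x \<in> k" "x \<in> k ==> y \<in> k ==> x / y \<in> k"
  using assms by (auto simp: sub_field_def sub_ringD divide_inverse)

lemma polys_overD: "p \<in> polys_over R ==> coeff p i \<in> R"
  by (simp add: polys_over_def)

lemma polys_over_ring:
  fixes R :: "'a::idom set"
  assumes "sub_ring R"
  shows "0 \<in> polys_over R" "1 \<in> polys_over R"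
    "p \<in> polys_over R ==> q \<in> polys_over R ==> p + q \<in> polys_over R"
    "p \<in> polys_over R ==> q \<in> polys_over R ==> p - q \<in> polys_over R"
    "p \<in> polys_over R ==> q \<in> polys_over R ==> p * q \<in> polys_over R"
    "p \<in> polys_over R ==> - p \<in> polys_over R"
    "a \<in> R ==> p \<in> polys_over R ==> smult a p \<in> polys_over R"
    "a \<in> R ==> monom a n \<in> polys_over R"
    "a \<in> R ==> p \<in> polys_over R ==> pCons a p \<in> polys_over R"
    "p \<in> polys_over R ==> pderiv p \<in> polys_over R"
proof -
  note R = sub_ringD[OF assms]
  show "0 \<in> polys_over R" by (simp add: polys_over_def R)
  show "1 \<in> polys_over R" by (simp add: polys_over_def R coeff_1)
  show "p \<in> polys_over R ==> q \<in> polys_over R ==> p + q \<in> polys_over R"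
    by (simp add: polys_over_def R)
  show "p \<in> polys_over R ==> q \<in> polys_over R ==> p - q \<in> polys_over R"
    by (simp add: polys_over_def R)
  show "p \<in> polys_over R ==> q \<in> polys_over R ==> p * q \<in> polys_over R"
    by (auto simp: polys_over_def coeff_mult intro!: sub_ring_sum[OF assms] R(4))
  show "p \<in> polys_over R ==> - p \<in> polys_over R"
    by (simp add: polys_over_def R)
  show "a \<in> R ==> p \<in> polys_over R ==> smult a p \<in> polys_over R"
    by (simp add: polys_over_def R)
  show "a \<in> R ==> monom a n \<in> polys_over R"
    by (simp add: polys_over_def R coeff_monom)
  show "a \<in> R ==> p \<in> polys_over R ==> pCons a p \<in> polys_over R"
    by (auto simp: polys_over_def coeff_pCons split: nat.split)
  show "p \<in> polys_over R ==> pderiv p \<in> polys_over R"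
    by (auto simp: polys_over_def coeff_pderiv simp del: of_nat_Suc intro!: R(4) sub_ring_of_nat[OF assms])
qed

lemma polys_over_mono: "k \<subseteq> l ==> polys_over k \<subseteq> polys_over l"
  by (auto simp: polys_over_def)

lemma algebraic_over_mono: "k \<subseteq> l ==> algebraic_over k x ==> algebraic_over l x"
  unfolding algebraic_over_def using polys_over_mono[of k l] by blast

lemma poly_mem: "sub_ring R ==> p \<in> polys_over R ==> x \<in> R ==> poly p x \<in> R"
  unfolding poly_altdef by (intro sub_ring_sum sub_ringD(4) sub_ring_power polys_overD)

lemma algebraic_over_self:
  assumes "sub_ring k" "x \<in> k" shows "algebraic_over k x"
  unfolding algebraic_over_def
  by (rule bexI[of _ "[:-x, 1:]"])
    (use sub_ringD[OF assms(1)] assms in \<open>auto simp: polys_over_def coeff_pCons split: nat.split\<close>)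

lemma poly_sum_upto: "degree p \<le> N ==> poly p (x::'a::comm_semiring_1) = (\<Sum>i\<le>N. coeff p i * x ^ i)"
  unfolding poly_altdef by (rule sum.mono_neutral_left) (auto simp: coeff_eq_0)

lemma lin_span_add:
  assumes "sub_ring k" "x \<in> lin_span k S" "y \<in> lin_span k S"
  shows "x + y \<in> lin_span k S"
proof -
  obtain c d where "x = (\<Sum>s\<in>S. c s * s)" "y = (\<Sum>s\<in>S. d s * s)" "\<forall>s. c s \<in> k" "\<forall>s. d s \<in> k"
    using assms by (auto simp: lin_span_def)
  thus ?thesis using assms(1)
    by (auto simp: lin_span_def sum.distrib[symmetric] distrib_right sub_ringD intro!: exI[of _ "\<lambda>s. c s + d s"])
qed

lemma lin_span_scale:
  assumes "sub_ring k" "x \<in> lin_span k S" "a \<in> k"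
  shows "a * x \<in> lin_span k S"
proof -
  obtain c where "x = (\<Sum>s\<in>S. c s * s)" "\<forall>s. c s \<in> k"
    using assms by (auto simp: lin_span_def)
  thus ?thesis using assms(1,3)
    by (auto simp: lin_span_def sum_distrib_left mult.assoc sub_ringD intro!: exI[of _ "\<lambda>s. a * c s"])
qed

lemma lin_span_0: "sub_ring k ==> 0 \<in> lin_span k S"
  by (auto simp: lin_span_def sub_ringD intro!: exI[of _ "\<lambda>s. 0"])

lemma lin_span_sum:
  "sub_ring k ==> (!!i. i \<in> I ==> f i \<in> lin_span k S) ==> sum f I \<in> lin_span k S"
  by (induction I rule: infinite_finite_induct) (auto simp: lin_span_0 lin_span_add)

lemma lin_span_base:
  assumes "sub_ring k" "finite S" "s \<in> S" shows "s \<in> lin_span k S"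
proof -
  have "s = (\<Sum>t\<in>S. (if t = s then 1 else 0) * t)"
    using assms by (simp add: if_distrib[of "\<lambda>c. c * _"] cong: if_cong)
  thus ?thesis unfolding lin_span_def using assms(1)
    by (intro CollectI exI[of _ "\<lambda>t. if t = s then 1 else 0"]) (auto simp: sub_ringD)
qed

lemma lin_span_mult:
  assumes k: "sub_ring k" and fin: "finite S" "finite T" and "x \<in> lin_span k S" "y \<in> lin_span k T"
  shows "x * y \<in> lin_span k ((\<lambda>(s,t). s * t) ` (S \<times> T))"
proof -
  obtain c d where *: "x = (\<Sum>s\<in>S. c s * s)" "y = (\<Sum>s\<in>T. d s * s)" "\<forall>s. c s \<in> k" "\<forall>s. d s \<in> k"
    using assms by (auto simp: lin_span_def)
  have "x * y = (\<Sum>s\<in>S. \<Sum>t\<in>T. (c s * d t) * (s * t))"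
    unfolding * sum_product by (intro sum.cong) (auto simp: algebra_simps)
  also have "\<dots> \<in> lin_span k ((\<lambda>(s,t). s * t) ` (S \<times> T))"
    by (intro lin_span_sum[OF k] lin_span_scale[OF k] lin_span_base[OF k])
      (use fin * k in \<open>auto simp: sub_ringD\<close>)
  finally show ?thesis .
qed

lemma lin_span_least:
  assumes "!!x y. x \<in> W ==> y \<in> W ==> x + y \<in> W" "!!a x. a \<in> k ==> x \<in> W ==> a * x \<in> W" "0 \<in> W" "S \<subseteq> W"
  shows "lin_span k S \<subseteq> W"
proof
  fix x assume "x \<in> lin_span k S"
  then obtain c where c: "x = (\<Sum>s\<in>S. c s * s)" "\<forall>s. c s \<in> k" by (auto simp: lin_span_def)
  have "(\<Sum>s\<in>S'. c s * s) \<in> W" if "S' \<subseteq> S" for S'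
    using that by (induction S' rule: infinite_finite_induct) (use assms c in auto)
  thus "x \<in> W" using c by auto
qed

text \<open>Gaussian elimination by induction on \<open>S\<close>: one element of \<open>J\<close> is used to remove one element of \<open>S\<close> from all the others.\<close>

lemma lin_span_dependent:
  fixes k :: "'a::field set"
  assumes k: "sub_field k"
  shows "finite S ==> finite J ==> card J > card S ==> (!!j. j \<in> J ==> v j \<in> lin_span k S) ==>
    \<exists>c. (\<forall>j. c j \<in> k) \<and> (\<exists>j\<in>J. c j ~= 0) \<and> (\<Sum>j\<in>J. c j * v j) = 0"
proof (induction S arbitrary: J v rule: finite_induct)
  case empty
  then obtain j where "j \<in> J" by (metis card.empty less_irrefl equals0I)
  thus ?case using empty sub_fieldD(1)[OF k]
    by (intro exI[of _ "\<lambda>_. 1"]) (auto simp: lin_span_def sub_ringD)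
next
  case (insert b S)
  note kr = sub_fieldD(1)[OF k]
  have "\<forall>j\<in>J. \<exists>a u. a \<in> k \<and> u \<in> lin_span k S \<and> v j = a * b + u"
  proof
    fix j assume "j \<in> J"
    then obtain c where "v j = (\<Sum>s\<in>insert b S. c s * s)" "\<forall>s. c s \<in> k"
      using insert.prems(3) by (auto simp: lin_span_def)
    thus "\<exists>a u. a \<in> k \<and> u \<in> lin_span k S \<and> v j = a * b + u" using insert.hyps
      by (intro exI[of _ "c b"] exI[of _ "\<Sum>s\<in>S. c s * s"]) (auto simp: lin_span_def)
  qed
  then obtain a u where au: "!!j. j \<in> J ==> a j \<in> k \<and> u j \<in> lin_span k S \<and> v j = a j * b + u j" by metis
  show ?case
  proof (cases "\<forall>j\<in>J. a j = 0")
    case True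
    have "card S < card J" using insert.hyps insert.prems by simp
    from insert.IH[OF insert.prems(1) this, of v] au True show ?thesis by auto
  next
    case False
    then obtain j0 where j0: "j0 \<in> J" "a j0 ~= 0" by auto
    define J' where "J' = J - {j0}"
    define w where "w j = v j - (a j / a j0) * v j0" for j
    have J: "J = insert j0 J'" "j0 \<notin> J'" "finite J'" using j0 insert.prems by (auto simp: J'_def)
    have "card S < card J'" using insert.hyps insert.prems J by simp
    moreover have "w j \<in> lin_span k S" if "j \<in> J'" for j
    proof -
      have j: "j \<in> J" using that J by auto
      have "w j = u j + (- (a j / a j0)) * u j0"
        using au[OF j] au[OF j0(1)] j0(2) by (simp add: w_def field_simps)
      moreover have "- (a j / a j0) \<in> k" using au[OF j] au[OF j0(1)] k by (metis sub_fieldD(3) sub_ringD(5) kr)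
      ultimately show ?thesis using au[OF j] au[OF j0(1)] by (metis lin_span_add lin_span_scale kr)
    qed
    ultimately obtain c where c: "\<forall>j. c j \<in> k" "\<exists>j\<in>J'. c j ~= 0" "(\<Sum>j\<in>J'. c j * w j) = 0"
      using insert.IH[of J' w] J(3) by blast
    define e where "e = (\<Sum>j\<in>J'. c j * (a j / a j0))"
    have e: "e \<in> k" unfolding e_def
      by (intro sub_ring_sum[OF kr] sub_ringD(4)[OF kr] sub_fieldD(3)[OF k]) (use c au J in auto)
    have "(\<Sum>j\<in>J'. c j * v j) - e * v j0 = 0"
      using c(3) by (simp add: w_def e_def sum_distrib_right right_diff_distrib sum_subtractf mult.assoc)
    hence "(\<Sum>j\<in>J. (c(j0 := - e)) j * v j) = 0"
      using J by (simp add: sum.insert cong: sum.cong_simp)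
        (smt (verit, best) sum.cong J(2) fun_upd_other diff_add_cancel)
    thus ?thesis using c e J kr by (intro exI[of _ "c(j0 := -e)"]) (auto simp: sub_ringD)
  qed
qed

text \<open>Finite extensions are algebraic: among \<open>card S + 1\<close> powers of \<open>x\<close> there is a linear relation.\<close>

lemma algebraic_over_if_powers_in_span:
  assumes k: "sub_field k" and fin: "finite S" and pw: "!!j. x ^ j \<in> lin_span k S"
  shows "algebraic_over k x"
proof -
  note kr = sub_fieldD(1)[OF k]
  obtain c :: "nat => 'a" where c: "\<forall>j. c j \<in> k" "\<exists>j\<in>{..card S}. c j ~= 0" "(\<Sum>j\<in>{..card S}. c j * x ^ j) = 0"
    using lin_span_dependent[OF k fin, of "{..card S}" "\<lambda>j. x ^ j"] pw by auto
  define p where "p = (\<Sum>j\<le>card S. monom (c j) j)"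
  have co: "coeff p i = (if i \<le> card S then c i else 0)" for i
    by (simp add: p_def coeff_sum coeff_monom)
  have "p \<in> polys_over k" using c kr by (auto simp: polys_over_def co sub_ringD)
  moreover have "p ~= 0" using c(2) co by (metis atMost_iff coeff_0)
  moreover have "poly p x = 0" using c(3) by (simp add: p_def poly_sum poly_monom)
  ultimately show ?thesis by (auto simp: algebraic_over_def)
qed

lemma inverse_as_poly:
  assumes k: "sub_field k" and "algebraic_over k x" "x ~= 0"
  shows "\<exists>q\<in>polys_over k. inverse x = poly q x"
proof -
  note kr = sub_fieldD(1)[OF k]
  have "\<exists>q\<in>polys_over k. inverse x = poly q x" if "p \<in> polys_over k" "p ~= 0" "poly p x = 0" for p
    using that
  proof (induction p)
    case (pCons a p)
    have a: "a \<in> k" "p \<in> polys_over k" using pCons.prems(1)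
      by (auto simp: polys_over_def coeff_pCons split: nat.splits dest: spec[of _ 0] spec[of _ "Suc _"])
    show ?case
    proof (cases "a = 0")
      case True
      thus ?thesis using pCons assms a by auto
    next
      case False
      have "x * poly p x = - a" using pCons.prems by (simp add: eq_neg_iff_add_eq_0 add.commute)
      hence "inverse x = poly (smult (- inverse a) p) x" using False assms(3)
        by (simp add: field_simps)
      moreover have "smult (- inverse a) p \<in> polys_over k"
        using a k kr by (auto intro!: polys_over_ring simp: sub_ringD sub_fieldD)
      ultimately show ?thesis by blast
    qed
  qed auto
  thus ?thesis using assms by (auto simp: algebraic_over_def)
qed

text \<open>A ring of algebraic elements is a field, as the inverse of an algebraic element is a polynomial in it.\<close>

lemma sub_field_if_algebraic:
  assumes "sub_field k" "k \<subseteq> R" "sub_ring R" "!!x. x \<in> R ==> algebraic_over k x"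
  shows "sub_field R"
proof -
  have "inverse x \<in> R" if x: "x \<in> R" for x
  proof (cases "x = 0")
    case False
    obtain q where "q \<in> polys_over k" "inverse x = poly q x"
      using inverse_as_poly[OF assms(1) assms(4)[OF x] False] by auto
    thus ?thesis using assms x polys_over_mono[OF assms(2)] by (auto intro!: poly_mem)
  qed (use assms in \<open>auto simp: sub_ringD\<close>)
  thus ?thesis using assms by (auto simp: sub_field_def)
qed

lemma sub_ring_poly_image:
  fixes R :: "'a::idom set"
  assumes "sub_ring R" shows "sub_ring ((\<lambda>q. poly q x) ` polys_over R)"
  unfolding sub_ring_def
proof (intro conjI ballI)
  show "0 \<in> (\<lambda>q. poly q x) ` polys_over R" by (rule image_eqI[of _ _ 0]) (simp_all add: polys_over_ring(1)[OF assms])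
  show "1 \<in> (\<lambda>q. poly q x) ` polys_over R" by (rule image_eqI[of _ _ 1]) (simp_all add: polys_over_ring(2)[OF assms])
next
  fix a b assume "a \<in> (\<lambda>q. poly q x) ` polys_over R" "b \<in> (\<lambda>q. poly q x) ` polys_over R"
  then obtain p q where pq: "a = poly p x" "b = poly q x" "p \<in> polys_over R" "q \<in> polys_over R" by auto
  show "a + b \<in> (\<lambda>q. poly q x) ` polys_over R"
    by (rule image_eqI[of _ _ "p + q"]) (use pq assms in \<open>auto intro: polys_over_ring\<close>)
  show "a * b \<in> (\<lambda>q. poly q x) ` polys_over R"
    by (rule image_eqI[of _ _ "p * q"]) (use pq assms in \<open>auto intro: polys_over_ring\<close>)
next
  fix a assume "a \<in> (\<lambda>q. poly q x) ` polys_over R"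
  then obtain p where p: "a = poly p x" "p \<in> polys_over R" by auto
  show "- a \<in> (\<lambda>q. poly q x) ` polys_over R"
    by (rule image_eqI[of _ _ "- p"]) (use p assms in \<open>auto intro: polys_over_ring\<close>)
qed

lemma finite_extension_one:
  assumes k: "sub_field k" and fin: "finite S" and M: "sub_ring (lin_span k S)" and x: "algebraic_over k x"
  shows "\<exists>T. finite T \<and> lin_span k T = (\<lambda>q. poly q x) ` polys_over (lin_span k S)"
proof -
  note kr = sub_fieldD(1)[OF k]
  obtain p where p: "p \<in> polys_over k" "p ~= 0" "poly p x = 0" using x by (auto simp: algebraic_over_def)
  define d where "d = degree p"
  define P where "P = (\<lambda>j. x ^ j) ` {..<d}"
  define T where "T = (\<lambda>(s,t). s * t) ` (S \<times> P)"
  have finP: "finite P" "finite T" using fin by (auto simp: P_def T_def)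
  have pow: "x ^ j \<in> lin_span k P" for j
  proof (induction j rule: less_induct)
    case (less j)
    show ?case
    proof (cases "j < d")
      case True thus ?thesis using finP kr by (auto intro!: lin_span_base simp: P_def)
    next
      case False
      have lc: "coeff p d ~= 0" using p by (simp add: d_def)
      have "0 = (\<Sum>i\<le>d. coeff p i * x ^ i)" using p(3) by (simp add: poly_altdef d_def)
      also have "\<dots> = (\<Sum>i<d. coeff p i * x ^ i) + coeff p d * x ^ d"
        by (simp add: lessThan_Suc_atMost[symmetric])
      finally have "x ^ d = (\<Sum>i<d. (- coeff p i / coeff p d) * x ^ i)" using lc
        by (simp add: sum_divide_distrib[symmetric] sum_negf field_simps eq_neg_iff_add_eq_0)
      moreover have "x ^ j = x ^ d * x ^ (j - d)" using False by (simp flip: power_add)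
      ultimately have "x ^ j = (\<Sum>i<d. (- coeff p i / coeff p d) * x ^ (i + (j - d)))"
        by (simp only: sum_distrib_right power_add mult.assoc)
      also have "\<dots> \<in> lin_span k P"
        using False polys_overD[OF p(1)] kr k
        by (intro lin_span_sum lin_span_scale less.IH) (auto simp: sub_ringD sub_fieldD)
      finally show ?thesis .
    qed
  qed
  have "(\<lambda>q. poly q x) ` polys_over (lin_span k S) \<subseteq> lin_span k T"
  proof safe
    fix q assume q: "q \<in> polys_over (lin_span k S)"
    show "poly q x \<in> lin_span k T" unfolding poly_altdef T_def
      by (intro lin_span_sum[OF kr] lin_span_mult[OF kr fin finP(1)] pow polys_overD[OF q])
  qed
  moreover have "lin_span k T \<subseteq> (\<lambda>q. poly q x) ` polys_over (lin_span k S)"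
  proof (rule lin_span_least)
    note R = sub_ring_poly_image[OF M, of x]
    show "0 \<in> (\<lambda>q. poly q x) ` polys_over (lin_span k S)" using R by (rule sub_ringD)
    show "a + b \<in> (\<lambda>q. poly q x) ` polys_over (lin_span k S)"
      if "a \<in> (\<lambda>q. poly q x) ` polys_over (lin_span k S)" "b \<in> (\<lambda>q. poly q x) ` polys_over (lin_span k S)" for a b
      using R that by (rule sub_ringD)
    show "a * b \<in> (\<lambda>q. poly q x) ` polys_over (lin_span k S)"
      if a: "a \<in> k" and b: "b \<in> (\<lambda>q. poly q x) ` polys_over (lin_span k S)" for a b
    proof -
      obtain q where q: "q \<in> polys_over (lin_span k S)" "b = poly q x" using b by auto
      have "smult a q \<in> polys_over (lin_span k S)" using q a kr by (auto simp: polys_over_def lin_span_scale)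
      thus ?thesis using q by (metis image_eqI poly_smult)
    qed
    show "T \<subseteq> (\<lambda>q. poly q x) ` polys_over (lin_span k S)"
    proof -
      have "s * x ^ j \<in> (\<lambda>q. poly q x) ` polys_over (lin_span k S)" if "s \<in> S" for s j
        by (rule image_eqI[of _ _ "monom s j"])
          (use that M fin kr in \<open>auto simp: poly_monom intro!: polys_over_ring lin_span_base\<close>)
      thus ?thesis by (auto simp: T_def P_def)
    qed
  qed
  ultimately show ?thesis using finP by blast
qed

text \<open>Finitely many algebraic elements lie in a common finite extension. This carries all closure properties of algebraic elements and later provides the field on which the trace is taken.\<close>

lemma finite_extension_exists:
  assumes k: "sub_field k" and "finite X" "!!x. x \<in> X ==> algebraic_over k x"
  shows "\<exists>S. finite S \<and> sub_field (lin_span k S) \<and> k \<subseteq> lin_span k S \<and> X \<subseteq> lin_span k S"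
  using assms(2,3)
proof (induction X rule: finite_induct)
  case empty
  have "lin_span k {1} = k" by (auto simp: lin_span_def)
  thus ?case using k by (intro exI[of _ "{1}"]) auto
next
  case (insert x X)
  note kr = sub_fieldD(1)[OF k]
  obtain S where S: "finite S" "sub_field (lin_span k S)" "k \<subseteq> lin_span k S" "X \<subseteq> lin_span k S"
    using insert by auto
  note M = sub_fieldD(1)[OF S(2)]
  obtain T where T: "finite T" "lin_span k T = (\<lambda>q. poly q x) ` polys_over (lin_span k S)"
    using finite_extension_one[OF k S(1) M] insert.prems by blast
  have R: "sub_ring (lin_span k T)" using sub_ring_poly_image[OF M] T by simp
  have sub: "lin_span k S \<subseteq> lin_span k T"
  proof
    fix a assume "a \<in> lin_span k S"
    thus "a \<in> lin_span k T" unfolding T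
      by (intro image_eqI[of _ _ "[:a:]"]) (auto intro!: polys_over_ring M)
  qed
  have "x \<in> lin_span k T" unfolding T
    by (rule image_eqI[of _ _ "[:0,1:]"]) (auto intro!: polys_over_ring M simp: sub_ringD[OF M])
  moreover have "sub_field (lin_span k T)"
    by (rule sub_field_if_algebraic[OF k _ R])
      (use sub S T sub_ring_power[OF R] algebraic_over_if_powers_in_span[OF k T(1)] in auto)
  ultimately show ?case using sub S T by (intro exI[of _ T]) auto
qed

lemma sub_field_algebraic_closure:
  assumes k: "sub_field k" shows "sub_field {x. algebraic_over k x}"
proof -
  note kr = sub_fieldD(1)[OF k]
  have *: "algebraic_over k (x + y) \<and> algebraic_over k (x * y) \<and> algebraic_over k (- x) \<and> algebraic_over k (inverse x)"
    if "algebraic_over k x" "algebraic_over k y" for x y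
  proof -
    have "\<exists>S. finite S \<and> sub_field (lin_span k S) \<and> k \<subseteq> lin_span k S \<and> {x,y} \<subseteq> lin_span k S"
      by (rule finite_extension_exists[OF k]) (use that in auto)
    then obtain S where S: "finite S" "sub_field (lin_span k S)" "k \<subseteq> lin_span k S" "{x,y} \<subseteq> lin_span k S"
      by blast
    note M = sub_fieldD(1)[OF S(2)]
    have "algebraic_over k z" if "z \<in> lin_span k S" for z
      using algebraic_over_if_powers_in_span[OF k S(1)] sub_ring_power[OF M that] by blast
    thus ?thesis using S M by (auto simp: sub_ringD sub_fieldD)
  qed
  show ?thesis unfolding sub_field_def sub_ring_def
    using * algebraic_over_self[OF kr] kr by (auto simp: sub_ringD)
qed

lemma algebraic_over_trans:
  assumes k: "sub_field k" and "algebraic_over {x. algebraic_over k x} y"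
  shows "algebraic_over k y"
proof -
  note kr = sub_fieldD(1)[OF k]
  obtain p where p: "p \<in> polys_over {x. algebraic_over k x}" "p ~= 0" "poly p y = 0"
    using assms by (auto simp: algebraic_over_def)
  obtain S where S: "finite S" "sub_field (lin_span k S)" "k \<subseteq> lin_span k S" "coeff p ` {..degree p} \<subseteq> lin_span k S"
    using finite_extension_exists[OF k, of "coeff p ` {..degree p}"] polys_overD[OF p(1)] by auto
  note M = sub_fieldD(1)[OF S(2)]
  have "p \<in> polys_over (lin_span k S)"
    unfolding polys_over_def
  proof (intro CollectI allI)
    fix i show "coeff p i \<in> lin_span k S"
      using S(4) coeff_eq_0[of p i] sub_ringD(1)[OF M] by (cases "i \<le> degree p") auto
  qed
  hence y: "algebraic_over (lin_span k S) y" using p by (auto simp: algebraic_over_def)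
  obtain T where T: "finite T" "sub_field (lin_span (lin_span k S) T)" "y \<in> lin_span (lin_span k S) T"
    using finite_extension_exists[OF S(2), of "{y}"] y by auto
  define U where "U = (\<lambda>(s,t). s * t) ` (S \<times> T)"
  have U: "finite U" using S T by (auto simp: U_def)
  have sub: "lin_span (lin_span k S) T \<subseteq> lin_span k U"
  proof
    fix z assume "z \<in> lin_span (lin_span k S) T"
    then obtain c where c: "z = (\<Sum>t\<in>T. c t * t)" "\<forall>t. c t \<in> lin_span k S" by (auto simp: lin_span_def)
    show "z \<in> lin_span k U" unfolding c U_def
      by (rule lin_span_sum[OF kr], rule lin_span_mult[OF kr S(1) T(1)], use c in blast,
          rule lin_span_base[OF kr T(1)])
  qed
  show ?thesis
    by (rule algebraic_over_if_powers_in_span[OF k U])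
      (use sub sub_ring_power[OF sub_fieldD(1)[OF T(2)] T(3)] in auto)
qed

lemma sub_field_adjoin:
  assumes k: "sub_field k" shows "sub_field (adjoin k x)" "k \<subseteq> adjoin k x" "x \<in> adjoin k x"
proof -
  note kr = sub_fieldD(1)[OF k]
  have memI: "poly p x / poly q x \<in> adjoin k x" if "p \<in> polys_over k" "q \<in> polys_over k" for p q
    using that by (auto simp: adjoin_def)
  show sub: "k \<subseteq> adjoin k x"
  proof
    fix a assume "a \<in> k"
    thus "a \<in> adjoin k x" using memI[of "[:a:]" 1] kr by (auto intro!: polys_over_ring)
  qed
  have "[:0, 1:] \<in> polys_over k" "1 \<in> polys_over k"
    using sub_ringD(1,2)[OF kr] by (auto simp: polys_over_def coeff_pCons coeff_1 split: nat.split)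
  thus "x \<in> adjoin k x" using memI[of "[:0,1:]" 1] by simp
  have cl: "a + b \<in> adjoin k x \<and> a * b \<in> adjoin k x \<and> - a \<in> adjoin k x \<and> inverse a \<in> adjoin k x"
    if ab: "a \<in> adjoin k x" "b \<in> adjoin k x" for a b
  proof -
    obtain p q where pq: "a = poly p x / poly q x" "p \<in> polys_over k" "q \<in> polys_over k"
      using ab(1) unfolding adjoin_def by blast
    obtain r s where rs: "b = poly r x / poly s x" "r \<in> polys_over k" "s \<in> polys_over k"
      using ab(2) unfolding adjoin_def by blast
    have "inverse a = poly q x / poly p x" using pq by simp
    moreover have "- a = poly (-p) x / poly q x" using pq by simp
    moreover have "a * b = poly (p * r) x / poly (q * s) x" using pq rs by simp
    moreover have "a + b \<in> adjoin k x"
    proof (cases "poly q x = 0 \<or> poly s x = 0")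
      case True thus ?thesis using ab pq rs by auto
    next
      case False
      hence "a + b = poly (p * s + r * q) x / poly (q * s) x" unfolding pq rs
        by (simp add: add_frac_eq)
      also have "\<dots> \<in> adjoin k x" by (intro memI polys_over_ring kr pq rs)
      finally show ?thesis .
    qed
    ultimately show ?thesis
      using memI[of "p * r" "q * s"] memI[of "-p" q] memI[of q p] polys_over_ring[OF kr] pq(2,3) rs(2,3)
      by metis
  qed
  have "0 \<in> adjoin k x" "1 \<in> adjoin k x" using sub sub_ringD(1,2)[OF kr] by auto
  thus "sub_field (adjoin k x)" unfolding sub_field_def sub_ring_def using cl by blast
qed

lemma adjoin_least:
  assumes "sub_field l" "k \<subseteq> l" "x \<in> l" shows "adjoin k x \<subseteq> l"
proof
  fix y assume "y \<in> adjoin k x"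
  then obtain p q where "y = poly p x / poly q x" "p \<in> polys_over k" "q \<in> polys_over k" by (auto simp: adjoin_def)
  thus "y \<in> l" using polys_over_mono[OF assms(2)] assms
    by (auto intro!: sub_fieldD(3) poly_mem dest: sub_fieldD(1))
qed

lemma adjoin_common_denominator:
  assumes k: "sub_field k" and "finite I" "!!i. i \<in> I ==> a i \<in> adjoin k x"
  shows "\<exists>q P. q \<in> polys_over k \<and> poly q x ~= 0 \<and> (\<forall>i\<in>I. P i \<in> polys_over k \<and> a i = poly (P i) x / poly q x)"
  using assms(2,3)
proof (induction I rule: finite_induct)
  case empty thus ?case using polys_over_ring(2)[OF sub_fieldD(1)[OF k]] by (intro exI[of _ 1]) auto
next
  case (insert i I)
  note kr = sub_fieldD(1)[OF k]
  obtain q P where q: "q \<in> polys_over k" "poly q x ~= 0" "\<forall>i\<in>I. P i \<in> polys_over k \<and> a i = poly (P i) x / poly q x"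
    using insert by auto
  obtain r s where rs: "a i = poly r x / poly s x" "r \<in> polys_over k" "s \<in> polys_over k"
    using insert.prems[of i] unfolding adjoin_def by blast
  have "\<exists>r s. a i = poly r x / poly s x \<and> r \<in> polys_over k \<and> s \<in> polys_over k \<and> poly s x ~= 0"
  proof (cases "poly s x = 0")
    case True
    thus ?thesis using rs polys_over_ring(1,2)[OF kr] by (intro exI[of _ 0] exI[of _ 1]) auto
  next
    case False
    thus ?thesis using rs by blast
  qed
  then obtain r s where rs: "a i = poly r x / poly s x" "r \<in> polys_over k" "s \<in> polys_over k" "poly s x ~= 0" by blast
  show ?case
    by (intro exI[of _ "q * s"] exI[of _ "\<lambda>j. if j = i then r * q else P j * s"])
      (use q rs kr insert.hyps in \<open>auto intro!: polys_over_ring\<close>)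
qed

text \<open>Steinitz exchange: a relation between \<open>x\<close> and \<open>y\<close> with coefficients in \<open>k\<close> involves \<open>x\<close> because \<open>y\<close> alone satisfies none.\<close>

lemma algebraic_exchange:
  assumes k: "sub_field k" and y: "algebraic_over (adjoin k x) y" and ny: "\<not> algebraic_over k y"
  shows "algebraic_over (adjoin k y) x"
proof -
  note kr = sub_fieldD(1)[OF k]
  obtain p where p: "p \<in> polys_over (adjoin k x)" "p ~= 0" "poly p y = 0" using y by (auto simp: algebraic_over_def)
  define n where "n = degree p"
  obtain q P where q: "q \<in> polys_over k" "poly q x ~= 0"
     "\<forall>i\<in>{..n}. P i \<in> polys_over k \<and> coeff p i = poly (P i) x / poly q x"
    using adjoin_common_denominator[OF k, of "{..n}" "coeff p" x] polys_overD[OF p(1)] by auto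
  define N where "N = Max (insert 0 ((\<lambda>j. degree (P j)) ` {..n}))"
  have N: "degree (P j) \<le> N" if "j \<le> n" for j
    unfolding N_def using that by (intro Max_ge) auto
  define Q where "Q = (\<Sum>i\<le>N. monom (\<Sum>j\<le>n. coeff (P j) i * y ^ j) i)"
  have coQ: "coeff Q i = (if i \<le> N then (\<Sum>j\<le>n. coeff (P j) i * y ^ j) else 0)" for i
    by (simp add: Q_def coeff_sum coeff_monom)
  have "poly Q x = (\<Sum>i\<le>N. \<Sum>j\<le>n. coeff (P j) i * y ^ j * x ^ i)"
    by (simp add: Q_def poly_sum poly_monom sum_distrib_right)
  also have "\<dots> = (\<Sum>j\<le>n. \<Sum>i\<le>N. coeff (P j) i * x ^ i * y ^ j)"
    by (subst sum.swap) (simp add: mult_ac)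
  also have "\<dots> = (\<Sum>j\<le>n. poly (P j) x * y ^ j)"
    by (intro sum.cong refl) (simp add: poly_sum_upto[OF N] sum_distrib_right)
  also have "\<dots> = poly q x * (\<Sum>j\<le>n. coeff p j * y ^ j)"
    unfolding sum_distrib_left using q by (intro sum.cong) auto
  also have "\<dots> = 0" using p(3) by (simp add: poly_altdef n_def)
  finally have "poly Q x = 0" .
  moreover have "Q \<in> polys_over (adjoin k y)"
  proof -
    have K: "sub_ring (adjoin k y)" using sub_field_adjoin[OF k] sub_fieldD by blast
    have "coeff (P j) i \<in> adjoin k y" if "j \<le> n" for i j
      using q(3) that polys_overD sub_field_adjoin(2)[OF k, of y] by blast
    hence "coeff Q i \<in> adjoin k y" for i
      using sub_ringD(1)[OF K]
      by (auto simp: coQ intro!: sub_ring_sum[OF K] sub_ringD(4)[OF K] sub_ring_power[OF K] sub_field_adjoin(3)[OF k])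
    thus ?thesis by (simp add: polys_over_def)
  qed
  moreover have "Q ~= 0"
  proof
    assume "Q = 0"
    have z: "coeff (P j) i = 0" if "j \<le> n" for i j
    proof (cases "i \<le> N")
      case True
      define r where "r = (\<Sum>j\<le>n. monom (coeff (P j) i) j)"
      have cor: "coeff r j = (if j \<le> n then coeff (P j) i else 0)" for j
        by (simp add: r_def coeff_sum coeff_monom)
      have "r \<in> polys_over k" using q kr by (auto simp: polys_over_def cor sub_ringD)
      moreover have "poly r y = 0" using coQ[of i] True \<open>Q = 0\<close> by (simp add: r_def poly_sum poly_monom)
      ultimately have "r = 0" using ny by (auto simp: algebraic_over_def)
      thus ?thesis using cor[of j] that by simp
    next
      case False thus ?thesis using N[OF that] by (simp add: coeff_eq_0)
    qed
    have "coeff p n = 0" using q(3) z[of n] by (simp add: poly_altdef)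
    thus False using p(2) by (simp add: n_def)
  qed
  ultimately show ?thesis by (auto simp: algebraic_over_def)
qed

section \<open>Derivations of fields\<close>

definition derivation_on :: "'a::comm_ring_1 set => ('a => 'a) => bool" where
  "derivation_on R D \<longleftrightarrow> (\<forall>x\<in>R. \<forall>y\<in>R. D (x + y) = D x + D y \<and> D (x * y) = x * D y + D x * y)"

abbreviation "derivation \<equiv> derivation_on UNIV"

lemma derivation_onD:
  assumes "derivation_on R D" "sub_ring R"
  shows "x \<in> R ==> y \<in> R ==> D (x + y) = D x + D y"
    "x \<in> R ==> y \<in> R ==> D (x * y) = x * D y + D x * y"
    "D 0 = 0" "D 1 = 0" "x \<in> R ==> D (- x) = - D x"
    "x \<in> R ==> y \<in> R ==> D (x - y) = D x - D y"
proof -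
  show a: "x \<in> R ==> y \<in> R ==> D (x + y) = D x + D y" for x y
    using assms by (simp add: derivation_on_def)
  show b: "x \<in> R ==> y \<in> R ==> D (x * y) = x * D y + D x * y" for x y
    using assms by (simp add: derivation_on_def)
  show z: "D 0 = 0" using a[of 0 0] sub_ringD[OF assms(2)] by simp
  show "D 1 = 0" using b[of 1 1] sub_ringD[OF assms(2)] by simp
  show n: "x \<in> R ==> D (- x) = - D x" for x
    using a[of x "-x"] sub_ringD[OF assms(2)] z by (simp add: eq_neg_iff_add_eq_0 add.commute)
  show "x \<in> R ==> y \<in> R ==> D (x - y) = D x - D y"
    using a[of x "-y"] n[of y] sub_ringD[OF assms(2)] by simp
qed

lemma derivation_on_sum:
  assumes "derivation_on R D" "sub_ring R" "!!i. i \<in> I ==> f i \<in> R"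
  shows "D (sum f I) = (\<Sum>i\<in>I. D (f i))"
  using assms(3)
  by (induction I rule: infinite_finite_induct)
    (auto simp: derivation_onD[OF assms(1,2)] sub_ring_sum[OF assms(2)])

lemma sub_ring_UNIV: "sub_ring UNIV" by (simp add: sub_ring_def)

lemma derivationD:
  assumes "derivation D"
  shows "D (x + y) = D x + D y" "D (x * y) = x * D y + D x * y"
    "D 0 = 0" "D 1 = 0" "D (- x) = - D x" "D (x - y) = D x - D y"
  using derivation_onD[OF assms sub_ring_UNIV] by auto

lemma derivation_sum: "derivation D ==> D (sum f I) = (\<Sum>i\<in>I. D (f i))"
  by (rule derivation_on_sum[OF _ sub_ring_UNIV]) auto

lemma derivation_of_nat: "derivation D ==> D (of_nat n) = 0"
  by (induction n) (auto simp: derivationD)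

lemma derivation_of_int: "derivation D ==> D (of_int n) = 0"
  by (cases n rule: int_cases2) (auto simp: derivation_of_nat derivationD)

lemma derivation_inverse:
  fixes D :: "'a::field => 'a"
  assumes D: "derivation D" shows "D (inverse x) = - D x / x\<^sup>2"
proof (cases "x = 0")
  case False
  have "D (x * inverse x) = 0" using False by (simp add: derivationD[OF D])
  thus ?thesis using False unfolding derivationD(2)[OF D]
    by (simp add: field_simps power2_eq_square eq_neg_iff_add_eq_0)
qed (simp add: derivationD[OF D])

lemma derivation_divide:
  fixes D :: "'a::field => 'a"
  assumes D: "derivation D" shows "D (x / y) = (D x * y - x * D y) / y\<^sup>2"
  unfolding divide_inverse derivationD(2)[OF D] derivation_inverse[OF D]
  by (cases "y = 0") (simp_all add: derivationD[OF D] field_simps power2_eq_square)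

lemma derivation_poly_const:
  assumes D: "derivation D" and "p \<in> polys_over k" "!!c. c \<in> k ==> D c = 0"
  shows "D (poly p x) = poly (pderiv p) x * D x"
  using assms(2)
proof (induction p)
  case (pCons a p)
  have "coeff (pCons a p) 0 \<in> k" "\<forall>i. coeff (pCons a p) (Suc i) \<in> k" using pCons.prems
    by (auto simp only: polys_over_def)
  hence "a \<in> k" "p \<in> polys_over k" by (auto simp: polys_over_def)
  thus ?case using pCons.IH assms(3) by (simp add: derivationD[OF D] pderiv_pCons algebra_simps)
qed (simp add: derivationD[OF D])

text \<open>An annihilator of least degree takes the place of the minimal polynomial.\<close>

lemma min_degree_annihilator:
  assumes "algebraic_over k x"
  shows "\<exists>p. p \<in> polys_over k \<and> p ~= 0 \<and> poly p x = 0 \<and>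
    (\<forall>q. q \<in> polys_over k --> degree q < degree p --> poly q x = 0 --> q = 0)"
proof -
  define P where "P p \<longleftrightarrow> p \<in> polys_over k \<and> p ~= 0 \<and> poly p x = 0" for p
  have "\<exists>p. P p" using assms by (auto simp: algebraic_over_def P_def)
  then obtain p where "P p" "!!q. P q ==> degree p \<le> degree q"
    using ex_has_least_nat[of P _ degree] by metis
  thus ?thesis unfolding P_def by (intro exI[of _ p]) (meson not_less)
qed

lemma pderiv_annihilator_nonzero:
  fixes x :: "'a::field_char_0"
  assumes k: "sub_ring k" and p: "p \<in> polys_over k" "p ~= 0" "poly p x = 0"
    "\<forall>q. q \<in> polys_over k --> degree q < degree p --> poly q x = 0 --> q = 0"
  shows "poly (pderiv p) x ~= 0"
proof
  assume z: "poly (pderiv p) x = 0"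
  have "degree p ~= 0"
  proof
    assume "degree p = 0"
    then obtain a where "p = [:a:]" by (metis degree_eq_zeroE)
    thus False using p by auto
  qed
  hence d: "degree (pderiv p) < degree p" by (simp add: degree_pderiv)
  have "pderiv p = 0" by (rule p(4)[rule_format]) (use d z polys_over_ring(10)[OF k p(1)] in auto)
  thus False using \<open>degree p ~= 0\<close> by (simp add: pderiv_eq_0_iff)
qed

lemma derivation_algebraic_zero:
  fixes x :: "'a::field_char_0"
  assumes D: "derivation D" and k: "sub_ring k" and "!!c. c \<in> k ==> D c = 0" "algebraic_over k x"
  shows "D x = 0"
proof -
  obtain p where p: "p \<in> polys_over k" "p ~= 0" "poly p x = 0"
    "\<forall>q. q \<in> polys_over k --> degree q < degree p --> poly q x = 0 --> q = 0"
    using min_degree_annihilator[OF assms(4)] by (elim exE conjE) (rule that)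
  have "poly (pderiv p) x * D x = 0"
    using derivation_poly_const[OF D p(1) assms(3), of x] p(3) by (simp add: derivationD[OF D])
  thus ?thesis using pderiv_annihilator_nonzero[OF k p] by simp
qed

lemma derivation_on_map_poly:
  assumes D: "derivation_on R D" and R: "sub_ring R" and p: "p \<in> polys_over R" "q \<in> polys_over R"
  shows "map_poly D (p + q) = map_poly D p + map_poly D q"
    "map_poly D (p * q) = p * map_poly D q + map_poly D p * q"
    "map_poly D (- p) = - map_poly D p"
    "a \<in> R ==> map_poly D (smult a p) = smult a (map_poly D p) + smult (D a) p"
proof -
  note d = derivation_onD[OF D R]
  have co: "coeff (map_poly D p) i = D (coeff p i)" for p i by (simp add: coeff_map_poly d)
  show "map_poly D (p + q) = map_poly D p + map_poly D q"
    using p by (intro poly_eqI) (simp add: co d polys_overD)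
  show "map_poly D (- p) = - map_poly D p"
    using p by (intro poly_eqI) (simp add: co d polys_overD)
  show "a \<in> R ==> map_poly D (smult a p) = smult a (map_poly D p) + smult (D a) p"
    using p by (intro poly_eqI) (simp add: co d polys_overD)
  show "map_poly D (p * q) = p * map_poly D q + map_poly D p * q"
  proof (rule poly_eqI)
    fix n
    have "D (\<Sum>i\<le>n. coeff p i * coeff q (n - i)) =
      (\<Sum>i\<le>n. coeff p i * D (coeff q (n - i)) + D (coeff p i) * coeff q (n - i))"
      using p R by (subst derivation_on_sum[OF D R]) (auto simp: d polys_overD sub_ringD)
    thus "coeff (map_poly D (p * q)) n = coeff (p * map_poly D q + map_poly D p * q) n"
      by (simp add: co coeff_mult sum.distrib)
  qed
qed

text \<open>Graphs of partial derivations with prescribed values, ordered by inclusion. A graph is easier to unite along a chain than a function with its domain; single-valuedness is the condition at \<open>0\<close>, because the graph is closed under differences.\<close>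

definition derivation_graph :: "'a::field set => 'a => ('a \<times> 'a) set => bool" where
  "derivation_graph C t G \<longleftrightarrow>
     (\<forall>c\<in>C. (c, 0) \<in> G) \<and> (t, 1) \<in> G \<and> (\<forall>b. (0, b) \<in> G --> b = 0) \<and>
     (\<forall>x a. (x, a) \<in> G --> (- x, - a) \<in> G) \<and>
     (\<forall>x a y b. (x, a) \<in> G \<and> (y, b) \<in> G --> (x + y, a + b) \<in> G \<and> (x * y, x * b + a * y) \<in> G)"

lemma derivation_graph_chain:
  assumes "subset.chain (Collect (derivation_graph C t)) \<G>" "\<G> ~= {}"
  shows "derivation_graph C t (\<Union>\<G>)"
proof -
  have g: "derivation_graph C t G" if "G \<in> \<G>" for G using that assms by (auto simp: subset.chain_def)
  have tot: "G \<subseteq> H \<or> H \<subseteq> G" if "G \<in> \<G>" "H \<in> \<G>" for G H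
    using that assms by (auto simp: subset.chain_def)
  obtain G0 where "G0 \<in> \<G>" using assms by auto
  have cl: "(x + y, a + b) \<in> \<Union>\<G> \<and> (x * y, x * b + a * y) \<in> \<Union>\<G>"
    if xy: "(x, a) \<in> \<Union>\<G>" "(y, b) \<in> \<Union>\<G>" for x a y b
  proof -
    obtain G H where GH: "G \<in> \<G>" "H \<in> \<G>" "(x, a) \<in> G" "(y, b) \<in> H" using xy by auto
    obtain I where "I \<in> \<G>" "(x, a) \<in> I" "(y, b) \<in> I" using tot[OF GH(1,2)] GH by blast
    thus ?thesis using g[of I] unfolding derivation_graph_def by blast
  qed
  show ?thesis unfolding derivation_graph_def
  proof (intro conjI ballI allI impI)
    show "(c, 0) \<in> \<Union>\<G>" if "c \<in> C" for c
      using that g[OF \<open>G0 \<in> \<G>\<close>] \<open>G0 \<in> \<G>\<close> unfolding derivation_graph_def by blast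
    show "(t, 1) \<in> \<Union>\<G>"
      using g[OF \<open>G0 \<in> \<G>\<close>] \<open>G0 \<in> \<G>\<close> unfolding derivation_graph_def by blast
    show "b = 0" if "(0, b) \<in> \<Union>\<G>" for b using that g unfolding derivation_graph_def by blast
    show "(- x, - a) \<in> \<Union>\<G>" if "(x, a) \<in> \<Union>\<G>" for x a using that g unfolding derivation_graph_def by blast
  qed (use cl in blast)+
qed

text \<open>A maximal graph from Zorn's lemma is total: an element \<open>x\<close> that is transcendental over the domain may get an arbitrary value, and for an algebraic \<open>x\<close> the value is dictated by an annihilator of least degree, whose derivative does not vanish at \<open>x\<close> in characteristic 0.\<close>

lemma derivation_extension:
  fixes t :: "'a::field_char_0"
  assumes C: "sub_field C" and t: "\<not> algebraic_over C t"
  shows "\<exists>D. derivation D \<and> D t = 1 \<and> (\<forall>c\<in>C. D c = 0)"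
proof -
  note Cr = sub_fieldD(1)[OF C]
  define G0 where "G0 = (\<lambda>p. (poly p t, poly (pderiv p) t)) ` polys_over C"
  have G0I: "(poly p t, poly (pderiv p) t) \<in> G0" if "p \<in> polys_over C" for p using that by (auto simp: G0_def)
  have "derivation_graph C t G0" unfolding derivation_graph_def
  proof (intro conjI ballI allI impI)
    show "(c, 0) \<in> G0" if "c \<in> C" for c
      using G0I[of "[:c:]"] that polys_over_ring[OF Cr] by (simp add: pderiv_pCons)
    have "[:0, 1:] \<in> polys_over C" using sub_ringD(1,2)[OF Cr] by (auto simp: polys_over_def coeff_pCons split: nat.split)
    thus "(t, 1) \<in> G0" using G0I[of "[:0,1:]"] by (simp add: pderiv_pCons)
    show "b = 0" if "(0, b) \<in> G0" for b using that t by (auto simp: G0_def algebraic_over_def)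
    show "(- x, - a) \<in> G0" if xa: "(x, a) \<in> G0" for x a
    proof -
      obtain p where "p \<in> polys_over C" "x = poly p t" "a = poly (pderiv p) t" using xa by (auto simp: G0_def)
      thus ?thesis using G0I[of "-p"] polys_over_ring(6)[OF Cr] by (simp add: pderiv_minus)
    qed
    fix x a y b assume "(x, a) \<in> G0 \<and> (y, b) \<in> G0"
    then obtain p q where *: "p \<in> polys_over C" "x = poly p t" "a = poly (pderiv p) t"
       "q \<in> polys_over C" "y = poly q t" "b = poly (pderiv q) t" by (auto simp: G0_def)
    show "(x + y, a + b) \<in> G0"
      using G0I[of "p + q"] polys_over_ring(3)[OF Cr] * by (simp add: pderiv_add)
    show "(x * y, x * b + a * y) \<in> G0"
      using G0I[of "p * q"] polys_over_ring(5)[OF Cr] * by (simp add: pderiv_mult algebra_simps)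
  qed
  then obtain G where G: "derivation_graph C t G" "!!H. derivation_graph C t H ==> G \<subseteq> H ==> H = G"
    using subset_Zorn_nonempty[of "Collect (derivation_graph C t)"] derivation_graph_chain[of C t]
    by (metis (mono_tags, lifting) empty_iff mem_Collect_eq)
  note g = G(1)[unfolded derivation_graph_def]
  have gC: "(c, 0) \<in> G" if "c \<in> C" for c using g that by blast
  have gt: "(t, 1) \<in> G" using g by blast
  have gz: "b = 0" if "(0, b) \<in> G" for b using g that by blast
  have gm: "(- x, - a) \<in> G" if "(x, a) \<in> G" for x a using g that by blast
  have gadd: "(x + y, a + b) \<in> G" if "(x, a) \<in> G" "(y, b) \<in> G" for x a y b using g that by blast
  have gmul: "(x * y, x * b + a * y) \<in> G" if "(x, a) \<in> G" "(y, b) \<in> G" for x a y b using g that by blast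
  have uniq: "a = b" if "(x, a) \<in> G" "(x, b) \<in> G" for x a b
    using gz[of "a + - b"] gadd[OF that(1) gm[OF that(2)]] by simp
  define S where "S = Domain G"
  define D where "D x = (THE a. (x, a) \<in> G)" for x
  have DG: "D x = a" if "(x, a) \<in> G" for x a unfolding D_def using that uniq by blast
  have GD: "(x, D x) \<in> G" if "x \<in> S" for x using that DG by (auto simp: S_def)
  have S1: "sub_ring S" unfolding sub_ring_def S_def
  proof (intro conjI ballI)
    show "0 \<in> Domain G" "1 \<in> Domain G" using gC sub_ringD(1,2)[OF Cr] by blast+
    fix x assume x: "x \<in> Domain G"
    show "- x \<in> Domain G" using x gm by blast
    fix y assume y: "y \<in> Domain G"
    show "x + y \<in> Domain G" using x y gadd by blast
    show "x * y \<in> Domain G" using x y gmul by blast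
  qed
  have D1: "derivation_on S D" unfolding derivation_on_def
  proof (intro ballI conjI)
    fix x y assume xy: "x \<in> S" "y \<in> S"
    show "D (x + y) = D x + D y" by (rule DG[OF gadd[OF GD[OF xy(1)] GD[OF xy(2)]]])
    show "D (x * y) = x * D y + D x * y" by (rule DG[OF gmul[OF GD[OF xy(1)] GD[OF xy(2)]]])
  qed
  note d = derivation_onD[OF D1 S1]
  have S2: "sub_field S"
  proof -
    define G1 where "G1 = {(x / y, (a * y - x * b) / y\<^sup>2) | x y a b. (x, a) \<in> G \<and> (y, b) \<in> G \<and> y ~= 0}"
    have G1I: "(x / y, (a * y - x * b) / y\<^sup>2) \<in> G1" if "(x, a) \<in> G" "(y, b) \<in> G" "y ~= 0" for x y a b
      using that by (auto simp: G1_def)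
    have one: "(1, 0) \<in> G" using gC sub_ringD(2)[OF Cr] by blast
    have sub: "G \<subseteq> G1"
    proof
      fix z assume "z \<in> G"
      then obtain x a where "z = (x, a)" "(x, a) \<in> G" by (cases z) auto
      thus "z \<in> G1" using G1I[OF _ one, of x a] by simp
    qed
    have "derivation_graph C t G1" unfolding derivation_graph_def
    proof (intro conjI ballI allI impI)
      show "(c, 0) \<in> G1" if "c \<in> C" for c using gC[OF that] sub by blast
      show "(t, 1) \<in> G1" using gt sub by blast
      show "b = 0" if b: "(0, b) \<in> G1" for b
      proof -
        obtain x y a e where *: "(x, a) \<in> G" "y ~= 0" "0 = x / y" "b = (a * y - x * e) / y\<^sup>2"
          using b by (auto simp: G1_def)
        hence "x = 0" by simp
        thus ?thesis using * gz[of a] by simp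
      qed
      show "(- x, - a) \<in> G1" if xa: "(x, a) \<in> G1" for x a
      proof -
        obtain u v c e where *: "(u, c) \<in> G" "(v, e) \<in> G" "v ~= 0" "x = u / v" "a = (c * v - u * e) / v\<^sup>2"
          using xa by (auto simp: G1_def)
        have "- a = (- c * v - (- u) * e) / v\<^sup>2" unfolding * by (simp add: minus_divide_left)
        thus ?thesis using G1I[OF gm[OF *(1)] *(2,3)] * by simp
      qed
      fix x a y b assume "(x, a) \<in> G1 \<and> (y, b) \<in> G1"
      then obtain u v c e u' v' c' e' where *: "(u, c) \<in> G" "(v, e) \<in> G" "v ~= 0" "x = u / v" "a = (c * v - u * e) / v\<^sup>2"
        and **: "(u', c') \<in> G" "(v', e') \<in> G" "v' ~= 0" "y = u' / v'" "b = (c' * v' - u' * e') / v'\<^sup>2"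
        by (auto simp: G1_def)
      note vv = gmul[OF *(2) **(2)]
      have nz: "v * v' ~= 0" using * ** by simp
      have 1: "x + y = (u * v' + u' * v) / (v * v')" using * ** by (simp add: field_simps)
      have "a + b = ((c * v - u * e) * v'\<^sup>2 + (c' * v' - u' * e') * v\<^sup>2) / (v\<^sup>2 * v'\<^sup>2)"
        unfolding *(5) **(5) using * ** by (subst add_frac_eq) auto
      also have "(c * v - u * e) * v'\<^sup>2 + (c' * v' - u' * e') * v\<^sup>2 =
        (u * e' + c * v' + (u' * e + c' * v)) * (v * v') - (u * v' + u' * v) * (v * e' + e * v')"
        by (simp add: algebra_simps power2_eq_square)
      finally have 2: "a + b = ((u * e' + c * v' + (u' * e + c' * v)) * (v * v') - (u * v' + u' * v) * (v * e' + e * v')) / (v * v')\<^sup>2"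
        by (simp add: power_mult_distrib)
      show "(x + y, a + b) \<in> G1" unfolding 1 2
        by (rule G1I[OF gadd[OF gmul[OF *(1) **(2)] gmul[OF **(1) *(2)]] vv nz])
      have 1: "x * y = (u * u') / (v * v')" using * ** by simp
      have "u / v * (N' / v'\<^sup>2) + N / v\<^sup>2 * (u' / v') = (u * v * N' + N * u' * v') / (v * v')\<^sup>2" for N N'
        using *(3) **(3) by (simp add: field_simps power2_eq_square)
      hence "x * b + a * y = (u * v * (c' * v' - u' * e') + (c * v - u * e) * u' * v') / (v * v')\<^sup>2"
        unfolding *(4,5) **(4,5) by blast
      hence 2: "x * b + a * y = ((u * c' + c * u') * (v * v') - (u * u') * (v * e' + e * v')) / (v * v')\<^sup>2"
        by (simp add: algebra_simps)
      show "(x * y, x * b + a * y) \<in> G1" unfolding 1 2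
        by (rule G1I[OF gmul[OF *(1) **(1)] vv nz])
    qed
    hence "G1 = G" using G(2) sub by blast
    hence "inverse x \<in> S" if "x \<in> S" for x
    proof (cases "x = 0")
      case False
      have "1 / x \<in> S" using G1I[OF one GD[OF that] False] \<open>G1 = G\<close> unfolding S_def by blast
      thus ?thesis by (simp add: inverse_eq_divide)
    qed (use sub_ringD(1)[OF S1] in simp)
    thus ?thesis using S1 by (simp add: sub_field_def)
  qed
  have "S = UNIV"
  proof (rule ccontr)
    assume "S ~= UNIV"
    then obtain y where y: "y \<notin> S" by auto
    define \<Psi> where "\<Psi> u F = poly (map_poly D F) y + poly (pderiv F) y * u" for u F
    have psi_add: "\<Psi> u (F + H) = \<Psi> u F + \<Psi> u H" if "F \<in> polys_over S" "H \<in> polys_over S" for F H u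
      using derivation_on_map_poly(1)[OF D1 S1 that] by (simp add: \<Psi>_def pderiv_add algebra_simps)
    have psi_mult: "\<Psi> u (F * H) = poly F y * \<Psi> u H + \<Psi> u F * poly H y"
      if "F \<in> polys_over S" "H \<in> polys_over S" for F H u
      using derivation_on_map_poly(2)[OF D1 S1 that] by (simp add: \<Psi>_def pderiv_mult algebra_simps)
    have psi_minus: "\<Psi> u (- F) = - \<Psi> u F" if "F \<in> polys_over S" for F u
      using derivation_on_map_poly(3)[OF D1 S1 that that] by (simp add: \<Psi>_def pderiv_minus algebra_simps)
    have "\<exists>u. \<forall>F\<in>polys_over S. poly F y = 0 --> \<Psi> u F = 0"
    proof (cases "algebraic_over S y")
      case False
      thus ?thesis by (intro exI[of _ 0]) (auto simp: \<Psi>_def algebraic_over_def)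
    next
      case True
      obtain m where m: "m \<in> polys_over S" "m ~= 0" "poly m y = 0"
        "\<forall>q. q \<in> polys_over S --> degree q < degree m --> poly q y = 0 --> q = 0"
        using min_degree_annihilator[OF True] by (elim exE conjE) (rule that)
      define u where "u = - poly (map_poly D m) y / poly (pderiv m) y"
      have um: "\<Psi> u m = 0" using pderiv_annihilator_nonzero[OF S1 m] by (simp add: \<Psi>_def u_def)
      have "\<Psi> u F = 0" if "F \<in> polys_over S" "poly F y = 0" for F
        using that
      proof (induction "degree F" arbitrary: F rule: less_induct)
        case less
        show ?case
        proof (cases "degree F < degree m")
          case True
          hence "F = 0" using m(4) less.prems by blast
          thus ?thesis by (simp add: \<Psi>_def)
        next
          case False
          define a where "a = lead_coeff m"
          define M where "M = monom (lead_coeff F) (degree F - degree m)"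
          have mem0: "[:a:] \<in> polys_over S" "M \<in> polys_over S"
            unfolding a_def M_def
            by (rule polys_over_ring(9,8)[OF S1] polys_over_ring(1)[OF S1] polys_overD[OF m(1)] polys_overD[OF less.prems(1)])+
          have mem: "[:a:] \<in> polys_over S" "M \<in> polys_over S" "[:a:] * F \<in> polys_over S" "M * m \<in> polys_over S"
            using mem0 polys_over_ring(5)[OF S1 mem0(1) less.prems(1)] polys_over_ring(5)[OF S1 mem0(2) m(1)] by auto
          define F' where "F' = [:a:] * F + - (M * m)"
          have F': "F' \<in> polys_over S" "poly F' y = 0"
            using polys_over_ring(3)[OF S1 mem(3) polys_over_ring(6)[OF S1 mem(4)]] less.prems m by (auto simp: F'_def)
          have a0: "a ~= 0" using m by (simp add: a_def)
          have psi: "\<Psi> u F' = a * \<Psi> u F"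
            using mem m um less.prems polys_over_ring(6)[OF S1]
            by (simp only: F'_def psi_add psi_mult psi_minus) simp
          show ?thesis
          proof (cases "degree F = 0")
            case True
            hence "degree m = 0" using False by simp
            then obtain b where "m = [:b:]" by (metis degree_eq_zeroE)
            thus ?thesis using m by auto
          next
            case dF: False
            have "degree F' < degree F"
            proof (rule degree_lessI)
              show "F' ~= 0 \<or> degree F > 0" using dF by simp
              show "\<forall>k\<ge>degree F. coeff F' k = 0"
              proof (intro allI impI)
                fix k assume k: "k \<ge> degree F"
                show "coeff F' k = 0"
                proof (cases "k = degree F")
                  case True
                  thus ?thesis using False by (simp add: F'_def a_def M_def coeff_monom_mult)
                next
                  case ne: False
                  have "k - (degree F - degree m) > degree m" using k ne False by linarith
                  thus ?thesis using k ne False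
                    by (simp add: F'_def M_def coeff_monom_mult coeff_eq_0)
                qed
              qed
            qed
            hence "\<Psi> u F' = 0" using less.hyps F' by blast
            thus ?thesis using psi a0 by simp
          qed
        qed
      qed
      thus ?thesis by blast
    qed
    then obtain u where u: "!!F. F \<in> polys_over S ==> poly F y = 0 ==> \<Psi> u F = 0" by blast
    define H where "H = (\<lambda>F. (poly F y, \<Psi> u F)) ` polys_over S"
    have HI: "(poly F y, \<Psi> u F) \<in> H" if "F \<in> polys_over S" for F using that by (auto simp: H_def)
    have sub: "G \<subseteq> H"
    proof
      fix z assume "z \<in> G"
      then obtain x a where z: "z = (x, a)" "(x, a) \<in> G" by (cases z) auto
      hence x: "x \<in> S" "a = D x" using DG by (auto simp: S_def)
      have "map_poly D [:x:] = [:D x:]" by (simp add: map_poly_pCons d)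
      thus "z \<in> H" using HI[of "[:x:]"] x z polys_over_ring[OF S1]
        by (simp add: \<Psi>_def pderiv_pCons)
    qed
    have "derivation_graph C t H" unfolding derivation_graph_def
    proof (intro conjI ballI allI impI)
      show "(c, 0) \<in> H" if "c \<in> C" for c using gC[OF that] sub by blast
      show "(t, 1) \<in> H" using gt sub by blast
      show "b = 0" if "(0, b) \<in> H" for b using that u by (auto simp: H_def)
      show "(- x, - a) \<in> H" if xa: "(x, a) \<in> H" for x a
      proof -
        obtain F where "F \<in> polys_over S" "x = poly F y" "a = \<Psi> u F" using xa by (auto simp: H_def)
        thus ?thesis using HI[of "-F"] polys_over_ring(6)[OF S1] psi_minus by simp
      qed
      fix x a z b assume "(x, a) \<in> H \<and> (z, b) \<in> H"
      then obtain p q where *: "p \<in> polys_over S" "x = poly p y" "a = \<Psi> u p"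
         "q \<in> polys_over S" "z = poly q y" "b = \<Psi> u q" by (auto simp: H_def)
      show "(x + z, a + b) \<in> H"
        using HI[of "p + q"] polys_over_ring(3)[OF S1] psi_add * by simp
      show "(x * z, x * b + a * z) \<in> H"
        using HI[of "p * q"] polys_over_ring(5)[OF S1] psi_mult * by simp
    qed
    hence "H = G" using G(2) sub by blast
    moreover have "[:0, 1:] \<in> polys_over S" using sub_ringD(1,2)[OF S1] by (auto simp: polys_over_def coeff_pCons split: nat.split)
    ultimately have "y \<in> S" using HI[of "[:0,1:]"] by (force simp: S_def)
    thus False using y by simp
  qed
  thus ?thesis using D1 DG[OF gt] DG[OF gC] by blast
qed

text \<open>By Zorn's lemma choose \<open>C\<close> maximal such that \<open>t\<close> stays transcendental. An \<open>x\<close> outside \<open>C\<close> makes \<open>t\<close> algebraic over \<open>C(x)\<close>, hence by exchange \<open>x\<close> is algebraic over \<open>C(t)\<close>.\<close>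

lemma maximal_avoiding_subfield:
  fixes t :: "'a::field"
  assumes F: "sub_field F" and t: "\<not> algebraic_over F t"
  obtains C where "sub_field C" "F \<subseteq> C" "\<not> algebraic_over C t" "!!x. algebraic_over (adjoin C t) x"
proof -
  define \<A> where "\<A> = {C. sub_field C \<and> F \<subseteq> C \<and> \<not> algebraic_over C t}"
  have "\<exists>M\<in>\<A>. \<forall>X\<in>\<A>. M \<subseteq> X --> X = M"
  proof (rule subset_Zorn_nonempty)
    show "\<A> ~= {}" using F t by (auto simp: \<A>_def)
    fix \<C> assume ne: "\<C> ~= {}" and ch: "subset.chain \<A> \<C>"
    have CA: "X \<in> \<A>" if "X \<in> \<C>" for X using that ch by (auto simp: subset.chain_def)
    have tot: "X \<subseteq> Y \<or> Y \<subseteq> X" if "X \<in> \<C>" "Y \<in> \<C>" for X Y using that ch by (auto simp: subset.chain_def)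
    have fin: "\<exists>X\<in>\<C>. T \<subseteq> X" if "finite T" "T \<subseteq> \<Union>\<C>" for T
      using that
    proof (induction T rule: finite_induct)
      case empty thus ?case using ne by auto
    next
      case (insert a T)
      then obtain X Y where "X \<in> \<C>" "T \<subseteq> X" "Y \<in> \<C>" "a \<in> Y" by auto
      thus ?case using tot[of X Y] by (metis insert_subset subset_trans subsetD)
    qed
    have sf: "sub_field (\<Union>\<C>)"
    proof -
      have "x + y \<in> \<Union>\<C> \<and> x * y \<in> \<Union>\<C> \<and> - x \<in> \<Union>\<C> \<and> inverse x \<in> \<Union>\<C>" if "x \<in> \<Union>\<C>" "y \<in> \<Union>\<C>" for x y
      proof -
        obtain X where X: "X \<in> \<C>" "{x, y} \<subseteq> X" using fin[of "{x,y}"] \<open>x \<in> \<Union>\<C>\<close> \<open>y \<in> \<Union>\<C>\<close> by auto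
        hence "sub_field X" using CA by (auto simp: \<A>_def)
        hence "x + y \<in> X \<and> x * y \<in> X \<and> - x \<in> X \<and> inverse x \<in> X"
          using X by (auto simp: sub_field_def sub_ring_def)
        thus ?thesis using X by blast
      qed
      moreover have "0 \<in> \<Union>\<C>" "1 \<in> \<Union>\<C>" using ne CA by (auto simp: \<A>_def sub_field_def sub_ring_def)
      ultimately show ?thesis unfolding sub_field_def sub_ring_def by blast
    qed
    have "\<not> algebraic_over (\<Union>\<C>) t"
    proof
      assume "algebraic_over (\<Union>\<C>) t"
      then obtain p where p: "p \<in> polys_over (\<Union>\<C>)" "p ~= 0" "poly p t = 0" by (auto simp: algebraic_over_def)
      obtain X where X: "X \<in> \<C>" "coeff p ` {..degree p} \<subseteq> X"
        using fin[of "coeff p ` {..degree p}"] p(1) polys_overD by (metis finite_atMost finite_imageI image_subsetI)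
      have "sub_field X" using CA X by (auto simp: \<A>_def)
      hence "0 \<in> X" by (simp add: sub_field_def sub_ring_def)
      hence "coeff p i \<in> X" for i using X coeff_eq_0[of p i] by (cases "i \<le> degree p") auto
      hence "algebraic_over X t" using p by (auto simp: algebraic_over_def polys_over_def)
      thus False using CA X by (auto simp: \<A>_def)
    qed
    moreover have "F \<subseteq> \<Union>\<C>" using ne CA by (auto simp: \<A>_def)
    ultimately show "\<Union>\<C> \<in> \<A>" using sf by (simp add: \<A>_def)
  qed
  then obtain C where C: "C \<in> \<A>" "!!X. X \<in> \<A> ==> C \<subseteq> X ==> X = C" by blast
  have Cf: "sub_field C" "F \<subseteq> C" "\<not> algebraic_over C t" using C by (auto simp: \<A>_def)
  have "algebraic_over (adjoin C t) x" for x
  proof (cases "x \<in> C")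
    case True
    thus ?thesis using sub_field_adjoin[OF Cf(1), of t] algebraic_over_self sub_fieldD(1) by blast
  next
    case False
    hence "adjoin C x ~= C" using sub_field_adjoin[OF Cf(1), of x] by blast
    hence "adjoin C x \<notin> \<A>" using C(2) sub_field_adjoin[OF Cf(1), of x] by blast
    hence "algebraic_over (adjoin C x) t" using sub_field_adjoin[OF Cf(1), of x] Cf by (auto simp: \<A>_def)
    thus ?thesis using algebraic_exchange[OF Cf(1)] Cf(3) by blast
  qed
  thus ?thesis using that Cf by blast
qed

section \<open>Traces and logarithmic derivatives\<close>

lemma derivation_prod:
  assumes D: "derivation D" and "finite I"
  shows "D (prod f I) = (\<Sum>i\<in>I. D (f i) * prod f (I - {i}))"
  using assms(2)
proof (induction I rule: finite_induct)
  case (insert a I)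
  have "D (prod f (insert a I)) = f a * (\<Sum>i\<in>I. D (f i) * prod f (I - {i})) + D (f a) * prod f I"
    using insert by (simp add: derivationD[OF D])
  also have "f a * (\<Sum>i\<in>I. D (f i) * prod f (I - {i})) = (\<Sum>i\<in>I. D (f i) * prod f (insert a I - {i}))"
    unfolding sum_distrib_left
  proof (intro sum.cong refl)
    fix i assume "i \<in> I"
    hence "insert a I - {i} = insert a (I - {i})" using insert by auto
    thus "f a * (D (f i) * prod f (I - {i})) = D (f i) * prod f (insert a I - {i})"
      using insert by (simp add: algebra_simps)
  qed
  also have "D (f a) * prod f I = D (f a) * prod f (insert a I - {a})" using insert by simp
  finally show ?case using insert by (simp add: add.commute)
qed (simp add: derivationD[OF D])

lemma derivation_det:
  fixes D :: "'a::field => 'a"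
  assumes D: "derivation D" and A: "A \<in> carrier_mat n n"
  shows "D (Determinant.det A) = (\<Sum>i<n. \<Sum>j<n. D (A $$ (i, j)) * cofactor A i j)"
proof -
  define B where "B i = Matrix.mat n n (\<lambda>(k, j). if k = i then D (A $$ (k, j)) else A $$ (k, j))" for i
  have B: "B i \<in> carrier_mat n n" for i by (simp add: B_def)
  have "D (Determinant.det A) = (\<Sum>p | p permutes {0..<n}. D (of_int (sign p) * (\<Prod>i = 0..<n. A $$ (i, p i))))"
    unfolding det_def'[OF A] by (rule derivation_sum[OF D])
  also have "\<dots> = (\<Sum>p | p permutes {0..<n}. \<Sum>i<n. of_int (sign p) * (\<Prod>k = 0..<n. B i $$ (k, p k)))"
  proof (intro sum.cong refl)
    fix p assume "p \<in> {p. p permutes {0..<n}}"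
    hence p: "p k < n" if "k < n" for k using that permutes_in_image[of p "{0..<n}" k] by auto
    have "D (of_int (sign p) * (\<Prod>i = 0..<n. A $$ (i, p i))) = of_int (sign p) * D (\<Prod>i = 0..<n. A $$ (i, p i))"
      by (simp add: derivationD[OF D] derivation_of_int[OF D])
    also have "D (\<Prod>i = 0..<n. A $$ (i, p i)) =
       (\<Sum>i=0..<n. D (A $$ (i, p i)) * (\<Prod>k\<in>{0..<n} - {i}. A $$ (k, p k)))"
      by (rule derivation_prod[OF D]) simp
    also have "\<dots> = (\<Sum>i=0..<n. \<Prod>k = 0..<n. B i $$ (k, p k))"
    proof (intro sum.cong refl)
      fix i assume i: "i \<in> {0..<n}"
      have "(\<Prod>k = 0..<n. B i $$ (k, p k)) = B i $$ (i, p i) * (\<Prod>k\<in>{0..<n} - {i}. B i $$ (k, p k))"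
        using i by (subst prod.remove[of _ i]) auto
      also have "B i $$ (i, p i) = D (A $$ (i, p i))" using i p by (simp add: B_def)
      also have "(\<Prod>k\<in>{0..<n} - {i}. B i $$ (k, p k)) = (\<Prod>k\<in>{0..<n} - {i}. A $$ (k, p k))"
        using i p by (intro prod.cong) (auto simp: B_def)
      finally show "D (A $$ (i, p i)) * (\<Prod>k\<in>{0..<n} - {i}. A $$ (k, p k)) = (\<Prod>k = 0..<n. B i $$ (k, p k))" ..
    qed
    finally show "D (of_int (sign p) * (\<Prod>i = 0..<n. A $$ (i, p i))) = (\<Sum>i<n. of_int (sign p) * (\<Prod>k = 0..<n. B i $$ (k, p k)))"
      by (simp add: sum_distrib_left atLeast0LessThan)
  qed
  also have "\<dots> = (\<Sum>i<n. Determinant.det (B i))"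
    unfolding det_def'[OF B] by (rule sum.swap)
  also have "\<dots> = (\<Sum>i<n. \<Sum>j<n. D (A $$ (i, j)) * cofactor A i j)"
  proof (intro sum.cong refl)
    fix i assume i: "i \<in> {..<n}"
    have "Determinant.det (B i) = (\<Sum>j<n. B i $$ (i, j) * cofactor (B i) i j)"
      using i by (intro laplace_expansion_row[OF B]) auto
    also have "\<dots> = (\<Sum>j<n. D (A $$ (i, j)) * cofactor A i j)"
    proof (intro sum.cong refl)
      fix j assume j: "j \<in> {..<n}"
      have "mat_delete (B i) i j = mat_delete A i j"
        using A i j by (intro eq_matI) (auto simp: mat_delete_def B_def)
      thus "B i $$ (i, j) * cofactor (B i) i j = D (A $$ (i, j)) * cofactor A i j"
        using i j by (simp add: cofactor_def B_def)
    qed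
    finally show "Determinant.det (B i) = (\<Sum>j<n. D (A $$ (i, j)) * cofactor A i j)" .
  qed
  finally show ?thesis .
qed

text \<open>Jacobi's formula: the logarithmic derivative of a determinant is the trace of \<open>A' A\<^sup>-\<^sup>1\<close>.\<close>

lemma derivation_det_log:
  fixes D :: "'a::field => 'a"
  assumes D: "derivation D" and A: "A \<in> carrier_mat n n" and B: "B \<in> carrier_mat n n"
    and inv: "A * B = 1\<^sub>m n"
  shows "Determinant.det A ~= 0"
    "D (Determinant.det A) / Determinant.det A = (\<Sum>i<n. \<Sum>j<n. D (A $$ (i, j)) * B $$ (j, i))"
proof -
  have "Determinant.det A * Determinant.det B = 1" using det_mult[OF A B] inv by simp
  thus nz: "Determinant.det A ~= 0" by auto
  have "adj_mat A = adj_mat A * (A * B)" using adj_mat(1)[OF A] inv by simp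
  also have "\<dots> = (adj_mat A * A) * B" using adj_mat(1)[OF A] A B by (metis assoc_mult_mat)
  also have "\<dots> = Determinant.det A \<cdot>\<^sub>m B" using adj_mat(3)[OF A] B by (simp add: mult_smult_assoc_mat[of _ n n _ n])
  finally have adj: "adj_mat A = Determinant.det A \<cdot>\<^sub>m B" .
  have "cofactor A i j = Determinant.det A * B $$ (j, i)" if "i < n" "j < n" for i j
  proof -
    have "cofactor A i j = adj_mat A $$ (j, i)" using that A by (simp add: adj_mat_def)
    thus ?thesis unfolding adj using that B by simp
  qed
  hence "D (Determinant.det A) = (\<Sum>i<n. \<Sum>j<n. Determinant.det A * (D (A $$ (i, j)) * B $$ (j, i)))"
    unfolding derivation_det[OF D A] by (intro sum.cong refl) (simp add: mult_ac)
  thus "D (Determinant.det A) / Determinant.det A = (\<Sum>i<n. \<Sum>j<n. D (A $$ (i, j)) * B $$ (j, i))"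
    using nz by (simp add: sum_distrib_left[symmetric])
qed

lemma lin_span_basis:
  fixes k :: "'a::field set"
  assumes k: "sub_field k" and fin: "finite S0"
  shows "\<exists>d (b::nat => 'a). (\<forall>i<d. b i \<in> lin_span k S0) \<and>
      (\<forall>x\<in>lin_span k S0. \<exists>c. (\<forall>i. c i \<in> k) \<and> x = (\<Sum>i<d. c i * b i)) \<and>
      (\<forall>c. (\<forall>i. c i \<in> k) --> (\<Sum>i<d. c i * b i) = 0 --> (\<forall>i<d. c i = 0))"
proof -
  note kr = sub_fieldD(1)[OF k]
  define P where "P S \<longleftrightarrow> finite S \<and> lin_span k S = lin_span k S0" for S
  obtain S where S: "P S" "!!T. P T ==> card S \<le> card T"
    using ex_has_least_nat[of P S0 card] fin by (auto simp: P_def)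
  have fS: "finite S" "lin_span k S = lin_span k S0" using S by (auto simp: P_def)
  have ind: "c s = 0" if c: "!!s. c s \<in> k" "(\<Sum>s\<in>S. c s * s) = 0" and s: "s \<in> S" for c s
  proof (rule ccontr)
    assume nz: "c s ~= 0"
    have "c s * s + (\<Sum>t\<in>S - {s}. c t * t) = 0" using c(2) s fS by (simp add: sum.remove)
    hence "s = (\<Sum>t\<in>S - {s}. (- c t / c s) * t)" using nz
      by (simp add: sum_divide_distrib[symmetric] sum_negf field_simps eq_neg_iff_add_eq_0)
    hence "s \<in> lin_span k (S - {s})" unfolding lin_span_def
      using c(1) k kr by (intro CollectI exI[of _ "\<lambda>t. - c t / c s"]) (auto simp: sub_ringD sub_fieldD)
    moreover have "t \<in> lin_span k (S - {s})" if "t \<in> S" "t ~= s" for t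
      using lin_span_base[OF kr, of "S - {s}" t] fS that by auto
    ultimately have "S \<subseteq> lin_span k (S - {s})" by blast
    hence 1: "lin_span k S \<subseteq> lin_span k (S - {s})"
      by (intro lin_span_least lin_span_add lin_span_scale lin_span_0 kr)
    have "lin_span k (S - {s}) \<subseteq> lin_span k S"
      by (intro lin_span_least lin_span_add lin_span_scale lin_span_0 kr) (use lin_span_base[OF kr fS(1)] in auto)
    hence "P (S - {s})" using 1 fS by (auto simp: P_def)
    hence "card S \<le> card (S - {s})" by (rule S(2))
    thus False using s fS by (metis card_Diff1_less not_less)
  qed
  obtain b where b: "bij_betw b {..<card S} S"
    using fS(1) ex_bij_betw_nat_finite[of S] by (metis atLeast0LessThan)
  define b' where "b' = inv_into {..<card S} b"
  have b': "b' (b i) = i" if "i < card S" for i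
    using b that by (simp add: b'_def bij_betw_def inv_into_f_f)
  have sums: "(\<Sum>s\<in>S. c s * s) = (\<Sum>i<card S. c (b i) * b i)" for c
    using sum.reindex_bij_betw[OF b, of "\<lambda>s. c s * s"] by simp
  show ?thesis
  proof (rule exI[of _ "card S"], rule exI[of _ b], intro conjI allI ballI impI)
    show "b i \<in> lin_span k S0" if "i < card S" for i
      using bij_betwE[OF b] that lin_span_base[OF kr fS(1)] fS(2) by auto
    show "\<exists>c. (\<forall>i. c i \<in> k) \<and> x = (\<Sum>i<card S. c i * b i)" if x: "x \<in> lin_span k S0" for x
    proof -
      have "x \<in> lin_span k S" using x fS(2) by simp
      then obtain c where "\<forall>s. c s \<in> k" "x = (\<Sum>s\<in>S. c s * s)" by (auto simp: lin_span_def)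
      thus ?thesis using sums by (intro exI[of _ "\<lambda>i. c (b i)"]) auto
    qed
    fix c i assume c: "\<forall>i. c i \<in> k" "(\<Sum>i<card S. c i * b i) = 0" and i: "i < card S"
    have "(\<Sum>s\<in>S. c (b' s) * s) = (\<Sum>i<card S. c i * b i)"
      unfolding sums[of "\<lambda>s. c (b' s)"] by (intro sum.cong refl) (simp add: b')
    moreover have "b i \<in> S" using bij_betwE[OF b] i by simp
    ultimately have "c (b' (b i)) = 0" using ind[of "\<lambda>s. c (b' s)" "b i"] c by simp
    thus "c i = 0" using b' i by simp
  qed
qed

text \<open>Let \<open>X x\<close> be the matrix of multiplication by \<open>x\<close> and \<open>\<Gamma>\<close> that of \<open>\<delta>\<close> on a basis. Then \<open>\<delta> (X g) = X (\<delta> g) + \<Gamma> X g - X g \<Gamma>\<close>, and as commutators have trace 0, Jacobi's formula shows that the trace of \<open>\<delta> g / g\<close> is the logarithmic derivative of the norm \<open>N = det (X g)\<close>.\<close>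

lemma trace_of_log_derivative:
  fixes \<delta> :: "'a::field => 'a"
  assumes \<delta>: "derivation \<delta>" and B: "sub_field B" and \<delta>B: "!!x. x \<in> B ==> \<delta> x \<in> B"
    and S: "finite S" and M: "sub_field (lin_span B S)"
    and \<delta>M: "!!x. x \<in> lin_span B S ==> \<delta> x \<in> lin_span B S"
  shows "\<exists>d>0. \<exists>Tr. (\<forall>x\<in>lin_span B S. \<forall>y\<in>lin_span B S. Tr (x + y) = Tr x + Tr y) \<and>
     (\<forall>a\<in>B. \<forall>x\<in>lin_span B S. Tr (a * x) = a * Tr x) \<and> Tr 1 = of_nat d \<and>
     (\<forall>g\<in>lin_span B S. g ~= 0 --> (\<exists>N\<in>B. N ~= 0 \<and> Tr (\<delta> g / g) = \<delta> N / N))"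
proof -
  note Br = sub_fieldD(1)[OF B] and Mr = sub_fieldD(1)[OF M]
  obtain d and b :: "nat => 'a" where b: "\<forall>i<d. b i \<in> lin_span B S"
      "\<forall>x\<in>lin_span B S. \<exists>c. (\<forall>i. c i \<in> B) \<and> x = (\<Sum>i<d. c i * b i)"
      "\<forall>c. (\<forall>i. c i \<in> B) --> (\<Sum>i<d. c i * b i) = 0 --> (\<forall>i<d. c i = 0)"
    using lin_span_basis[OF B S] by (elim exE conjE) (rule that)
  have uniq: "c i = e i" if ce: "\<forall>i. c i \<in> B" "\<forall>i. e i \<in> B" "(\<Sum>i<d. c i * b i) = (\<Sum>i<d. e i * b i)" "i < d" for c e i
  proof -
    have "(\<Sum>i<d. (c i - e i) * b i) = 0" using ce(3) by (simp add: left_diff_distrib sum_subtractf)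
    moreover have "c i - e i \<in> B" for i by (rule sub_ringD(6)[OF Br ce(1)[rule_format] ce(2)[rule_format]])
    ultimately have "c i - e i = 0" by (intro b(3)[rule_format, of "\<lambda>i. c i - e i", OF _ _ ce(4)])
    thus ?thesis by simp
  qed
  have d: "d > 0"
  proof (rule ccontr)
    assume "\<not> d > 0"
    hence "d = 0" by simp
    hence "(1::'a) = 0" using b(2) sub_ringD(2)[OF Mr] by fastforce
    thus False by simp
  qed
  obtain co where co: "!!x i. x \<in> lin_span B S ==> co x i \<in> B" "!!x. x \<in> lin_span B S ==> x = (\<Sum>i<d. co x i * b i)"
    using b(2) by metis
  have co_eqI: "co x i = c i" if "x \<in> lin_span B S" "x = (\<Sum>i<d. c i * b i)" "!!i. c i \<in> B" "i < d" for x c i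
    by (rule uniq[OF allI[OF co(1)[OF that(1)]] allI[OF that(3)] _ that(4)])
      (metis co(2)[OF that(1)] that(2))
  define X where "X x i = co (x * b i)" for x i
  have mem: "x * b i \<in> lin_span B S" if "x \<in> lin_span B S" "i < d" for x i
    using that b(1) Mr by (auto simp: sub_ringD)
  have XB: "X x i j \<in> B" if "x \<in> lin_span B S" "i < d" for x i j using co(1) mem that by (simp add: X_def)
  have X: "x * b i = (\<Sum>j<d. X x i j * b j)" if "x \<in> lin_span B S" "i < d" for x i
    using co(2)[OF mem[OF that]] by (simp add: X_def)
  have X_eqI: "X x i j = c j" if "x \<in> lin_span B S" "i < d" "j < d" "x * b i = (\<Sum>j<d. c j * b j)" "!!i. c i \<in> B" for x i j c
    unfolding X_def by (rule co_eqI[OF mem[OF that(1,2)] that(4,5,3)])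
  have X1: "X 1 i j = (if i = j then 1 else 0)" if "i < d" "j < d" for i j
    by (rule X_eqI) (use that Mr Br in \<open>auto simp: sub_ringD if_distrib[of "\<lambda>c. c * _"] cong: if_cong\<close>)
  have Xadd: "X (x + y) i j = X x i j + X y i j"
    if "x \<in> lin_span B S" "y \<in> lin_span B S" "i < d" "j < d" for x y i j
    by (rule X_eqI) (use that Mr Br in \<open>auto simp: sub_ringD XB distrib_right sum.distrib X[symmetric]\<close>)
  have BM: "a * x \<in> lin_span B S" if "a \<in> B" "x \<in> lin_span B S" for a x
    using lin_span_scale[OF Br that(2,1)] .
  have Xscale: "X (a * x) i j = a * X x i j"
    if "a \<in> B" "x \<in> lin_span B S" "i < d" "j < d" for a x i j
    by (rule X_eqI) (use that Br BM in \<open>auto simp: sub_ringD XB mult.assoc sum_distrib_left[symmetric] X[symmetric]\<close>)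
  have Xmult: "X (x * y) i k = (\<Sum>j<d. X y i j * X x j k)"
    if xy: "x \<in> lin_span B S" "y \<in> lin_span B S" "i < d" "k < d" for x y i k
  proof (rule X_eqI)
    show "x * y \<in> lin_span B S" using xy Mr by (simp add: sub_ringD)
    have "x * y * b i = x * (\<Sum>j<d. X y i j * b j)" using X xy by (simp add: mult.assoc)
    also have "\<dots> = (\<Sum>j<d. X y i j * (x * b j))" by (simp add: sum_distrib_left algebra_simps)
    also have "\<dots> = (\<Sum>j<d. \<Sum>k<d. X y i j * X x j k * b k)"
      using X xy by (simp add: sum_distrib_left mult.assoc)
    also have "\<dots> = (\<Sum>k<d. (\<Sum>j<d. X y i j * X x j k) * b k)"
      by (subst sum.swap) (simp add: sum_distrib_right)
    finally show "x * y * b i = (\<Sum>k<d. (\<Sum>j<d. X y i j * X x j k) * b k)" .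
    show "(\<Sum>j<d. X y i j * X x j k) \<in> B" for k
      using xy by (intro sub_ring_sum[OF Br] sub_ringD(4)[OF Br] XB) auto
  qed (use xy in auto)
  define \<Gamma> where "\<Gamma> i = co (\<delta> (b i))" for i
  have \<Gamma>B: "\<Gamma> i j \<in> B" if "i < d" for i j unfolding \<Gamma>_def using that b(1) \<delta>M co(1) by auto
  have \<Gamma>: "\<delta> (b i) = (\<Sum>j<d. \<Gamma> i j * b j)" if "i < d" for i
    unfolding \<Gamma>_def using that b(1) \<delta>M co(2) by auto
  have X\<delta>: "\<delta> (X x i k) + (\<Sum>j<d. X x i j * \<Gamma> j k) = X (\<delta> x) i k + (\<Sum>j<d. \<Gamma> i j * X x j k)"
    if x: "x \<in> lin_span B S" "i < d" "k < d" for x i k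
  proof -
    have "\<delta> (x * b i) = (\<Sum>j<d. X x i j * \<delta> (b j) + \<delta> (X x i j) * b j)"
      using X[OF x(1,2)] by (simp add: derivation_sum[OF \<delta>] derivationD[OF \<delta>])
    also have "\<dots> = (\<Sum>j<d. \<Sum>k<d. X x i j * \<Gamma> j k * b k) + (\<Sum>j<d. \<delta> (X x i j) * b j)"
      by (simp add: sum.distrib \<Gamma> sum_distrib_left mult.assoc)
    also have "\<dots> = (\<Sum>k<d. (\<delta> (X x i k) + (\<Sum>j<d. X x i j * \<Gamma> j k)) * b k)"
      by (subst sum.swap) (simp add: sum.distrib distrib_right sum_distrib_right)
    finally have 1: "\<delta> (x * b i) = (\<Sum>k<d. (\<delta> (X x i k) + (\<Sum>j<d. X x i j * \<Gamma> j k)) * b k)" .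
    have "\<delta> (x * b i) = \<delta> x * b i + x * (\<Sum>j<d. \<Gamma> i j * b j)"
      using \<Gamma> x by (simp add: derivationD[OF \<delta>])
    also have "\<dots> = (\<Sum>k<d. X (\<delta> x) i k * b k) + (\<Sum>j<d. \<Gamma> i j * (x * b j))"
      using X[OF \<delta>M[OF x(1)] x(2)] by (simp add: sum_distrib_left algebra_simps)
    also have "\<dots> = (\<Sum>k<d. X (\<delta> x) i k * b k) + (\<Sum>j<d. \<Sum>k<d. \<Gamma> i j * X x j k * b k)"
      using X x by (simp add: sum_distrib_left mult.assoc)
    also have "\<dots> = (\<Sum>k<d. (X (\<delta> x) i k + (\<Sum>j<d. \<Gamma> i j * X x j k)) * b k)"
      by (subst sum.swap) (simp add: sum.distrib distrib_right sum_distrib_right)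
    finally have 2: "\<delta> (x * b i) = (\<Sum>k<d. (X (\<delta> x) i k + (\<Sum>j<d. \<Gamma> i j * X x j k)) * b k)" .
    show ?thesis
    proof (rule uniq[where c = "\<lambda>k. \<delta> (X x i k) + (\<Sum>j<d. X x i j * \<Gamma> j k)"
          and e = "\<lambda>k. X (\<delta> x) i k + (\<Sum>j<d. \<Gamma> i j * X x j k)"])
      show "\<forall>k. \<delta> (X x i k) + (\<Sum>j<d. X x i j * \<Gamma> j k) \<in> B"
        using x \<delta>B XB \<Gamma>B by (intro allI sub_ringD(3,4)[OF Br] sub_ring_sum[OF Br]) auto
      show "\<forall>k. X (\<delta> x) i k + (\<Sum>j<d. \<Gamma> i j * X x j k) \<in> B"
        using x \<delta>M XB \<Gamma>B by (intro allI sub_ringD(3,4)[OF Br] sub_ring_sum[OF Br]) auto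
    qed (use 1 2 x in auto)
  qed
  define Tr where "Tr x = (\<Sum>i<d. X x i i)" for x
  have log: "\<exists>N\<in>B. N ~= 0 \<and> Tr (\<delta> g / g) = \<delta> N / N" if g: "g \<in> lin_span B S" "g ~= 0" for g
  proof -
    define h where "h = inverse g"
    have h: "h \<in> lin_span B S" "h * g = 1" using g M by (auto simp: h_def sub_fieldD)
    define A where "A = Matrix.mat d d (\<lambda>(i, j). X g i j)"
    define H where "H = Matrix.mat d d (\<lambda>(i, j). X h i j)"
    have AH: "(\<Sum>j<d. X g i j * X h j k) = (if i = k then 1 else 0)" if "i < d" "k < d" for i k
      using Xmult[OF h(1) g(1) that] X1[OF that] h(2) by simp
    have HA: "(\<Sum>j<d. X h i j * X g j k) = (if i = k then 1 else 0)" if "i < d" "k < d" for i k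
      using Xmult[OF g(1) h(1) that] X1[OF that] h(2) by (simp add: mult.commute)
    have inv: "A * H = 1\<^sub>m d"
      by (rule eq_matI) (auto simp: A_def H_def scalar_prod_def AH atLeast0LessThan)
    have carr: "A \<in> carrier_mat d d" "H \<in> carrier_mat d d" by (auto simp: A_def H_def)
    define N where "N = Determinant.det A"
    have N0: "N ~= 0" unfolding N_def by (rule derivation_det_log[OF \<delta> carr inv])
    have NB: "N \<in> B" unfolding N_def det_def'[OF carr(1)]
    proof (intro sub_ring_sum[OF Br] sub_ringD(4)[OF Br] sub_ring_of_int[OF Br] sub_ring_prod[OF Br])
      fix p i assume "p \<in> {p. p permutes {0..<d}}" "i \<in> {0..<d}"
      moreover from this have "p i < d" using permutes_in_image[of p "{0..<d}" i] by auto
      ultimately show "A $$ (i, p i) \<in> B" using XB[OF g(1)] by (simp add: A_def)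
    qed
    have "\<delta> N / N = (\<Sum>i<d. \<Sum>j<d. \<delta> (X g i j) * X h j i)"
      using derivation_det_log(2)[OF \<delta> carr inv] by (simp add: N_def A_def H_def)
    also have "\<dots> = (\<Sum>i<d. \<Sum>j<d. (X (\<delta> g) i j + (\<Sum>l<d. \<Gamma> i l * X g l j) - (\<Sum>l<d. X g i l * \<Gamma> l j)) * X h j i)"
      by (intro sum.cong refl arg_cong2[of _ _ _ _ "(*)"]) (use X\<delta>[OF g(1)] in \<open>simp add: eq_diff_eq\<close>)
    also have "\<dots> = (\<Sum>i<d. \<Sum>j<d. X (\<delta> g) i j * X h j i)
        + (\<Sum>i<d. \<Sum>j<d. \<Sum>l<d. \<Gamma> i l * X g l j * X h j i)
        - (\<Sum>i<d. \<Sum>j<d. \<Sum>l<d. X g i l * \<Gamma> l j * X h j i)"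
      by (simp add: left_diff_distrib distrib_right sum.distrib sum_subtractf sum_distrib_right)
    also have "(\<Sum>i<d. \<Sum>j<d. X (\<delta> g) i j * X h j i) = Tr (h * \<delta> g)"
      unfolding Tr_def by (intro sum.cong refl) (use Xmult[OF h(1) \<delta>M[OF g(1)]] in auto)
    also have "(\<Sum>i<d. \<Sum>j<d. \<Sum>l<d. \<Gamma> i l * X g l j * X h j i) = (\<Sum>i<d. \<Gamma> i i)"
    proof (intro sum.cong refl)
      fix i assume i: "i \<in> {..<d}"
      have "(\<Sum>j<d. \<Sum>l<d. \<Gamma> i l * X g l j * X h j i) = (\<Sum>l<d. \<Gamma> i l * (\<Sum>j<d. X g l j * X h j i))"
        by (subst sum.swap) (simp add: sum_distrib_left mult.assoc)
      also have "\<dots> = \<Gamma> i i" using i by (simp add: AH if_distrib[of "\<lambda>c. _ * c"] cong: if_cong)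
      finally show "(\<Sum>j<d. \<Sum>l<d. \<Gamma> i l * X g l j * X h j i) = \<Gamma> i i" .
    qed
    also have "(\<Sum>i<d. \<Sum>j<d. \<Sum>l<d. X g i l * \<Gamma> l j * X h j i) = (\<Sum>i<d. \<Gamma> i i)"
    proof -
      have "(\<Sum>i<d. \<Sum>j<d. \<Sum>l<d. X g i l * \<Gamma> l j * X h j i) = (\<Sum>j<d. \<Sum>i<d. \<Sum>l<d. X g i l * \<Gamma> l j * X h j i)"
        by (rule sum.swap)
      also have "\<dots> = (\<Sum>j<d. \<Sum>l<d. \<Sum>i<d. X g i l * \<Gamma> l j * X h j i)"
        by (intro sum.cong[OF refl] sum.swap)
      also have "\<dots> = (\<Sum>j<d. \<Sum>l<d. \<Gamma> l j * (\<Sum>i<d. X h j i * X g i l))"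
        by (simp add: sum_distrib_left mult_ac)
      also have "\<dots> = (\<Sum>j<d. \<Gamma> j j)"
        by (intro sum.cong refl) (simp add: HA if_distrib[of "\<lambda>c. _ * c"] cong: if_cong)
      finally show ?thesis .
    qed
    finally have "\<delta> N / N = Tr (h * \<delta> g)" by simp
    thus ?thesis using N0 NB by (intro bexI[of _ N]) (auto simp: h_def field_simps)
  qed
  show ?thesis
  proof (rule exI[of _ d], intro conjI exI[of _ Tr] ballI impI)
    show "Tr 1 = of_nat d" by (simp add: Tr_def X1)
    show "Tr (x + y) = Tr x + Tr y" if "x \<in> lin_span B S" "y \<in> lin_span B S" for x y
      using that by (simp add: Tr_def Xadd sum.distrib)
    show "Tr (a * x) = a * Tr x" if "a \<in> B" "x \<in> lin_span B S" for a x
      using that by (simp add: Tr_def Xscale sum_distrib_left)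
  qed (use d log in auto)
qed

lemma derivation_poly:
  assumes D: "derivation D"
  shows "D (poly p x) = poly (map_poly D p) x + poly (pderiv p) x * D x"
proof (induction p)
  case (pCons a p)
  thus ?case by (simp add: map_poly_pCons derivationD[OF D] pderiv_pCons algebra_simps)
qed (simp add: derivationD[OF D])

lemma derivation_preserves_finite_extension:
  fixes \<delta> :: "'a::field_char_0 => 'a"
  assumes \<delta>: "derivation \<delta>" and B: "sub_field B" and \<delta>B: "!!x. x \<in> B ==> \<delta> x \<in> B"
    and S: "finite S" and M: "sub_field (lin_span B S)" "B \<subseteq> lin_span B S" and x: "x \<in> lin_span B S"
  shows "\<delta> x \<in> lin_span B S"
proof -
  note Br = sub_fieldD(1)[OF B] and Mr = sub_fieldD(1)[OF M(1)]
  have "algebraic_over B x"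
    by (rule algebraic_over_if_powers_in_span[OF B S sub_ring_power[OF Mr x]])
  from min_degree_annihilator[OF this] obtain p where p: "p \<in> polys_over B" "p ~= 0" "poly p x = 0"
    "\<forall>q. q \<in> polys_over B --> degree q < degree p --> poly q x = 0 --> q = 0"
    by (elim exE conjE) (rule that)
  have nz: "poly (pderiv p) x ~= 0" by (rule pderiv_annihilator_nonzero[OF Br p])
  have "0 = poly (map_poly \<delta> p) x + poly (pderiv p) x * \<delta> x"
    using derivation_poly[OF \<delta>, of p x] p(3) by (simp add: derivationD[OF \<delta>])
  hence eq: "\<delta> x = - poly (map_poly \<delta> p) x / poly (pderiv p) x" using nz by (simp add: field_simps eq_neg_iff_add_eq_0)
  have "map_poly \<delta> p \<in> polys_over B" using p(1) \<delta>B by (auto simp: polys_over_def coeff_map_poly derivationD[OF \<delta>])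
  hence "poly (map_poly \<delta> p) x \<in> lin_span B S" "poly (pderiv p) x \<in> lin_span B S"
    using polys_over_mono[OF M(2)] polys_over_ring(10)[OF Br p(1)] by (auto intro!: poly_mem[OF Mr] x)
  thus ?thesis unfolding eq using M(1) Mr by (auto intro: sub_fieldD sub_ringD)
qed

text \<open>Values at \<open>s\<close> of rational functions that vanish at infinity.\<close>

definition proper_fraction :: "'a::field set => 'a => 'a => bool" where
  "proper_fraction k s x \<longleftrightarrow> (\<exists>e\<in>polys_over k. \<exists>r\<in>polys_over k. poly r s ~= 0 \<and> x = poly e s / poly r s \<and>
     (e = 0 \<or> degree e < degree r))"

lemma proper_fraction_add:
  assumes k: "sub_field k" and x: "proper_fraction k s x" and y: "proper_fraction k s y"
  shows "proper_fraction k s (x + y)"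
proof -
  note kr = sub_fieldD(1)[OF k]
  obtain e r where x: "e \<in> polys_over k" "r \<in> polys_over k" "poly r s ~= 0" "x = poly e s / poly r s" "e = 0 \<or> degree e < degree r"
    using x unfolding proper_fraction_def by blast
  obtain e' r' where y: "e' \<in> polys_over k" "r' \<in> polys_over k" "poly r' s ~= 0" "y = poly e' s / poly r' s" "e' = 0 \<or> degree e' < degree r'"
    using y unfolding proper_fraction_def by blast
  have r0: "r ~= 0" "r' ~= 0" using x y by auto
  have "degree (e * r') < degree (r * r') \<or> e = 0" using x(5) r0 by (cases "e = 0") (auto simp: degree_mult_eq)
  moreover have "degree (e' * r) < degree (r * r') \<or> e' = 0" using y(5) r0 by (cases "e' = 0") (auto simp: degree_mult_eq)
  ultimately have "e * r' + e' * r = 0 \<or> degree (e * r' + e' * r) < degree (r * r')"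
    by (cases "e = 0"; cases "e' = 0") (auto intro: degree_add_less)
  moreover have "x + y = poly (e * r' + e' * r) s / poly (r * r') s"
    unfolding x(4) y(4) using x(3) y(3) by (subst add_frac_eq) auto
  ultimately show ?thesis unfolding proper_fraction_def
    by (intro bexI[of _ "e * r' + e' * r"] bexI[of _ "r * r'"])
      (use x y in \<open>auto intro!: polys_over_ring[OF kr]\<close>)
qed

lemma proper_fraction_scale:
  assumes k: "sub_field k" and x: "proper_fraction k s x" and a: "a \<in> k"
  shows "proper_fraction k s (a * x)"
proof -
  note kr = sub_fieldD(1)[OF k]
  obtain e r where x: "e \<in> polys_over k" "r \<in> polys_over k" "poly r s ~= 0" "x = poly e s / poly r s" "e = 0 \<or> degree e < degree r"
    using x unfolding proper_fraction_def by blast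
  have "degree (smult a e) \<le> degree e" by (rule degree_smult_le)
  hence "smult a e = 0 \<or> degree (smult a e) < degree r" using x(5) by auto
  thus ?thesis unfolding proper_fraction_def
    by (intro bexI[of _ "smult a e"] bexI[of _ r]) (use x a in \<open>auto intro!: polys_over_ring[OF kr]\<close>)
qed

lemma proper_fraction_0: "sub_field k ==> proper_fraction k s 0"
  unfolding proper_fraction_def
  by (intro bexI[of _ 0] bexI[of _ 1]) (auto intro!: polys_over_ring sub_fieldD)

lemma proper_fraction_sum:
  assumes "sub_field k" "!!j. j \<in> J ==> proper_fraction k s (f j)"
  shows "proper_fraction k s (sum f J)"
  using assms(2)
  by (induction J rule: infinite_finite_induct) (auto intro: proper_fraction_add proper_fraction_0 assms(1))

text \<open>\<open>\<delta>\<close> acts on \<open>k(s)\<close> as \<open>d/ds\<close>, and a logarithmic derivative \<open>p'/p - q'/q\<close> vanishes at infinity.\<close>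

lemma log_derivative_proper:
  fixes \<delta> :: "'a::field_char_0 => 'a"
  assumes \<delta>: "derivation \<delta>" and k: "sub_field k" and \<delta>k: "!!c. c \<in> k ==> \<delta> c = 0" and s: "\<delta> s = 1"
    and N: "N \<in> adjoin k s" "N ~= 0"
  shows "proper_fraction k s (\<delta> N / N)"
proof -
  note kr = sub_fieldD(1)[OF k]
  obtain p q where pq: "N = poly p s / poly q s" "p \<in> polys_over k" "q \<in> polys_over k"
    using N(1) unfolding adjoin_def by blast
  have nz: "poly p s ~= 0" "poly q s ~= 0" using N pq by auto
  hence pq0: "p ~= 0" "q ~= 0" by auto
  define e where "e = pderiv p * q - p * pderiv q"
  have dp: "\<delta> (poly p s) = poly (pderiv p) s" "\<delta> (poly q s) = poly (pderiv q) s"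
    using derivation_poly_const[OF \<delta> _ \<delta>k, of _ k s] pq s by auto
  have "\<delta> N / N = poly e s / poly (p * q) s"
    unfolding pq(1) derivation_divide[OF \<delta>] dp using nz by (simp add: e_def field_simps power2_eq_square)
  moreover have "e = 0 \<or> degree e < degree (p * q)"
  proof (cases "degree (p * q) = 0")
    case True
    hence "degree p = 0" "degree q = 0" using pq0 by (auto simp: degree_mult_eq)
    thus ?thesis by (auto simp: e_def elim!: degree_eq_zeroE simp: pderiv_pCons)
  next
    case False
    have 1: "degree (pderiv p * q) < degree (p * q)"
    proof (cases "pderiv p = 0")
      case False
      hence "degree p ~= 0" by (simp add: pderiv_eq_0_iff)
      thus ?thesis using False pq0 by (simp add: degree_mult_eq degree_pderiv)
    qed (use False in auto)
    have 2: "degree (p * pderiv q) < degree (p * q)"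
    proof (cases "pderiv q = 0")
      case False
      hence "degree q ~= 0" by (simp add: pderiv_eq_0_iff)
      thus ?thesis using False pq0 by (simp add: degree_mult_eq degree_pderiv)
    qed (use False in auto)
    show ?thesis unfolding e_def using degree_diff_less[OF 1 2] by simp
  qed
  ultimately show ?thesis unfolding proper_fraction_def
    by (intro bexI[of _ e] bexI[of _ "p * q"])
      (use nz pq in \<open>auto simp: e_def intro!: polys_over_ring[OF kr]\<close>)
qed

text \<open>The trace to \<open>k(s)\<close> of such a sum would be a positive integer, but it is a combination of logarithmic derivatives of norms and hence a proper fraction in \<open>s\<close>. Here \<open>s\<close> is transcendental over \<open>k\<close> because \<open>\<delta> s = 1\<close>.\<close>

lemma log_derivative_sum_neq_1:
  fixes \<delta> :: "'a::field_char_0 => 'a"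
  assumes \<delta>: "derivation \<delta>" and k: "sub_field k" and \<delta>k: "!!c. c \<in> k ==> \<delta> c = 0" and s: "\<delta> s = 1"
    and J: "finite J" and g: "!!j. j \<in> J ==> g j ~= 0 \<and> algebraic_over (adjoin k s) (g j) \<and> \<nu> j \<in> k"
  shows "(\<Sum>j\<in>J. \<nu> j * (\<delta> (g j) / g j)) ~= 1"
proof
  assume eq: "(\<Sum>j\<in>J. \<nu> j * (\<delta> (g j) / g j)) = 1"
  note kr = sub_fieldD(1)[OF k]
  define B where "B = adjoin k s"
  have B: "sub_field B" "k \<subseteq> B" "s \<in> B" using sub_field_adjoin[OF k] by (auto simp: B_def)
  note Br = sub_fieldD(1)[OF B(1)]
  have ns: "\<not> algebraic_over k s" using derivation_algebraic_zero[OF \<delta> kr \<delta>k] s by fastforce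
  have \<delta>B: "\<delta> x \<in> B" if x: "x \<in> B" for x
  proof -
    obtain p q where pq: "x = poly p s / poly q s" "p \<in> polys_over k" "q \<in> polys_over k"
      using x unfolding B_def adjoin_def by blast
    have dp: "\<delta> (poly p s) = poly (pderiv p) s" "\<delta> (poly q s) = poly (pderiv q) s"
      using derivation_poly_const[OF \<delta> _ \<delta>k, of _ k s] pq s by auto
    have "poly r s \<in> B" if "r \<in> polys_over k" for r
      by (rule poly_mem[OF Br]) (use that polys_over_mono[OF B(2)] B in auto)
    hence "poly p s \<in> B" "poly q s \<in> B" "poly (pderiv p) s \<in> B" "poly (pderiv q) s \<in> B"
      using pq polys_over_ring(10)[OF kr] by auto
    thus ?thesis unfolding pq(1) derivation_divide[OF \<delta>] dp
      by (intro sub_fieldD(3)[OF B(1)] sub_ringD(4,6)[OF Br] sub_ring_power[OF Br])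
  qed
  obtain S where S: "finite S" "sub_field (lin_span B S)" "B \<subseteq> lin_span B S" "g ` J \<subseteq> lin_span B S"
    using finite_extension_exists[OF B(1), of "g ` J"] J g unfolding B_def by auto
  note Mr = sub_fieldD(1)[OF S(2)]
  have \<delta>M: "\<delta> x \<in> lin_span B S" if "x \<in> lin_span B S" for x
    by (rule derivation_preserves_finite_extension[OF \<delta> B(1) \<delta>B S(1,2,3) that])
  obtain d Tr where d: "d > 0" and Tr: "\<forall>x\<in>lin_span B S. \<forall>y\<in>lin_span B S. Tr (x + y) = Tr x + Tr y"
     "\<forall>a\<in>B. \<forall>x\<in>lin_span B S. Tr (a * x) = a * Tr x" "Tr 1 = of_nat d"
     "\<forall>g\<in>lin_span B S. g ~= 0 --> (\<exists>N\<in>B. N ~= 0 \<and> Tr (\<delta> g / g) = \<delta> N / N)"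
    using trace_of_log_derivative[OF \<delta> B(1) _ S(1,2), OF \<delta>B \<delta>M, simplified] by (elim exE conjE) (rule that)
  have Tr0: "Tr 0 = 0" using Tr(1) sub_ringD(1)[OF Mr] by (metis add_cancel_right_right)
  have tm: "\<nu> j * (\<delta> (g j) / g j) \<in> lin_span B S" if "j \<in> J" for j
    using g[OF that] S that B \<delta>M by (intro sub_ringD(4)[OF Mr] sub_fieldD(3)[OF S(2)]) auto
  have "Tr (\<Sum>j\<in>J. \<nu> j * (\<delta> (g j) / g j)) = (\<Sum>j\<in>J. Tr (\<nu> j * (\<delta> (g j) / g j)))"
    using J tm
  proof (induction J rule: finite_induct)
    case (insert a J)
    have "(\<Sum>j\<in>J. \<nu> j * (\<delta> (g j) / g j)) \<in> lin_span B S" using insert by (intro sub_ring_sum[OF Mr]) auto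
    thus ?case using insert Tr(1) by simp
  qed (simp add: Tr0)
  also have "\<dots> = (\<Sum>j\<in>J. \<nu> j * Tr (\<delta> (g j) / g j))"
  proof (intro sum.cong refl)
    fix j assume j: "j \<in> J"
    have "\<delta> (g j) / g j \<in> lin_span B S" using S(4) j \<delta>M by (intro sub_fieldD(3)[OF S(2)]) auto
    thus "Tr (\<nu> j * (\<delta> (g j) / g j)) = \<nu> j * Tr (\<delta> (g j) / g j)" using Tr(2) g[OF j] B(2) by blast
  qed
  finally have "of_nat d = (\<Sum>j\<in>J. \<nu> j * Tr (\<delta> (g j) / g j))" using eq Tr(3) by simp
  moreover have "proper_fraction k s (\<Sum>j\<in>J. \<nu> j * Tr (\<delta> (g j) / g j))"
  proof (intro proper_fraction_sum[OF k] proper_fraction_scale[OF k])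
    fix j assume j: "j \<in> J"
    obtain N where N: "N \<in> B" "N ~= 0" "Tr (\<delta> (g j) / g j) = \<delta> N / N" using Tr(4) S(4) g[OF j] j by blast
    show "proper_fraction k s (Tr (\<delta> (g j) / g j))"
      using log_derivative_proper[OF \<delta> k \<delta>k s] N unfolding B_def by simp
  qed (use g in auto)
  ultimately have "proper_fraction k s (of_nat d)" by simp
  then obtain e r where er: "e \<in> polys_over k" "r \<in> polys_over k" "poly r s ~= 0"
      "of_nat d = poly e s / poly r s" "e = 0 \<or> degree e < degree r"
    unfolding proper_fraction_def by blast
  define w where "w = smult (of_nat d) r - e"
  have "w \<in> polys_over k" unfolding w_def using er by (intro polys_over_ring[OF kr] sub_ring_of_nat[OF kr])
  moreover have "poly w s = 0" using er by (simp add: w_def)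
  ultimately have "w = 0" using ns by (auto simp: algebraic_over_def)
  hence "e = smult (of_nat d) r" by (simp add: w_def)
  moreover have "of_nat d ~= (0::'a)" "r ~= 0" using d er(3) by auto
  ultimately have "e ~= 0" "degree e = degree r" by auto
  thus False using er(5) by auto
qed

section \<open>Laurent series and separated functions\<close>

no_notation fps_nth (infixl "$" 75)

no_notation fls_nth (infixl "$$" 75)

no_notation vec_index (infixl "$" 100)

no_notation index_mat (infixl "$$" 100)

lemma fls_mult_nth_bounds:
  fixes f g :: "'a::field fls"
  assumes f: "!!i. i < a ==> fls_nth f i = 0" and g: "!!i. i < b ==> fls_nth g i = 0"
  shows "fls_nth (f * g) n = (\<Sum>i=a..n - b. fls_nth f i * fls_nth g (n - i))"
proof -
  have *: "fls_nth f i * fls_nth g (n - i) = 0" if "i < a \<or> i > n - b \<or> i < fls_subdegree f \<or> i > n - fls_subdegree g" for i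
    using that f[of i] g[of "n - i"] fls_eq0_below_subdegree[of i f] fls_eq0_below_subdegree[of "n - i" g] by auto
  have "fls_nth (f * g) n = (\<Sum>i=fls_subdegree f..n - fls_subdegree g. fls_nth f i * fls_nth g (n - i))"
    by (rule fls_times_nth(2))
  also have "\<dots> = (\<Sum>i\<in>{fls_subdegree f..n - fls_subdegree g} \<union> {a..n - b}. fls_nth f i * fls_nth g (n - i))"
    by (rule sum.mono_neutral_left) (auto simp del: mult_eq_0_iff intro!: *)
  also have "\<dots> = (\<Sum>i=a..n - b. fls_nth f i * fls_nth g (n - i))"
  proof (rule sum.mono_neutral_right)
    show "\<forall>i\<in>{fls_subdegree f..n - fls_subdegree g} \<union> {a..n - b} - {a..n - b}. fls_nth f i * fls_nth g (n - i) = 0"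
    proof
      fix i assume "i \<in> {fls_subdegree f..n - fls_subdegree g} \<union> {a..n - b} - {a..n - b}"
      hence "i < a \<or> i > n - b" by auto
      thus "fls_nth f i * fls_nth g (n - i) = 0" by (intro *) auto
    qed
  qed auto
  finally show ?thesis .
qed

definition fls_coeffs_in :: "'a::field set => 'a fls set" where
  "fls_coeffs_in A = {f. \<forall>n. fls_nth f n \<in> A}"

lemma sub_field_fls_coeffs_in:
  assumes A: "sub_field A" shows "sub_field (fls_coeffs_in A)"
proof -
  note Ar = sub_fieldD(1)[OF A]
  have mult: "f * g \<in> fls_coeffs_in A" if "f \<in> fls_coeffs_in A" "g \<in> fls_coeffs_in A" for f g
    using that unfolding fls_coeffs_in_def
    by (auto simp: fls_times_nth(2) intro!: sub_ring_sum[OF Ar] sub_ringD(4)[OF Ar])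
  have inv: "inverse f \<in> fls_coeffs_in A" if f: "f \<in> fls_coeffs_in A" for f
  proof (cases "f = 0")
    case False
    define d where "d = fls_subdegree f"
    define h where "h = inverse f"
    have h0: "fls_nth h i = 0" if "i < - d" for i
      using that fls_eq0_below_subdegree[of i h] by (simp add: h_def d_def)
    have lead: "fls_nth f d ~= 0" using False by (simp add: d_def)
    have fA: "fls_nth f i \<in> A" for i using f by (simp add: fls_coeffs_in_def)
    have "fls_nth h (int m - d) \<in> A" for m
    proof (induction m rule: less_induct)
      case (less m)
      define n where "n = int m - d"
      have "(\<Sum>i=d..n + d + d. fls_nth f i * fls_nth h (n + d - i)) = fls_nth (f * h) (n + d)"
        by (subst fls_mult_nth_bounds[of d f "-d" h]) (use h0 in \<open>auto simp: d_def\<close>)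
      also have "f * h = 1" using False by (simp add: h_def)
      also have "{d..n + d + d} = insert d {d+1..n + d + d}" by (auto simp: n_def)
      finally have "fls_nth f d * fls_nth h n + (\<Sum>i=d+1..n + d + d. fls_nth f i * fls_nth h (n + d - i)) = fls_nth 1 (n + d)"
        by simp
      hence "fls_nth h n = (fls_nth 1 (n + d) - (\<Sum>i=d+1..n + d + d. fls_nth f i * fls_nth h (n + d - i))) / fls_nth f d"
        using lead by (simp add: field_simps)
      also have "\<dots> \<in> A"
      proof (intro sub_fieldD(3)[OF A] sub_ringD(6)[OF Ar] sub_ring_sum[OF Ar] sub_ringD(4)[OF Ar] fA)
        show "fls_nth 1 (n + d) \<in> A" using sub_ringD(1,2)[OF Ar] by simp
        fix i assume i: "i \<in> {d+1..n + d + d}"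
        have "fls_nth h (int (nat (n + d - i + d)) - d) \<in> A" by (rule less.IH) (use i in \<open>auto simp: n_def\<close>)
        moreover have "int (nat (n + d - i + d)) - d = n + d - i" using i by simp
        ultimately show "fls_nth h (n + d - i) \<in> A" by metis
      qed
      finally show ?case by (simp add: n_def)
    qed
    hence "fls_nth h (int (nat (i + d)) - d) \<in> A" for i .
    hence "fls_nth h i \<in> A" if "\<not> i < - d" for i
      using that by (metis add_diff_cancel_right' int_nat_eq le_add_iff2 linorder_not_less neg_le_iff_le minus_le_iff diff_ge_0_iff_ge diff_minus_eq_add minus_diff_eq add.commute)
    hence "fls_nth h i \<in> A" for i
      using h0[of i] sub_ringD(1)[OF Ar] by (cases "i < - d") auto
    thus ?thesis by (simp add: fls_coeffs_in_def h_def)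
  qed (use sub_ringD(1)[OF Ar] in \<open>simp add: fls_coeffs_in_def\<close>)
  show ?thesis unfolding sub_field_def sub_ring_def
    using mult inv sub_ringD[OF Ar] by (auto simp: fls_coeffs_in_def)
qed

text \<open>The lift of a derivation of the coefficient field to Laurent series; it commutes with the derivation \<open>d/dw\<close>.\<close>

definition fls_coeff_map :: "('a::field => 'a) => 'a fls => 'a fls" where
  "fls_coeff_map D f = Abs_fls (\<lambda>n. D (fls_nth f n))"

lemma fls_coeff_map_nth:
  assumes "D 0 = 0" shows "fls_nth (fls_coeff_map D f) n = D (fls_nth f n)"
  unfolding fls_coeff_map_def using assms
  by (subst nth_Abs_fls_lower_bound[of "fls_subdegree f"]) auto

lemma derivation_fls_coeff_map:
  assumes D: "derivation D" shows "derivation (fls_coeff_map D)"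
proof -
  note z = derivationD(3)[OF D]
  note nth = fls_coeff_map_nth[of D, OF z]
  have "fls_coeff_map D (f * g) = f * fls_coeff_map D g + fls_coeff_map D f * g" for f g
  proof (rule fls_eqI)
    fix n
    define a where "a = fls_subdegree f"
    define b where "b = fls_subdegree g"
    have ab: "!!i. i < a ==> fls_nth f i = 0" "!!i. i < b ==> fls_nth g i = 0"
      by (auto simp: a_def b_def fls_eq0_below_subdegree)
    have ab': "!!i. i < a ==> fls_nth (fls_coeff_map D f) i = 0" "!!i. i < b ==> fls_nth (fls_coeff_map D g) i = 0"
      using ab z by (auto simp: nth)
    show "fls_nth (fls_coeff_map D (f * g)) n = fls_nth (f * fls_coeff_map D g + fls_coeff_map D f * g) n"
      using fls_mult_nth_bounds[of a f b g n] fls_mult_nth_bounds[of a f b "fls_coeff_map D g" n]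
        fls_mult_nth_bounds[of a "fls_coeff_map D f" b g n] ab ab'
      by (simp add: nth derivation_sum[OF D] derivationD[OF D] sum.distrib)
  qed
  moreover have "fls_coeff_map D (f + g) = fls_coeff_map D f + fls_coeff_map D g" for f g
    by (rule fls_eqI) (simp add: nth derivationD[OF D])
  ultimately show ?thesis by (simp add: derivation_on_def)
qed

lemma fls_coeff_map_const: "D 0 = 0 ==> fls_coeff_map D (fls_const a) = fls_const (D a)"
  by (rule fls_eqI) (simp add: fls_coeff_map_nth)

lemma derivation_fls_deriv: "derivation (fls_deriv :: 'a::field fls => 'a fls)"
  by (simp add: derivation_on_def)

lemma derivation_of_int_mult:
  fixes D :: "'a::field => 'a"
  assumes "derivation D" shows "D (of_int n * x) = of_int n * D x"
  using assms by (simp add: derivationD derivation_of_int)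

lemma fls_coeff_map_deriv_commute:
  assumes D: "derivation D" shows "fls_coeff_map D (fls_deriv f) = fls_deriv (fls_coeff_map D f)"
  by (rule fls_eqI) (simp add: fls_coeff_map_nth derivationD(3)[OF D] derivation_of_int_mult[OF D, of "_ + 1", simplified]
      derivation_of_int_mult[OF D] del: of_int_add)

definition constants_of :: "('a::field => 'a) => 'a set" where
  "constants_of D = {x. D x = 0}"

lemma sub_field_constants:
  assumes D: "derivation D" shows "sub_field (constants_of D)"
  unfolding sub_field_def sub_ring_def constants_of_def
  by (auto simp: derivationD[OF D] derivation_inverse[OF D])

definition generated_field :: "'a::field set => 'a set" where
  "generated_field S = \<Inter>{L. sub_field L \<and> S \<subseteq> L}"

lemma generated_field:
  shows "sub_field (generated_field S)" "S \<subseteq> generated_field S"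
    "sub_field L ==> S \<subseteq> L ==> generated_field S \<subseteq> L"
  unfolding generated_field_def by (auto simp: sub_field_def sub_ring_def)

text \<open>With coefficients that are functions of \<open>z\<close>, these are the functions of \<open>z\<close> alone and, for the field \<open>F\<close> of constants, the functions of \<open>w\<close> alone.\<close>

definition separated_series :: "'k::field set => 'k fls set" where
  "separated_series F = range fls_const \<union> fls_coeffs_in F"

definition separated_field :: "'k::field set => 'k fls set" where
  "separated_field F = generated_field (separated_series F)"

lemma poly_map_fls_const: "poly (map_poly fls_const p) (fls_const x) = fls_const (poly (p::'a::field poly) x)"
  by (induction p) (auto simp: map_poly_pCons fls_plus_const)

lemma map_poly_fls_const_mem:
  "p \<in> polys_over A ==> fls_const ` A \<subseteq> B ==> map_poly fls_const p \<in> polys_over B"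
  by (auto simp: polys_over_def coeff_map_poly)

lemma algebraic_over_fls_const:
  fixes t :: "'a::field"
  assumes a: "algebraic_over (adjoin C t) a" and sub: "fls_const ` C \<subseteq> k"
  shows "algebraic_over (adjoin k (fls_const t)) (fls_const a)"
proof -
  have "fls_const ` adjoin C t \<subseteq> adjoin k (fls_const t)"
  proof safe
    fix x assume "x \<in> adjoin C t"
    then obtain p q where pq: "x = poly p t / poly q t" "p \<in> polys_over C" "q \<in> polys_over C"
      unfolding adjoin_def by blast
    have "fls_const x = poly (map_poly fls_const p) (fls_const t) / poly (map_poly fls_const q) (fls_const t)"
      by (simp add: pq(1) poly_map_fls_const fls_const_divide_const)
    thus "fls_const x \<in> adjoin k (fls_const t)"
      unfolding adjoin_def using map_poly_fls_const_mem[OF _ sub] pq by blast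
  qed
  moreover obtain p where p: "p \<in> polys_over (adjoin C t)" "p ~= 0" "poly p a = 0"
    using a unfolding algebraic_over_def by blast
  ultimately have "map_poly fls_const p \<in> polys_over (adjoin k (fls_const t))"
    by (intro map_poly_fls_const_mem)
  moreover have "map_poly fls_const p ~= 0" using p(2) by (subst map_poly_eq_0_iff) auto
  moreover have "poly (map_poly fls_const p) (fls_const a) = 0" using p(3) by (simp add: poly_map_fls_const)
  ultimately show ?thesis unfolding algebraic_over_def by blast
qed

lemma derivation_log_divide:
  fixes D :: "'a::field => 'a"
  assumes D: "derivation D" and "c ~= 0" "g ~= 0" "D c = 0"
  shows "D (g * c) / (g * c) = D g / g"
  using assms by (simp add: derivationD[OF D])

lemma fls_nth_of_sum: "fls_nth (sum f I) n = (\<Sum>i\<in>I. fls_nth (f i :: 'a::field fls) n)"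
  by (induction I rule: infinite_finite_induct) auto

text \<open>Suppose that the coefficient \<open>t\<close> of \<open>w\<^sup>n\<close> in \<open>f\<close> is transcendental over \<open>F\<close>. Take a subfield \<open>C\<close> over which \<open>t\<close> is still transcendental while everything is algebraic over \<open>C(t)\<close>, and the derivation \<open>D\<close> with \<open>D t = 1\<close> and \<open>D C = 0\<close>, lifted to the coefficients. Applied to the identity it shows that \<open>D f - \<Sum>\<nu>\<^sub>j D g\<^sub>j / g\<^sub>j\<close> is free of \<open>w\<close>; dividing each \<open>g\<^sub>j\<close> by its leading coefficient and subtracting from \<open>f\<close> its coefficient of \<open>w\<^sup>0\<close> makes it vanish. The new \<open>f\<close> has \<open>D f ~= 0\<close>, and by exchange the \<open>g\<^sub>j\<close> are algebraic over \<open>k(f)\<close> with \<open>k\<close> the constants of the lifted \<open>D\<close>. The derivation \<open>D / D f\<close> then contradicts \<open>log_derivative_sum_neq_1\<close>.\<close>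

lemma log_derivative_identity:
  fixes f :: "'k::field_char_0 fls"
  assumes F: "sub_field F" and J: "finite J"
    and f: "algebraic_over (separated_field F) f"
    and g: "!!j. j \<in> J ==> g j ~= 0 \<and> algebraic_over (separated_field F) (g j) \<and> \<nu> j \<in> F"
    and eq: "fls_deriv f = (\<Sum>j\<in>J. fls_const (\<nu> j) * (fls_deriv (g j) / g j))"
    and n: "n ~= 0"
  shows "algebraic_over F (fls_nth f n)"
proof (rule ccontr)
  define t where "t = fls_nth f n"
  assume "\<not> algebraic_over F (fls_nth f n)"
  hence "\<not> algebraic_over F t" by (simp add: t_def)
  then obtain C where C: "sub_field C" "F \<subseteq> C" "\<not> algebraic_over C t" "!!x. algebraic_over (adjoin C t) x"
    using maximal_avoiding_subfield[OF F, of t] by metis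
  obtain D where D: "derivation D" "D t = 1" "!!c. c \<in> C ==> D c = 0"
    using derivation_extension[OF C(1,3)] by blast
  define \<D> where "\<D> = fls_coeff_map D"
  have dD: "derivation \<D>" unfolding \<D>_def by (rule derivation_fls_coeff_map[OF D(1)])
  note D0 = derivationD(3)[OF D(1)]
  have nth: "fls_nth (\<D> x) i = D (fls_nth x i)" for x i unfolding \<D>_def by (rule fls_coeff_map_nth[of D, OF D0])
  have comm: "\<D> (fls_deriv x) = fls_deriv (\<D> x)" for x
    unfolding \<D>_def by (rule fls_coeff_map_deriv_commute[OF D(1)])
  have \<D>const: "\<D> (fls_const a) = fls_const (D a)" for a unfolding \<D>_def by (rule fls_coeff_map_const[of D, OF D0])
  note dw = derivation_fls_deriv
  define k0 where "k0 = constants_of \<D>"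
  have k0: "sub_field k0" unfolding k0_def by (rule sub_field_constants[OF dD])
  define \<tau> where "\<tau> = fls_const t"
  have constC: "fls_const ` C \<subseteq> k0" using D(3) by (auto simp: k0_def constants_of_def \<D>const)
  define \<A> where "\<A> = {x. algebraic_over (adjoin k0 \<tau>) x}"
  have ad: "sub_field (adjoin k0 \<tau>)" "k0 \<subseteq> adjoin k0 \<tau>" by (rule sub_field_adjoin[OF k0])+
  have \<A>: "sub_field \<A>" unfolding \<A>_def by (rule sub_field_algebraic_closure[OF ad(1)])
  have constA: "fls_const a \<in> \<A>" for a
    unfolding \<A>_def \<tau>_def using algebraic_over_fls_const[OF C(4) constC] by simp
  have "separated_series F \<subseteq> \<A>"
  proof -
    have "fls_coeffs_in F \<subseteq> k0"
    proof
      fix x assume "x \<in> fls_coeffs_in F"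
      hence "D (fls_nth x i) = 0" for i using C(2) D(3) by (auto simp: fls_coeffs_in_def)
      thus "x \<in> k0" by (auto simp: k0_def constants_of_def nth intro!: fls_eqI)
    qed
    moreover have "k0 \<subseteq> \<A>" unfolding \<A>_def
      using ad algebraic_over_self[OF sub_fieldD(1)[OF ad(1)]] by blast
    ultimately show ?thesis using constA by (auto simp: separated_series_def)
  qed
  hence "separated_field F \<subseteq> \<A>" unfolding separated_field_def by (intro generated_field(3) \<A>)
  hence algA: "x \<in> \<A>" if "algebraic_over (separated_field F) x" for x
    using algebraic_over_mono[OF _ that] algebraic_over_trans[OF ad(1)] unfolding \<A>_def by blast
  note Ar = sub_fieldD(1)[OF \<A>]
  \<comment> \<open>with leading coefficient 1, the logarithmic derivative \<open>\<D> (h j) / h j\<close> has no coefficient of \<open>w\<^sup>0\<close>\<close>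
  define a where "a j = fls_nth (g j) (fls_subdegree (g j))" for j
  define h where "h j = g j * fls_const (inverse (a j))" for j
  define s where "s = f - fls_const (fls_nth f 0)"
  have a0: "a j ~= 0" if "j \<in> J" for j using g[OF that] by (simp add: a_def)
  have h0: "h j ~= 0" if "j \<in> J" for j using g[OF that] a0[OF that] by (simp add: h_def)
  have hA: "h j \<in> \<A>" if "j \<in> J" for j
    unfolding h_def using algA g[OF that] constA by (intro sub_ringD(4)[OF Ar]) auto
  have sA: "s \<in> \<A>" unfolding s_def using algA[OF f] constA by (intro sub_ringD(6)[OF Ar]) auto
  have hlog: "fls_deriv (h j) / h j = fls_deriv (g j) / g j" if "j \<in> J" for j
    unfolding h_def by (rule derivation_log_divide[OF dw]) (use that g a0 in auto)
  have s': "fls_deriv s = (\<Sum>j\<in>J. fls_const (\<nu> j) * (fls_deriv (h j) / h j))"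
    using eq hlog by (simp add: s_def)
  define E where "E = \<D> s - (\<Sum>j\<in>J. fls_const (\<nu> j) * (\<D> (h j) / h j))"
  have \<D>\<nu>: "\<D> (fls_const (\<nu> j)) = 0" if "j \<in> J" for j using g[OF that] C(2) D(3) by (auto simp: \<D>const)
  have "fls_deriv E = 0"
  proof -
    have "\<D> (fls_deriv s) = (\<Sum>j\<in>J. fls_const (\<nu> j) * \<D> (fls_deriv (h j) / h j))"
      unfolding s' derivation_sum[OF dD]
      by (intro sum.cong refl) (simp only: derivationD(2)[OF dD] \<D>\<nu>, simp)
    also have "\<dots> = (\<Sum>j\<in>J. fls_deriv (fls_const (\<nu> j) * (\<D> (h j) / h j)))"
      by (intro sum.cong refl)
        (simp add: derivation_divide[OF dD] derivation_divide[OF dw] comm algebra_simps diff_divide_distrib)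
    finally show ?thesis by (simp add: E_def comm derivation_sum[OF dw])
  qed
  moreover have "fls_nth E 0 = 0"
  proof -
    have "fls_nth (\<D> (h j) / h j) 0 = 0" if j: "j \<in> J" for j
    proof -
      define d where "d = fls_subdegree (g j)"
      have hn: "fls_nth (h j) i = fls_nth (g j) i * inverse (a j)" for i by (simp add: h_def)
      have sd: "fls_subdegree (h j) = d"
        unfolding h_def d_def using g[OF j] a0[OF j] by (subst fls_subdegree_mult) auto
      have 1: "fls_nth (\<D> (h j)) i = 0" if "i < d + 1" for i
      proof (cases "i = d")
        case True
        thus ?thesis using a0[OF j] by (simp add: nth hn d_def flip: a_def) (simp add: a_def derivationD[OF D(1)])
      next
        case False
        hence "i < d" using that by simp
        thus ?thesis by (simp add: nth hn d_def D0)
      qed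
      have 2: "fls_nth (inverse (h j)) i = 0" if "i < - d" for i
        using that sd fls_eq0_below_subdegree[of i "inverse (h j)"] by simp
      show ?thesis unfolding divide_inverse
        by (subst fls_mult_nth_bounds[of "d + 1" _ "-d", OF 1 2]) auto
    qed
    hence "fls_nth (\<Sum>j\<in>J. fls_const (\<nu> j) * (\<D> (h j) / h j)) 0 = 0"
      by (simp add: fls_nth_of_sum del: times_divide_eq_right)
    thus ?thesis by (simp add: E_def nth s_def D0)
  qed
  ultimately have "E = 0"
  proof -
    have "fls_nth E i = 0" for i
    proof (cases "i = 0")
      case False
      have "fls_nth (fls_deriv E) (i - 1) = 0" using \<open>fls_deriv E = 0\<close> by simp
      thus ?thesis using False by simp
    qed (use \<open>fls_nth E 0 = 0\<close> in simp)
    thus ?thesis by (intro fls_eqI) auto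
  qed
  hence rel: "\<D> s = (\<Sum>j\<in>J. fls_const (\<nu> j) * (\<D> (h j) / h j))" by (simp add: E_def)
  have "fls_nth (\<D> s) n = 1" using n D(2) by (simp add: nth s_def t_def)
  hence \<D>s: "\<D> s ~= 0" by auto
  have "\<not> algebraic_over k0 s"
    using derivation_algebraic_zero[OF dD sub_fieldD(1)[OF k0]] \<D>s by (auto simp: k0_def constants_of_def)
  hence ex: "algebraic_over (adjoin k0 s) \<tau>"
    using algebraic_exchange[OF k0] sA by (simp add: \<A>_def)
  have as: "sub_field (adjoin k0 s)" "k0 \<subseteq> adjoin k0 s" by (rule sub_field_adjoin[OF k0])+
  have "adjoin k0 \<tau> \<subseteq> {x. algebraic_over (adjoin k0 s) x}"
    by (rule adjoin_least[OF sub_field_algebraic_closure[OF as(1)]])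
      (use ex as algebraic_over_self[OF sub_fieldD(1)[OF as(1)]] in auto)
  hence hs: "algebraic_over (adjoin k0 s) (h j)" if "j \<in> J" for j
    using algebraic_over_trans[OF as(1)] algebraic_over_mono hA[OF that] unfolding \<A>_def by blast
  define \<delta> where "\<delta> x = \<D> x / \<D> s" for x
  have d\<delta>: "derivation \<delta>"
    by (auto simp: derivation_on_def \<delta>_def derivationD[OF dD] add_divide_distrib)
  have "(\<Sum>j\<in>J. fls_const (\<nu> j) * (\<delta> (h j) / h j)) ~= 1"
  proof (rule log_derivative_sum_neq_1[OF d\<delta> k0])
    show "\<delta> c = 0" if "c \<in> k0" for c using that by (simp add: \<delta>_def k0_def constants_of_def)
    show "\<delta> s = 1" using \<D>s by (simp add: \<delta>_def)
    show "h j ~= 0 \<and> algebraic_over (adjoin k0 s) (h j) \<and> fls_const (\<nu> j) \<in> k0" if "j \<in> J" for j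
      using h0 hs \<D>\<nu> that by (simp add: k0_def constants_of_def)
  qed (rule J)
  moreover have "(\<Sum>j\<in>J. fls_const (\<nu> j) * (\<delta> (h j) / h j)) = \<D> s / \<D> s"
    unfolding rel[symmetric] by (subst (1) rel) (simp add: \<delta>_def sum_divide_distrib mult.commute)
  ultimately show False using \<D>s by simp
qed

lemma derivation_preserves_algebraic:
  fixes D :: "'a::field_char_0 => 'a"
  assumes D: "derivation D" and B: "sub_field B" "!!x. x \<in> B ==> D x \<in> B" and x: "algebraic_over B x"
  shows "algebraic_over B (D x)"
proof -
  note Br = sub_fieldD(1)[OF B(1)]
  have "\<exists>S. finite S \<and> sub_field (lin_span B S) \<and> B \<subseteq> lin_span B S \<and> {x} \<subseteq> lin_span B S"
    by (rule finite_extension_exists[OF B(1)]) (use x in auto)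
  then obtain S where S: "finite S" "sub_field (lin_span B S)" "B \<subseteq> lin_span B S" "x \<in> lin_span B S" by auto
  have "D x \<in> lin_span B S"
    by (rule derivation_preserves_finite_extension[OF D B(1) _ S]) (rule B(2))
  thus ?thesis
    by (intro algebraic_over_if_powers_in_span[OF B(1) S(1)] sub_ring_power[OF sub_fieldD(1)[OF S(2)]])
qed

definition separated_algebraic :: "'k::field set => 'k fls set" where
  "separated_algebraic F = {x. algebraic_over (separated_field F) x}"

lemma separated_algebraic:
  fixes F :: "'k::field_char_0 set"
  assumes F: "sub_field F"
  shows "sub_field (separated_algebraic F)"
    "algebraic_over (separated_algebraic F) x ==> x \<in> separated_algebraic F"
    "x \<in> separated_algebraic F ==> fls_deriv x \<in> separated_algebraic F"
    "fls_deriv x = 0 ==> x \<in> separated_algebraic F"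
    "separated_series F \<subseteq> separated_algebraic F"
proof -
  have sf: "sub_field (separated_field F)" unfolding separated_field_def by (rule generated_field)
  show "sub_field (separated_algebraic F)"
    unfolding separated_algebraic_def by (rule sub_field_algebraic_closure[OF sf])
  show "algebraic_over (separated_algebraic F) x ==> x \<in> separated_algebraic F"
    unfolding separated_algebraic_def using algebraic_over_trans[OF sf] by blast
  show sub: "separated_series F \<subseteq> separated_algebraic F"
    using generated_field(2)[of "separated_series F"] algebraic_over_self[OF sub_fieldD(1)[OF sf]]
    unfolding separated_algebraic_def separated_field_def by blast
  show "x \<in> separated_algebraic F" if "fls_deriv x = 0"
  proof -
    have "fls_nth x i = 0" if "i ~= 0" for i
    proof -
      have "fls_nth (fls_deriv x) (i - 1) = 0" using \<open>fls_deriv x = 0\<close> by simp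
      thus ?thesis using that by simp
    qed
    hence "x = fls_const (fls_nth x 0)" by (intro fls_eqI) auto
    thus ?thesis using sub unfolding separated_series_def by blast
  qed
  define L where "L = {x \<in> separated_field F. fls_deriv x \<in> separated_field F}"
  note sr = sub_fieldD(1)[OF sf]
  have "sub_field L" unfolding sub_field_def sub_ring_def L_def
    using sub_ringD[OF sr] sub_fieldD[OF sf] sub_ring_power[OF sr]
    by (auto simp: derivation_inverse[OF derivation_fls_deriv])
  moreover have "separated_series F \<subseteq> L"
  proof
    fix x assume x: "x \<in> separated_series F"
    have "fls_deriv x \<in> separated_series F"
    proof (cases "x \<in> range fls_const")
      case True
      have "(0::'k fls) \<in> range fls_const" by (metis fls_const_0 rangeI)
      thus ?thesis using True by (auto simp: separated_series_def)
    next
      case False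
      hence "x \<in> fls_coeffs_in F" using x by (auto simp: separated_series_def)
      hence "of_int (i + 1) * fls_nth x (i + 1) \<in> F" for i
        using sub_ringD(4)[OF sub_fieldD(1)[OF F] sub_ring_of_int[OF sub_fieldD(1)[OF F], of "i + 1"]]
        by (simp add: fls_coeffs_in_def del: of_int_add)
      hence "fls_deriv x \<in> fls_coeffs_in F" by (simp add: fls_coeffs_in_def del: of_int_add)
      thus ?thesis by (simp add: separated_series_def)
    qed
    thus "x \<in> L" using x generated_field(2)[of "separated_series F"] by (auto simp: L_def separated_field_def)
  qed
  ultimately have "separated_field F \<subseteq> L" unfolding separated_field_def by (rule generated_field(3))
  hence "fls_deriv x \<in> separated_field F" if "x \<in> separated_field F" for x using that by (auto simp: L_def)
  thus "x \<in> separated_algebraic F ==> fls_deriv x \<in> separated_algebraic F"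
    unfolding separated_algebraic_def using derivation_preserves_algebraic[OF derivation_fls_deriv sf] by blast
qed

text \<open>The situation of a power product \<open>U\<close> of elements of \<open>A\<close>: its logarithmic derivative \<open>u\<close> is in \<open>A\<close>, but \<open>U\<close> itself is not, hence it is transcendental over the algebraically closed \<open>A\<close>.\<close>

locale hyperexponential =
  fixes D :: "'f::field_char_0 => 'f" and A C :: "'f set" and U u :: 'f
  assumes D: "derivation D" and A: "sub_field A" "!!x. algebraic_over A x ==> x \<in> A" "!!x. D x = 0 ==> x \<in> A"
    "!!x. x \<in> A ==> D x \<in> A"
    and C: "sub_field C" "!!x. x \<in> C ==> D x = 0"
    and U: "D U = u * U" "u \<in> A" "U \<notin> A"
begin

lemma U0: "U ~= 0" using U(3) sub_ringD(1)[OF sub_fieldD(1)[OF A(1)]] by auto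

lemma u0: "u ~= 0" using U A(3)[of U] by auto

lemma CA: "C \<subseteq> A" using A(3) C(2) by blast

text \<open>A rational function of \<open>U\<close> is replaced by its Laurent expansion in an indeterminate; \<open>pD\<close> and \<open>sD\<close> are the derivations of polynomials and series that correspond to \<open>D\<close>, so that \<open>sD\<close> acts on the coefficient of \<open>U\<^sup>n\<close> as \<open>c \<mapsto> D c + n u c\<close>.\<close>

definition embed :: "'f poly => 'f fls" where "embed N = fps_to_fls (fps_of_poly N)"

definition pD :: "'f poly => 'f poly" where "pD N = map_poly D N + smult u (pCons 0 (pderiv N))"

definition sD :: "'f fls => 'f fls" where "sD f = fls_coeff_map D f + fls_const u * (fls_X * fls_deriv f)"

lemma embed_add: "embed (p + q) = embed p + embed q"
  by (simp add: embed_def fps_of_poly_add)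

lemma embed_mult: "embed (p * q) = embed p * embed q"
  by (simp add: embed_def fps_of_poly_mult fls_times_fps_to_fls)

lemma embed_smult: "embed (smult c p) = fls_const c * embed p"
  by (simp add: embed_def fps_of_poly_smult fls_times_fps_to_fls)

lemma embed_diff: "embed (p - q) = embed p - embed q"
  by (simp add: embed_def fps_of_poly_diff)

lemma embed_eq_0: "embed p = 0 \<longleftrightarrow> p = 0"
  by (simp add: embed_def)

lemma embed_inj: "embed p = embed q \<longleftrightarrow> p = q"
  by (simp add: embed_def fps_of_poly_eq_iff)

lemma embed_nth: "fls_nth (embed p) n = (if n < 0 then 0 else coeff p (nat n))"
  by (simp add: embed_def)

lemma embed_coeffs: "sub_field B ==> p \<in> polys_over B ==> embed p \<in> fls_coeffs_in B"
  by (auto simp: fls_coeffs_in_def embed_nth polys_overD sub_ringD dest: sub_fieldD(1))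

lemma embed_pCons_0: "embed (pCons 0 p) = fls_X * embed p"
  by (rule fls_eqI) (auto simp: embed_nth fls_X_times_conv_shift coeff_pCons nat_diff_distrib' split: nat.splits, (metis Suc_nat_eq_nat_zadd1 diff_add_cancel nat_eq_iff not_less nat.inject)?)

lemma embed_pderiv: "fls_deriv (embed p) = embed (pderiv p)"
  by (simp add: embed_def fls_deriv_fps_to_fls fps_of_poly_pderiv)

lemma derivation_sD: "derivation sD"
  using derivation_fls_coeff_map[OF D]
  by (auto simp: sD_def derivation_on_def algebra_simps)

lemma sD_nth: "fls_nth (sD f) n = D (fls_nth f n) + of_int n * u * fls_nth f n"
  by (simp add: sD_def fls_coeff_map_nth[of D, OF derivationD(3)[OF D]] fls_X_times_conv_shift)

lemma sD_embed: "sD (embed N) = embed (pD N)"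
proof -
  have "fls_coeff_map D (embed N) = embed (map_poly D N)"
    by (rule fls_eqI) (simp add: fls_coeff_map_nth[of D, OF derivationD(3)[OF D]] embed_nth coeff_map_poly derivationD(3)[OF D])
  thus ?thesis by (simp add: sD_def pD_def embed_add embed_smult embed_pCons_0 embed_pderiv)
qed

lemma D_poly_U: "D (poly N U) = poly (pD N) U"
  by (simp add: derivation_poly[OF D] pD_def U(1) algebra_simps)

lemma pD_mem: "N \<in> polys_over A ==> pD N \<in> polys_over A"
proof -
  note Ar = sub_fieldD(1)[OF A(1)]
  assume N: "N \<in> polys_over A"
  have "map_poly D N \<in> polys_over A"
    using N A(4) by (auto simp: polys_over_def coeff_map_poly derivationD(3)[OF D])
  thus ?thesis unfolding pD_def
    using N U(2) sub_ringD(1)[OF Ar] by (intro polys_over_ring[OF Ar])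
qed

lemma poly_U_eq_0: "N \<in> polys_over A ==> poly N U = 0 ==> N = 0"
  using A(2)[of U] U(3) by (auto simp: algebraic_over_def)

lemma poly_map_fraction:
  assumes N: "N \<in> polys_over A" and M: "M \<in> polys_over A" "M ~= 0" and r: "N' \<in> polys_over A" "M' \<in> polys_over A" "M' ~= 0"
    and eq: "D (poly N U / poly M U) = poly N' U / poly M' U"
  shows "sD (embed N / embed M) = embed N' / embed M'"
proof -
  note Ar = sub_fieldD(1)[OF A(1)]
  have MU: "poly M U ~= 0" "poly M' U ~= 0" using poly_U_eq_0 M r by auto
  define W where "W = (pD N * M - N * pD M) * M' - N' * M\<^sup>2"
  have "poly W U = 0"
    using eq MU unfolding derivation_divide[OF D] D_poly_U W_def
    by (simp add: field_simps power2_eq_square)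
  moreover have "W \<in> polys_over A" unfolding W_def power2_eq_square
    using N M r pD_mem by (intro polys_over_ring[OF Ar])
  ultimately have "W = 0" by (rule poly_U_eq_0[rotated])
  hence "(pD N * M - N * pD M) * M' = N' * M\<^sup>2" by (simp add: W_def)
  hence "embed ((pD N * M - N * pD M) * M') = embed (N' * M\<^sup>2)" by simp
  hence "(sD (embed N) * embed M - embed N * sD (embed M)) * embed M' = embed N' * (embed M)\<^sup>2"
    by (simp only: embed_mult embed_diff sD_embed power2_eq_square)
  thus ?thesis using M(2) r(3)
    by (simp add: derivation_divide[OF derivation_sD] embed_eq_0 frac_eq_eq)
qed

text \<open>With \<open>R = P/Q\<close>, the logarithmic derivative of \<open>R(U)\<close> is \<open>u * Lnum P Q / (P Q)\<close> at \<open>U\<close>.\<close>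

definition Lnum :: "'f poly => 'f poly => 'f poly" where
  "Lnum P Q = pCons 0 (pderiv P * Q - P * pderiv Q)"

lemma Lnum_mem: "P \<in> polys_over C ==> Q \<in> polys_over C ==> Lnum P Q \<in> polys_over C"
proof -
  note Cr = sub_fieldD(1)[OF C(1)]
  assume "P \<in> polys_over C" "Q \<in> polys_over C"
  thus ?thesis unfolding Lnum_def using sub_ringD(1)[OF Cr] by (intro polys_over_ring[OF Cr])
qed

lemma degree_Lnum: "degree (Lnum P Q) \<le> degree (P * Q)"
proof (cases "pderiv P * Q - P * pderiv Q = 0")
  case False
  hence PQ: "P ~= 0" "Q ~= 0" by auto
  have pos: "degree P + degree Q > 0"
  proof (rule ccontr)
    assume "\<not> ?thesis"
    hence "pderiv P = 0" "pderiv Q = 0" by (auto simp: pderiv_eq_0_iff)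
    thus False using False by simp
  qed
  have 1: "degree (pderiv P * Q) \<le> degree P + degree Q - 1"
  proof (cases "pderiv P = 0")
    case False
    hence "degree P > 0" by (simp add: pderiv_eq_0_iff)
    thus ?thesis using degree_mult_le[of "pderiv P" Q] by (simp add: degree_pderiv)
  qed simp
  have 2: "degree (P * pderiv Q) \<le> degree P + degree Q - 1"
  proof (cases "pderiv Q = 0")
    case False
    hence "degree Q > 0" by (simp add: pderiv_eq_0_iff)
    thus ?thesis using degree_mult_le[of P "pderiv Q"] by (simp add: degree_pderiv)
  qed simp
  have "degree (pderiv P * Q - P * pderiv Q) \<le> degree P + degree Q - 1"
    by (rule degree_diff_le[OF 1 2])
  hence "Suc (degree (pderiv P * Q - P * pderiv Q)) \<le> degree P + degree Q" using pos by linarith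
  thus ?thesis using False PQ by (simp add: Lnum_def degree_mult_eq)
qed (simp add: Lnum_def)

text \<open>If \<open>T\<close> is a rational function of \<open>U\<close> with derivative in \<open>A\<close>, its coefficient of \<open>U\<^sup>0\<close> has the same derivative.\<close>

theorem integral_descends:
  assumes PQ: "P \<in> polys_over C" "Q \<in> polys_over C" and T: "T ~= 0" "poly Q U ~= 0" "poly P U ~= 0"
    and v: "v \<in> A" and r: "r \<in> A" "D T = r"
    and eq: "r * poly (P * Q) U = T * (u * poly (Lnum P Q) U + v * poly (P * Q) U)"
  shows "\<exists>c\<in>A. D c = r"
proof (cases "r = 0")
  case True
  thus ?thesis using sub_ringD(1)[OF sub_fieldD(1)[OF A(1)]] derivationD(3)[OF D] by blast
next
  case r0: False
  note Ar = sub_fieldD(1)[OF A(1)]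
  note cm = polys_over_mono[OF CA]
  define N where "N = smult r (P * Q)"
  define M where "M = smult u (Lnum P Q) + smult v (P * Q)"
  have PQC: "P * Q \<in> polys_over C" using PQ by (intro polys_over_ring sub_fieldD(1)[OF C(1)])
  have mem: "N \<in> polys_over A" "M \<in> polys_over A"
    unfolding N_def M_def
    by (intro polys_over_ring(3,7)[OF Ar] r(1) U(2) v subsetD[OF cm] PQC Lnum_mem[OF PQ])+
  have TM: "poly N U = T * poly M U" using eq by (simp add: N_def M_def)
  have NU: "poly N U ~= 0" using r0 T by (simp add: N_def)
  hence MU: "poly M U ~= 0" using TM by auto
  hence M0: "M ~= 0" by auto
  have T_eq: "T = poly N U / poly M U" using TM MU by simp
  have "sD (embed N / embed M) = embed [:r:] / embed 1"
    by (rule poly_map_fraction[OF mem M0]) (use r T_eq in \<open>auto intro!: polys_over_ring[OF Ar]\<close>)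
  also have "\<dots> = fls_const r" by (simp add: embed_def fps_of_poly_const)
  finally have "fls_nth (sD (embed N / embed M)) 0 = r" by simp
  hence "D (fls_nth (embed N / embed M) 0) = r" by (simp add: sD_nth)
  moreover have "embed N / embed M \<in> fls_coeffs_in A"
    using embed_coeffs[OF A(1)] mem by (intro sub_fieldD(3)[OF sub_field_fls_coeffs_in[OF A(1)]])
  ultimately show ?thesis unfolding fls_coeffs_in_def by blast
qed

text \<open>As a rational function of \<open>U\<close>, \<open>y\<close> expands to \<open>W = (u L + v) / q\<close> with the expansion \<open>L\<close> of \<open>U R'(U) / R(U)\<close> for \<open>R = P/Q\<close>, which has coefficients in \<open>C\<close> and no negative powers. If a power \<open>U\<^sup>n\<close> with \<open>n > 0\<close> occurs in it, the term \<open>c U\<^sup>n\<close> of \<open>W\<close> satisfies the same equation as \<open>y\<close>, so \<open>y\<close> is a constant multiple of it; but the numerator of \<open>y\<close> has at most the degree of the denominator. Hence \<open>L\<close> is a constant.\<close>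

theorem hyperexponential_descends:
  assumes PQ: "P \<in> polys_over C" "Q \<in> polys_over C" and UPQ: "poly Q U ~= 0" "poly P U ~= 0"
    and v: "v \<in> A" and q: "q \<in> A" "q ~= 0" and y: "y ~= 0" "D y = q * y"
    and eq: "D y * poly (P * Q) U = u * poly (Lnum P Q) U + v * poly (P * Q) U"
  shows "y \<in> A \<and> (\<exists>l\<in>C. D y = l * u + v)"
proof -
  note Ar = sub_fieldD(1)[OF A(1)]
  note cm = polys_over_mono[OF CA]
  have PQ0: "P ~= 0" "Q ~= 0" using UPQ by auto
  define N where "N = smult u (Lnum P Q) + smult v (P * Q)"
  define M where "M = smult q (P * Q)"
  have PQC: "P * Q \<in> polys_over C" using PQ by (intro polys_over_ring sub_fieldD(1)[OF C(1)])
  have mem: "N \<in> polys_over A" "M \<in> polys_over A"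
    unfolding N_def M_def
    by (intro polys_over_ring(3,7)[OF Ar] q(1) U(2) v subsetD[OF cm] PQC Lnum_mem[OF PQ])+
  have M0: "M ~= 0" using q PQ0 by (simp add: M_def)
  have MU: "poly M U ~= 0" using q UPQ by (simp add: M_def)
  have y_eq: "y = poly N U / poly M U" using eq MU y(2) by (simp add: N_def M_def field_simps)
  define W where "W = embed N / embed M"
  have "sD W = embed (smult q N) / embed M" unfolding W_def
    by (rule poly_map_fraction[OF mem M0 _ mem(2) M0]) (use y y_eq q mem in \<open>auto intro!: polys_over_ring[OF Ar]\<close>)
  hence sW: "sD W = fls_const q * W" by (simp add: W_def embed_smult)
  define R where "R = embed P / embed Q"
  define L where "L = fls_X * fls_deriv R / R"
  have e0: "embed P ~= 0" "embed Q ~= 0" using PQ0 by (auto simp: embed_eq_0)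
  hence R0: "R ~= 0" by (simp add: R_def)
  have LL: "L = embed (Lnum P Q) / embed (P * Q)"
    using e0 by (simp add: L_def R_def derivation_divide[OF derivation_fls_deriv] Lnum_def embed_pCons_0 embed_diff embed_mult
       embed_pderiv field_simps power2_eq_square)
  have W_L: "W = fls_const (u / q) * L + fls_const (v / q)"
  proof -
    have nz: "embed (P * Q) ~= 0" using PQ0 by (simp add: embed_eq_0)
    have N': "embed N = fls_const u * embed (Lnum P Q) + fls_const v * embed (P * Q)"
      by (simp add: N_def embed_add embed_smult)
    have M': "embed M = fls_const q * embed (P * Q)" by (simp add: M_def embed_smult)
    have q': "fls_const q ~= 0" using q by simp
    have uv: "fls_const (u / q) = fls_const u / fls_const q" "fls_const (v / q) = fls_const v / fls_const q"
      by (simp_all add: fls_const_divide_const)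
    show ?thesis unfolding W_def LL N' M' uv using nz q'
      by (simp add: field_simps del: fls_const_divide_const)
  qed
  have LC: "fls_nth L i \<in> C" for i
  proof -
    note fC = sub_field_fls_coeffs_in[OF C(1)]
    have "L \<in> fls_coeffs_in C" unfolding LL
      using embed_coeffs[OF C(1)] PQC Lnum_mem[OF PQ] by (intro sub_fieldD(3)[OF fC])
    thus ?thesis by (simp add: fls_coeffs_in_def)
  qed
  have Lneg: "fls_nth L i = 0" if "i < 0" for i
  proof -
    define d where "d = fls_subdegree R"
    have 1: "fls_nth (fls_X * fls_deriv R) i = 0" if "i < d" for i
      using that by (simp add: fls_X_times_conv_shift d_def fls_eq0_below_subdegree)
    have 2: "fls_nth (inverse R) i = 0" if "i < - d" for i
      using that fls_eq0_below_subdegree[of i "inverse R"] by (simp add: d_def)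
    have "L = (fls_X * fls_deriv R) * inverse R" by (simp add: L_def divide_inverse)
    thus ?thesis using fls_mult_nth_bounds[of d "fls_X * fls_deriv R" "-d" "inverse R" i] 1 2 that by simp
  qed
  have Lpos: "fls_nth L i = 0" if i: "i > 0" for i
  proof (rule ccontr)
    assume nz: "fls_nth L i ~= 0"
    define c where "c = fls_nth W i"
    have c: "c = (u / q) * fls_nth L i" using i by (simp add: c_def W_L)
    hence c0: "c ~= 0" using u0 q nz by simp
    define n where "n = nat i"
    have "D c + of_int i * u * c = q * c"
      using sW sD_nth[of W i] by (simp add: c_def)
    moreover have "D (c * U ^ n) = (D c + of_nat n * u * c) * U ^ n"
    proof -
      have "D (U ^ m) = of_nat m * u * U ^ m" for m
        by (induction m) (simp_all add: derivationD[OF D] U(1) algebra_simps)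
      thus ?thesis by (simp add: derivationD(2)[OF D] algebra_simps)
    qed
    ultimately have Dc: "D (c * U ^ n) = q * (c * U ^ n)" using i by (simp add: n_def)
    define \<kappa> where "\<kappa> = y / (c * U ^ n)"
    have "D \<kappa> = 0" unfolding \<kappa>_def derivation_divide[OF D] Dc y(2) by simp
    hence \<kappa>: "\<kappa> \<in> A" by (rule A(3))
    have cA: "c \<in> A" unfolding c using U(2) q LC CA by (auto intro!: sub_ringD(4)[OF Ar] sub_fieldD(3)[OF A(1)])
    have "y = \<kappa> * c * U ^ n" using c0 U0 by (simp add: \<kappa>_def)
    hence "poly (N - monom (\<kappa> * c) n * M) U = 0" using y_eq MU by (simp add: poly_monom field_simps)
    moreover have "N - monom (\<kappa> * c) n * M \<in> polys_over A"
      using mem \<kappa> cA sub_ringD(4)[OF Ar] by (intro polys_over_ring[OF Ar]) auto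
    ultimately have NM: "N = monom (\<kappa> * c) n * M" using poly_U_eq_0 by fastforce
    have \<kappa>0: "\<kappa> ~= 0" using y c0 U0 by (simp add: \<kappa>_def)
    have "degree N = n + degree (P * Q)"
      unfolding NM using \<kappa>0 c0 M0 q by (simp add: degree_mult_eq degree_monom_eq monom_eq_0_iff M_def)
    moreover have "degree N \<le> degree (P * Q)" unfolding N_def
      by (intro degree_add_le order_trans[OF degree_smult_le] degree_Lnum order_refl)
    ultimately show False using i by (simp add: n_def)
  qed
  define l where "l = fls_nth L 0"
  have "L = fls_const l" using Lneg Lpos by (intro fls_eqI) (auto simp: l_def, metis linorder_neqE)
  define c where "c = (u * l + v) / q"
  have "W = fls_const c" unfolding W_L \<open>L = fls_const l\<close>
    by (simp add: fls_plus_const c_def add_divide_distrib)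
  hence "embed N = embed (smult c M)" using M0 by (simp add: W_def embed_smult embed_eq_0 field_simps)
  hence "N = smult c M" by (simp add: embed_inj)
  hence "y = c" using y_eq MU by simp
  moreover have "c \<in> A" using U(2) v q LC[of 0] CA unfolding c_def l_def
    by (intro sub_fieldD(3)[OF A(1)] sub_ringD(3,4)[OF Ar]) auto
  moreover have "D y = l * u + v"
  proof -
    have "D y = q * c" by (simp only: y(2)) (simp only: \<open>y = c\<close>)
    also have "\<dots> = l * u + v" using q by (simp add: c_def mult.commute)
    finally show ?thesis .
  qed
  ultimately show ?thesis using LC[of 0] by (auto simp: l_def)
qed

end

section \<open>Holomorphic functions of two complex variables\<close>

text \<open>Joint complex differentiability in two variables, in curried form because its slices in either variable are used throughout.\<close>

definition hol2 :: "(complex => complex => complex) => (complex \<times> complex) set => bool" where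
  "hol2 F S \<longleftrightarrow> (\<forall>p\<in>S. \<exists>a b. ((\<lambda>q. F (fst q) (snd q)) has_derivative (\<lambda>v. a * fst v + b * snd v)) (at p))"

lemma hol2_subset: "hol2 F S ==> T \<subseteq> S ==> hol2 F T"
  unfolding hol2_def by blast

lemma hol2_const: "hol2 (\<lambda>z w. c) S"
  unfolding hol2_def by (auto intro!: exI[of _ 0])

lemma hol2_fst: "hol2 (\<lambda>z w. z) S"
  unfolding hol2_def
proof
  fix p assume "p \<in> S"
  have "((\<lambda>q::complex \<times> complex. fst q) has_derivative (\<lambda>v. 1 * fst v + 0 * snd v)) (at p)"
    by (auto intro!: derivative_eq_intros)
  thus "\<exists>a b. ((\<lambda>q::complex \<times> complex. fst q) has_derivative (\<lambda>v. a * fst v + b * snd v)) (at p)" by blast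
qed

lemma hol2_snd: "hol2 (\<lambda>z w. w) S"
  unfolding hol2_def
proof
  fix p assume "p \<in> S"
  have "((\<lambda>q::complex \<times> complex. snd q) has_derivative (\<lambda>v. 0 * fst v + 1 * snd v)) (at p)"
    by (auto intro!: derivative_eq_intros)
  thus "\<exists>a b. ((\<lambda>q::complex \<times> complex. snd q) has_derivative (\<lambda>v. a * fst v + b * snd v)) (at p)" by blast
qed

lemma hol2_add:
  assumes "hol2 F S" "hol2 G S" shows "hol2 (\<lambda>z w. F z w + G z w) S"
  unfolding hol2_def
proof
  fix p assume "p \<in> S"
  then obtain a b c d where "((\<lambda>q. F (fst q) (snd q)) has_derivative (\<lambda>v. a * fst v + b * snd v)) (at p)"
    "((\<lambda>q. G (fst q) (snd q)) has_derivative (\<lambda>v. c * fst v + d * snd v)) (at p)"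
    using assms unfolding hol2_def by blast
  from has_derivative_add[OF this] show "\<exists>a b. ((\<lambda>q. F (fst q) (snd q) + G (fst q) (snd q)) has_derivative (\<lambda>v. a * fst v + b * snd v)) (at p)"
    by (intro exI[of _ "a + c"] exI[of _ "b + d"]) (simp add: algebra_simps)
qed

lemma hol2_mult:
  assumes "hol2 F S" "hol2 G S" shows "hol2 (\<lambda>z w. F z w * G z w) S"
  unfolding hol2_def
proof
  fix p assume "p \<in> S"
  then obtain a b c d where "((\<lambda>q. F (fst q) (snd q)) has_derivative (\<lambda>v. a * fst v + b * snd v)) (at p)"
    "((\<lambda>q. G (fst q) (snd q)) has_derivative (\<lambda>v. c * fst v + d * snd v)) (at p)"
    using assms unfolding hol2_def by blast
  from has_derivative_mult[OF this] show "\<exists>a b. ((\<lambda>q. F (fst q) (snd q) * G (fst q) (snd q)) has_derivative (\<lambda>v. a * fst v + b * snd v)) (at p)"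
    by (intro exI[of _ "F (fst p) (snd p) * c + a * G (fst p) (snd p)"] exI[of _ "F (fst p) (snd p) * d + b * G (fst p) (snd p)"])
      (simp add: algebra_simps)
qed

lemma hol2_comp:
  assumes F: "hol2 F S" and g: "g holomorphic_on T" "open T" "!!z w. (z, w) \<in> S ==> F z w \<in> T"
  shows "hol2 (\<lambda>z w. g (F z w)) S"
  unfolding hol2_def
proof
  fix p assume p: "p \<in> S"
  then obtain a b where F': "((\<lambda>q. F (fst q) (snd q)) has_derivative (\<lambda>v. a * fst v + b * snd v)) (at p)"
    using F unfolding hol2_def by blast
  have "(g has_field_derivative deriv g (F (fst p) (snd p))) (at (F (fst p) (snd p)))"
    using g p by (intro holomorphic_derivI[OF g(1,2)]) auto
  hence "(g has_derivative (*) (deriv g (F (fst p) (snd p)))) (at (F (fst p) (snd p)))"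
    by (simp add: has_field_derivative_def)
  from has_derivative_compose[OF F' this]
  show "\<exists>a b. ((\<lambda>q. g (F (fst q) (snd q))) has_derivative (\<lambda>v. a * fst v + b * snd v)) (at p)"
    by (intro exI[of _ "deriv g (F (fst p) (snd p)) * a"] exI[of _ "deriv g (F (fst p) (snd p)) * b"])
      (simp add: algebra_simps)
qed

lemma hol2_minus: "hol2 F S ==> hol2 (\<lambda>z w. - F z w) S"
  using hol2_mult[OF hol2_const[of "-1"], of F S] by simp

lemma hol2_diff: "hol2 F S ==> hol2 G S ==> hol2 (\<lambda>z w. F z w - G z w) S"
  using hol2_add[of F S "\<lambda>z w. - G z w"] hol2_minus by simp

lemma hol2_sum: "(!!i. i \<in> I ==> hol2 (F i) S) ==> hol2 (\<lambda>z w. \<Sum>i\<in>I. F i z w) S"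
  by (induction I rule: infinite_finite_induct) (auto intro: hol2_const hol2_add)

lemma hol2_prod: "(!!i. i \<in> I ==> hol2 (F i) S) ==> hol2 (\<lambda>z w. \<Prod>i\<in>I. F i z w) S"
  by (induction I rule: infinite_finite_induct) (auto intro: hol2_const hol2_mult)

lemma hol2_power: "hol2 F S ==> hol2 (\<lambda>z w. F z w ^ n) S"
  by (induction n) (auto intro: hol2_const hol2_mult)

lemma hol2_exp: "hol2 F S ==> hol2 (\<lambda>z w. exp (F z w)) S"
  by (rule hol2_comp[where T = UNIV]) (auto intro: holomorphic_intros)

lemma hol2_poly: "hol2 F S ==> hol2 (\<lambda>z w. poly p (F z w)) S"
  by (rule hol2_comp[where T = UNIV]) (auto intro: holomorphic_intros)

lemma hol2_inverse: "hol2 F S ==> (!!z w. (z, w) \<in> S ==> F z w ~= 0) ==> hol2 (\<lambda>z w. inverse (F z w)) S"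
  by (rule hol2_comp[where T = "- {0}"]) (auto intro!: holomorphic_intros)

lemma hol2_divide:
  "hol2 F S ==> hol2 G S ==> (!!z w. (z, w) \<in> S ==> G z w ~= 0) ==> hol2 (\<lambda>z w. F z w / G z w) S"
  unfolding divide_inverse by (intro hol2_mult hol2_inverse)

lemma hol2_fun_fst:
  assumes "f holomorphic_on T" "open T" "fst ` S \<subseteq> T" shows "hol2 (\<lambda>z w. f z) S"
  by (rule hol2_comp[OF hol2_fst assms(1,2)]) (use assms(3) in force)

lemma hol2_fun_snd:
  assumes "f holomorphic_on T" "open T" "snd ` S \<subseteq> T" shows "hol2 (\<lambda>z w. f w) S"
  by (rule hol2_comp[OF hol2_snd assms(1,2)]) (use assms(3) in force)

lemma hol2_subst:
  assumes F: "hol2 F S" and \<Phi>: "hol2 \<Phi> T" "hol2 \<Psi> T" "!!z w. (z, w) \<in> T ==> (\<Phi> z w, \<Psi> z w) \<in> S"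
  shows "hol2 (\<lambda>z w. F (\<Phi> z w) (\<Psi> z w)) T"
  unfolding hol2_def
proof
  fix p assume p: "p \<in> T"
  obtain a b where 1: "((\<lambda>q. \<Phi> (fst q) (snd q)) has_derivative (\<lambda>v. a * fst v + b * snd v)) (at p)"
    using \<Phi>(1) p unfolding hol2_def by blast
  obtain c d where 2: "((\<lambda>q. \<Psi> (fst q) (snd q)) has_derivative (\<lambda>v. c * fst v + d * snd v)) (at p)"
    using \<Phi>(2) p unfolding hol2_def by blast
  note 3 = has_derivative_Pair[OF 1 2]
  have "(\<Phi> (fst p) (snd p), \<Psi> (fst p) (snd p)) \<in> S" using \<Phi>(3) p by auto
  then obtain e f where "((\<lambda>q. F (fst q) (snd q)) has_derivative (\<lambda>v. e * fst v + f * snd v)) (at (\<Phi> (fst p) (snd p), \<Psi> (fst p) (snd p)))"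
    using F unfolding hol2_def by blast
  from has_derivative_compose[OF 3 this]
  show "\<exists>a b. ((\<lambda>q. F (\<Phi> (fst q) (snd q)) (\<Psi> (fst q) (snd q))) has_derivative (\<lambda>v. a * fst v + b * snd v)) (at p)"
    by (intro exI[of _ "e * a + f * c"] exI[of _ "e * b + f * d"]) (simp add: algebra_simps)
qed

lemma hol2_cholomorphic:
  fixes H :: "complex ^ 'k::finite => complex"
  assumes H: "H cholomorphic_on D" "open D" and \<gamma>: "!!i. hol2 (\<gamma> i) S"
    and D: "!!z w. (z, w) \<in> S ==> (\<chi> i. \<gamma> i z w) \<in> D"
  shows "hol2 (\<lambda>z w. H (\<chi> i. \<gamma> i z w)) S"
  unfolding hol2_def
proof
  fix p assume p: "p \<in> S"
  have "\<forall>i. \<exists>a b. ((\<lambda>q. \<gamma> i (fst q) (snd q)) has_derivative (\<lambda>v. a * fst v + b * snd v)) (at p)"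
    using \<gamma> p unfolding hol2_def by blast
  then obtain a b where ab: "!!i. ((\<lambda>q. \<gamma> i (fst q) (snd q)) has_derivative (\<lambda>v. a i * fst v + b i * snd v)) (at p)"
    by metis
  have 1: "((\<lambda>q. \<chi> i. \<gamma> i (fst q) (snd q)) has_derivative (\<lambda>v. \<chi> i. a i * fst v + b i * snd v)) (at p)"
  proof (subst has_derivative_componentwise_within, rule ballI)
    fix e :: "complex ^ 'k" assume "e \<in> Basis"
    then obtain i u where e: "e = axis i u" "u \<in> Basis" by (auto simp: Basis_vec_def)
    have "((\<lambda>q. \<gamma> i (fst q) (snd q) \<bullet> u) has_derivative (\<lambda>v. (a i * fst v + b i * snd v) \<bullet> u)) (at p)"
      using has_derivative_inner_left[OF ab[of i], of u] .
    thus "((\<lambda>q. (\<chi> i. \<gamma> i (fst q) (snd q)) \<bullet> e) has_derivative (\<lambda>v. (\<chi> i. a i * fst v + b i * snd v) \<bullet> e)) (at p)"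
      by (simp add: e inner_axis)
  qed
  define x where "x = (\<chi> i. \<gamma> i (fst p) (snd p))"
  have xD: "x \<in> D" using D p by (auto simp: x_def)
  then obtain H' where H': "(H has_derivative H') (at x within D)" "!!c v. H' (c *s v) = c * H' v"
    using H(1) unfolding cholomorphic_on_def by blast
  have H'': "(H has_derivative H') (at x)" using H' at_within_open[OF xD H(2)] by simp
  interpret H': linear H' using H'' by (rule has_derivative_linear)
  have eq: "H' (\<chi> i. a i * z + b i * w) = H' (\<chi> i. a i) * z + H' (\<chi> i. b i) * w" for z w
  proof -
    have "(\<chi> i. a i * z + b i * w) = z *s (\<chi> i. a i) + w *s (\<chi> i. b i)"
      by (simp add: Finite_Cartesian_Product.vec_eq_iff vector_scalar_mult_def mult.commute)
    thus ?thesis by (simp add: H'.add H'(2) mult.commute)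
  qed
  from has_derivative_compose[OF 1, of H H'] H'' x_def
  have "((\<lambda>q. H (\<chi> i. \<gamma> i (fst q) (snd q))) has_derivative (\<lambda>v. H' (\<chi> i. a i * fst v + b i * snd v))) (at p)" by simp
  thus "\<exists>a b. ((\<lambda>q. H (\<chi> i. \<gamma> i (fst q) (snd q))) has_derivative (\<lambda>v. a * fst v + b * snd v)) (at p)"
    unfolding eq by blast
qed

lemma hol2_continuous: "hol2 F S ==> continuous_on S (\<lambda>q. F (fst q) (snd q))"
  unfolding hol2_def by (intro continuous_at_imp_continuous_on ballI) (blast intro: has_derivative_continuous)

lemma hol2_curve:
  assumes F: "hol2 F S" and "(\<phi> has_field_derivative \<phi>') (at t)" "(\<psi> has_field_derivative \<psi>') (at t)" "(\<phi> t, \<psi> t) \<in> S"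
  shows "(\<lambda>t. F (\<phi> t) (\<psi> t)) field_differentiable (at t)"
proof -
  obtain a b where ab: "((\<lambda>q. F (fst q) (snd q)) has_derivative (\<lambda>v. a * fst v + b * snd v)) (at (\<phi> t, \<psi> t))"
    using F assms(4) unfolding hol2_def by blast
  have "((\<lambda>t. (\<phi> t, \<psi> t)) has_derivative (\<lambda>h. (\<phi>' * h, \<psi>' * h))) (at t)"
    using assms(2,3) by (intro has_derivative_Pair) (auto simp: has_field_derivative_def)
  from has_derivative_compose[OF this ab]
  have "((\<lambda>t. F (\<phi> t) (\<psi> t)) has_derivative (\<lambda>h. (a * \<phi>' + b * \<psi>') * h)) (at t)"
    by (simp add: algebra_simps)
  thus ?thesis unfolding field_differentiable_def has_field_derivative_def by blast
qed

lemma hol2_curve_holomorphic: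
  assumes F: "hol2 F S" and "\<phi> holomorphic_on T" "\<psi> holomorphic_on T" "open T" "!!t. t \<in> T ==> (\<phi> t, \<psi> t) \<in> S"
  shows "(\<lambda>t. F (\<phi> t) (\<psi> t)) holomorphic_on T"
  unfolding holomorphic_on_def
  using hol2_curve[OF F] assms holomorphic_derivI field_differentiable_at_within by blast

lemma hol2_slice:
  assumes "hol2 F (T \<times> V)"
  shows "open V ==> z \<in> T ==> F z holomorphic_on V" "open T ==> w \<in> V ==> (\<lambda>z. F z w) holomorphic_on T"
  using hol2_curve_holomorphic[OF assms, of "\<lambda>_. z" V "\<lambda>w. w"] hol2_curve_holomorphic[OF assms, of "\<lambda>z. z" T "\<lambda>_. w"]
  by auto

text \<open>Cauchy's formula writes the derivative as an integral over a fixed circle that depends continuously on the parameters.\<close>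

lemma deriv_fst_continuous:
  assumes F: "continuous_on (ball 0 r \<times> ball 0 r) (\<lambda>q. F (fst q) (snd q))"
    "!!w. w \<in> ball 0 r ==> (\<lambda>z. F z w) holomorphic_on ball 0 r" and r: "r > 0"
  shows "continuous_on (ball 0 (r/2) \<times> ball 0 r) (\<lambda>(z, w). deriv (\<lambda>z. F z w) z)"
proof -
  define \<rho> where "\<rho> = 3 * r / 4"
  have \<rho>: "\<rho> > 0" "\<rho> < r" "r/2 < \<rho>" using r by (auto simp: \<rho>_def)
  have cb: "cball 0 \<rho> \<subseteq> ball (0::complex) r" using \<rho> by auto
  define c where "c t = circlepath (0::complex) \<rho> t" for t
  define c' where "c' t = vector_derivative (circlepath (0::complex) \<rho>) (at t)" for t
  have cn: "cmod (c t) = \<rho>" for t using \<rho> by (simp add: c_def circlepath norm_mult)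
  have "continuous_on UNIV c"
    unfolding c_def circlepath by (auto intro!: continuous_intros)
  moreover have "continuous_on UNIV c'"
    unfolding c'_def vector_derivative_circlepath by (auto intro!: continuous_intros)
  ultimately have ccont: "continuous_on UNIV c" "continuous_on UNIV c'" .
  have eq: "deriv (\<lambda>z. F z w) z = 1 / (2 * of_real pi * \<i>) * integral {0..1} (\<lambda>t. F (c t) w / (c t - z)\<^sup>2 * c' t)"
    if zw: "z \<in> ball 0 (r/2)" "w \<in> ball 0 r" for z w
  proof -
    have hol: "(\<lambda>z. F z w) holomorphic_on ball 0 r" using F(2) zw by auto
    have "((\<lambda>z. F z w) has_field_derivative (1 / (2 * of_real pi * \<i>) * contour_integral (circlepath 0 \<rho>) (\<lambda>u. F u w / (u - z)\<^sup>2))) (at z)"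
      by (rule Cauchy_derivative_integral_circlepath(2))
        (use hol cb zw \<rho> in \<open>auto intro!: holomorphic_on_imp_continuous_on elim!: holomorphic_on_subset\<close>)
    thus ?thesis unfolding contour_integral_integral c_def c'_def by (rule DERIV_imp_deriv)
  qed
  have cont: "continuous_on (ball 0 (r/2) \<times> ball 0 r) (\<lambda>p. integral (cbox 0 (1::real)) (\<lambda>t. F (c t) (snd p) / (c t - fst p)\<^sup>2 * c' t))"
  proof (rule integral_continuous_on_param)
    have 1: "continuous_on ((ball 0 (r/2) \<times> ball 0 r) \<times> cbox 0 1) (\<lambda>x. F (fst (c (snd x), snd (fst x))) (snd (c (snd x), snd (fst x))))"
    proof (rule continuous_on_compose2[OF F(1), of _ "\<lambda>x. (c (snd x), snd (fst x))"])
      show "continuous_on ((ball 0 (r/2) \<times> ball 0 r) \<times> cbox 0 1) (\<lambda>x. (c (snd x), snd (fst x)))"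
        by (intro continuous_intros continuous_on_compose2[OF ccont(1)]) auto
      show "(\<lambda>x. (c (snd x), snd (fst x))) ` ((ball 0 (r/2) \<times> ball 0 r) \<times> cbox 0 1) \<subseteq> ball 0 r \<times> ball 0 r"
        using cn \<rho> by auto
    qed
    have 2: "c (snd x) - fst (fst x) ~= 0" if "x \<in> (ball 0 (r/2) \<times> ball 0 r) \<times> cbox 0 1" for x
    proof
      assume "c (snd x) - fst (fst x) = 0"
      hence "cmod (fst (fst x)) = \<rho>" using cn[of "snd x"] by simp
      thus False using that \<rho> by auto
    qed
    have "continuous_on ((ball 0 (r/2) \<times> ball 0 r) \<times> cbox 0 1)
        (\<lambda>x. F (c (snd x)) (snd (fst x)) / (c (snd x) - fst (fst x))\<^sup>2 * c' (snd x))"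
      by (intro continuous_intros continuous_on_compose2[OF ccont(1)] continuous_on_compose2[OF ccont(2)])
        (use 1 cn \<rho> in auto)
    thus "continuous_on ((ball 0 (r/2) \<times> ball 0 r) \<times> cbox 0 1) (\<lambda>(p, t). F (c t) (snd p) / (c t - fst p)\<^sup>2 * c' t)"
      by (simp add: case_prod_beta')
  qed
  have "continuous_on (ball 0 (r/2) \<times> ball 0 r) (\<lambda>p. 1 / (2 * of_real pi * \<i>) * integral {0..1} (\<lambda>t. F (c t) (snd p) / (c t - fst p)\<^sup>2 * c' t))"
    using cont by (intro continuous_intros) auto
  thus ?thesis by (rule continuous_on_eq) (use eq in auto)
qed

lemma hol2_coeff_holomorphic:
  assumes F: "hol2 F (ball 0 r \<times> ball 0 r)" and r: "r > 0"
  shows "(\<lambda>z. (deriv ^^ k) (F z) 0) holomorphic_on ball 0 (r/2)"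
proof -
  define \<rho> where "\<rho> = r / 2"
  have \<rho>: "\<rho> > 0" "\<rho> < r" using r by (auto simp: \<rho>_def)
  have cb: "cball 0 \<rho> \<subseteq> ball (0::complex) r" using \<rho> by auto
  define c where "c t = circlepath (0::complex) \<rho> t" for t
  define c' where "c' t = vector_derivative (circlepath (0::complex) \<rho>) (at t)" for t
  have cn: "cmod (c t) = \<rho>" for t using \<rho> by (simp add: c_def circlepath norm_mult)
  have c0: "c t ~= 0" for t using cn[of t] \<rho> by auto
  have "continuous_on UNIV c"
    unfolding c_def circlepath by (auto intro!: continuous_intros)
  moreover have "continuous_on UNIV c'"
    unfolding c'_def vector_derivative_circlepath by (auto intro!: continuous_intros)
  ultimately have ccont: "continuous_on UNIV c" "continuous_on UNIV c'" .
  define g where "g t = c' t / c t ^ Suc k" for t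
  have gcont: "continuous_on UNIV g" unfolding g_def by (intro continuous_intros ccont) (use c0 in auto)
  have eq: "(deriv ^^ k) (F z) 0 = fact k / (2 * pi * \<i>) * integral (cbox 0 1) (\<lambda>t. F z (c t) * g t)"
    if z: "z \<in> ball 0 (r/2)" for z
  proof -
    have z': "z \<in> ball 0 r" using z r by auto
    have hol: "F z holomorphic_on ball 0 r" using hol2_slice(1)[OF F _ z'] by auto
    have "(deriv ^^ k) (F z) 0 = fact k / (2 * pi * \<i>) * contour_integral (circlepath 0 \<rho>) (\<lambda>u. F z u / (u - 0) ^ Suc k)"
      by (rule Cauchy_higher_derivative_integral_circlepath(2))
        (use hol cb \<rho> in \<open>auto intro!: holomorphic_on_imp_continuous_on elim!: holomorphic_on_subset\<close>)
    thus ?thesis unfolding contour_integral_integral c_def c'_def g_def by simp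
  qed
  have "(\<lambda>z. integral (cbox 0 1) (\<lambda>t. F z (c t) * g t)) holomorphic_on ball 0 (r/2)"
  proof (rule leibniz_rule_holomorphic[where fx = "\<lambda>z t. deriv (\<lambda>z. F z (c t)) z * g t"])
    fix z t assume z: "z \<in> ball (0::complex) (r/2)"
    have "(\<lambda>z. F z (c t)) holomorphic_on ball 0 r" using hol2_slice(2)[OF F, of "c t"] cn \<rho> by auto
    hence "((\<lambda>z. F z (c t)) has_field_derivative deriv (\<lambda>z. F z (c t)) z) (at z)"
      using z r by (intro holomorphic_derivI[of _ "ball 0 r"]) auto
    from DERIV_mult[OF this DERIV_const[of "g t"]]
    show "((\<lambda>z. F z (c t) * g t) has_field_derivative deriv (\<lambda>z. F z (c t)) z * g t) (at z within ball 0 (r/2))"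
      by (auto intro: has_field_derivative_at_within)
  next
    fix z assume z: "z \<in> ball (0::complex) (r/2)"
    have "continuous_on (cbox 0 1) (\<lambda>t. F (fst (z, c t)) (snd (z, c t)) * g t)"
    proof (intro continuous_intros continuous_on_subset[OF gcont] continuous_on_compose2[OF hol2_continuous[OF F], of _ "\<lambda>t. (z, c t)"])
      show "continuous_on (cbox 0 1) c" by (rule continuous_on_subset[OF ccont(1)]) auto
    qed (use z cn \<rho> r in auto)
    thus "(\<lambda>t. F z (c t) * g t) integrable_on cbox 0 1" by (intro integrable_continuous) simp
  next
    have "continuous_on (ball 0 (r/2) \<times> cbox 0 1) (\<lambda>x. case (fst x, c (snd x)) of (z, w) => deriv (\<lambda>z. F z w) z)"
    proof (rule continuous_on_compose2[OF deriv_fst_continuous[OF hol2_continuous[OF F] hol2_slice(2)[OF F open_ball] r]])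
      show "continuous_on (ball 0 (r/2) \<times> cbox 0 1) (\<lambda>x. (fst x, c (snd x)))"
        by (intro continuous_intros continuous_on_compose2[OF ccont(1)]) auto
    qed (use cn \<rho> in auto)
    moreover have "continuous_on (ball 0 (r/2) \<times> cbox 0 1) (\<lambda>x. g (snd x))"
      by (intro continuous_on_compose2[OF gcont] continuous_intros) auto
    ultimately show "continuous_on (ball 0 (r/2) \<times> cbox 0 1) (\<lambda>(z, t). deriv (\<lambda>z. F z (c t)) z * g t)"
      by (auto simp: case_prod_beta' intro!: continuous_intros)
  qed auto
  hence "(\<lambda>z. fact k / (2 * pi * \<i>) * integral (cbox 0 1) (\<lambda>t. F z (c t) * g t)) holomorphic_on ball 0 (r/2)"
    by (intro holomorphic_intros)
  thus ?thesis by (rule holomorphic_transform) (use eq in auto)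
qed

text \<open>What the formal expansion needs; unlike \<open>hol2\<close> it passes to \<open>\<partial>F/\<partial>w\<close> without a further smoothness theorem.\<close>

definition biholo :: "(complex => complex => complex) => real => bool" where
  "biholo F r \<longleftrightarrow> r > 0 \<and> (\<forall>z\<in>ball 0 r. F z holomorphic_on ball 0 r) \<and>
     (\<forall>k. (\<lambda>z. fps_nth (fps_expansion (F z) 0) k) holomorphic_on ball 0 r)"

text \<open>The expansion in powers of \<open>w\<close> whose coefficients are expanded in powers of \<open>z\<close>. It maps into a field, and \<open>\<partial>/\<partial>w\<close> becomes the formal derivative.\<close>

definition bi_series :: "(complex => complex => complex) => complex fls fls" where
  "bi_series F = fps_to_fls (Abs_fps (\<lambda>k. fps_to_fls (fps_expansion (\<lambda>z. fps_nth (fps_expansion (F z) 0) k) 0)))"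

lemma hol2_biholo:
  assumes "hol2 F (ball 0 r \<times> ball 0 r)" "r > 0" shows "biholo F (r/2)"
  unfolding biholo_def
proof (intro conjI ballI allI)
  show "F z holomorphic_on ball 0 (r/2)" if "z \<in> ball 0 (r/2)" for z
    using hol2_slice(1)[OF assms(1), of z] that assms(2) by (auto elim!: holomorphic_on_subset)
  show "(\<lambda>z. fps_nth (fps_expansion (F z) 0) k) holomorphic_on ball 0 (r/2)" for k
    using hol2_coeff_holomorphic[OF assms, of k] by (auto simp: fps_expansion_def intro!: holomorphic_intros)
qed (use assms in simp)

lemma has_fps_expansion_ball: "f holomorphic_on ball 0 r ==> r > 0 ==> f has_fps_expansion fps_expansion f 0"
  by (rule has_fps_expansion_fps_expansion[of "ball 0 r"]) auto

lemma fps_expansion_eqI: "f has_fps_expansion P ==> fps_expansion f 0 = P"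
  by (rule fps_ext) (simp add: fps_expansion_def fps_nth_fps_expansion)

lemma fps_expansion_ring:
  assumes "f holomorphic_on ball 0 r" "g holomorphic_on ball 0 r" "r > 0"
  shows "fps_expansion (\<lambda>z. f z + g z) 0 = fps_expansion f 0 + fps_expansion g 0"
    "fps_expansion (\<lambda>z. f z * g z) 0 = fps_expansion f 0 * fps_expansion g 0"
    "fps_expansion (deriv f) 0 = fps_deriv (fps_expansion f 0)"
  by (intro fps_expansion_eqI has_fps_expansion_add has_fps_expansion_mult has_fps_expansion_deriv has_fps_expansion_ball[OF _ assms(3)] assms)+

lemma fps_expansion_of_const: "fps_expansion (\<lambda>z. c) 0 = fps_const c"
  by (intro fps_expansion_eqI) auto

lemma fps_expansion_of_sum:
  assumes "!!i. i \<in> I ==> f i holomorphic_on ball 0 r" "r > 0"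
  shows "fps_expansion (\<lambda>z. \<Sum>i\<in>I. f i z) 0 = (\<Sum>i\<in>I. fps_expansion (f i) 0)"
  by (intro fps_expansion_eqI has_fps_expansion_sum has_fps_expansion_ball[OF _ assms(2)] assms(1))

lemma fps_expansion_cong_ball:
  assumes "!!z. z \<in> ball 0 r ==> f z = g z" "r > 0" shows "fps_expansion f 0 = fps_expansion g 0"
  by (rule fps_expansion_cong) (use assms in \<open>auto simp: eventually_nhds_metric dist_commute\<close>)

lemma bi_series_nth:
  "fls_nth (bi_series F) n = (if n < 0 then 0 else fps_to_fls (fps_expansion (\<lambda>z. fps_nth (fps_expansion (F z) 0) (nat n)) 0))"
  by (simp add: bi_series_def)

lemma bi_series_eqI:
  assumes "r > 0" "!!z w. cmod z < r ==> cmod w < r ==> F z w = G z w"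
  shows "bi_series F = bi_series G"
proof -
  have "fps_expansion (F z) 0 = fps_expansion (G z) 0" if "z \<in> ball 0 r" for z
    by (rule fps_expansion_cong_ball[of r]) (use assms that in auto)
  hence "fps_expansion (\<lambda>z. fps_nth (fps_expansion (F z) 0) k) 0 = fps_expansion (\<lambda>z. fps_nth (fps_expansion (G z) 0) k) 0" for k
    by (intro fps_expansion_cong_ball[of r]) (use assms in auto)
  thus ?thesis by (intro fls_eqI) (simp add: bi_series_nth)
qed

lemma biholo_ops:
  assumes F: "biholo F r" and G: "biholo G r"
  shows "biholo (\<lambda>z w. F z w + G z w) r" "bi_series (\<lambda>z w. F z w + G z w) = bi_series F + bi_series G"
    "biholo (\<lambda>z w. F z w * G z w) r" "bi_series (\<lambda>z w. F z w * G z w) = bi_series F * bi_series G"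
    "biholo (\<lambda>z. deriv (F z)) r" "bi_series (\<lambda>z. deriv (F z)) = fls_deriv (bi_series F)"
proof -
  have r: "r > 0" using F by (simp add: biholo_def)
  have Fz: "F z holomorphic_on ball 0 r" "G z holomorphic_on ball 0 r" if "z \<in> ball 0 r" for z
    using F G that by (auto simp: biholo_def)
  define f where "f k z = fps_nth (fps_expansion (F z) 0) k" for k z
  define g where "g k z = fps_nth (fps_expansion (G z) 0) k" for k z
  have fg: "f k holomorphic_on ball 0 r" "g k holomorphic_on ball 0 r" for k
    using F G unfolding biholo_def f_def g_def by auto
  have add: "fps_nth (fps_expansion (\<lambda>w. F z w + G z w) 0) k = f k z + g k z" if "z \<in> ball 0 r" for z k
    by (simp add: fps_expansion_ring[OF Fz[OF that] r] f_def g_def)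
  have mult: "fps_nth (fps_expansion (\<lambda>w. F z w * G z w) 0) k = (\<Sum>i=0..k. f i z * g (k - i) z)" if "z \<in> ball 0 r" for z k
    by (simp add: fps_expansion_ring[OF Fz[OF that] r] f_def g_def fps_mult_nth)
  have der: "fps_nth (fps_expansion (deriv (F z)) 0) k = of_nat (Suc k) * f (Suc k) z" if "z \<in> ball 0 r" for z k
    by (simp add: fps_expansion_ring(3)[OF Fz(1)[OF that] Fz(1)[OF that] r] f_def)
  have nthF: "fls_nth (bi_series F) n = (if n < 0 then 0 else fps_to_fls (fps_expansion (f (nat n)) 0))" for n
    by (simp add: bi_series_nth f_def[abs_def])
  have nthG: "fls_nth (bi_series G) n = (if n < 0 then 0 else fps_to_fls (fps_expansion (g (nat n)) 0))" for n
    by (simp add: bi_series_nth g_def[abs_def])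
  show "biholo (\<lambda>z w. F z w + G z w) r" unfolding biholo_def
  proof (intro conjI ballI allI r)
    show "(\<lambda>z. fps_nth (fps_expansion (\<lambda>w. F z w + G z w) 0) k) holomorphic_on ball 0 r" for k
      by (rule holomorphic_transform[of "\<lambda>z. f k z + g k z"]) (use fg add in \<open>auto intro!: holomorphic_intros\<close>)
  qed (use Fz in \<open>auto intro!: holomorphic_intros\<close>)
  show "biholo (\<lambda>z w. F z w * G z w) r" unfolding biholo_def
  proof (intro conjI ballI allI r)
    show "(\<lambda>z. fps_nth (fps_expansion (\<lambda>w. F z w * G z w) 0) k) holomorphic_on ball 0 r" for k
      by (rule holomorphic_transform[of "\<lambda>z. \<Sum>i=0..k. f i z * g (k - i) z"]) (use fg mult in \<open>auto intro!: holomorphic_intros\<close>)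
  qed (use Fz in \<open>auto intro!: holomorphic_intros\<close>)
  show "biholo (\<lambda>z. deriv (F z)) r" unfolding biholo_def
  proof (intro conjI ballI allI r)
    show "(\<lambda>z. fps_nth (fps_expansion (deriv (F z)) 0) k) holomorphic_on ball 0 r" for k
      by (rule holomorphic_transform[of "\<lambda>z. of_nat (Suc k) * f (Suc k) z"]) (use fg der in \<open>auto intro!: holomorphic_intros\<close>)
  qed (use Fz in \<open>auto intro!: holomorphic_intros\<close>)
  show "bi_series (\<lambda>z w. F z w + G z w) = bi_series F + bi_series G"
  proof (rule fls_eqI)
    fix n
    have *: "fps_expansion (\<lambda>z. fps_nth (fps_expansion (\<lambda>w. F z w + G z w) 0) k) 0 = fps_expansion (f k) 0 + fps_expansion (g k) 0" for k
      using fps_expansion_cong_ball[OF add r] fps_expansion_ring(1)[OF fg r] by simp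
    show "fls_nth (bi_series (\<lambda>z w. F z w + G z w)) n = fls_nth (bi_series F + bi_series G) n"
      unfolding bi_series_nth[of "\<lambda>z w. F z w + G z w"] fls_plus_nth nthF nthG * by simp
  qed
  show "bi_series (\<lambda>z. deriv (F z)) = fls_deriv (bi_series F)"
  proof (rule fls_eqI)
    fix n
    have "fps_expansion (\<lambda>z. fps_nth (fps_expansion (deriv (F z)) 0) k) 0 = fps_const (of_nat (Suc k)) * fps_expansion (f (Suc k)) 0" for k
      using fps_expansion_cong_ball[OF der r] fps_expansion_ring(2)[OF holomorphic_on_const fg(1) r, of "of_nat (Suc k)" "Suc k"]
      by (simp add: fps_expansion_of_const del: of_nat_Suc)
    hence *: "fps_to_fls (fps_expansion (\<lambda>z. fps_nth (fps_expansion (deriv (F z)) 0) k) 0) =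
       of_nat (Suc k) * fps_to_fls (fps_expansion (f (Suc k)) 0)" for k
      by (simp add: fls_times_fps_to_fls fls_of_nat del: of_nat_Suc)
    show "fls_nth (bi_series (\<lambda>z. deriv (F z))) n = fls_nth (fls_deriv (bi_series F)) n"
    proof (cases "n < 0")
      case True
      thus ?thesis unfolding bi_series_nth[of "\<lambda>z. deriv (F z)"] fls_deriv_nth nthF by (cases "n = -1") auto
    next
      case False
      have "nat (n + 1) = Suc (nat n)" "of_int (n + 1) = (of_nat (Suc (nat n)) :: complex fls)" using False
        by (simp_all add: Suc_nat_eq_nat_zadd1 of_nat_nat)
      thus ?thesis using False unfolding bi_series_nth[of "\<lambda>z. deriv (F z)"] fls_deriv_nth nthF
        by (simp only: *) auto
    qed
  qed
  show "bi_series (\<lambda>z w. F z w * G z w) = bi_series F * bi_series G"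
  proof -
    have *: "fps_expansion (\<lambda>z. fps_nth (fps_expansion (\<lambda>w. F z w * G z w) 0) k) 0 = (\<Sum>i=0..k. fps_expansion (f i) 0 * fps_expansion (g (k - i)) 0)" for k
    proof -
      have "fps_expansion (\<lambda>z. fps_nth (fps_expansion (\<lambda>w. F z w * G z w) 0) k) 0 = fps_expansion (\<lambda>z. \<Sum>i=0..k. f i z * g (k - i) z) 0"
        by (rule fps_expansion_cong_ball[OF mult r])
      also have "\<dots> = (\<Sum>i=0..k. fps_expansion (\<lambda>z. f i z * g (k - i) z) 0)"
        by (rule fps_expansion_of_sum[OF _ r]) (auto intro!: holomorphic_intros fg)
      also have "\<dots> = (\<Sum>i=0..k. fps_expansion (f i) 0 * fps_expansion (g (k - i)) 0)"
        by (intro sum.cong refl fps_expansion_ring(2)[OF fg r])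
      finally show ?thesis .
    qed
    have sumfls: "fps_to_fls (\<Sum>i\<in>I. h i) = (\<Sum>i\<in>I. fps_to_fls (h i :: complex fps))" for I and h :: "nat => complex fps"
      by (induction I rule: infinite_finite_induct) auto
    show ?thesis unfolding bi_series_def fls_times_fps_to_fls[symmetric]
      by (intro arg_cong[where f = fps_to_fls] fps_ext)
        (simp add: * fps_mult_nth sumfls fls_times_fps_to_fls f_def[symmetric, abs_def] g_def[symmetric, abs_def])
  qed
qed

section \<open>Nash algebraic functions as algebraic series\<close>

definition const_field :: "complex fls set" where "const_field = range fls_const"

lemma sub_field_const_field: "sub_field const_field"
proof -
  have "inverse (fls_const c) = fls_const (inverse c)" for c :: complex
    using fls_const_divide_const[of 1 c] by (simp add: inverse_eq_divide)
  thus ?thesis unfolding sub_field_def sub_ring_def const_field_def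
    by (auto simp: fls_plus_const simp flip: fls_const_uminus)
qed

text \<open>A polynomial with constant coefficients splits into linear factors over the complex numbers.\<close>

lemma const_field_algebraically_closed:
  assumes "algebraic_over const_field x" shows "x \<in> const_field"
proof -
  have key: "\<exists>r. x = fls_const r" if "poly (map_poly fls_const P) x = 0" "P ~= 0" for P :: "complex poly"
    using that
  proof (induction "degree P" arbitrary: P rule: less_induct)
    case less
    show ?case
    proof (cases "degree P = 0")
      case True
      then obtain a where "P = [:a:]" by (metis degree_eq_zeroE)
      thus ?thesis using less.prems by (simp add: map_poly_pCons)
    next
      case False
      hence "\<not> (\<exists>a l. a ~= 0 \<and> l = 0 \<and> P = pCons a l)" by auto
      then obtain r where "poly P r = 0"
        using fundamental_theorem_of_algebra_alt[of P] by blast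
      then obtain Q where Q: "P = [:- r, 1:] * Q" by (metis poly_eq_0_iff_dvd dvdE)
      have "Q ~= 0" using less.prems Q by auto
      have "degree ([:- r, 1:] * Q) = degree [:- r, 1:] + degree Q"
        by (rule degree_mult_eq) (use \<open>Q ~= 0\<close> in auto)
      hence deg: "degree Q < degree P" unfolding Q by simp
      have "map_poly fls_const ([:- r, 1:] * Q) = map_poly fls_const [:- r, 1:] * map_poly fls_const Q"
      proof -
        have "map_poly fls_const ([:a, 1:] * Q) = map_poly fls_const [:a, 1:] * map_poly fls_const Q" for a
          by (intro poly_eqI) (auto simp: coeff_map_poly coeff_pCons map_poly_pCons fls_plus_const split: nat.split)
        thus ?thesis .
      qed
      hence "(x - fls_const r) * poly (map_poly fls_const Q) x = 0"
        using less.prems(1) unfolding Q by (simp only: poly_mult) (simp add: map_poly_pCons)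
      hence "poly (map_poly fls_const Q) x = 0 \<or> x = fls_const r" by auto
      thus ?thesis
      proof
        assume "poly (map_poly fls_const Q) x = 0"
        thus ?thesis by (rule less.hyps[OF deg _ \<open>Q ~= 0\<close>])
      qed auto
    qed
  qed
  obtain p where p: "p \<in> polys_over const_field" "p ~= 0" "poly p x = 0"
    using assms unfolding algebraic_over_def by blast
  define P where "P = map_poly (\<lambda>a. fls_nth a 0) p"
  have "p = map_poly fls_const P"
  proof (rule poly_eqI)
    fix n
    obtain c where "coeff p n = fls_const c" using polys_overD[OF p(1), of n] by (auto simp: const_field_def)
    thus "coeff p n = coeff (map_poly fls_const P) n" by (simp add: P_def coeff_map_poly)
  qed
  moreover from this p have "P ~= 0" by auto
  ultimately show ?thesis using key[of P] p by (auto simp: const_field_def)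
qed

abbreviation "bidisc r \<equiv> ball (0::complex) r \<times> ball (0::complex) r"

lemma bi_series_hol2:
  assumes "hol2 F (bidisc r)" "hol2 G (bidisc r)" "r > 0"
  shows "bi_series (\<lambda>z w. F z w + G z w) = bi_series F + bi_series G"
    "bi_series (\<lambda>z w. F z w * G z w) = bi_series F * bi_series G"
    "bi_series (\<lambda>z. deriv (F z)) = fls_deriv (bi_series F)"
  using biholo_ops[OF hol2_biholo[OF assms(1,3)] hol2_biholo[OF assms(2,3)]] by auto

lemma bi_series_fun_fst: "bi_series (\<lambda>z w. f z) = fls_const (fps_to_fls (fps_expansion f 0))"
  by (rule fls_eqI) (simp add: bi_series_nth fps_expansion_of_const)

lemma bi_series_const: "bi_series (\<lambda>z w. c) = fls_const (fls_const c)"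
  by (simp add: bi_series_fun_fst fps_expansion_of_const)

lemma bi_series_fun_snd: "bi_series (\<lambda>z w. g w) \<in> fls_coeffs_in const_field"
  using sub_ringD(1)[OF sub_fieldD(1)[OF sub_field_const_field]]
  by (auto simp: fls_coeffs_in_def bi_series_nth fps_expansion_of_const const_field_def)

lemma eval_fps_expansion_ball:
  assumes "f holomorphic_on ball 0 r" "z \<in> ball 0 r"
  shows "eval_fps (fps_expansion f 0) z = f z"
  using eval_fps_expansion'[of f 0 "ereal r" z] assms by (simp add: eball_def ball_def)

lemma bi_series_separated:
  assumes F: "biholo F r" and c: "!!n. n > 0 ==> fls_nth (bi_series F) n \<in> const_field"
    and z: "z \<in> ball 0 r" and w: "w \<in> ball 0 r"
  shows "F z w = F z 0 + F 0 w - F 0 0"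
proof -
  have r: "r > 0" using F by (simp add: biholo_def)
  define f where "f k z = fps_nth (fps_expansion (F z) 0) k" for k z
  have fh: "f k holomorphic_on ball 0 r" for k using F unfolding biholo_def f_def by auto
  have const: "f k z = f k 0" if "k > 0" "z \<in> ball 0 r" for k z
  proof -
    have "fps_to_fls (fps_expansion (f k) 0) \<in> const_field"
      using c[of "int k"] that by (simp add: bi_series_nth f_def[abs_def])
    then obtain a where "fps_to_fls (fps_expansion (f k) 0) = fps_to_fls (fps_const a)"
      by (auto simp: const_field_def)
    hence a: "fps_expansion (f k) 0 = fps_const a" by (simp only: fps_to_fls_eq_iff)
    have "f k z = a" if "z \<in> ball 0 r" for z
      using eval_fps_expansion_ball[OF fh that, of k] by (simp add: a)
    thus ?thesis using that r by simp
  qed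
  have hol: "F z holomorphic_on ball 0 r" "F 0 holomorphic_on ball 0 r" using F z r by (auto simp: biholo_def)
  have "fps_expansion (\<lambda>w. F z w - F 0 w) 0 = fps_expansion (F z) 0 - fps_expansion (F 0) 0"
    by (intro fps_expansion_eqI has_fps_expansion_diff has_fps_expansion_ball[OF _ r] hol)
  also have "\<dots> = fps_const (f 0 z - f 0 0)"
    using const z by (intro fps_ext) (auto simp: f_def)
  finally have "F z w - F 0 w = f 0 z - f 0 0"
    using eval_fps_expansion_ball[OF holomorphic_on_diff[OF hol] w] by simp
  thus ?thesis by (simp add: f_def fps_expansion_def algebra_simps)
qed

lemma bi_series_zeroD:
  assumes F: "biholo F r" and "bi_series F = 0" and z: "z \<in> ball 0 r" and w: "w \<in> ball 0 r"
  shows "F z w = 0"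
proof -
  have r: "r > 0" using F by (simp add: biholo_def)
  have "fps_expansion (\<lambda>z. fps_nth (fps_expansion (F z) 0) k) 0 = 0" for k
    using arg_cong[OF assms(2), of "\<lambda>x. fls_nth x (int k)"] by (simp add: bi_series_nth)
  hence "fps_nth (fps_expansion (F z) 0) k = 0" for k
    using eval_fps_expansion_ball[of "\<lambda>z. fps_nth (fps_expansion (F z) 0) k" r z] F z by (simp add: biholo_def)
  hence "fps_expansion (F z) 0 = 0" by (intro fps_ext) simp
  thus ?thesis using eval_fps_expansion_ball[of "F z" r w] F z w by (simp add: biholo_def)
qed

lemma bi_series_0: "bi_series (\<lambda>z w. 0) = 0"
  by (simp add: bi_series_const)

lemma base_digits_less:
  fixes a :: "nat => nat"
  assumes "!!i. i < n ==> a i < B" shows "(\<Sum>i<n. a i * B ^ i) < B ^ n"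
  using assms
proof (induction n)
  case (Suc n)
  have "(\<Sum>i<Suc n. a i * B ^ i) < B ^ n + a n * B ^ n" using Suc by simp
  also have "\<dots> = (1 + a n) * B ^ n" by simp
  also have "\<dots> \<le> B * B ^ n" using Suc.prems[of n] by (intro mult_right_mono) auto
  finally show ?case by simp
qed simp

lemma base_digits_unique:
  fixes a b :: "nat => nat"
  assumes "!!i. i < n ==> a i < B" "!!i. i < n ==> b i < B" "(\<Sum>i<n. a i * B ^ i) = (\<Sum>i<n. b i * B ^ i)" "j < n"
  shows "a j = b j"
  using assms
proof (induction n)
  case (Suc n)
  have B: "B > 0" using Suc.prems(1)[of n] by auto
  have 1: "(\<Sum>i<n. a i * B ^ i) < B ^ n" "(\<Sum>i<n. b i * B ^ i) < B ^ n"
    using Suc.prems by (auto intro!: base_digits_less)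
  have "a n = ((\<Sum>i<n. a i * B ^ i) + a n * B ^ n) div B ^ n" using 1 B by simp
  also have "\<dots> = ((\<Sum>i<n. b i * B ^ i) + b n * B ^ n) div B ^ n" using Suc.prems(3) by simp
  also have "\<dots> = b n" using 1 B by simp
  finally have n: "a n = b n" .
  show ?case
  proof (cases "j = n")
    case False
    thus ?thesis using Suc n by simp
  qed (use n in simp)
qed simp

text \<open>Kronecker substitution: for large \<open>B\<close> the point with coordinates \<open>t^(B^i)\<close> turns different monomials into different powers of \<open>t\<close>.\<close>

lemma monomials_independent:
  fixes c :: "('k::finite => nat) => complex"
  assumes K: "finite K" "k0 \<in> K" "c k0 ~= 0"
  shows "\<exists>b. (\<Sum>k\<in>K. c k * monomial_fun k b) ~= 0"
proof -
  define n where "n = CARD('k)"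
  obtain e :: "nat => 'k" where e: "bij_betw e {..<n} UNIV"
    using ex_bij_betw_nat_finite[of "UNIV :: 'k set"] by (auto simp: n_def atLeast0LessThan)
  define B where "B = Suc (Max ((\<lambda>(k, i). k i) ` (K \<times> UNIV)))"
  have B: "k i < B" if "k \<in> K" for k i
    unfolding B_def less_Suc_eq_le by (rule Max_ge) (use that K in \<open>auto intro!: image_eqI[of _ _ "(k, i)"]\<close>)
  define N where "N k = (\<Sum>j<n. k (e j) * B ^ j)" for k :: "'k => nat"
  have inj: "k = k'" if "k \<in> K" "k' \<in> K" "N k = N k'" for k k'
  proof
    fix i obtain j where j: "j < n" "e j = i" using bij_betw_imp_surj_on[OF e] by (metis UNIV_I imageE lessThan_iff)
    have "k (e j) = k' (e j)"
      using base_digits_unique[of n "\<lambda>j. k (e j)" B "\<lambda>j. k' (e j)" j] B that j by (simp add: N_def)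
    thus "k i = k' i" using j by simp
  qed
  define iv where "iv = inv_into {..<n} e"
  have iv: "iv (e j) = j" if "j < n" for j using e that by (simp add: iv_def bij_betw_def inv_into_f_f)
  define b where "b t = (\<chi> i. t ^ (B ^ iv i))" for t :: complex
  have mon: "monomial_fun k (b t) = t ^ N k" for k t
  proof -
    have "monomial_fun k (b t) = (\<Prod>i\<in>UNIV. (t ^ (B ^ iv i)) ^ k i)" by (simp add: monomial_fun_def b_def)
    also have "\<dots> = (\<Prod>j<n. (t ^ (B ^ iv (e j))) ^ k (e j))"
      using prod.reindex_bij_betw[OF e, of "\<lambda>i. (t ^ (B ^ iv i)) ^ k i"] by simp
    also have "\<dots> = (\<Prod>j<n. t ^ (k (e j) * B ^ j))"
      by (intro prod.cong refl) (simp add: iv power_mult[symmetric] mult.commute)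
    finally show ?thesis by (simp add: N_def power_sum)
  qed
  define p where "p = (\<Sum>k\<in>K. monom (c k) (N k))"
  have "coeff p (N k0) = (\<Sum>k\<in>K. if k = k0 then c k else 0)"
    unfolding p_def coeff_sum coeff_monom by (intro sum.cong refl) (use inj K in auto)
  hence "p ~= 0" using K by auto
  then obtain t where "poly p t ~= 0" by (metis poly_all_0_iff_0)
  hence "(\<Sum>k\<in>K. c k * monomial_fun k (b t)) ~= 0" by (simp add: p_def poly_sum poly_monom mon)
  thus ?thesis by blast
qed

text \<open>Near the origin, \<open>F\<close> is algebraic over the functions of one variable; \<open>sep2\<close> below is membership in the field that these generate.\<close>

definition alg2 :: "(complex => complex => complex) => real => bool" where
  "alg2 F r \<longleftrightarrow> hol2 F (bidisc r) \<and> bi_series F \<in> separated_algebraic const_field"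

definition sep2 :: "(complex => complex => complex) => real => bool" where
  "sep2 F r \<longleftrightarrow> hol2 F (bidisc r) \<and> bi_series F \<in> separated_field const_field"

lemma separated_field: "sub_field (separated_field const_field)" "separated_series const_field \<subseteq> separated_field const_field"
  unfolding separated_field_def by (rule generated_field)+

lemma sep2_ops:
  assumes "sep2 F r" "sep2 G r" "r > 0"
  shows "sep2 (\<lambda>z w. F z w + G z w) r" "sep2 (\<lambda>z w. F z w * G z w) r"
  using assms sub_ringD(3,4)[OF sub_fieldD(1)[OF separated_field(1)]]
  unfolding sep2_def by (auto simp: bi_series_hol2 hol2_add hol2_mult)

lemma sep2_const: "sep2 (\<lambda>z w. c) r"
  using separated_field(2) by (auto simp: sep2_def hol2_const bi_series_const separated_series_def)

lemma sep2_sum: "(!!i. i \<in> I ==> sep2 (F i) r) ==> r > 0 ==> sep2 (\<lambda>z w. \<Sum>i\<in>I. F i z w) r"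
  by (induction I rule: infinite_finite_induct) (auto intro: sep2_const sep2_ops)

lemma sep2_fun_fst: "f holomorphic_on ball 0 r ==> sep2 (\<lambda>z w. f z) r"
  using separated_field(2) hol2_fun_fst[of f "ball 0 r" "bidisc r"]
  by (auto simp: sep2_def bi_series_fun_fst separated_series_def)

lemma sep2_fun_snd: "f holomorphic_on ball 0 r ==> sep2 (\<lambda>z w. f w) r"
  using separated_field(2) hol2_fun_snd[of f "ball 0 r" "bidisc r"] bi_series_fun_snd[of f]
  by (auto simp: sep2_def separated_series_def)

definition sep2_poly :: "(complex => complex => complex poly) => real => bool" where
  "sep2_poly q r \<longleftrightarrow> (\<forall>n. sep2 (\<lambda>z w. coeff (q z w) n) r)"

lemma sep2_poly_ops:
  assumes "sep2_poly p r" "sep2_poly q r" "r > 0"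
  shows "sep2_poly (\<lambda>z w. p z w + q z w) r" "sep2_poly (\<lambda>z w. p z w * q z w) r"
  using assms unfolding sep2_poly_def
  by (auto simp: coeff_mult intro!: sep2_ops sep2_sum)

lemma sep2_poly_const: "sep2_poly (\<lambda>z w. p) r" by (simp add: sep2_poly_def sep2_const)

lemma sep2_poly_sum: "(!!i. i \<in> I ==> sep2_poly (F i) r) ==> r > 0 ==> sep2_poly (\<lambda>z w. \<Sum>i\<in>I. F i z w) r"
  by (induction I rule: infinite_finite_induct) (auto intro: sep2_poly_const sep2_poly_ops)

lemma sep2_poly_prod: "(!!i. i \<in> I ==> sep2_poly (F i) r) ==> r > 0 ==> sep2_poly (\<lambda>z w. \<Prod>i\<in>I. F i z w) r"
  by (induction I rule: infinite_finite_induct) (auto intro: sep2_poly_const sep2_poly_ops)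

lemma sep2_poly_power: "sep2_poly F r ==> r > 0 ==> sep2_poly (\<lambda>z w. F z w ^ n) r"
  by (induction n) (auto intro: sep2_poly_const sep2_poly_ops)

text \<open>The polynomial relation of \<open>H\<close> may become trivial on the image of \<open>\<gamma>\<close>. Move the argument to \<open>\<gamma> + \<epsilon> v\<close>, where \<open>v\<close> is chosen such that the relation does not vanish identically in \<open>\<epsilon>\<close>, divide by the power of \<open>\<epsilon>\<close> that all its coefficients share, and let \<open>\<epsilon>\<close> tend to 0. What remains is a nontrivial relation whose coefficients are polynomials in the components of \<open>\<gamma>\<close>.\<close>

lemma nash_algebraic_composition:
  fixes H :: "complex ^ 'k::finite => complex"
  assumes H: "nash_algebraic_on H D" and D: "open D" and r: "r > 0"
    and \<gamma>: "!!i. sep2 (\<gamma> i) r" and mem: "!!z w. (z, w) \<in> bidisc r ==> (\<chi> i. \<gamma> i z w) \<in> D"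
  shows "alg2 (\<lambda>z w. H (\<chi> i. \<gamma> i z w)) r"
proof -
  define F where "F z w = H (\<chi> i. \<gamma> i z w)" for z w
  have Hh: "H cholomorphic_on D" using H by (simp add: nash_algebraic_on_def)
  have F: "hol2 F (bidisc r)" unfolding F_def
    by (rule hol2_cholomorphic[OF Hh D]) (use \<gamma> mem in \<open>auto simp: sep2_def\<close>)
  obtain S c where S: "finite S" "\<exists>s\<in>S. c s ~= 0"
    and rel: "!!x. x \<in> D ==> (\<Sum>(k, d)\<in>S. c (k, d) * monomial_fun k x * H x ^ d) = 0"
    using H unfolding nash_algebraic_on_def by blast
  define E where "E = snd ` S"
  define K where "K d = {k. (k, d) \<in> S}" for d
  have finE: "finite E" using S by (simp add: E_def)
  have finK: "finite (K d)" for d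
    using finite_subset[of "K d" "fst ` S"] S(1) by (force simp: K_def)
  have S_eq: "S = (\<lambda>(d, k). (k, d)) ` (SIGMA d:E. K d)" by (force simp: E_def K_def)
  have reidx: "(\<Sum>(k, d)\<in>S. g k d) = (\<Sum>d\<in>E. \<Sum>k\<in>K d. g k d)" for g :: "('k => nat) => nat => complex"
  proof -
    have "(\<Sum>(k, d)\<in>S. g k d) = (\<Sum>(d, k)\<in>(SIGMA d:E. K d). g k d)"
      by (subst S_eq, subst sum.reindex) (auto simp: inj_on_def case_prod_beta')
    thus ?thesis using finE finK by (simp add: sum.Sigma)
  qed
  obtain k0 d0 where s0: "(k0, d0) \<in> S" "c (k0, d0) ~= 0" using S by auto
  obtain b where b: "(\<Sum>k\<in>K d0. c (k, d0) * monomial_fun k b) ~= 0"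
    using monomials_independent[of "K d0" k0 "\<lambda>k. c (k, d0)"] finK s0 by (auto simp: K_def)
  define v where "v i = b $ i - \<gamma> i 0 0" for i
  define q where "q d z w = (\<Sum>k\<in>K d. [:c (k, d):] * (\<Prod>i\<in>UNIV. [:\<gamma> i z w, v i:] ^ k i))" for d z w
  have q_eval: "poly (q d z w) \<epsilon> = (\<Sum>k\<in>K d. c (k, d) * monomial_fun k (\<chi> i. \<gamma> i z w + \<epsilon> * v i))" for d z w \<epsilon>
    by (simp add: q_def poly_sum poly_prod monomial_fun_def)
  have line: "sep2_poly (\<lambda>z w. [:\<gamma> i z w, v i:]) r" for i
    unfolding sep2_poly_def
  proof
    fix n show "sep2 (\<lambda>z w. coeff [:\<gamma> i z w, v i:] n) r"
      using \<gamma>[of i] sep2_const[of "v i" r] sep2_const[of 0 r] by (cases n; cases "n - 1") (auto simp: coeff_pCons)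
  qed
  have q: "sep2_poly (q d) r" for d unfolding q_def
    by (intro sep2_poly_sum sep2_poly_ops sep2_poly_const sep2_poly_prod sep2_poly_power line r)
  define a where "a n d z w = coeff (q d z w) n" for n d z w
  have a: "sep2 (a n d) r" for n d using q by (simp add: sep2_poly_def a_def[abs_def])
  have a_zero: "a n d z w = 0" if "bi_series (a n d) = 0" "z \<in> ball 0 (r/2)" "w \<in> ball 0 (r/2)" for n d z w
    using bi_series_zeroD[OF hol2_biholo that] a r by (simp add: sep2_def)
  have ex: "\<exists>n. \<exists>d\<in>E. bi_series (a n d) ~= 0"
  proof -
    have "poly (q d0 0 0) 1 ~= 0" using b by (simp add: q_eval v_def)
    hence "q d0 0 0 ~= 0" by auto
    then obtain n where "coeff (q d0 0 0) n ~= 0" by (metis leading_coeff_0_iff)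
    hence "bi_series (a n d0) ~= 0" using a_zero[of n d0 0 0] r by (auto simp: a_def)
    thus ?thesis using s0 by (force simp: E_def)
  qed
  define n where "n = (LEAST n. \<exists>d\<in>E. bi_series (a n d) ~= 0)"
  obtain d1 where d1: "d1 \<in> E" "bi_series (a n d1) ~= 0" using LeastI_ex[OF ex] by (auto simp: n_def)
  have low: "bi_series (a m d) = 0" if "m < n" "d \<in> E" for m d
    using not_less_Least[OF that(1)[unfolded n_def]] that by blast
  have key: "(\<Sum>d\<in>E. a n d z w * F z w ^ d) = 0" if zw: "z \<in> ball 0 (r/2)" "w \<in> ball 0 (r/2)" for z w
  proof -
    define x where "x \<epsilon> = (\<chi> i. \<gamma> i z w + \<epsilon> * v i)" for \<epsilon>
    have x0: "x 0 = (\<chi> i. \<gamma> i z w)" by (simp add: x_def)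
    have xD: "x 0 \<in> D" unfolding x0 using zw r by (intro mem) auto
    have xcont: "isCont x 0" unfolding x_def isCont_def
      by (intro vec_tendstoI) (auto intro!: tendsto_eq_intros)
    have evD: "\<forall>\<^sub>F \<epsilon> in at 0. x \<epsilon> \<in> D"
      using xcont[unfolded isCont_def] topological_tendstoD[OF _ D xD] by blast
    have Hcont: "isCont H (x 0)"
    proof -
      obtain H' where "(H has_derivative H') (at (x 0) within D)"
        using Hh xD unfolding cholomorphic_on_def by blast
      thus ?thesis using at_within_open[OF xD D] has_derivative_continuous by metis
    qed
    define p where "p d = poly_shift n (q d z w)" for d
    have p: "poly (q d z w) \<epsilon> = \<epsilon> ^ n * poly (p d) \<epsilon>" if "d \<in> E" for d \<epsilon>
    proof -
      have "q d z w = monom 1 n * p d"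
      proof (rule poly_eqI)
        fix m show "coeff (q d z w) m = coeff (monom 1 n * p d) m"
          using a_zero[OF low[OF _ that] zw, of m]
          by (auto simp: coeff_monom_mult p_def coeff_poly_shift a_def)
      qed
      thus ?thesis by (simp add: poly_monom)
    qed
    have ev: "\<forall>\<^sub>F \<epsilon> in at 0. (\<Sum>d\<in>E. poly (p d) \<epsilon> * H (x \<epsilon>) ^ d) = 0"
      using evD eventually_neq_at_within[of 0 0 UNIV]
    proof eventually_elim
      case (elim \<epsilon>)
      have "0 = (\<Sum>d\<in>E. poly (q d z w) \<epsilon> * H (x \<epsilon>) ^ d)"
        using rel[OF elim(1)] unfolding reidx q_eval x_def by (simp add: sum_distrib_right)
      also have "\<dots> = \<epsilon> ^ n * (\<Sum>d\<in>E. poly (p d) \<epsilon> * H (x \<epsilon>) ^ d)"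
        unfolding sum_distrib_left by (intro sum.cong refl) (simp add: p)
      finally show ?case using elim(2) by simp
    qed
    have lim: "((\<lambda>\<epsilon>. \<Sum>d\<in>E. poly (p d) \<epsilon> * H (x \<epsilon>) ^ d) \<longlongrightarrow> (\<Sum>d\<in>E. poly (p d) 0 * H (x 0) ^ d)) (at 0)"
    proof -
      have "((\<lambda>\<epsilon>. H (x \<epsilon>)) \<longlongrightarrow> H (x 0)) (at 0)"
        using isCont_tendsto_compose[OF Hcont] xcont by (simp add: isCont_def)
      thus ?thesis by (intro tendsto_intros)
    qed
    have "(\<Sum>d\<in>E. poly (p d) 0 * H (x 0) ^ d) = 0"
      by (rule tendsto_unique[OF _ lim tendsto_eventually[OF ev]]) simp
    thus ?thesis by (simp add: poly_0_coeff_0 p_def coeff_poly_shift a_def F_def x0)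
  qed
  define pp where "pp = (\<Sum>d\<in>E. monom (bi_series (a n d)) d)"
  have copp: "coeff pp d = (if d \<in> E then bi_series (a n d) else 0)" for d
    using finE by (simp add: pp_def coeff_sum coeff_monom)
  have "bi_series (\<lambda>z w. \<Sum>d\<in>E. a n d z w * F z w ^ d) = 0"
    using bi_series_eqI[of "r/2" "\<lambda>z w. \<Sum>d\<in>E. a n d z w * F z w ^ d" "\<lambda>z w. 0"] key r by (simp add: bi_series_0)
  moreover have "bi_series (\<lambda>z w. \<Sum>d\<in>E. a n d z w * F z w ^ d) = (\<Sum>d\<in>E. bi_series (a n d) * bi_series F ^ d)"
  proof -
    have pow: "bi_series (\<lambda>z w. F z w ^ d) = bi_series F ^ d" for d
      by (induction d) (simp_all add: bi_series_const bi_series_hol2[OF F hol2_power[OF F] r])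
    have "bi_series (\<lambda>z w. \<Sum>d\<in>E'. a n d z w * F z w ^ d) = (\<Sum>d\<in>E'. bi_series (a n d) * bi_series F ^ d)" if "finite E'" for E'
      using that
    proof (induction E' rule: finite_induct)
      case (insert e E')
      have h: "hol2 (\<lambda>z w. a n e z w * F z w ^ e) (bidisc r)" "hol2 (\<lambda>z w. \<Sum>d\<in>E'. a n d z w * F z w ^ d) (bidisc r)"
        using a F unfolding sep2_def by (auto intro!: hol2_mult hol2_power hol2_sum)
      have ah: "hol2 (a n e) (bidisc r)" using a by (simp add: sep2_def)
      show ?case using insert
        by (simp add: bi_series_hol2(1)[OF h r] bi_series_hol2(2)[OF ah hol2_power[OF F] r] pow)
    qed (simp add: bi_series_0)
    thus ?thesis using finE .
  qed
  ultimately have "poly pp (bi_series F) = 0" by (simp add: pp_def poly_sum poly_monom)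
  moreover have "pp ~= 0" using copp[of d1] d1 by auto
  moreover have "pp \<in> polys_over (separated_field const_field)"
    using a sub_ringD(1)[OF sub_fieldD(1)[OF separated_field(1)]] by (auto simp: polys_over_def copp sep2_def)
  ultimately have "bi_series F \<in> separated_algebraic const_field"
    unfolding separated_algebraic_def algebraic_over_def by blast
  thus ?thesis using F unfolding alg2_def F_def by simp
qed

section \<open>Polarization and the local consequences of the algebra\<close>

lemma holomorphic_zero_extension:
  assumes f: "f holomorphic_on S" "open S" "connected S" and a: "a \<in> S" "\<epsilon> > 0"
    and z: "!!w. w \<in> S ==> dist a w < \<epsilon> ==> f w = 0" and w: "w \<in> S"
  shows "f w = 0"
proof (rule analytic_continuation[OF f, of "S \<inter> ball a \<epsilon>" a])
  show "a islimpt S \<inter> ball a \<epsilon>"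
    by (rule interior_limit_point) (use a f(2) in \<open>auto simp: interior_open open_Int\<close>)
qed (use a z w in auto)

lemma holomorphic_zero_on_reals:
  assumes f: "f holomorphic_on ball 0 r" and z: "!!x::real. \<bar>x\<bar> < r ==> f (of_real x) = 0" and w: "w \<in> ball 0 r"
  shows "f w = 0"
proof (rule analytic_continuation[OF f, of "of_real ` {-r<..<r}" 0])
  have r: "r > 0" using w by (auto intro: le_less_trans[OF norm_ge_zero])
  show "(0::complex) islimpt of_real ` {-r<..<r}" unfolding islimpt_approachable
  proof (intro allI impI)
    fix e :: real assume "e > 0"
    define x where "x = min (e/2) (r/2)"
    have "x > 0" "x < e" "x < r" using r \<open>e > 0\<close> by (auto simp: x_def)
    thus "\<exists>x'\<in>of_real ` {-r<..<r}. x' ~= 0 \<and> dist x' (0::complex) < e"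
      by (intro bexI[of _ "of_real x"]) auto
  qed
  show "0 \<in> ball (0::complex) r" using r by simp
  show "f z = 0" if "z \<in> of_real ` {- r<..<r}" for z using that z by auto
  show "of_real ` {- r<..<r} \<subseteq> ball (0::complex) r" by auto
qed (use w in auto)

lemma hol2_zero_extension:
  assumes F: "hol2 F (T \<times> V)" "open T" "connected T" "open V" "connected V" and a: "a \<in> T" "b \<in> V" "\<epsilon> > 0"
    and z: "!!z w. z \<in> T ==> w \<in> V ==> dist a z < \<epsilon> ==> dist b w < \<epsilon> ==> F z w = 0"
    and zw: "z \<in> T" "w \<in> V"
  shows "F z w = 0"
proof -
  have 1: "F z w = 0" if "z \<in> T" "dist a z < \<epsilon>" "w \<in> V" for z w
    by (rule holomorphic_zero_extension[OF hol2_slice(1)[OF F(1,4) that(1)] F(4,5) a(2,3) _ that(3)]) (use z that in auto)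
  show ?thesis
    by (rule holomorphic_zero_extension[OF hol2_slice(2)[OF F(1,2) zw(2)] F(2,3) a(1,3) _ zw(1)]) (use 1 zw in auto)
qed

text \<open>In the coordinates \<open>\<xi> = (z + w)/2\<close> and \<open>\<eta> = (z - w)/2\<i>\<close> the diagonal consists of the real points, and a holomorphic function vanishing on the reals is 0, first in \<open>\<xi>\<close> and then in \<open>\<eta>\<close>.\<close>

lemma polarization:
  assumes F: "hol2 F (bidisc r)" and d: "!!z. z \<in> ball 0 r ==> F z (cnj z) = 0" and zw: "z \<in> ball 0 r" "w \<in> ball 0 r"
  shows "F z w = 0"
proof -
  have r: "r > 0" using zw by (auto intro: le_less_trans[OF norm_ge_zero])
  have small: "F z w = 0" if zw: "cmod z < r/2" "cmod w < r/2" for z w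
  proof -
    define \<xi> where "\<xi> = (z + w) / 2"
    define \<eta> where "\<eta> = (z - w) / (2 * \<i>)"
    have zw_eq: "z = \<xi> + \<i> * \<eta>" "w = \<xi> - \<i> * \<eta>" by (auto simp: \<xi>_def \<eta>_def field_simps)
    have nx: "cmod \<xi> < r/2" "cmod \<eta> < r/2"
      using norm_triangle_ineq[of z w] norm_triangle_ineq4[of z w] zw by (auto simp: \<xi>_def \<eta>_def norm_divide norm_mult)
    have in_disc: "s + \<i> * t \<in> ball 0 r" "s - \<i> * t \<in> ball 0 r" if "cmod s < r/2" "cmod t < r/2" for s t
      using norm_triangle_ineq[of s "\<i> * t"] norm_triangle_ineq4[of s "\<i> * t"] that by (auto simp: norm_mult)
    have hol1: "(\<lambda>s. F (s + \<i> * t) (s - \<i> * t)) holomorphic_on ball 0 (r/2)" if "cmod t < r/2" for t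
      by (rule hol2_curve_holomorphic[OF F]) (use in_disc that in \<open>auto intro!: holomorphic_intros\<close>)
    have hol2: "(\<lambda>t. F (s + \<i> * t) (s - \<i> * t)) holomorphic_on ball 0 (r/2)" if "cmod s < r/2" for s
      by (rule hol2_curve_holomorphic[OF F]) (use in_disc that in \<open>auto intro!: holomorphic_intros\<close>)
    have real: "F (of_real x + \<i> * of_real y) (of_real x - \<i> * of_real y) = 0" if "\<bar>x\<bar> < r/2" "\<bar>y\<bar> < r/2" for x y
      using d[OF in_disc(1)[of "of_real x" "of_real y"]] that by simp
    have semi: "F (s + \<i> * of_real y) (s - \<i> * of_real y) = 0" if "cmod s < r/2" "\<bar>y\<bar> < r/2" for s y
      by (rule holomorphic_zero_on_reals[OF hol1]) (use that real in auto)
    have "F (\<xi> + \<i> * \<eta>) (\<xi> - \<i> * \<eta>) = 0"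
      by (rule holomorphic_zero_on_reals[OF hol2[OF nx(1)]]) (use nx semi in auto)
    thus ?thesis using zw_eq by simp
  qed
  show ?thesis
    by (rule hol2_zero_extension[OF F, of 0 0 "r/2"]) (use small zw r in auto)
qed

abbreviation shift2 :: "complex => complex => (complex => complex => complex) => complex => complex => complex" where
  "shift2 a b F \<equiv> (\<lambda>z w. F (a + z) (b + w))"

lemma hol2_shift:
  assumes F: "hol2 F S" and "!!z w. (z, w) \<in> T ==> (a + z, b + w) \<in> S"
  shows "hol2 (shift2 a b F) T"
  by (rule hol2_subst[OF F]) (use assms in \<open>auto intro!: hol2_add hol2_const hol2_fst hol2_snd\<close>)

lemma shift_in_disc: "cmod a + \<rho> \<le> R ==> z \<in> ball 0 \<rho> ==> a + z \<in> ball 0 R"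
  using norm_triangle_ineq[of a z] by auto

lemma hol2_shift_bidisc:
  assumes F: "hol2 F (bidisc R)" and "cmod a + \<rho> \<le> R" "cmod b + \<rho> \<le> R"
  shows "hol2 (shift2 a b F) (bidisc \<rho>)"
  by (rule hol2_shift[OF F]) (use assms shift_in_disc in blast)

lemma polarization_at:
  assumes F: "hol2 F (bidisc R)" and U: "open U" "U \<subseteq> ball 0 R" "U ~= {}" and d: "!!z. z \<in> U ==> F z (cnj z) = 0"
    and zw: "z \<in> ball 0 R" "w \<in> ball 0 R"
  shows "F z w = 0"
proof -
  obtain a where a: "a \<in> U" using U by auto
  obtain \<epsilon> where e: "\<epsilon> > 0" "ball a \<epsilon> \<subseteq> U" using U a open_contains_ball by blast
  define \<rho> where "\<rho> = min \<epsilon> (R - cmod a)"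
  have aR: "cmod a < R" using U a by auto
  have \<rho>: "\<rho> > 0" "cmod a + \<rho> \<le> R" "\<rho> \<le> \<epsilon>" using e aR by (auto simp: \<rho>_def)
  have h: "hol2 (shift2 a (cnj a) F) (bidisc \<rho>)" by (rule hol2_shift_bidisc[OF F]) (use \<rho> in auto)
  have 0: "shift2 a (cnj a) F x y = 0" if "x \<in> ball 0 \<rho>" "y \<in> ball 0 \<rho>" for x y
  proof (rule polarization[OF h _ that])
    fix z assume "z \<in> ball (0::complex) \<rho>"
    hence "a + z \<in> U" using e \<rho> by (auto simp: dist_norm)
    thus "F (a + z) (cnj a + cnj z) = 0" using d[of "a + z"] by simp
  qed
  show ?thesis
  proof (rule hol2_zero_extension[OF F, of a "cnj a" \<rho>])
    fix z w assume "z \<in> ball 0 R" "w \<in> ball 0 R" "dist a z < \<rho>" "dist (cnj a) w < \<rho>"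
    thus "F z w = 0" using 0[of "z - a" "w - cnj a"] by (simp add: dist_norm norm_minus_commute)
  qed (use zw aR \<rho> in auto)
qed

text \<open>By polarization a function that is not identically zero cannot vanish on an open part of the diagonal; the finitely many functions are treated one after the other.\<close>

lemma generic_diagonal_point:
  assumes "finite I" "!!i. i \<in> I ==> hol2 (F i) (bidisc R) \<and> (\<exists>z w. z \<in> ball 0 R \<and> w \<in> ball 0 R \<and> F i z w ~= 0)"
    and U: "open U" "U \<subseteq> ball 0 R" "U ~= {}"
  shows "\<exists>V. open V \<and> V ~= {} \<and> V \<subseteq> U \<and> (\<forall>z\<in>V. \<forall>i\<in>I. F i z (cnj z) ~= 0)"
  using assms(1,2)
proof (induction I rule: finite_induct)
  case empty thus ?case using U by auto
next
  case (insert i I)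
  then obtain V where V: "open V" "V ~= {}" "V \<subseteq> U" "\<forall>z\<in>V. \<forall>i\<in>I. F i z (cnj z) ~= 0" by auto
  have Fi: "hol2 (F i) (bidisc R)" "\<exists>z w. z \<in> ball 0 R \<and> w \<in> ball 0 R \<and> F i z w ~= 0" using insert.prems by auto
  have VR: "V \<subseteq> ball 0 R" using V U by auto
  have "\<exists>z\<in>V. F i z (cnj z) ~= 0"
    using polarization_at[OF Fi(1) V(1) VR V(2)] Fi(2) by blast
  then obtain z0 where z0: "z0 \<in> V" "F i z0 (cnj z0) ~= 0" by blast
  have cont: "continuous_on V (\<lambda>z. F i z (cnj z))"
  proof -
    have "continuous_on V (\<lambda>z. (\<lambda>q. F i (fst q) (snd q)) (z, cnj z))"
      by (rule continuous_on_compose2[OF hol2_continuous[OF Fi(1)]]) (use VR in \<open>auto intro!: continuous_intros\<close>)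
    thus ?thesis by simp
  qed
  define W where "W = {z \<in> V. F i z (cnj z) ~= 0}"
  have "open W" using continuous_open_preimage[OF cont V(1) open_Compl[OF closed_singleton[of 0]]] by (simp add: W_def vimage_def Int_def)
  thus ?case using z0 V by (intro exI[of _ W]) (auto simp: W_def)
qed

text \<open>Both sides are holomorphic in \<open>(z, w)\<close> and agree on the diagonal.\<close>

lemma hermitian_axis:
  assumes F: "hol2 F (bidisc R)" and real: "!!z. z \<in> ball 0 R ==> F z (cnj z) \<in> \<real>" and w: "z \<in> ball 0 R" "w \<in> ball 0 R"
  shows "F z w = cnj (F (cnj w) (cnj z))"
proof -
  have h: "hol2 (\<lambda>z w. cnj (F (cnj w) (cnj z))) (bidisc R)"
    unfolding hol2_def
  proof
    fix p :: "complex \<times> complex" assume p: "p \<in> bidisc R"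
    define p' where "p' = (cnj (snd p), cnj (fst p))"
    have "p' \<in> bidisc R" using p by (auto simp: p'_def)
    then obtain a b where ab: "((\<lambda>q. F (fst q) (snd q)) has_derivative (\<lambda>v. a * fst v + b * snd v)) (at p')"
      using F unfolding hol2_def by blast
    have 1: "((\<lambda>q::complex \<times> complex. (cnj (snd q), cnj (fst q))) has_derivative (\<lambda>v. (cnj (snd v), cnj (fst v)))) (at p)"
      by (intro has_derivative_Pair bounded_linear.has_derivative[OF bounded_linear_cnj] has_derivative_fst has_derivative_snd has_derivative_ident)
    from bounded_linear.has_derivative[OF bounded_linear_cnj has_derivative_compose[OF 1 ab[unfolded p'_def]]]
    have "((\<lambda>q. cnj (F (cnj (snd q)) (cnj (fst q)))) has_derivative (\<lambda>v. cnj b * fst v + cnj a * snd v)) (at p)"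
      by (simp add: algebra_simps)
    thus "\<exists>a b. ((\<lambda>q. cnj (F (cnj (snd q)) (cnj (fst q)))) has_derivative (\<lambda>v. a * fst v + b * snd v)) (at p)" by blast
  qed
  have "F z w - cnj (F (cnj w) (cnj z)) = 0"
    by (rule polarization[OF hol2_diff[OF F h] _ w]) (use real in \<open>simp add: Reals_cnj_iff\<close>)
  thus ?thesis by simp
qed

definition log_deriv :: "(complex => complex => complex) => complex => complex => complex" where
  "log_deriv g z w = deriv (g z) w / g z w"

lemma bi_series_inverse:
  assumes g: "hol2 g (bidisc r)" "r > 0" and nz: "!!z w. (z, w) \<in> bidisc r ==> g z w ~= 0"
  shows "bi_series g ~= 0" "bi_series (\<lambda>z w. inverse (g z w)) = inverse (bi_series g)"
proof -
  have inv: "hol2 (\<lambda>z w. inverse (g z w)) (bidisc r)" by (rule hol2_inverse[OF g(1)]) (use nz in auto)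
  have "bi_series (\<lambda>z w. g z w * inverse (g z w)) = bi_series (\<lambda>z w. 1)"
    by (rule bi_series_eqI[OF g(2)]) (use nz in auto)
  hence 1: "bi_series g * bi_series (\<lambda>z w. inverse (g z w)) = 1"
    by (simp add: bi_series_hol2(2)[OF g(1) inv g(2)] bi_series_const)
  thus nz': "bi_series g ~= 0" by auto
  show "bi_series (\<lambda>z w. inverse (g z w)) = inverse (bi_series g)"
    using 1 nz' by (metis inverse_unique)
qed

lemma biholo_log_deriv:
  assumes g: "hol2 g (bidisc r)" "r > 0" and nz: "!!z w. (z, w) \<in> bidisc r ==> g z w ~= 0"
  shows "biholo (log_deriv g) (r/2)" "bi_series (log_deriv g) = fls_deriv (bi_series g) / bi_series g"
proof -
  have inv: "hol2 (\<lambda>z w. inverse (g z w)) (bidisc r)" by (rule hol2_inverse[OF g(1)]) (use nz in auto)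
  have binv: "bi_series (\<lambda>z w. inverse (g z w)) = inverse (bi_series g)"
    by (rule bi_series_inverse(2)[OF g]) (use nz in auto)
  note b = hol2_biholo[OF g] hol2_biholo[OF inv g(2)]
  have eq: "log_deriv g = (\<lambda>z w. deriv (g z) w * inverse (g z w))"
    by (intro ext) (simp add: log_deriv_def divide_inverse)
  show "biholo (log_deriv g) (r/2)" unfolding eq
    by (rule biholo_ops(3)[OF biholo_ops(5)[OF b(1) b(1)] b(2)])
  show "bi_series (log_deriv g) = fls_deriv (bi_series g) / bi_series g" unfolding eq
    by (simp add: biholo_ops(4)[OF biholo_ops(5)[OF b(1) b(1)] b(2)] biholo_ops(6)[OF b(1) b(1)]
        binv divide_inverse)
qed

lemma biholo_lincomb:
  assumes "finite J" "!!j. j \<in> J ==> biholo (g j) r" "r > 0"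
  shows "biholo (\<lambda>z w. \<Sum>j\<in>J. c j * g j z w) r \<and>
    bi_series (\<lambda>z w. \<Sum>j\<in>J. c j * g j z w) = (\<Sum>j\<in>J. fls_const (fls_const (c j)) * bi_series (g j))"
  using assms(1,2)
proof (induction J rule: finite_induct)
  case empty
  show ?case using assms(3) by (auto simp: bi_series_0 biholo_def fps_expansion_of_const)
next
  case (insert j J)
  have c: "biholo (\<lambda>z w. c j) r" using assms(3) by (auto simp: biholo_def fps_expansion_of_const)
  have 1: "biholo (\<lambda>z w. c j * g j z w) r" "bi_series (\<lambda>z w. c j * g j z w) = fls_const (fls_const (c j)) * bi_series (g j)"
    using biholo_ops(3,4)[OF c, of "g j"] insert.prems by (auto simp: bi_series_const)
  have 2: "biholo (\<lambda>z w. \<Sum>j\<in>J. c j * g j z w) r"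
    "bi_series (\<lambda>z w. \<Sum>j\<in>J. c j * g j z w) = (\<Sum>j\<in>J. fls_const (fls_const (c j)) * bi_series (g j))"
    using insert by auto
  show ?case using insert.hyps biholo_ops(1,2)[OF 1(1) 2(1)] 1 2 by simp
qed

lemma bi_series_lincomb_log_deriv:
  assumes "finite J" "!!j. j \<in> J ==> hol2 (g j) (bidisc r) \<and> (\<forall>z w. (z, w) \<in> bidisc r --> g j z w ~= 0)" "r > 0"
  shows "biholo (\<lambda>z w. \<Sum>j\<in>J. c j * log_deriv (g j) z w) (r/2)"
    "bi_series (\<lambda>z w. \<Sum>j\<in>J. c j * log_deriv (g j) z w) =
       (\<Sum>j\<in>J. fls_const (fls_const (c j)) * (fls_deriv (bi_series (g j)) / bi_series (g j)))"
proof -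
  have *: "biholo (log_deriv (g j)) (r/2)" "bi_series (log_deriv (g j)) = fls_deriv (bi_series (g j)) / bi_series (g j)" if "j \<in> J" for j
    using biholo_log_deriv[of "g j" r] assms that by auto
  show "biholo (\<lambda>z w. \<Sum>j\<in>J. c j * log_deriv (g j) z w) (r/2)"
    using biholo_lincomb[OF assms(1), of "\<lambda>j. log_deriv (g j)" "r/2" c] * assms(3) by auto
  show "bi_series (\<lambda>z w. \<Sum>j\<in>J. c j * log_deriv (g j) z w) =
       (\<Sum>j\<in>J. fls_const (fls_const (c j)) * (fls_deriv (bi_series (g j)) / bi_series (g j)))"
    using biholo_lincomb[OF assms(1), of "\<lambda>j. log_deriv (g j)" "r/2" c] * assms(3) by auto
qed

definition const_poly :: "complex poly => complex fls fls poly" where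
  "const_poly P = map_poly (\<lambda>c. fls_const (fls_const c)) P"

lemma const_poly_mem: "const_poly P \<in> polys_over (fls_const ` const_field)"
  by (auto simp: const_poly_def polys_over_def coeff_map_poly const_field_def)

lemma bi_series_poly:
  assumes U: "hol2 U (bidisc r)" "r > 0"
  shows "bi_series (\<lambda>z w. poly P (U z w)) = poly (const_poly P) (bi_series U)"
proof (induction P)
  case (pCons a P)
  have "hol2 (\<lambda>z w. U z w * poly P (U z w)) (bidisc r)" by (intro hol2_mult hol2_poly U)
  from bi_series_hol2(1)[OF hol2_const this U(2)] bi_series_hol2(2)[OF U(1) hol2_poly[OF U(1)] U(2)]
  show ?case using pCons by (simp add: const_poly_def map_poly_pCons bi_series_const)
qed (simp add: const_poly_def bi_series_0)

text \<open>The analytic data near a point where no factor vanishes. The powers \<open>U\<close> and \<open>V\<close> of the products of the \<open>H j\<close> enter only through their logarithmic derivatives with respect to \<open>w\<close>.\<close>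

locale local_ratpow =
  fixes r :: real and J1 J2 J3 :: "nat set" and H h :: "nat => complex => complex => complex"
    and \<mu> \<nu> :: "nat => complex" and T U V :: "complex => complex => complex" and P Q :: "complex poly"
  assumes r: "r > 0" and fin: "finite J1" "finite J2" "finite J3"
    and H: "!!j. j \<in> J1 \<union> J2 ==> alg2 (H j) r" "!!j z w. j \<in> J1 \<union> J2 ==> (z, w) \<in> bidisc r ==> H j z w ~= 0"
    and h: "!!j. j \<in> J3 ==> alg2 (h j) r" "!!j z w. j \<in> J3 ==> (z, w) \<in> bidisc r ==> h j z w ~= 0"
    and TUV: "hol2 T (bidisc r)" "hol2 U (bidisc r)" "hol2 V (bidisc r)"
    and U0: "!!z w. (z, w) \<in> bidisc r ==> U z w ~= 0" and V0: "!!z w. (z, w) \<in> bidisc r ==> V z w ~= 0"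
    and QU0: "!!z w. (z, w) \<in> bidisc r ==> poly Q (U z w) ~= 0"
    and U': "!!z w. (z, w) \<in> bidisc r ==> log_deriv U z w = (\<Sum>j\<in>J1. \<mu> j * log_deriv (H j) z w)"
    and V': "!!z w. (z, w) \<in> bidisc r ==> log_deriv V z w = (\<Sum>j\<in>J2. \<mu> j * log_deriv (H j) z w)"
    and T: "!!z w. (z, w) \<in> bidisc r ==> T z w * poly Q (U z w) = poly P (U z w) * V z w"
begin

abbreviation "A \<equiv> separated_algebraic const_field"

abbreviation "C \<equiv> fls_const ` const_field"

abbreviation "dlog x \<equiv> fls_deriv x / x"

abbreviation "kk c \<equiv> fls_const (fls_const c)"

definition "t = bi_series T"

definition "uu = bi_series U"

definition "vv = bi_series V"

definition "u = (\<Sum>j\<in>J1. kk (\<mu> j) * dlog (bi_series (H j)))"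

definition "v = (\<Sum>j\<in>J2. kk (\<mu> j) * dlog (bi_series (H j)))"

definition "q = (\<Sum>j\<in>J3. kk (\<nu> j) * dlog (bi_series (h j)))"

definition "p1 = poly (const_poly P) uu"

definition "q1 = poly (const_poly Q) uu"

lemma A: "sub_field A" "!!x. algebraic_over A x ==> x \<in> A" "!!x. fls_deriv x = 0 ==> x \<in> A" "!!x. x \<in> A ==> fls_deriv x \<in> A"
  using separated_algebraic[OF sub_field_const_field] by auto

lemma Ar: "sub_ring A" using A(1) by (rule sub_fieldD)

lemma kkA: "kk c \<in> A"
  using separated_algebraic(5)[OF sub_field_const_field] by (auto simp: separated_series_def)

lemma sub_field_C: "sub_field C"
proof -
  have "inverse (fls_const c) = fls_const (inverse c)" for c :: "complex fls"
    using fls_const_divide_const[of 1 c] by (simp add: inverse_eq_divide)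
  thus ?thesis using sub_field_const_field unfolding sub_field_def sub_ring_def
    by (auto simp: fls_plus_const simp flip: fls_const_uminus)
qed

lemma nz: "j \<in> J1 \<union> J2 ==> bi_series (H j) ~= 0" "j \<in> J3 ==> bi_series (h j) ~= 0" "uu ~= 0" "vv ~= 0" "q1 ~= 0"
proof -
  show "j \<in> J1 \<union> J2 ==> bi_series (H j) ~= 0"
    using bi_series_inverse(1)[of "H j" r] H r unfolding alg2_def by blast
  show "j \<in> J3 ==> bi_series (h j) ~= 0"
    using bi_series_inverse(1)[of "h j" r] h r unfolding alg2_def by blast
  show "uu ~= 0" unfolding uu_def by (rule bi_series_inverse(1)[OF TUV(2) r U0])
  show "vv ~= 0" unfolding vv_def by (rule bi_series_inverse(1)[OF TUV(3) r V0])
  show "q1 ~= 0" unfolding q1_def uu_def bi_series_poly[OF TUV(2) r, symmetric]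
    by (rule bi_series_inverse(1)[OF hol2_poly[OF TUV(2)] r QU0])
qed

lemma HA: "j \<in> J1 \<union> J2 ==> bi_series (H j) \<in> A" "j \<in> J3 ==> bi_series (h j) \<in> A"
  using H(1) h(1) by (auto simp: alg2_def)

lemma dlogA: "x \<in> A ==> dlog x \<in> A" using A by (auto intro: sub_fieldD)

lemma uvq: "u \<in> A" "v \<in> A" "q \<in> A"
  unfolding u_def v_def q_def using HA kkA
  by (auto intro!: sub_ring_sum[OF Ar] sub_ringD(4)[OF Ar] dlogA simp del: times_divide_eq_right)

lemma uu': "fls_deriv uu = u * uu"
proof -
  have "bi_series (log_deriv U) = bi_series (\<lambda>z w. \<Sum>j\<in>J1. \<mu> j * log_deriv (H j) z w)"
    by (rule bi_series_eqI[OF r]) (use U' in auto)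
  also have "\<dots> = u" unfolding u_def
    by (rule bi_series_lincomb_log_deriv(2)[OF fin(1) _ r]) (use H in \<open>auto simp: alg2_def\<close>)
  finally have "fls_deriv uu / uu = u" unfolding uu_def using biholo_log_deriv(2)[OF TUV(2) r U0] by simp
  thus ?thesis using nz by (simp add: field_simps)
qed

lemma vv': "fls_deriv vv = v * vv"
proof -
  have "bi_series (log_deriv V) = bi_series (\<lambda>z w. \<Sum>j\<in>J2. \<mu> j * log_deriv (H j) z w)"
    by (rule bi_series_eqI[OF r]) (use V' in auto)
  also have "\<dots> = v" unfolding v_def
    by (rule bi_series_lincomb_log_deriv(2)[OF fin(2) _ r]) (use H in \<open>auto simp: alg2_def\<close>)
  finally have "fls_deriv vv / vv = v" unfolding vv_def using biholo_log_deriv(2)[OF TUV(3) r V0] by simp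
  thus ?thesis using nz by (simp add: field_simps)
qed

lemma t_eq: "t * q1 = p1 * vv"
proof -
  have "bi_series (\<lambda>z w. T z w * poly Q (U z w)) = bi_series (\<lambda>z w. poly P (U z w) * V z w)"
    by (rule bi_series_eqI[OF r]) (use T in auto)
  thus ?thesis
    using bi_series_hol2(2)[OF TUV(1) hol2_poly[OF TUV(2)] r] bi_series_hol2(2)[OF hol2_poly[OF TUV(2)] TUV(3) r]
    by (simp add: t_def q1_def p1_def uu_def vv_def bi_series_poly[OF TUV(2) r])
qed

lemma der_const_poly: "fls_deriv (poly (const_poly N) uu) = poly (pderiv (const_poly N)) uu * (u * uu)"
proof -
  have "fls_deriv c = 0" if "c \<in> C" for c using that by auto
  from derivation_poly_const[OF derivation_fls_deriv const_poly_mem this, of N uu] uu' show ?thesis by simp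
qed

definition Lpq where "Lpq = pCons 0 (pderiv (const_poly P) * const_poly Q - const_poly P * pderiv (const_poly Q))"

lemma t_deriv: "fls_deriv t * (p1 * q1) = t * (u * poly Lpq uu + v * (p1 * q1))"
proof -
  have p': "fls_deriv p1 = poly (pderiv (const_poly P)) uu * (u * uu)"
    and q': "fls_deriv q1 = poly (pderiv (const_poly Q)) uu * (u * uu)"
    unfolding p1_def q1_def by (rule der_const_poly)+
  have "fls_deriv (t * q1) = fls_deriv (p1 * vv)" by (simp add: t_eq)
  hence "fls_deriv t * q1 = fls_deriv p1 * vv + p1 * (v * vv) - t * fls_deriv q1"
    using vv' by (simp add: algebra_simps)
  hence "p1 * (fls_deriv t * q1) = p1 * (fls_deriv p1 * vv + p1 * (v * vv) - t * fls_deriv q1)" by simp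
  hence "fls_deriv t * (p1 * q1) = fls_deriv p1 * (p1 * vv) + p1 * v * (p1 * vv) - t * p1 * fls_deriv q1"
    by (simp add: algebra_simps)
  also have "\<dots> = t * (fls_deriv p1 * q1 + p1 * v * q1 - p1 * fls_deriv q1)"
    unfolding t_eq[symmetric] by (simp add: algebra_simps)
  also have "\<dots> = t * (u * poly Lpq uu + v * (p1 * q1))"
    unfolding p' q' by (simp add: Lpq_def p1_def q1_def algebra_simps)
  finally show ?thesis .
qed

text \<open>The situation of a power product \<open>U\<close> of elements of \<open>A\<close>: its logarithmic derivative \<open>u\<close> is in \<open>A\<close>, but \<open>U\<close> itself is not, hence it is transcendental over the algebraically closed \<open>A\<close>.\<close>

lemma hyperexponential: "uu \<notin> A ==> hyperexponential fls_deriv A C uu u"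
  by unfold_locales (use A sub_field_C uu' uvq derivation_fls_deriv in auto)

lemma fls_deriv_eq_nth: "fls_deriv x = fls_deriv y ==> n ~= 0 ==> fls_nth x n = fls_nth (y::complex fls fls) n"
proof -
  assume "fls_deriv x = fls_deriv y" "n ~= 0"
  hence "fls_nth (fls_deriv x) (n - 1) = fls_nth (fls_deriv y) (n - 1)" by simp
  thus ?thesis using \<open>n ~= 0\<close> by simp
qed

text \<open>\<open>log_derivative_identity\<close> makes all coefficients of positive powers of \<open>w\<close> algebraic over the constants, hence constant.\<close>

lemma separated_if_log_derivative:
  fixes g :: "'i => complex fls fls"
  assumes F: "hol2 F (bidisc r)" and c: "c \<in> A" "fls_deriv (bi_series F) = fls_deriv c" and J: "finite J"
    and g: "!!j. j \<in> J ==> g j ~= 0 \<and> g j \<in> A" and eq: "fls_deriv c = (\<Sum>j\<in>J. kk (\<alpha> j) * dlog (g j))"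
    and zw: "z \<in> ball 0 (r/2)" "w \<in> ball 0 (r/2)"
  shows "F z w = F z 0 + F 0 w - F 0 0"
proof (rule bi_series_separated[OF hol2_biholo[OF F r] _ zw])
  fix n :: int assume n: "n > 0"
  have "algebraic_over const_field (fls_nth c n)"
    by (rule log_derivative_identity[OF sub_field_const_field J _ _ eq])
      (use c g n in \<open>auto simp: separated_algebraic_def const_field_def\<close>)
  hence "fls_nth c n \<in> const_field" by (rule const_field_algebraically_closed)
  thus "fls_nth (bi_series F) n \<in> const_field" using fls_deriv_eq_nth[OF c(2), of n] n by simp
qed

lemma UA_mem: "uu \<in> A ==> p1 \<in> A \<and> q1 \<in> A \<and> poly Lpq uu \<in> A"
proof -
  assume uA: "uu \<in> A"
  have "C \<subseteq> A" using kkA by (auto simp: const_field_def)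
  hence cA: "const_poly N \<in> polys_over A" for N using const_poly_mem polys_over_mono by blast
  have "Lpq \<in> polys_over A" unfolding Lpq_def
    by (intro polys_over_ring[OF Ar] sub_ringD(1)[OF Ar] cA)
  thus ?thesis unfolding p1_def q1_def using cA uA by (auto intro!: poly_mem[OF Ar])
qed

text \<open>Case \<open>exp T = \<Prod>h\<^sub>j\<^sup>\<nu>\<^sup>j\<close>: the derivative of \<open>T\<close> is in \<open>A\<close>, and there is \<open>c\<close> in \<open>A\<close> with the same derivative, to which the core statement applies.\<close>

theorem exp_local:
  assumes T': "!!z w. (z, w) \<in> bidisc r ==> deriv (T z) w = (\<Sum>j\<in>J3. \<nu> j * log_deriv (h j) z w)"
    and zw: "z \<in> ball 0 (r/2)" "w \<in> ball 0 (r/2)"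
  shows "T z w = T z 0 + T 0 w - T 0 0"
proof -
  have t': "fls_deriv t = q"
  proof -
    have "bi_series (\<lambda>z. deriv (T z)) = bi_series (\<lambda>z w. \<Sum>j\<in>J3. \<nu> j * log_deriv (h j) z w)"
      by (rule bi_series_eqI[OF r]) (use T' in auto)
    also have "\<dots> = q" unfolding q_def
      by (rule bi_series_lincomb_log_deriv(2)[OF fin(3) _ r]) (use h in \<open>auto simp: alg2_def\<close>)
    finally show ?thesis unfolding t_def using bi_series_hol2(3)[OF TUV(1) TUV(1) r] by simp
  qed
  have "\<exists>c\<in>A. fls_deriv c = q"
  proof (cases "q = 0 \<or> t = 0")
    case True
    hence "q = 0" using t' by auto
    thus ?thesis using sub_ringD(1)[OF Ar] by (intro bexI[of _ 0]) auto
  next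
    case False
    hence p1: "p1 ~= 0" using t_eq nz by auto
    show ?thesis
    proof (cases "uu \<in> A")
      case True
      note m = UA_mem[OF True]
      define D where "D = u * poly Lpq uu + v * (p1 * q1)"
      have eq: "q * (p1 * q1) = t * D" using t_deriv t' by (simp add: D_def)
      have "D ~= 0" using eq False p1 nz by auto
      hence "t = q * (p1 * q1) / D" using eq by simp
      moreover have "q * (p1 * q1) / D \<in> A" unfolding D_def using m uvq
        by (intro sub_fieldD(3)[OF A(1)] sub_ringD(3,4)[OF Ar]) auto
      ultimately show ?thesis using t' by auto
    next
      case uA: False
      interpret HX: hyperexponential fls_deriv A C uu u by (rule hyperexponential[OF uA])
      show ?thesis
        by (rule HX.integral_descends[where P = "const_poly P" and Q = "const_poly Q" and T = t and v = v])
          (use False p1 nz uvq t' t_deriv const_poly_mem in \<open>auto simp: p1_def q1_def HX.Lnum_def Lpq_def\<close>)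
    qed
  qed
  then obtain c where c: "c \<in> A" "fls_deriv c = q" by blast
  show ?thesis
    by (rule separated_if_log_derivative[OF TUV(1) c(1) _ fin(3), where g = "\<lambda>j. bi_series (h j)" and \<alpha> = \<nu>, OF _ _ _ zw])
      (use t' c nz HA in \<open>auto simp: t_def q_def\<close>)
qed

text \<open>Case \<open>y = log T = \<Prod>h\<^sub>j\<^sup>\<nu>\<^sup>j\<close>: \<open>y\<close> is shown to be in \<open>A\<close>, and its derivative is a combination of logarithmic derivatives, of \<open>P(U)\<close>, \<open>Q(U)\<close> and the \<open>H j\<close> if \<open>U\<close> is in \<open>A\<close>, and of the \<open>H j\<close> alone otherwise.\<close>

theorem log_local:
  assumes y: "hol2 y (bidisc r)" and yT: "!!z w. (z, w) \<in> bidisc r ==> exp (y z w) = T z w"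
    and y': "!!z w. (z, w) \<in> bidisc r ==> deriv (y z) w = (\<Sum>j\<in>J3. \<nu> j * log_deriv (h j) z w) * y z w"
    and zw: "z \<in> ball 0 (r/2)" "w \<in> ball 0 (r/2)"
  shows "y z w = y z 0 + y 0 w - y 0 0"
proof -
  define Y where "Y = bi_series y"
  have Y': "fls_deriv Y = q * Y"
  proof -
    have b: "biholo (\<lambda>z w. \<Sum>j\<in>J3. \<nu> j * log_deriv (h j) z w) (r/2)" "bi_series (\<lambda>z w. \<Sum>j\<in>J3. \<nu> j * log_deriv (h j) z w) = q"
      unfolding q_def by (rule bi_series_lincomb_log_deriv[OF fin(3) _ r]; use h in \<open>auto simp: alg2_def\<close>)+
    have "bi_series (\<lambda>z. deriv (y z)) = bi_series (\<lambda>z w. (\<Sum>j\<in>J3. \<nu> j * log_deriv (h j) z w) * y z w)"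
      by (rule bi_series_eqI[OF r]) (use y' in auto)
    also have "\<dots> = q * Y" unfolding Y_def using biholo_ops(4)[OF b(1) hol2_biholo[OF y r]] b(2) by simp
    finally show ?thesis unfolding Y_def using bi_series_hol2(3)[OF y y r] by simp
  qed
  have T0: "T z w ~= 0" if "(z, w) \<in> bidisc r" for z w using yT[OF that] by auto
  have t0: "t ~= 0" unfolding t_def by (rule bi_series_inverse(1)[OF TUV(1) r T0])
  hence p1: "p1 ~= 0" using t_eq nz by auto
  have Yt: "fls_deriv Y * t = fls_deriv t"
  proof -
    have "deriv (T z) w = deriv (y z) w * T z w" if zw: "cmod z < r" "cmod w < r" for z w
    proof -
      have hol: "y z holomorphic_on ball 0 r" using hol2_slice(1)[OF y, of z] zw by auto
      have "((\<lambda>w. exp (y z w)) has_field_derivative exp (y z w) * deriv (y z) w) (at w)"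
        using holomorphic_derivI[OF hol, of w] zw by (auto intro!: DERIV_chain2[OF DERIV_exp])
      hence "(T z has_field_derivative exp (y z w) * deriv (y z) w) (at w)"
        by (rule has_field_derivative_transform_within_open[where S = "ball 0 r"]) (use zw yT in auto)
      thus ?thesis using yT[of z w] zw by (simp add: DERIV_imp_deriv mult.commute)
    qed
    hence "bi_series (\<lambda>z. deriv (T z)) = bi_series (\<lambda>z w. deriv (y z) w * T z w)"
      by (intro bi_series_eqI[OF r]) auto
    also have "\<dots> = bi_series (\<lambda>z. deriv (y z)) * t" unfolding t_def
      using biholo_ops(4)[OF biholo_ops(5)[OF hol2_biholo[OF y r] hol2_biholo[OF y r]] hol2_biholo[OF TUV(1) r]] by simp
    finally show ?thesis unfolding Y_def t_def bi_series_hol2(3)[OF y y r] bi_series_hol2(3)[OF TUV(1) TUV(1) r] by simp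
  qed
  have Yeq: "fls_deriv Y * (p1 * q1) = u * poly Lpq uu + v * (p1 * q1)"
  proof -
    have "t * (fls_deriv Y * (p1 * q1)) = t * (u * poly Lpq uu + v * (p1 * q1))"
      using t_deriv unfolding Yt[symmetric] by (simp add: algebra_simps)
    thus ?thesis using t0 by simp
  qed
  show ?thesis
  proof (cases "fls_deriv Y = 0")
    case True
    show ?thesis
      by (rule separated_if_log_derivative[OF y, where c = 0 and J = "{} :: nat set" and g = "\<lambda>_. 0", OF _ _ _ _ _ zw])
        (use True sub_ringD(1)[OF Ar] in \<open>auto simp: Y_def\<close>)
  next
    case False
    hence q0: "q ~= 0" "Y ~= 0" using Y' by auto
    show ?thesis
    proof (cases "uu \<in> A")
      case True
      note m = UA_mem[OF True]
      have e: "fls_deriv Y = (u * poly Lpq uu + v * (p1 * q1)) / (p1 * q1)"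
        using Yeq p1 nz by (simp add: field_simps)
      have "fls_deriv Y \<in> A" unfolding e using m uvq
        by (intro sub_fieldD(3)[OF A(1)] sub_ringD(3,4)[OF Ar]) auto
      moreover have "Y = fls_deriv Y / q" using Y' q0 by simp
      ultimately have YA: "Y \<in> A" using uvq by (metis sub_fieldD(3)[OF A(1)])
      define g where "g i = (case i of Inl j => bi_series (H j) | Inr b => if b then p1 else q1)" for i :: "nat + bool"
      define \<alpha> where "\<alpha> i = (case i of Inl j => \<mu> j | Inr b => if b then 1 else -1)" for i :: "nat + bool"
      have pq: "dlog p1 - dlog q1 = u * poly Lpq uu / (p1 * q1)"
      proof -
        have p': "fls_deriv p1 = poly (pderiv (const_poly P)) uu * (u * uu)"
          and q': "fls_deriv q1 = poly (pderiv (const_poly Q)) uu * (u * uu)"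
          unfolding p1_def q1_def by (rule der_const_poly)+
        have "dlog p1 - dlog q1 = (fls_deriv p1 * q1 - p1 * fls_deriv q1) / (p1 * q1)"
          using p1 nz by (simp add: field_simps)
        thus ?thesis unfolding p' q' by (simp add: Lpq_def p1_def q1_def algebra_simps)
      qed
      have "fls_deriv Y = dlog p1 - dlog q1 + v" unfolding pq e using p1 nz by (simp add: add_divide_distrib)
      also have "\<dots> = (\<Sum>i\<in>J2 <+> UNIV. kk (\<alpha> i) * dlog (g i))"
        unfolding v_def by (subst sum.Plus) (use fin in \<open>auto simp: UNIV_bool \<alpha>_def g_def simp del: times_divide_eq_right\<close>)
      finally have eq: "fls_deriv Y = (\<Sum>i\<in>J2 <+> UNIV. kk (\<alpha> i) * dlog (g i))" .
      show ?thesis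
        by (rule separated_if_log_derivative[OF y YA _ _ _ eq zw])
          (use m p1 nz HA fin in \<open>auto simp: Y_def g_def split: sum.splits\<close>)
    next
      case uA: False
      interpret HX: hyperexponential fls_deriv A C uu u by (rule hyperexponential[OF uA])
      have "Y \<in> A \<and> (\<exists>l\<in>C. fls_deriv Y = l * u + v)"
        by (rule HX.hyperexponential_descends[where P = "const_poly P" and Q = "const_poly Q" and q = q])
          (use q0 p1 nz uvq Y' Yeq const_poly_mem in \<open>auto simp: p1_def q1_def HX.Lnum_def Lpq_def\<close>)
      then obtain l where l: "Y \<in> A" "fls_deriv Y = kk l * u + v" by (auto simp: const_field_def)
      define g where "g i = (case i of Inl j => bi_series (H j) | Inr j => bi_series (H j))" for i :: "nat + nat"
      define \<alpha> where "\<alpha> i = (case i of Inl j => l * \<mu> j | Inr j => \<mu> j)" for i :: "nat + nat"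
      have eq: "fls_deriv Y = (\<Sum>i\<in>J1 <+> J2. kk (\<alpha> i) * dlog (g i))"
        unfolding l(2) u_def v_def
        by (subst sum.Plus) (use fin in \<open>auto simp: \<alpha>_def g_def sum_distrib_left mult.assoc simp flip: fls_const_mult_const simp del: times_divide_eq_right\<close>)
      show ?thesis
        by (rule separated_if_log_derivative[OF y l(1) _ _ _ eq zw])
          (use nz HA fin in \<open>auto simp: Y_def g_def split: sum.splits\<close>)
    qed
  qed
qed

end

section \<open>Real powers on the diagonal and separation of variables\<close>

abbreviation dv :: "(complex => complex => complex) => complex => real" where
  "dv F z \<equiv> Re (F z (cnj z))"

text \<open>For an integral exponent any logarithm of \<open>x\<close> will do, which covers negative \<open>x\<close>; otherwise \<open>x > 0\<close> and the real logarithm is required.\<close>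

lemma real_power_exp:
  assumes "power_defined x \<nu>" "exp l = complex_of_real x" "x > 0 ==> l = of_real (ln x)"
  shows "complex_of_real (real_power x \<nu>) = exp (of_real \<nu> * l)"
proof (cases "\<nu> \<in> \<int>")
  case True
  then obtain n where n: "\<nu> = of_int n" by (auto elim: Ints_cases)
  have "complex_of_real (real_power x \<nu>) = complex_of_real x powi n" by (simp add: real_power_def n)
  also have "\<dots> = exp (of_int n * l)" unfolding assms(2)[symmetric] by (rule exp_power_int)
  finally show ?thesis by (simp add: n)
next
  case False
  have "x ~= 0" using assms(2) exp_not_eq_zero[of l] by auto
  hence "x > 0" using assms(1) False by (auto simp: power_defined_def)
  thus ?thesis using assms(3) False by (simp add: real_power_def powr_def exp_of_real[symmetric])
qed

lemma real_power_0: "\<nu> ~= 0 ==> real_power 0 \<nu> = 0"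
  by (auto simp: real_power_def power_int_def elim!: Ints_cases)

lemma real_power_exponent_0: "real_power x 0 = 1"
  by (simp add: real_power_def)

definition real_diag :: "(complex => complex => complex) => real => bool" where
  "real_diag F r \<longleftrightarrow> (\<forall>z\<in>ball 0 r. F z (cnj z) \<in> \<real>)"

lemma real_diagD: "real_diag F r ==> z \<in> ball 0 r ==> F z (cnj z) = of_real (dv F z)"
  by (simp add: real_diag_def)

text \<open>A holomorphic logarithm that is real on the diagonal wherever \<open>F\<close> is positive there, as \<open>real_power_exp\<close> requires.\<close>

definition diag_log :: "(complex => complex => complex) => (complex => complex => complex) => real => bool" where
  "diag_log L F r \<longleftrightarrow> hol2 L (bidisc r) \<and> (\<forall>z\<in>ball 0 r. \<forall>w\<in>ball 0 r. exp (L z w) = F z w) \<and>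
     (\<forall>z\<in>ball 0 r. dv F z > 0 --> L z (cnj z) = of_real (ln (dv F z)))"

text \<open>Division by the value at the origin moves \<open>F\<close> into the right half plane, where \<open>Ln\<close> is holomorphic. The value depends on \<open>F z w\<close> only, so that it inherits \<open>F z 0 = F 0 0\<close>.\<close>

definition loc_log :: "(complex => complex => complex) => complex => complex => complex" where
  "loc_log F z w = Ln (F z w / F 0 0) + Ln (F 0 0)"

lemma diag_log_loc_log:
  assumes F: "hol2 F (bidisc r)" "real_diag F r" "F 0 0 ~= 0" and r: "r > 0"
    and pos: "!!z w. z \<in> ball 0 r ==> w \<in> ball 0 r ==> Re (F z w / F 0 0) > 0"
  shows "diag_log (loc_log F) F r"
  unfolding diag_log_def
proof (intro conjI ballI impI)
  have "hol2 (\<lambda>z w. Ln (F z w / F 0 0)) (bidisc r)"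
    by (rule hol2_comp[where T = "- \<real>\<^sub>\<le>\<^sub>0"])
      (use F pos in \<open>auto intro!: hol2_divide hol2_const holomorphic_intros simp: complex_nonpos_Reals_iff not_le open_Compl closed_nonpos_Reals_complex\<close>)
  thus "hol2 (loc_log F) (bidisc r)" unfolding loc_log_def by (intro hol2_add hol2_const)
  show "exp (loc_log F z w) = F z w" if "z \<in> ball 0 r" "w \<in> ball 0 r" for z w
  proof -
    have "F z w ~= 0" using pos[OF that] by auto
    thus ?thesis using F(3) by (simp add: loc_log_def exp_add)
  qed
  fix z assume z: "z \<in> ball 0 r" "dv F z > 0"
  have 0: "F 0 0 = of_real (dv F 0)" using real_diagD[OF F(2), of 0] r by simp
  have Fz: "F z (cnj z) = of_real (dv F z)" using real_diagD[OF F(2)] z by simp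
  have "Re (F z (cnj z) / F 0 0) = dv F z / dv F 0" by (subst Fz, subst 0) (simp flip: of_real_divide)
  hence y: "dv F 0 > 0" using pos[of z "cnj z"] z by (auto simp: zero_less_divide_iff)
  have "loc_log F z (cnj z) = Ln (of_real (dv F z / dv F 0)) + Ln (of_real (dv F 0))"
    unfolding loc_log_def by (subst Fz, subst (1 2) 0) simp
  also have "\<dots> = of_real (ln (dv F z / dv F 0) + ln (dv F 0))"
    using z y by (simp only: Ln_of_real divide_pos_pos of_real_add)
  also have "\<dots> = of_real (ln (dv F z))" using z y by (simp add: ln_div)
  finally show "loc_log F z (cnj z) = of_real (ln (dv F z))" .
qed

lemma bidisc_in_open:
  assumes "open S" "(0, 0) \<in> S" shows "\<exists>\<rho>>0. bidisc \<rho> \<subseteq> S"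
proof -
  obtain A B where AB: "open A" "open B" "(0, 0) \<in> A \<times> B" "A \<times> B \<subseteq> S" using assms by (rule open_prod_elim)
  then obtain a b where "a > 0" "b > 0" "ball 0 a \<subseteq> A" "ball 0 b \<subseteq> B"
    using open_contains_ball by (metis mem_Sigma_iff)
  thus ?thesis using AB by (intro exI[of _ "min a b"]) fastforce
qed

lemma uniform_radius:
  assumes "finite I" "!!i. i \<in> I ==> \<exists>\<rho>>0. P i \<rho>" "!!i \<rho> \<rho>'. i \<in> I ==> P i \<rho> ==> 0 < \<rho>' ==> \<rho>' \<le> \<rho> ==> P i \<rho>'"
  shows "\<exists>\<rho>>0::real. \<forall>i\<in>I. P i \<rho>"
  using assms
proof (induction I rule: finite_induct)
  case empty thus ?case by (auto intro: exI[of _ 1])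
next
  case (insert i I)
  obtain a where a: "a > 0" "P i a" using insert.prems(1) by blast
  have "\<exists>\<rho>>0. \<forall>i\<in>I. P i \<rho>"
    by (rule insert.IH) (use insert.prems(1) in blast, rule insert.prems(2), auto)
  then obtain b where b: "b > 0" "\<forall>i\<in>I. P i b" by blast
  have "P k (min a b)" if "k \<in> insert i I" for k
  proof (cases "k = i")
    case True thus ?thesis using insert.prems(2)[of i a "min a b"] a b by auto
  next
    case False thus ?thesis using insert.prems(2)[of k b "min a b"] that a b by auto
  qed
  thus ?case using a b by (intro exI[of _ "min a b"]) auto
qed

lemma open_hol2_preimage:
  assumes "hol2 F (bidisc r)" "open T" shows "open {p \<in> bidisc r. F (fst p) (snd p) \<in> T}"
  using continuous_open_preimage[OF hol2_continuous[OF assms(1)] _ assms(2)]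
  by (simp add: vimage_def Int_def open_Times)

lemma positive_bidisc:
  assumes "finite J" "!!j. j \<in> J ==> hol2 (F j) (bidisc r) \<and> F j 0 0 ~= 0" "r > 0"
  shows "\<exists>\<rho>>0. \<rho> \<le> r \<and> (\<forall>j\<in>J. \<forall>z\<in>ball 0 \<rho>. \<forall>w\<in>ball 0 \<rho>. Re (F j z w / F j 0 0) > 0)"
proof -
  have "\<exists>\<rho>>0. \<forall>j\<in>J. \<forall>z\<in>ball 0 \<rho>. \<forall>w\<in>ball 0 \<rho>. Re (F j z w / F j 0 0) > 0"
  proof (rule uniform_radius[OF assms(1)])
    fix j assume j: "j \<in> J"
    have h: "hol2 (\<lambda>z w. F j z w / F j 0 0) (bidisc r)" using assms(2)[OF j] by (auto intro!: hol2_divide hol2_const)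
    have "open {p \<in> bidisc r. F j (fst p) (snd p) / F j 0 0 \<in> {u. Re u > 0}}"
      by (rule open_hol2_preimage[OF h open_halfspace_Re_gt])
    from bidisc_in_open[OF this] show "\<exists>\<rho>>0. \<forall>z\<in>ball 0 \<rho>. \<forall>w\<in>ball 0 \<rho>. Re (F j z w / F j 0 0) > 0"
      using assms(2)[OF j] assms(3) by fastforce
  qed auto
  then obtain \<rho> where "\<rho> > 0" "\<forall>j\<in>J. \<forall>z\<in>ball 0 \<rho>. \<forall>w\<in>ball 0 \<rho>. Re (F j z w / F j 0 0) > 0" by blast
  thus ?thesis using assms(3) by (intro exI[of _ "min \<rho> r"]) auto
qed

lemma diag_log_deriv:
  assumes L: "diag_log L F r" and zw: "z \<in> ball 0 r" "w \<in> ball 0 r"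
  shows "(L z has_field_derivative log_deriv F z w) (at w)"
proof -
  have hol: "L z holomorphic_on ball 0 r" using hol2_slice(1)[of L "ball 0 r" "ball 0 r" z] L zw by (auto simp: diag_log_def)
  have d: "(L z has_field_derivative deriv (L z) w) (at w)" using holomorphic_derivI[OF hol _ zw(2)] by simp
  have "((\<lambda>w. exp (L z w)) has_field_derivative exp (L z w) * deriv (L z) w) (at w)"
    by (rule DERIV_chain2[OF DERIV_exp d])
  hence "(F z has_field_derivative exp (L z w) * deriv (L z) w) (at w)"
    by (rule has_field_derivative_transform_within_open[where S = "ball 0 r"]) (use zw L in \<open>auto simp: diag_log_def\<close>)
  hence "deriv (F z) w = F z w * deriv (L z) w" using L zw by (simp add: DERIV_imp_deriv diag_log_def)
  moreover have "F z w ~= 0" using L zw by (metis diag_log_def exp_not_eq_zero)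
  ultimately show ?thesis using d by (simp add: log_deriv_def)
qed

definition upow :: "'i set => ('i => complex => complex => complex) => ('i => real) => complex => real" where
  "upow J F \<mu> z = (\<Prod>j\<in>J. real_power (dv (F j) z) (\<mu> j))"

text \<open>The holomorphic extension of the power product \<open>upow\<close> off the diagonal.\<close>

definition pexp :: "'i set => ('i => complex => complex => complex) => ('i => real) => complex => complex => complex" where
  "pexp J L \<mu> z w = (\<Prod>j\<in>J. exp (of_real (\<mu> j) * L j z w))"

text \<open>The holomorphic extension of the power product \<open>upow\<close> off the diagonal.\<close>

lemma pexp:
  assumes J: "finite J" "!!j. j \<in> J ==> diag_log (L j) (F j) r"
  shows "hol2 (pexp J L \<mu>) (bidisc r)" "pexp J L \<mu> z w ~= 0"
    "z \<in> ball 0 r ==> w \<in> ball 0 r ==> log_deriv (pexp J L \<mu>) z w = (\<Sum>j\<in>J. of_real (\<mu> j) * log_deriv (F j) z w)"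
    "z \<in> ball 0 r ==> (!!j. j \<in> J ==> real_diag (F j) r \<and> power_defined (dv (F j) z) (\<mu> j)) ==>
      pexp J L \<mu> z (cnj z) = of_real (upow J F \<mu> z)"
proof -
  show "hol2 (pexp J L \<mu>) (bidisc r)" unfolding pexp_def
    using J by (intro hol2_prod hol2_exp hol2_mult hol2_const) (auto simp: diag_log_def)
  show nz: "pexp J L \<mu> z w ~= 0" for z w using J by (simp add: pexp_def)
  have eq: "pexp J L \<mu> z = (\<lambda>w. exp (\<Sum>j\<in>J. of_real (\<mu> j) * L j z w))" for z
    using J by (simp add: pexp_def exp_sum fun_eq_iff)
  show "log_deriv (pexp J L \<mu>) z w = (\<Sum>j\<in>J. of_real (\<mu> j) * log_deriv (F j) z w)" if "z \<in> ball 0 r" "w \<in> ball 0 r"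
  proof -
    have "((\<lambda>w. \<Sum>j\<in>J. of_real (\<mu> j) * L j z w) has_field_derivative (\<Sum>j\<in>J. of_real (\<mu> j) * log_deriv (F j) z w)) (at w)"
      by (intro DERIV_sum DERIV_cmult diag_log_deriv[OF J(2) that])
    from DERIV_chain2[OF DERIV_exp this]
    have "deriv (pexp J L \<mu> z) w = pexp J L \<mu> z w * (\<Sum>j\<in>J. of_real (\<mu> j) * log_deriv (F j) z w)"
      unfolding eq by (rule DERIV_imp_deriv)
    thus ?thesis using nz[of z w] by (simp add: log_deriv_def)
  qed
  assume z: "z \<in> ball 0 r" and F: "!!j. j \<in> J ==> real_diag (F j) r \<and> power_defined (dv (F j) z) (\<mu> j)"
  have "complex_of_real (real_power (dv (F j) z) (\<mu> j)) = exp (of_real (\<mu> j) * L j z (cnj z))" if "j \<in> J" for j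
    by (rule real_power_exp) (use F[OF that] J(2)[OF that] z real_diagD[of "F j" r z] in \<open>auto simp: diag_log_def\<close>)
  thus "pexp J L \<mu> z (cnj z) = of_real (upow J F \<mu> z)" by (simp add: pexp_def upow_def)
qed

definition ratp where
  "ratp P Q J1 J2 H \<mu> z = poly P (upow J1 H \<mu> z) / poly Q (upow J1 H \<mu> z) * upow J2 H \<mu> z"

definition pdata where
  "pdata J F \<mu> R \<longleftrightarrow> finite J \<and> (\<forall>j\<in>J. hol2 (F j) (bidisc R) \<and> real_diag (F j) R \<and>
     (\<forall>z\<in>ball 0 R. power_defined (dv (F j) z) (\<mu> j)))"

abbreviation "cpoly P \<equiv> map_poly complex_of_real P"

lemma poly_of_real: "poly (cpoly P) (of_real x) = of_real (poly P x)"
  by (induction P) (simp_all add: map_poly_pCons)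

lemma alg2_mono: "alg2 F r ==> s \<le> r ==> alg2 F s"
  unfolding alg2_def by (auto intro: hol2_subset)

lemma pdata_diag_log:
  assumes J: "pdata J F \<mu> r" and nz: "!!j. j \<in> J ==> F j 0 0 ~= 0" and r: "r > 0"
  shows "\<exists>\<rho>>0. \<rho> \<le> r \<and> (\<forall>j\<in>J. diag_log (loc_log (F j)) (F j) \<rho>)"
proof -
  obtain \<rho> where \<rho>: "\<rho> > 0" "\<rho> \<le> r" "\<forall>j\<in>J. \<forall>z\<in>ball 0 \<rho>. \<forall>w\<in>ball 0 \<rho>. Re (F j z w / F j 0 0) > 0"
    using positive_bidisc[of J F r] J nz r unfolding pdata_def by blast
  have sub: "bidisc \<rho> \<subseteq> bidisc r" using \<rho> by auto
  have "diag_log (loc_log (F j)) (F j) \<rho>" if "j \<in> J" for j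
    by (rule diag_log_loc_log) (use that J nz[OF that] \<rho> in \<open>auto simp: pdata_def real_diag_def intro: hol2_subset[OF _ sub]\<close>)
  thus ?thesis using \<rho> by blast
qed

lemma diag_log_mono: "diag_log L F r ==> s \<le> r ==> diag_log L F s"
  unfolding diag_log_def by (auto intro: hol2_subset)

lemma pdata_mono: "pdata J F \<mu> r ==> s \<le> r ==> pdata J F \<mu> s"
  unfolding pdata_def real_diag_def by (auto intro: hol2_subset)

text \<open>The function \<open>W\<close> extends \<open>T\<close> in the first alternative and \<open>log T\<close> in the second. All relations are transferred from the diagonal by polarization.\<close>

lemma separated_near_centre:
  fixes J1 J2 J3 :: "nat set"
  assumes r: "r > 0" and J: "pdata J1 H \<mu> r" "pdata J2 H \<mu> r" "pdata J3 h \<nu> r"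
    and alg: "!!j. j \<in> J1 \<union> J2 ==> alg2 (H j) r \<and> H j 0 0 ~= 0" "!!j. j \<in> J3 ==> alg2 (h j) r \<and> h j 0 0 ~= 0"
    and Q: "!!z. z \<in> ball 0 r ==> poly Q (upow J1 H \<mu> z) ~= 0"
    and W: "hol2 W (bidisc r)" "real_diag W r"
    and E: "(\<forall>z\<in>ball 0 r. ratp P Q J1 J2 H \<mu> z = dv W z \<and> upow J3 h \<nu> z = exp (dv W z)) \<or>
      (\<forall>z\<in>ball 0 r. ratp P Q J1 J2 H \<mu> z = exp (dv W z) \<and> upow J3 h \<nu> z = dv W z)"
  shows "\<exists>\<rho>>0. \<forall>z\<in>ball 0 \<rho>. \<forall>w\<in>ball 0 \<rho>. W z w = W z 0 + W 0 w - W 0 0"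
proof -
  obtain \<rho>1 where \<rho>1: "\<rho>1 > 0" "\<rho>1 \<le> r" "\<forall>j\<in>J1. diag_log (loc_log (H j)) (H j) \<rho>1"
    using pdata_diag_log[OF J(1) _ r] alg by blast
  obtain \<rho>2 where \<rho>2: "\<rho>2 > 0" "\<rho>2 \<le> r" "\<forall>j\<in>J2. diag_log (loc_log (H j)) (H j) \<rho>2"
    using pdata_diag_log[OF J(2) _ r] alg by blast
  obtain \<rho>3 where \<rho>3: "\<rho>3 > 0" "\<rho>3 \<le> r" "\<forall>j\<in>J3. diag_log (loc_log (h j)) (h j) \<rho>3"
    using pdata_diag_log[OF J(3) _ r] alg by blast
  have fin: "finite J1" "finite J2" "finite J3" using J by (auto simp: pdata_def)
  define LH where "LH j = loc_log (H j)" for j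
  define Lh where "Lh j = loc_log (h j)" for j
  define U where "U = pexp J1 LH \<mu>"
  define V where "V = pexp J2 LH \<mu>"
  define X where "X = pexp J3 Lh \<nu>"
  have hU1: "hol2 U (bidisc \<rho>1)" unfolding U_def LH_def by (rule pexp(1)[OF fin(1)]) (use \<rho>1 in auto)
  have U_diag: "U z (cnj z) = of_real (upow J1 H \<mu> z)" if "z \<in> ball 0 \<rho>1" for z
    unfolding U_def LH_def using that \<rho>1 J(1)
    by (intro pexp(4)[OF fin(1), where r = \<rho>1]) (auto simp: pdata_def real_diag_def)
  have "open {p \<in> bidisc \<rho>1. poly (cpoly Q) (U (fst p) (snd p)) \<in> - {0}}"
    by (rule open_hol2_preimage[OF hol2_poly[OF hU1]]) auto
  moreover have "poly (cpoly Q) (U 0 0) ~= 0"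
    using U_diag[of 0] Q[of 0] \<rho>1 r by (simp add: poly_of_real)
  ultimately obtain \<rho>4 where \<rho>4: "\<rho>4 > 0" "bidisc \<rho>4 \<subseteq> {p \<in> bidisc \<rho>1. poly (cpoly Q) (U (fst p) (snd p)) \<in> - {0}}"
    using bidisc_in_open[of "{p \<in> bidisc \<rho>1. poly (cpoly Q) (U (fst p) (snd p)) \<in> - {0}}"] \<rho>1 by auto
  define \<rho> where "\<rho> = min (min \<rho>1 \<rho>2) (min \<rho>3 \<rho>4)"
  have \<rho>: "\<rho> > 0" "\<rho> \<le> \<rho>1" "\<rho> \<le> \<rho>2" "\<rho> \<le> \<rho>3" "\<rho> \<le> \<rho>4" "\<rho> \<le> r" using \<rho>1 \<rho>2 \<rho>3 \<rho>4 by (auto simp: \<rho>_def)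
  have dl: "!!j. j \<in> J1 ==> diag_log (LH j) (H j) \<rho>" "!!j. j \<in> J2 ==> diag_log (LH j) (H j) \<rho>" "!!j. j \<in> J3 ==> diag_log (Lh j) (h j) \<rho>"
    using \<rho> \<rho>1 \<rho>2 \<rho>3 unfolding LH_def Lh_def by (blast intro: diag_log_mono)+
  have dlnz: "F z w ~= 0" if "diag_log L F \<rho>" "z \<in> ball 0 \<rho>" "w \<in> ball 0 \<rho>" for L F z w
    using that by (metis diag_log_def exp_not_eq_zero)
  have J': "pdata J1 H \<mu> \<rho>" "pdata J2 H \<mu> \<rho>" "pdata J3 h \<nu> \<rho>" using J pdata_mono \<rho>(6) by blast+
  have W': "hol2 W (bidisc \<rho>)" "real_diag W \<rho>" using W \<rho> by (auto simp: real_diag_def intro: hol2_subset)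
  have diag: "U z (cnj z) = of_real (upow J1 H \<mu> z)" "V z (cnj z) = of_real (upow J2 H \<mu> z)"
    "X z (cnj z) = of_real (upow J3 h \<nu> z)" if "z \<in> ball 0 \<rho>" for z
    unfolding U_def V_def X_def using that J'
    by (intro pexp(4)[OF fin(1) dl(1)] pexp(4)[OF fin(2) dl(2)] pexp(4)[OF fin(3) dl(3)]; auto simp: pdata_def)+
  have hUVX: "hol2 U (bidisc \<rho>)" "hol2 V (bidisc \<rho>)" "hol2 X (bidisc \<rho>)"
    unfolding U_def V_def X_def using fin dl by (auto intro!: pexp(1))
  have QU: "poly (cpoly Q) (U z w) ~= 0" if "z \<in> ball 0 \<rho>" "w \<in> ball 0 \<rho>" for z w
    using \<rho>4(2) \<rho> that by (auto simp: subset_iff)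
  have inst: "local_ratpow \<rho> J1 J2 J3 H h (\<lambda>j. of_real (\<mu> j)) T U V (cpoly P) (cpoly Q)"
    if T: "hol2 T (bidisc \<rho>)" "!!z. z \<in> ball 0 \<rho> ==> T z (cnj z) = of_real (ratp P Q J1 J2 H \<mu> z)" for T
  proof
    show "alg2 (H j) \<rho>" if "j \<in> J1 \<union> J2" for j using alg(1)[OF that] alg2_mono \<rho>(6) by blast
    show "alg2 (h j) \<rho>" if "j \<in> J3" for j using alg(2)[OF that] alg2_mono \<rho>(6) by blast
    show "H j z w ~= 0" if "j \<in> J1 \<union> J2" "(z, w) \<in> bidisc \<rho>" for j z w using dlnz[OF dl(1)] dlnz[OF dl(2)] that by auto
    show "h j z w ~= 0" if "j \<in> J3" "(z, w) \<in> bidisc \<rho>" for j z w using dlnz[OF dl(3)] that by auto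
    show "U z w ~= 0" for z w unfolding U_def by (rule pexp(2)[OF fin(1) dl(1)])
    show "V z w ~= 0" for z w unfolding V_def by (rule pexp(2)[OF fin(2) dl(2)])
    show "log_deriv U z w = (\<Sum>j\<in>J1. of_real (\<mu> j) * log_deriv (H j) z w)" if "(z, w) \<in> bidisc \<rho>" for z w
      unfolding U_def using that by (intro pexp(3)[OF fin(1) dl(1)]) auto
    show "log_deriv V z w = (\<Sum>j\<in>J2. of_real (\<mu> j) * log_deriv (H j) z w)" if "(z, w) \<in> bidisc \<rho>" for z w
      unfolding V_def using that by (intro pexp(3)[OF fin(2) dl(2)]) auto
    show "T z w * poly (cpoly Q) (U z w) = poly (cpoly P) (U z w) * V z w" if "(z, w) \<in> bidisc \<rho>" for z w
    proof -
      have "T z w * poly (cpoly Q) (U z w) - poly (cpoly P) (U z w) * V z w = 0"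
      proof (rule polarization[where F = "\<lambda>z w. T z w * poly (cpoly Q) (U z w) - poly (cpoly P) (U z w) * V z w" and r = \<rho>])
        show "hol2 (\<lambda>z w. T z w * poly (cpoly Q) (U z w) - poly (cpoly P) (U z w) * V z w) (bidisc \<rho>)"
          by (intro hol2_diff hol2_mult hol2_poly T hUVX)
        fix z :: complex assume z: "z \<in> ball 0 \<rho>"
        hence "poly Q (upow J1 H \<mu> z) ~= 0" using Q \<rho> by auto
        thus "T z (cnj z) * poly (cpoly Q) (U z (cnj z)) - poly (cpoly P) (U z (cnj z)) * V z (cnj z) = 0"
          using T(2)[OF z] diag[OF z] by (simp add: poly_of_real ratp_def)
      qed (use that in auto)
      thus ?thesis by simp
    qed
  qed (use \<rho> fin T hUVX QU in auto)
  have X': "deriv (X z) w = (\<Sum>j\<in>J3. of_real (\<nu> j) * log_deriv (h j) z w) * X z w" if "z \<in> ball 0 \<rho>" "w \<in> ball 0 \<rho>" for z w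
  proof -
    have "log_deriv X z w = (\<Sum>j\<in>J3. of_real (\<nu> j) * log_deriv (h j) z w)"
      unfolding X_def using that by (intro pexp(3)[OF fin(3) dl(3)])
    moreover have "X z w ~= 0" unfolding X_def by (rule pexp(2)[OF fin(3) dl(3)])
    ultimately show ?thesis by (simp add: log_deriv_def field_simps)
  qed
  have "W z w = W z 0 + W 0 w - W 0 0" if zw: "z \<in> ball 0 (\<rho>/2)" "w \<in> ball 0 (\<rho>/2)" for z w
    using E
  proof
    assume E: "\<forall>z\<in>ball 0 r. ratp P Q J1 J2 H \<mu> z = dv W z \<and> upow J3 h \<nu> z = exp (dv W z)"
    interpret local_ratpow \<rho> J1 J2 J3 H h "\<lambda>j. of_real (\<mu> j)" "\<lambda>j. of_real (\<nu> j)" W U V "cpoly P" "cpoly Q"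
      by (rule inst[OF W'(1)]) (use E \<rho> real_diagD[OF W'(2)] in auto)
    have XW: "X z w = exp (W z w)" if "z \<in> ball 0 \<rho>" "w \<in> ball 0 \<rho>" for z w
    proof -
      have "X z w - exp (W z w) = 0"
      proof (rule polarization[where F = "\<lambda>z w. X z w - exp (W z w)" and r = \<rho>])
        fix z :: complex assume z: "z \<in> ball 0 \<rho>"
        have "upow J3 h \<nu> z = exp (dv W z)" using E z \<rho> by auto
        hence "X z (cnj z) = exp (of_real (dv W z))" using diag(3)[OF z] by (simp add: exp_of_real)
        hence "X z (cnj z) = exp (W z (cnj z))" by (rule trans) (rule arg_cong[OF real_diagD[OF W'(2) z], symmetric])
        thus "X z (cnj z) - exp (W z (cnj z)) = 0" by (simp only: right_minus_eq)
      qed (use that in \<open>auto intro!: hol2_diff hol2_exp hUVX W'\<close>)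
      thus ?thesis by simp
    qed
    show ?thesis
    proof (rule exp_local[OF _ zw])
      fix z w assume p: "(z, w) \<in> bidisc \<rho>"
      have hol: "W z holomorphic_on ball 0 \<rho>" using hol2_slice(1)[OF W'(1)] p by auto
      have "((\<lambda>w. exp (W z w)) has_field_derivative exp (W z w) * deriv (W z) w) (at w)"
        using holomorphic_derivI[OF hol, of w] p by (auto intro!: DERIV_chain2[OF DERIV_exp])
      hence "(X z has_field_derivative exp (W z w) * deriv (W z) w) (at w)"
        by (rule has_field_derivative_transform_within_open[where S = "ball 0 \<rho>"]) (use p XW in auto)
      hence "deriv (X z) w = X z w * deriv (W z) w" using p XW by (auto dest: DERIV_imp_deriv)
      moreover have "X z w ~= 0" unfolding X_def by (rule pexp(2)[OF fin(3) dl(3)])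
      ultimately show "deriv (W z) w = (\<Sum>j\<in>J3. of_real (\<nu> j) * log_deriv (h j) z w)" using X'[of z w] p by simp
    qed
  next
    assume E: "\<forall>z\<in>ball 0 r. ratp P Q J1 J2 H \<mu> z = exp (dv W z) \<and> upow J3 h \<nu> z = dv W z"
    interpret local_ratpow \<rho> J1 J2 J3 H h "\<lambda>j. of_real (\<mu> j)" "\<lambda>j. of_real (\<nu> j)" "\<lambda>z w. exp (W z w)" U V "cpoly P" "cpoly Q"
      by (rule inst[OF hol2_exp[OF W'(1)]]) (use E \<rho> real_diagD[OF W'(2)] in \<open>auto simp flip: exp_of_real\<close>)
    have XW: "X z w = W z w" if "z \<in> ball 0 \<rho>" "w \<in> ball 0 \<rho>" for z w
    proof -
      have "X z w - W z w = 0"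
      proof (rule polarization[where F = "\<lambda>z w. X z w - W z w" and r = \<rho>])
        fix z :: complex assume z: "z \<in> ball 0 \<rho>"
        thus "X z (cnj z) - W z (cnj z) = 0"
          using diag(3)[OF z] real_diagD[OF W'(2) z] E \<rho> by auto
      qed (use that in \<open>auto intro!: hol2_diff hUVX W'\<close>)
      thus ?thesis by simp
    qed
    show ?thesis
    proof (rule log_local[OF W'(1) refl _ zw])
      fix z w assume p: "(z, w) \<in> bidisc \<rho>"
      have "deriv (W z) w = deriv (X z) w"
        by (rule deriv_cong_ev[OF eventually_nhds_in_open[THEN eventually_mono, of "ball 0 \<rho>"] refl]) (use p XW in auto)
      thus "deriv (W z) w = (\<Sum>j\<in>J3. of_real (\<nu> j) * log_deriv (h j) z w) * W z w" using X'[of z w] XW[of z w] p by simp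
    qed
  qed
  hence "\<forall>z\<in>ball 0 (\<rho>/2). \<forall>w\<in>ball 0 (\<rho>/2). W z w = W z 0 + W 0 w - W 0 0" by blast
  moreover have "\<rho>/2 > 0" using \<rho> by simp
  ultimately show ?thesis by blast
qed

text \<open>Algebraic near every point of the bidisc, so that the algebra can be applied at a generic point of the diagonal.\<close>

definition nash2 where
  "nash2 F R \<longleftrightarrow> (\<forall>a\<in>ball 0 R. \<forall>b\<in>ball 0 R. \<exists>\<rho>>0. alg2 (shift2 a b F) \<rho>)"

text \<open>A factor that is identically zero kills the product unless its exponent is 0, in which case it is \<open>0\<^sup>0 = 1\<close> and can be omitted.\<close>

lemma pdata_reduce:
  assumes J: "pdata J F \<mu> R"
  shows "\<exists>J'\<subseteq>J. (\<forall>j\<in>J'. \<mu> j ~= 0 \<and> (\<exists>z\<in>ball 0 R. F j z (cnj z) ~= 0)) \<and>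
     ((\<forall>z\<in>ball 0 R. upow J F \<mu> z = 0) \<or> (\<forall>z\<in>ball 0 R. upow J F \<mu> z = upow J' F \<mu> z))"
proof -
  define J' where "J' = {j \<in> J. \<mu> j ~= 0 \<and> (\<exists>z\<in>ball 0 R. F j z (cnj z) ~= 0)}"
  have fin: "finite J" using J by (simp add: pdata_def)
  have "(\<forall>z\<in>ball 0 R. upow J F \<mu> z = 0) \<or> (\<forall>z\<in>ball 0 R. upow J F \<mu> z = upow J' F \<mu> z)"
  proof (cases "\<exists>j\<in>J. \<mu> j ~= 0 \<and> (\<forall>z\<in>ball 0 R. F j z (cnj z) = 0)")
    case True
    then obtain j where j: "j \<in> J" "\<mu> j ~= 0" "\<forall>z\<in>ball 0 R. F j z (cnj z) = 0" by blast
    have "upow J F \<mu> z = 0" if "z \<in> ball 0 R" for z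
      unfolding upow_def by (rule prod_zero[OF fin]) (use j that real_power_0 in \<open>auto intro!: bexI[of _ j]\<close>)
    thus ?thesis by blast
  next
    case False
    have "upow J F \<mu> z = upow J' F \<mu> z" for z
      unfolding upow_def
      by (rule prod.mono_neutral_right[OF fin]) (use False in \<open>auto simp: J'_def real_power_exponent_0\<close>)
    thus ?thesis by blast
  qed
  thus ?thesis by (intro exI[of _ J']) (auto simp: J'_def)
qed

lemma pdata_subset: "pdata J F \<mu> R ==> J' \<subseteq> J ==> pdata J' F \<mu> R"
  unfolding pdata_def using finite_subset by blast

lemma ratp_reduce:
  assumes J: "pdata J1 H \<mu> R" "pdata J2 H \<mu> R" and Q: "!!z. z \<in> ball 0 R ==> poly Q (upow J1 H \<mu> z) ~= 0"
    and R: "R > 0"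
  shows "\<exists>P' Q' J1' J2'. J1' \<subseteq> J1 \<and> J2' \<subseteq> J2 \<and> (\<forall>j\<in>J1' \<union> J2'. \<mu> j ~= 0 \<and> (\<exists>z\<in>ball 0 R. H j z (cnj z) ~= 0)) \<and>
    (\<forall>z\<in>ball 0 R. poly Q' (upow J1' H \<mu> z) ~= 0 \<and> ratp P' Q' J1' J2' H \<mu> z = ratp P Q J1 J2 H \<mu> z)"
proof -
  obtain A where A: "A \<subseteq> J1" "\<forall>j\<in>A. \<mu> j ~= 0 \<and> (\<exists>z\<in>ball 0 R. H j z (cnj z) ~= 0)"
     "(\<forall>z\<in>ball 0 R. upow J1 H \<mu> z = 0) \<or> (\<forall>z\<in>ball 0 R. upow J1 H \<mu> z = upow A H \<mu> z)"
    using pdata_reduce[OF J(1)] by blast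
  obtain B where B: "B \<subseteq> J2" "\<forall>j\<in>B. \<mu> j ~= 0 \<and> (\<exists>z\<in>ball 0 R. H j z (cnj z) ~= 0)"
     "(\<forall>z\<in>ball 0 R. upow J2 H \<mu> z = 0) \<or> (\<forall>z\<in>ball 0 R. upow J2 H \<mu> z = upow B H \<mu> z)"
    using pdata_reduce[OF J(2)] by blast
  have 0: "upow {} H \<mu> z = 1" for z by (simp add: upow_def)
  have 1: "\<exists>P1 Q1 A'. A' \<subseteq> A \<and> (\<forall>z\<in>ball 0 R. poly Q1 (upow A' H \<mu> z) ~= 0 \<and>
    poly P1 (upow A' H \<mu> z) / poly Q1 (upow A' H \<mu> z) = poly P (upow J1 H \<mu> z) / poly Q (upow J1 H \<mu> z))"
    using A(3)
  proof
    assume z: "\<forall>z\<in>ball 0 R. upow J1 H \<mu> z = 0"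
    moreover from this have "poly Q 0 ~= 0" using Q[of 0] R by simp
    ultimately show ?thesis by (intro exI[of _ "[:poly P 0:]"] exI[of _ "[:poly Q 0:]"] exI[of _ "{}"]) auto
  next
    assume "\<forall>z\<in>ball 0 R. upow J1 H \<mu> z = upow A H \<mu> z"
    thus ?thesis using Q by (intro exI[of _ P] exI[of _ Q] exI[of _ A]) auto
  qed
  then obtain P1 Q1 A' where A': "A' \<subseteq> A" "!!z. z \<in> ball 0 R ==> poly Q1 (upow A' H \<mu> z) ~= 0"
    "!!z. z \<in> ball 0 R ==> poly P1 (upow A' H \<mu> z) / poly Q1 (upow A' H \<mu> z) = poly P (upow J1 H \<mu> z) / poly Q (upow J1 H \<mu> z)"
    by blast
  from B(3) show ?thesis
  proof
    assume 0: "\<forall>z\<in>ball 0 R. upow J2 H \<mu> z = 0"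
    have "ratp 0 Q1 A' {} H \<mu> z = ratp P Q J1 J2 H \<mu> z" if "z \<in> ball 0 R" for z
      unfolding ratp_def using 0 that by simp
    moreover have "A' \<subseteq> J1" "\<forall>j\<in>A' \<union> {}. \<mu> j ~= 0 \<and> (\<exists>z\<in>ball 0 R. H j z (cnj z) ~= 0)" using A(1,2) A'(1) by blast+
    ultimately show ?thesis using A'(2)
      by (intro exI[of _ 0] exI[of _ Q1] exI[of _ A'] exI[of _ "{}"] conjI) simp_all
  next
    assume 1: "\<forall>z\<in>ball 0 R. upow J2 H \<mu> z = upow B H \<mu> z"
    have "ratp P1 Q1 A' B H \<mu> z = ratp P Q J1 J2 H \<mu> z" if "z \<in> ball 0 R" for z
      unfolding ratp_def A'(3)[OF that] using 1 that by simp
    moreover have "A' \<subseteq> J1" "\<forall>j\<in>A' \<union> B. \<mu> j ~= 0 \<and> (\<exists>z\<in>ball 0 R. H j z (cnj z) ~= 0)" using A(1,2) A'(1) B(2) by blast+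
    ultimately show ?thesis using A'(2) B(1)
      by (intro exI[of _ P1] exI[of _ Q1] exI[of _ A'] exI[of _ B] conjI) simp_all
  qed
qed

lemma pdata_shift:
  assumes "pdata J F \<mu> R" "cmod a + r \<le> R"
  shows "pdata J (\<lambda>j. shift2 a (cnj a) (F j)) \<mu> r"
proof -
  have "a + z \<in> ball 0 R" if "z \<in> ball 0 r" for z using shift_in_disc[OF assms(2) that] .
  moreover have "hol2 (shift2 a (cnj a) (F j)) (bidisc r)" if "j \<in> J" for j
    by (rule hol2_shift_bidisc[where R = R]) (use assms that in \<open>auto simp: pdata_def\<close>)
  ultimately show ?thesis using assms unfolding pdata_def real_diag_def by (auto simp flip: complex_cnj_add)
qed

lemma upow_shift: "upow J (\<lambda>j. shift2 a (cnj a) (F j)) \<mu> z = upow J F \<mu> (a + z)"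
  by (simp add: upow_def)

lemma ratp_shift: "ratp P Q J1 J2 (\<lambda>j. shift2 a (cnj a) (H j)) \<mu> z = ratp P Q J1 J2 H \<mu> (a + z)"
  unfolding ratp_def by (simp only: upow_shift)

lemma generic_centre:
  assumes I: "finite I" "!!i. i \<in> I ==> hol2 (F i) (bidisc R) \<and> (\<exists>z\<in>ball 0 R. F i z (cnj z) ~= 0)"
    and s: "0 < s" "s \<le> R"
  shows "\<exists>V. open V \<and> V ~= {} \<and> V \<subseteq> ball 0 s \<and> (\<forall>z\<in>V. \<forall>i\<in>I. F i z (cnj z) ~= 0)"
proof (rule generic_diagonal_point[OF I(1), where R = R])
  fix i assume "i \<in> I"
  from I(2)[OF this] obtain z where "hol2 (F i) (bidisc R)" "z \<in> ball 0 R" "F i z (cnj z) ~= 0" by blast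
  thus "hol2 (F i) (bidisc R) \<and> (\<exists>z w. z \<in> ball 0 R \<and> w \<in> ball 0 R \<and> F i z w ~= 0)"
    by (intro conjI exI[of _ z] exI[of _ "cnj z"]) auto
qed (use s in auto)

text \<open>\<open>W z w - W z b - W a w + W a b\<close> vanishes near \<open>(a, b)\<close>, hence everywhere.\<close>

lemma separated_extension:
  assumes W: "hol2 W (bidisc R)" and a: "a \<in> ball 0 R" "b \<in> ball 0 R" "\<epsilon> > 0"
    and sep: "!!z w. z \<in> ball 0 \<epsilon> ==> w \<in> ball 0 \<epsilon> ==> W (a + z) (b + w) = W (a + z) b + W a (b + w) - W a b"
    and zw: "z \<in> ball 0 R" "w \<in> ball 0 R"
  shows "W z w = W z 0 + W 0 w - W 0 0"
proof -
  have R: "0 \<in> ball (0::complex) R" using zw by (auto intro: le_less_trans[OF norm_ge_zero])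
  have e: "W z w - W z b - W a w + W a b = 0" if zw: "z \<in> ball 0 R" "w \<in> ball 0 R" for z w
  proof (rule hol2_zero_extension[where F = "\<lambda>z w. W z w - W z b - W a w + W a b" and a = a and b = b and \<epsilon> = \<epsilon> and T = "ball 0 R" and V = "ball 0 R"])
    have "(\<lambda>w. W a w) holomorphic_on ball 0 R" "(\<lambda>z. W z b) holomorphic_on ball 0 R"
      using hol2_slice[OF W] a by auto
    hence "hol2 (\<lambda>z w. W a w) (bidisc R)" "hol2 (\<lambda>z w. W z b) (bidisc R)"
      by (auto intro: hol2_fun_snd[where T = "ball 0 R"] hol2_fun_fst[where T = "ball 0 R"])
    thus "hol2 (\<lambda>z w. W z w - W z b - W a w + W a b) (bidisc R)"
      by (intro hol2_add[OF hol2_diff[OF hol2_diff[OF W]]] hol2_const)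
    fix z w assume "dist a z < \<epsilon>" "dist b w < \<epsilon>"
    thus "W z w - W z b - W a w + W a b = 0" using sep[of "z - a" "w - b"] by (simp add: dist_norm norm_minus_commute)
  qed (use a zw in auto)
  have "W z w - (W z 0 + W 0 w - W 0 0) = (W z w - W z b - W a w + W a b) - (W z 0 - W z b - W a 0 + W a b)
      - (W 0 w - W 0 b - W a w + W a b) + (W 0 0 - W 0 b - W a 0 + W a b)" by (simp add: algebra_simps)
  also have "\<dots> = 0" unfolding e[OF zw] e[OF zw(1) R] e[OF R zw(2)] e[OF R R] by simp
  finally show ?thesis by simp
qed

text \<open>Move to a diagonal point where none of the relevant functions vanishes, use the local statement there, and extend the result to the whole bidisc.\<close>

theorem separated_on_disc:
  fixes J1 J2 J3 :: "nat set"
  assumes R: "R > 0" and J: "pdata J1 H \<mu> R" "pdata J2 H \<mu> R" "pdata J3 h \<nu> R"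
    and nash: "!!j. j \<in> J1 \<union> J2 ==> nash2 (H j) R" "!!j. j \<in> J3 ==> nash2 (h j) R"
    and Q: "!!z. z \<in> ball 0 R ==> poly Q (upow J1 H \<mu> z) ~= 0"
    and W: "hol2 W (bidisc R)" "real_diag W R"
    and E: "(\<forall>z\<in>ball 0 R. ratp P Q J1 J2 H \<mu> z = dv W z \<and> upow J3 h \<nu> z = exp (dv W z)) \<or>
      (\<forall>z\<in>ball 0 R. ratp P Q J1 J2 H \<mu> z = exp (dv W z) \<and> upow J3 h \<nu> z = dv W z)"
    and zw: "z \<in> ball 0 R" "w \<in> ball 0 R"
  shows "W z w = W z 0 + W 0 w - W 0 0"
proof -
  obtain P' Q' A B where AB: "A \<subseteq> J1" "B \<subseteq> J2" "!!j. j \<in> A \<union> B ==> \<exists>z\<in>ball 0 R. H j z (cnj z) ~= 0"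
    "!!z. z \<in> ball 0 R ==> poly Q' (upow A H \<mu> z) ~= 0" 
    "!!z. z \<in> ball 0 R ==> ratp P' Q' A B H \<mu> z = ratp P Q J1 J2 H \<mu> z"
    using ratp_reduce[OF J(1,2) Q R, of P] by blast
  obtain C where C: "C \<subseteq> J3" "\<forall>j\<in>C. \<nu> j ~= 0 \<and> (\<exists>z\<in>ball 0 R. h j z (cnj z) ~= 0)"
     "(\<forall>z\<in>ball 0 R. upow J3 h \<nu> z = 0) \<or> (\<forall>z\<in>ball 0 R. upow J3 h \<nu> z = upow C h \<nu> z)"
    using pdata_reduce[OF J(3)] by blast
  from C(3) show ?thesis
  proof
    assume 0: "\<forall>z\<in>ball 0 R. upow J3 h \<nu> z = 0"
    hence "W z (cnj z) = 0" if "z \<in> ball 0 R" for z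
      using E real_diagD[OF W(2) that] that by (metis exp_not_eq_zero of_real_0)
    hence "W z w = 0" if "z \<in> ball 0 R" "w \<in> ball 0 R" for z w using polarization[OF W(1) _ that] by blast
    thus ?thesis using zw R by simp
  next
    assume C3: "\<forall>z\<in>ball 0 R. upow J3 h \<nu> z = upow C h \<nu> z"
    have J': "pdata A H \<mu> R" "pdata B H \<mu> R" "pdata C h \<nu> R" by (rule pdata_subset[OF J(1) AB(1)] pdata_subset[OF J(2) AB(2)] pdata_subset[OF J(3) C(1)])+
    define I where "I = (A \<union> B) <+> C"
    define F where "F i = (case i of Inl j => H j | Inr j => h j)" for i
    have fin: "finite I" using J' by (auto simp: I_def pdata_def)
    have FI: "hol2 (F i) (bidisc R) \<and> (\<exists>z\<in>ball 0 R. F i z (cnj z) ~= 0)" if "i \<in> I" for i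
    proof (cases i)
      case (Inl j)
      hence j: "j \<in> A \<union> B" using that by (auto simp: I_def)
      have "hol2 (H j) (bidisc R)" using j J'(1,2) unfolding pdata_def by blast
      thus ?thesis using AB(3)[OF j] by (simp add: Inl F_def)
    next
      case (Inr j)
      hence j: "j \<in> C" using that by (auto simp: I_def)
      have "hol2 (h j) (bidisc R)" using j J'(3) unfolding pdata_def by blast
      thus ?thesis using C(2) j by (simp add: Inr F_def)
    qed
    have "\<exists>V. open V \<and> V ~= {} \<and> V \<subseteq> ball 0 R \<and> (\<forall>z\<in>V. \<forall>i\<in>I. F i z (cnj z) ~= 0)"
      by (rule generic_centre[OF fin FI R order_refl])
    then obtain V where V: "V ~= {}" "V \<subseteq> ball 0 R" "\<forall>z\<in>V. \<forall>i\<in>I. F i z (cnj z) ~= 0" by (elim exE conjE) (rule that)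
    then obtain a where a: "a \<in> ball 0 R" "!!i. i \<in> I ==> F i a (cnj a) ~= 0" by blast
    have ca: "cnj a \<in> ball 0 R" using a by simp
    have "\<exists>\<rho>>0. \<forall>i\<in>I. alg2 (shift2 a (cnj a) (F i)) \<rho>"
    proof (rule uniform_radius[OF fin])
      show "\<exists>\<rho>>0. alg2 (shift2 a (cnj a) (F i)) \<rho>" if "i \<in> I" for i
      proof -
        have "nash2 (F i) R" using that nash AB(1,2) C(1) unfolding I_def F_def by (cases i) auto
        thus ?thesis using a(1) ca unfolding nash2_def by blast
      qed
    qed (use alg2_mono in blast)
    then obtain \<rho>0 where \<rho>0: "\<rho>0 > 0" "\<forall>i\<in>I. alg2 (shift2 a (cnj a) (F i)) \<rho>0" by blast
    define r where "r = min \<rho>0 (R - cmod a)"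
    have r: "r > 0" "cmod a + r \<le> R" "r \<le> \<rho>0" using \<rho>0 a by (auto simp: r_def)
    have alg: "alg2 (shift2 a (cnj a) (F i)) r" if "i \<in> I" for i using \<rho>0 that r alg2_mono by blast
    have in_disc: "a + z \<in> ball 0 R" if "z \<in> ball 0 r" for z using shift_in_disc[OF r(2) that] .
    have "\<exists>\<rho>>0. \<forall>z\<in>ball 0 \<rho>. \<forall>w\<in>ball 0 \<rho>. shift2 a (cnj a) W z w =
        shift2 a (cnj a) W z 0 + shift2 a (cnj a) W 0 w - shift2 a (cnj a) W 0 0"
    proof (rule separated_near_centre[OF r(1) pdata_shift[OF J'(1) r(2)] pdata_shift[OF J'(2) r(2)] pdata_shift[OF J'(3) r(2)]])
      show "alg2 (shift2 a (cnj a) (H j)) r \<and> H j (a + 0) (cnj a + 0) ~= 0" if "j \<in> A \<union> B" for j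
        using alg[of "Inl j"] a(2)[of "Inl j"] that by (auto simp: I_def F_def)
      show "alg2 (shift2 a (cnj a) (h j)) r \<and> h j (a + 0) (cnj a + 0) ~= 0" if "j \<in> C" for j
        using alg[of "Inr j"] a(2)[of "Inr j"] that by (auto simp: I_def F_def)
      show "poly Q' (upow A (\<lambda>j. shift2 a (cnj a) (H j)) \<mu> z) ~= 0" if "z \<in> ball 0 r" for z
        unfolding upow_shift using AB(4)[OF in_disc[OF that]] .
      show "hol2 (shift2 a (cnj a) W) (bidisc r)" by (rule hol2_shift_bidisc[OF W(1)]) (use r in auto)
      show "real_diag (shift2 a (cnj a) W) r"
        using W(2) in_disc unfolding real_diag_def by (auto simp flip: complex_cnj_add)
      have "ratp P' Q' A B H \<mu> (a + z) = ratp P Q J1 J2 H \<mu> (a + z) \<and> upow C h \<nu> (a + z) = upow J3 h \<nu> (a + z) \<and>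
          dv (shift2 a (cnj a) W) z = dv W (a + z)" if "z \<in> ball 0 r" for z
        using AB(5) C3 in_disc[OF that] by simp
      thus "(\<forall>z\<in>ball 0 r. ratp P' Q' A B (\<lambda>j. shift2 a (cnj a) (H j)) \<mu> z = dv (shift2 a (cnj a) W) z \<and>
          upow C (\<lambda>j. shift2 a (cnj a) (h j)) \<nu> z = exp (dv (shift2 a (cnj a) W) z)) \<or>
        (\<forall>z\<in>ball 0 r. ratp P' Q' A B (\<lambda>j. shift2 a (cnj a) (H j)) \<mu> z = exp (dv (shift2 a (cnj a) W) z) \<and>
          upow C (\<lambda>j. shift2 a (cnj a) (h j)) \<nu> z = dv (shift2 a (cnj a) W) z)"
        unfolding upow_shift ratp_shift using E in_disc by metis
    qed
    then obtain \<rho> where \<rho>: "\<rho> > 0" "\<forall>z\<in>ball 0 \<rho>. \<forall>w\<in>ball 0 \<rho>. shift2 a (cnj a) W z w =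
        shift2 a (cnj a) W z 0 + shift2 a (cnj a) W 0 w - shift2 a (cnj a) W 0 0" by blast
    show ?thesis
      by (rule separated_extension[OF W(1) a(1) ca \<rho>(1) _ zw]) (use \<rho>(2) in simp)
  qed
qed

section \<open>Values on the axis\<close>

lemma exp_eq_imp_diff_const:
  assumes f: "f holomorphic_on S" "g holomorphic_on S" and S: "open S" "convex S"
    and eq: "!!s. s \<in> S ==> exp (f s) = exp (g s :: complex)" and st: "s \<in> S" "t \<in> S"
  shows "f s - f t = g s - g t"
proof -
  have "((\<lambda>s. f s - g s) has_field_derivative 0) (at x within S)" if x: "x \<in> S" for x
  proof -
    define d where "d = deriv f x - deriv g x"
    have d: "((\<lambda>s. f s - g s) has_field_derivative d) (at x)"
      unfolding d_def using holomorphic_derivI[OF f(1) S(1) x] holomorphic_derivI[OF f(2) S(1) x] by (rule DERIV_diff)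
    have "((\<lambda>s. exp (f s - g s)) has_field_derivative exp (f x - g x) * d) (at x)" by (rule DERIV_chain2[OF DERIV_exp d])
    hence "((\<lambda>s. 1) has_field_derivative exp (f x - g x) * d) (at x)"
      by (rule has_field_derivative_transform_within_open[OF _ S(1) x]) (simp add: exp_diff eq)
    hence "exp (f x - g x) * d = 0" using DERIV_unique[OF _ DERIV_const] by blast
    hence "d = 0" by simp
    thus ?thesis using d has_field_derivative_at_within by blast
  qed
  then obtain c where "\<forall>s\<in>S. f s - g s = c" using has_field_derivative_zero_constant[OF S(2)] by blast
  hence "f s - g s = f t - g t" using st by simp
  thus ?thesis by (simp add: algebra_simps)
qed

text \<open>A thin sector just above the segment from 0 to 1 avoids the finitely many zeros of \<open>g\<close>, is simply connected, has 0 in its closure and comes close to 1. It serves to continue logarithms from \<open>s\<close> near 1 to the limit \<open>s \<rightarrow> 0\<close>.\<close>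

lemma zero_free_sector:
  fixes g :: "complex => complex"
  assumes fin: "finite {s \<in> cball 0 1. g s = 0}"
  shows "\<exists>D. open D \<and> convex D \<and> D \<subseteq> ball 0 1 \<and> (\<forall>s\<in>D. g s ~= 0) \<and>
    (\<forall>s\<in>D. \<forall>\<tau>::real. 0 < \<tau> \<and> \<tau> \<le> 1 --> of_real \<tau> * s \<in> D) \<and> (\<forall>\<delta>>0. \<exists>s\<in>D. dist 1 s < \<delta>)"
proof -
  define K where "K = {s \<in> cball 0 1. g s = 0} \<inter> {s. Im s > 0 \<and> Re s > 0}"
  define c where "c = Min (insert 1 ((\<lambda>s. Im s / Re s) ` K))"
  have K: "finite K" using fin by (simp add: K_def)
  have c: "c > 0" "c \<le> 1" "!!s. s \<in> K ==> c \<le> Im s / Re s" using K by (auto simp: c_def K_def)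
  define D where "D = ball 0 1 \<inter> ({s. Im s > 0} \<inter> {s. Complex c (-1) \<bullet> s > 0})"
  have D_iff: "s \<in> D \<longleftrightarrow> cmod s < 1 \<and> Im s > 0 \<and> Im s < c * Re s" for s
    by (simp add: D_def inner_complex_def)
  show ?thesis
  proof (intro exI[of _ D] conjI ballI allI impI)
    show "open D" unfolding D_def by (intro open_Int open_ball open_halfspace_Im_gt open_halfspace_gt)
    show "convex D" unfolding D_def by (intro convex_Int convex_ball convex_halfspace_Im_gt convex_halfspace_gt)
    show "D \<subseteq> ball 0 1" by (auto simp: D_def)
    show "g s ~= 0" if s: "s \<in> D" for s
    proof
      assume "g s = 0"
      have "c * Re s > 0" using s by (simp add: D_iff)
      hence Re: "Re s > 0" using c by (simp add: zero_less_mult_iff)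
      have "s \<in> K" using s \<open>g s = 0\<close> Re by (auto simp: K_def D_iff)
      hence "c * Re s \<le> Im s" using c(3)[of s] Re by (simp add: pos_le_divide_eq)
      thus False using s by (simp add: D_iff)
    qed
    show "of_real \<tau> * s \<in> D" if "s \<in> D" "0 < \<tau> \<and> \<tau> \<le> 1" for s and \<tau> :: real
    proof -
      have "\<tau> * cmod s \<le> 1 * cmod s" using that by (intro mult_right_mono) auto
      moreover have "\<tau> * Im s < \<tau> * (c * Re s)" using that by (simp add: D_iff)
      ultimately show ?thesis using that by (auto simp: D_iff norm_mult mult.left_commute)
    qed
    fix \<delta> :: real assume \<delta>: "\<delta> > 0"
    define \<epsilon> where "\<epsilon> = min (\<delta>/4) (1/2)"
    define \<eta> where "\<eta> = min \<epsilon> (c/2)"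
    have e: "\<epsilon> > 0" "\<epsilon> \<le> \<delta>/4" "\<epsilon> \<le> 1/2" "\<eta> > 0" "\<eta> \<le> \<epsilon>" "\<eta> < c" using \<delta> c by (auto simp: \<epsilon>_def \<eta>_def)
    define s where "s = Complex (1 - \<epsilon>) ((1 - \<epsilon>) * \<eta>)"
    have "cmod s \<le> \<bar>1 - \<epsilon>\<bar> + \<bar>(1 - \<epsilon>) * \<eta>\<bar>" using cmod_le[of s] by (simp add: s_def)
    also have "\<dots> = (1 - \<epsilon>) * (1 + \<eta>)" using e by (simp add: abs_mult algebra_simps)
    also have "\<dots> \<le> (1 - \<epsilon>) * (1 + \<epsilon>)" using e by (intro mult_left_mono) auto
    also have "\<dots> < 1" using e by (simp add: algebra_simps)
    finally have "cmod s < 1" .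
    moreover have "(1 - \<epsilon>) * \<eta> < (1 - \<epsilon>) * c" using e by (intro mult_strict_left_mono) auto
    ultimately have "s \<in> D" using e by (auto simp: D_iff s_def mult.commute)
    moreover have "dist 1 s < \<delta>"
    proof -
      have "dist 1 s \<le> \<bar>Re (1 - s)\<bar> + \<bar>Im (1 - s)\<bar>" unfolding dist_norm by (rule cmod_le)
      also have "\<dots> = \<epsilon> + (1 - \<epsilon>) * \<eta>" using e by (simp add: s_def)
      also have "\<dots> \<le> \<epsilon> + 1 * \<epsilon>" using e by (intro add_left_mono mult_mono) auto
      finally show ?thesis using e \<delta> by simp
    qed
    ultimately show "\<exists>s\<in>D. dist 1 s < \<delta>" by blast
  qed
qed

text \<open>The modulus does not depend on the branch of the logarithm because the exponent is real.\<close>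

lemma real_power_tendsto_0:
  fixes f :: "real => complex"
  assumes f: "(f \<longlongrightarrow> 0) F" and l: "\<forall>\<^sub>F x in F. exp (l x) = f x" and \<mu>: "\<mu> > 0"
  shows "((\<lambda>x. exp (of_real \<mu> * l x)) \<longlongrightarrow> 0) F"
proof (rule tendsto_norm_zero_cancel)
  have "((\<lambda>x. cmod (f x) powr \<mu>) \<longlongrightarrow> 0) F"
    by (rule tendsto_zero_powrI[where b = \<mu>]) (use tendsto_norm_zero[OF f] \<mu> in auto)
  moreover have "\<forall>\<^sub>F x in F. cmod (f x) powr \<mu> = norm (exp (of_real \<mu> * l x))"
    using l
  proof eventually_elim
    case (elim x)
    have "cmod (f x) = exp (Re (l x))" unfolding elim[symmetric] by simp
    thus ?case by (simp add: powr_def)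
  qed
  ultimately show "((\<lambda>x. norm (exp (of_real \<mu> * l x))) \<longlongrightarrow> 0) F" by (rule Lim_transform_eventually)
qed

lemma holomorphic_zero_on_convex:
  assumes "f holomorphic_on D" "open D" "convex D" "a \<in> D" "\<epsilon> > 0" "!!w. w \<in> D ==> dist a w < \<epsilon> ==> f w = 0" "w \<in> D"
  shows "f w = (0::complex)"
  using holomorphic_zero_extension[OF assms(1,2) convex_connected[OF assms(3)] assms(4,5,6,7)] .

text \<open>If some \<open>H j\<close> vanish at the origin, their powers are not holomorphic near it and \<open>W z 0\<close> cannot be read off. Fix a generic point \<open>(a, b)\<close> of the diagonal and continue the identity \<open>W = (P/Q)(U) V\<close> along \<open>(a, s b)\<close> from \<open>s\<close> near 1 to \<open>s \<rightarrow> 0\<close> inside a zero-free sector. Factors with \<open>H j 0 0 ~= 0\<close> keep their principal branch and tend to their value at the origin since \<open>H j a 0 = H j 0 0\<close>; the others have a positive exponent and tend to 0, like their value at the origin.\<close>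

lemma constant_on_axis:
  fixes H :: "'i => complex => complex => complex"
  assumes R: "R > 0" and J: "pdata J1 H \<mu> R" "pdata J2 H \<mu> R"
    and Q: "!!z. z \<in> ball 0 R ==> poly Q (upow J1 H \<mu> z) ~= 0"
    and W: "hol2 W (bidisc R)" "!!z. z \<in> ball 0 R ==> W z (cnj z) = of_real (ratp P Q J1 J2 H \<mu> z)"
    and axis: "!!j z. j \<in> J1 \<union> J2 ==> z \<in> ball 0 R ==> H j z 0 = H j 0 0"
    and z: "z \<in> ball 0 R"
  shows "W z 0 = W 0 0"
proof -
  obtain P' Q' A B where AB: "A \<subseteq> J1" "B \<subseteq> J2" "!!j. j \<in> A \<union> B ==> \<mu> j ~= 0 \<and> (\<exists>z\<in>ball 0 R. H j z (cnj z) ~= 0)"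
    "!!z. z \<in> ball 0 R ==> poly Q' (upow A H \<mu> z) ~= 0"
    "!!z. z \<in> ball 0 R ==> ratp P' Q' A B H \<mu> z = ratp P Q J1 J2 H \<mu> z"
    using ratp_reduce[OF J Q R, of P] by blast
  define I where "I = A \<union> B"
  have JA: "pdata A H \<mu> R" "pdata B H \<mu> R" using J AB pdata_subset by blast+
  hence JI: "pdata I H \<mu> R" by (auto simp: pdata_def I_def)
  have fin: "finite A" "finite B" "finite I" using JA by (auto simp: pdata_def I_def)
  define N where "N = {j \<in> I. H j 0 0 ~= 0}"
  define Z where "Z = {j \<in> I. H j 0 0 = 0}"
  have I_NZ: "I = N \<union> Z" "N \<inter> Z = {}" by (auto simp: N_def Z_def)
  have Zpos: "\<mu> j > 0" if "j \<in> Z" for j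
  proof -
    have "\<forall>z\<in>ball 0 R. power_defined (dv (H j) z) (\<mu> j)" using JI that unfolding pdata_def Z_def by blast
    from bspec[OF this, of 0] have "power_defined (dv (H j) 0) (\<mu> j)" using R by simp
    thus ?thesis using that AB(3)[of j] by (auto simp: power_defined_def Z_def I_def)
  qed
  have "pdata N H \<mu> R" by (rule pdata_subset[OF JI]) (auto simp: N_def)
  from pdata_diag_log[OF this _ R]
  have "\<exists>r>0. r \<le> R \<and> (\<forall>j\<in>N. diag_log (loc_log (H j)) (H j) r)" by (simp add: N_def)
  then obtain r where r: "r > 0" "r \<le> R" "\<forall>j\<in>N. diag_log (loc_log (H j)) (H j) r" by blast
  have "\<exists>V. open V \<and> V ~= {} \<and> V \<subseteq> ball 0 r \<and> (\<forall>z\<in>V. \<forall>i\<in>I. H i z (cnj z) ~= 0)"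
    by (rule generic_centre[OF fin(3) _ r(1,2)]) (use JI AB(3) in \<open>auto simp: pdata_def I_def\<close>)
  then obtain V where V: "open V" "V ~= {}" "V \<subseteq> ball 0 r" "\<forall>z\<in>V. \<forall>i\<in>I. H i z (cnj z) ~= 0"
    by (elim exE conjE) (rule that)
  have key: "W a 0 = W 0 0" if aV: "a \<in> V" for a
  proof (cases "a = 0")
    case False
    define b where "b = cnj a"
    have ar: "cmod a < r" "a \<in> ball 0 R" "b ~= 0" "cmod b = cmod a" using aV V(3) r False by (auto simp: b_def)
    have Ha: "hol2 (H j) (bidisc R)" "H j a b ~= 0" if "j \<in> I" for j using JI V(4) aV that by (auto simp: pdata_def b_def)
    have sb: "s * b \<in> ball 0 r" if "cmod s \<le> 1" for s
      using mult_right_mono[OF that norm_ge_zero[of a]] ar by (auto simp: norm_mult)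
    define t where "t = r / cmod a"
    have t: "t > 1" using ar by (simp add: t_def field_simps False)
    have sbt: "s * b \<in> ball 0 r" if "s \<in> ball 0 t" for s
      using that ar False by (auto simp: norm_mult t_def pos_less_divide_eq)
    have slice: "(\<lambda>s. F a (s * b)) holomorphic_on ball 0 t" if "hol2 F (bidisc r)" for F
      by (rule hol2_curve_holomorphic[OF that]) (use ar sbt in \<open>auto intro!: holomorphic_intros\<close>)
    have sub: "bidisc r \<subseteq> bidisc R" using r by auto
    have gh: "(\<lambda>s. H j a (s * b)) holomorphic_on ball 0 t" if "j \<in> I" for j
      by (rule slice[OF hol2_subset[OF Ha(1)[OF that] sub]])
    define g where "g s = (\<Prod>j\<in>Z. H j a (s * b))" for s
    have finZ: "finite Z" using fin by (simp add: Z_def)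
    have "finite {s \<in> cball 0 1. g s = 0}"
    proof (cases "Z = {}")
      case False
      have "g holomorphic_on ball 0 t" unfolding g_def using gh by (intro holomorphic_intros) (auto simp: Z_def)
      moreover have "g 0 = 0"
      proof -
        obtain j where j: "j \<in> Z" using False by blast
        hence "j \<in> J1 \<union> J2" using AB(1,2) by (auto simp: Z_def I_def)
        from axis[OF this ar(2)] have "H j a (0 * b) = 0" using j by (simp add: Z_def)
        with j have "\<exists>j\<in>Z. H j a (0 * b) = 0" by (rule bexI[rotated])
        thus ?thesis unfolding g_def by (rule prod_zero[OF finZ])
      qed
      moreover have "g 1 ~= 0" using Ha(2) finZ by (auto simp: g_def Z_def)
      ultimately have g: "g holomorphic_on ball 0 t" "g 0 ~= g 1" by auto
      have "\<not> g constant_on ball 0 t"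
      proof
        assume "g constant_on ball 0 t"
        then obtain c where "!!s. s \<in> ball 0 t ==> g s = c" by (auto simp: constant_on_def)
        from this[of 0] this[of 1] show False using g(2) t by simp
      qed
      thus ?thesis
        by (rule holomorphic_compact_finite_zeros[OF g(1) open_ball connected_ball compact_cball, rotated]) (use t in auto)
    qed (simp add: g_def)
    from zero_free_sector[OF this] obtain D where D: "open D" "convex D" "D \<subseteq> ball 0 1" "\<forall>s\<in>D. g s ~= 0"
      "!!s \<tau>::real. s \<in> D ==> 0 < \<tau> ==> \<tau> \<le> 1 ==> of_real \<tau> * s \<in> D" "!!\<delta>. \<delta> > 0 ==> \<exists>s\<in>D. dist 1 s < \<delta>"
      by (elim exE conjE) blast
    have Dt: "D \<subseteq> ball 0 t" using D(3) t by force
    have "pdata Z (\<lambda>j. shift2 a b (H j)) \<mu> (r - cmod a)" unfolding b_def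
      by (rule pdata_shift[where R = r]) (use pdata_mono[OF pdata_subset[OF JI] r(2)] in \<open>auto simp: Z_def\<close>)
    from pdata_diag_log[OF this]
    have "\<exists>\<rho>>0. \<rho> \<le> r - cmod a \<and> (\<forall>j\<in>Z. diag_log (loc_log (shift2 a b (H j))) (shift2 a b (H j)) \<rho>)"
      using Ha(2) ar by (simp add: Z_def)
    then obtain \<rho> where \<rho>: "\<rho> > 0" "\<rho> \<le> r - cmod a"
      "\<forall>j\<in>Z. diag_log (loc_log (shift2 a b (H j))) (shift2 a b (H j)) \<rho>" by blast
    define L where "L j = (if j \<in> Z then loc_log (shift2 a b (H j)) else shift2 a b (loc_log (H j)))" for j
    have L: "diag_log (L j) (shift2 a b (H j)) \<rho>" if "j \<in> I" for j
    proof (cases "j \<in> Z")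
      case False
      hence "diag_log (loc_log (H j)) (H j) r" using r(3) that I_NZ by blast
      moreover have "a + z \<in> ball 0 r" "b + z \<in> ball 0 r" if "z \<in> ball 0 \<rho>" for z
        using shift_in_disc[of a \<rho> r z] shift_in_disc[of b \<rho> r z] \<rho> that ar by auto
      moreover have "hol2 (shift2 a b (loc_log (H j))) (bidisc \<rho>)"
        by (rule hol2_shift_bidisc[where R = r]) (use \<rho> ar \<open>diag_log (loc_log (H j)) (H j) r\<close> in \<open>auto simp: diag_log_def\<close>)
      ultimately show ?thesis using False by (auto simp: L_def diag_log_def b_def simp flip: complex_cnj_add)
    qed (use \<rho> in \<open>simp add: L_def\<close>)
    define \<delta> where "\<delta> = \<rho> / cmod a"
    have \<delta>: "\<delta> > 0" using \<rho> False by (simp add: \<delta>_def)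
    have near: "s * b - b \<in> ball 0 \<rho>" if "dist 1 s < \<delta>" for s
    proof -
      have "s * b - b = (s - 1) * b" by (simp add: algebra_simps)
      hence "cmod (s * b - b) = cmod (s - 1) * cmod a" using ar by (simp only: norm_mult)
      also have "\<dots> < \<rho>" using that False by (simp add: \<delta>_def dist_norm norm_minus_commute pos_less_divide_eq)
      finally show ?thesis by simp
    qed
    define E where "E = D \<inter> ball 1 \<delta>"
    have E: "open E" "convex E" using D by (auto simp: E_def convex_Int open_Int)
    obtain e where e: "e \<in> E" using D(6)[OF \<delta>] by (auto simp: E_def)
    obtain \<epsilon> where \<epsilon>: "\<epsilon> > 0" "ball e \<epsilon> \<subseteq> E" using E(1) e open_contains_ball by blast
    have "\<exists>l. l holomorphic_on D \<and> (\<forall>s\<in>D. exp (l s) = H j a (s * b)) \<and> (\<forall>s\<in>E. l s = L j 0 (s * b - b))" if j: "j \<in> I" for j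
    proof (cases "j \<in> Z")
      case True
      have nz: "H j a (s * b) ~= 0" if "s \<in> D" for s using D(4) that True finZ by (auto simp: g_def)
      obtain l where l: "l holomorphic_on D" "!!s. s \<in> D ==> exp (l s) = H j a (s * b)"
        by (rule holomorphic_logarithm_exists[OF D(2,1) holomorphic_on_subset[OF gh[OF j] Dt] nz, of e]) (use e in \<open>auto simp: E_def\<close>)
      define k where "k s = L j 0 (s * b - b)" for s
      have Lj: "hol2 (L j) (bidisc \<rho>)" using L[OF j] by (simp add: diag_log_def)
      have k: "k holomorphic_on E" unfolding k_def
        by (rule hol2_curve_holomorphic[OF Lj _ _ E(1)]) (use near \<rho> in \<open>auto simp: E_def intro!: holomorphic_intros\<close>)
      have ek: "exp (k s) = H j a (s * b)" if "s \<in> E" for s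
        using L[OF j] near[of s] \<rho> that unfolding diag_log_def E_def k_def by (auto simp: algebra_simps)
      have lE: "l holomorphic_on E" using l(1) by (rule holomorphic_on_subset) (auto simp: E_def)
      have "l s - l e = k s - k e" if "s \<in> E" for s
        by (rule exp_eq_imp_diff_const[OF lE k E _ that e]) (use ek l(2) in \<open>auto simp: E_def\<close>)
      hence "l s + (k e - l e) = k s" if "s \<in> E" for s using that by (simp add: algebra_simps)
      moreover have "exp (k e - l e) = 1" using ek[OF e] l(2)[of e] e nz by (auto simp: exp_diff E_def)
      ultimately show ?thesis using l
        by (intro exI[of _ "\<lambda>s. l s + (k e - l e)"]) (auto simp: exp_add k_def intro!: holomorphic_intros)
    next
      case False
      have dl: "diag_log (loc_log (H j)) (H j) r" using r(3) False j I_NZ by blast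
      show ?thesis
      proof (intro exI[of _ "\<lambda>s. loc_log (H j) a (s * b)"] conjI ballI)
        show "(\<lambda>s. loc_log (H j) a (s * b)) holomorphic_on D"
          by (rule holomorphic_on_subset[OF slice Dt]) (use dl in \<open>simp add: diag_log_def\<close>)
        show "exp (loc_log (H j) a (s * b)) = H j a (s * b)" if "s \<in> D" for s
          using dl sb[of s] ar D(3) that by (auto simp: diag_log_def)
        show "loc_log (H j) a (s * b) = L j 0 (s * b - b)" for s using False by (simp add: L_def)
      qed
    qed
    then obtain l where l: "!!j. j \<in> I ==> l j holomorphic_on D" "!!j s. j \<in> I ==> s \<in> D ==> exp (l j s) = H j a (s * b)"
      "!!j s. j \<in> I ==> s \<in> E ==> l j s = L j 0 (s * b - b)" by metis
    define X where "X J s = (\<Prod>j\<in>J. exp (of_real (\<mu> j) * l j s))" for J s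
    have Xh: "X J holomorphic_on D" if "J \<subseteq> I" for J
      unfolding X_def using l(1) that by (intro holomorphic_intros) auto
    have XE: "X J s = pexp J L \<mu> 0 (s * b - b)" if "J \<subseteq> I" "s \<in> E" for J s
      unfolding X_def pexp_def using l(3) that by (intro prod.cong) auto
    have local_id: "shift2 a b W z w * poly (cpoly Q') (pexp A L \<mu> z w) = poly (cpoly P') (pexp A L \<mu> z w) * pexp B L \<mu> z w"
      if zw: "z \<in> ball 0 \<rho>" "w \<in> ball 0 \<rho>" for z w
    proof -
      have \<rho>R: "cmod a + \<rho> \<le> R" "cmod b + \<rho> \<le> R" using \<rho> r ar by auto
      have LA: "j \<in> A ==> diag_log (L j) (shift2 a b (H j)) \<rho>" "j \<in> B ==> diag_log (L j) (shift2 a b (H j)) \<rho>" for j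
        using L by (auto simp: I_def)
      have "shift2 a b W z w * poly (cpoly Q') (pexp A L \<mu> z w) - poly (cpoly P') (pexp A L \<mu> z w) * pexp B L \<mu> z w = 0"
      proof (rule polarization[where F = "\<lambda>z w. shift2 a b W z w * poly (cpoly Q') (pexp A L \<mu> z w) - poly (cpoly P') (pexp A L \<mu> z w) * pexp B L \<mu> z w" and r = \<rho>])
        show "hol2 (\<lambda>z w. shift2 a b W z w * poly (cpoly Q') (pexp A L \<mu> z w) - poly (cpoly P') (pexp A L \<mu> z w) * pexp B L \<mu> z w) (bidisc \<rho>)"
          by (intro hol2_diff hol2_mult hol2_poly pexp(1)[OF fin(1) LA(1)] pexp(1)[OF fin(2) LA(2)] hol2_shift_bidisc[OF W(1) \<rho>R])
        fix z :: complex assume z: "z \<in> ball 0 \<rho>"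
        have az: "a + z \<in> ball 0 R" by (rule shift_in_disc[OF \<rho>R(1) z])
        have pA: "pdata A (\<lambda>j. shift2 a b (H j)) \<mu> \<rho>" "pdata B (\<lambda>j. shift2 a b (H j)) \<mu> \<rho>"
          unfolding b_def using pdata_shift[OF JA(1) \<rho>R(1)] pdata_shift[OF JA(2) \<rho>R(1)] .
        have "pexp A L \<mu> z (cnj z) = of_real (upow A (\<lambda>j. shift2 a b (H j)) \<mu> z)"
          by (rule pexp(4)[OF fin(1) LA(1) z]) (use pA z in \<open>auto simp: pdata_def\<close>)
        moreover have "pexp B L \<mu> z (cnj z) = of_real (upow B (\<lambda>j. shift2 a b (H j)) \<mu> z)"
          by (rule pexp(4)[OF fin(2) LA(2) z]) (use pA z in \<open>auto simp: pdata_def\<close>)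
        moreover have "shift2 a b W z (cnj z) = of_real (ratp P' Q' A B H \<mu> (a + z))"
          using W(2)[OF az] AB(5)[OF az] by (simp add: b_def)
        ultimately show "shift2 a b W z (cnj z) * poly (cpoly Q') (pexp A L \<mu> z (cnj z)) - poly (cpoly P') (pexp A L \<mu> z (cnj z)) * pexp B L \<mu> z (cnj z) = 0"
          using AB(4)[OF az] by (simp add: b_def upow_shift poly_of_real ratp_def)
      qed (use zw in auto)
      thus ?thesis by simp
    qed
    have AI: "A \<subseteq> I" "B \<subseteq> I" by (auto simp: I_def)
    have Wh: "(\<lambda>s. W a (s * b)) holomorphic_on ball 0 t" by (rule slice[OF hol2_subset[OF W(1) sub]])
    have id: "W a (s * b) * poly (cpoly Q') (X A s) - poly (cpoly P') (X A s) * X B s = 0" if "s \<in> D" for s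
    proof (rule holomorphic_zero_on_convex[where f = "\<lambda>s. W a (s * b) * poly (cpoly Q') (X A s) - poly (cpoly P') (X A s) * X B s", OF _ D(1,2), of e])
      show "(\<lambda>s. W a (s * b) * poly (cpoly Q') (X A s) - poly (cpoly P') (X A s) * X B s) holomorphic_on D"
        by (intro holomorphic_intros Xh AI holomorphic_on_subset[OF Wh Dt])
      show "e \<in> D" using e by (simp add: E_def)
      show "\<epsilon> > 0" by (rule \<epsilon>)
      fix s assume "s \<in> D" "dist e s < \<epsilon>"
      hence s: "s \<in> E" "dist 1 s < \<delta>" using \<epsilon>(2) by (auto simp: subset_iff E_def)
      have "shift2 a b W 0 (s * b - b) = W a (s * b)" by (simp add: algebra_simps)
      thus "W a (s * b) * poly (cpoly Q') (X A s) - poly (cpoly P') (X A s) * X B s = 0"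
        using local_id[of 0 "s * b - b"] near[OF s(2)] \<rho>(1) unfolding XE[OF AI(1) s(1)] XE[OF AI(2) s(1)] by simp
    qed (use that in auto)
    define F where "F = at_right (0::real)"
    define \<phi> where "\<phi> \<tau> = of_real \<tau> * e" for \<tau> :: real
    have eD: "e \<in> D" using e by (simp add: E_def)
    have evD: "\<forall>\<^sub>F \<tau> in F. \<phi> \<tau> \<in> D" unfolding F_def
      using eventually_at_right_real[of 0 1, simplified]
      by eventually_elim (use D(5)[OF eD] in \<open>auto simp: \<phi>_def\<close>)
    have \<phi>0: "(\<phi> \<longlongrightarrow> 0) F" unfolding F_def \<phi>_def by (auto intro!: tendsto_eq_intros)
    have lim: "((\<lambda>\<tau>. f (\<phi> \<tau>)) \<longlongrightarrow> f 0) F" if "f holomorphic_on ball 0 t" for f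
    proof -
      have "isCont f 0" using that t by (auto intro!: continuous_on_interior[OF holomorphic_on_imp_continuous_on])
      thus ?thesis using isCont_tendsto_compose \<phi>0 by blast
    qed
    have "((\<lambda>\<tau>. exp (of_real (\<mu> j) * l j (\<phi> \<tau>))) \<longlongrightarrow> of_real (real_power (dv (H j) 0) (\<mu> j))) F" if j: "j \<in> I" for j
    proof (cases "j \<in> Z")
      case True
      have H0: "H j a 0 = 0" "H j 0 0 = 0" using axis[of j a] j AB(1,2) ar True by (auto simp: I_def Z_def)
      have "((\<lambda>\<tau>. exp (of_real (\<mu> j) * l j (\<phi> \<tau>))) \<longlongrightarrow> 0) F"
        by (rule real_power_tendsto_0[of "\<lambda>\<tau>. H j a (\<phi> \<tau> * b)"])
          (use lim[OF gh[OF j]] H0 Zpos[OF True] eventually_mono[OF evD l(2)[OF j]] in auto)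
      thus ?thesis using H0 Zpos[OF True] by (simp add: real_power_0)
    next
      case False
      hence dl: "diag_log (loc_log (H j)) (H j) r" using r(3) j I_NZ by blast
      have dlh: "hol2 (loc_log (H j)) (bidisc r)" using dl by (simp add: diag_log_def)
      have "H j a 0 = H j 0 0" using axis[of j a] j AB(1,2) ar by (auto simp: I_def)
      hence a0: "loc_log (H j) a 0 = loc_log (H j) 0 0" by (simp add: loc_log_def)
      have lD: "l j s = loc_log (H j) a (s * b)" if "s \<in> D" for s
      proof -
        have "l j s - loc_log (H j) a (s * b) = 0"
        proof (rule holomorphic_zero_on_convex[where f = "\<lambda>s. l j s - loc_log (H j) a (s * b)", OF _ D(1,2) eD])
          show "(\<lambda>s. l j s - loc_log (H j) a (s * b)) holomorphic_on D"
            by (intro holomorphic_intros l j holomorphic_on_subset[OF slice[OF dlh] Dt])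
          show "\<epsilon> > 0" by (rule \<epsilon>)
          show "l j s - loc_log (H j) a (s * b) = 0" if "dist e s < \<epsilon>" for s
            using l(3)[OF j, of s] \<epsilon>(2) that False by (auto simp: subset_iff L_def)
        qed (use that in auto)
        thus ?thesis by simp
      qed
      have "((\<lambda>\<tau>. exp (of_real (\<mu> j) * loc_log (H j) a (\<phi> \<tau> * b))) \<longlongrightarrow> exp (of_real (\<mu> j) * loc_log (H j) a (0 * b))) F"
        by (rule lim) (intro holomorphic_intros slice[OF dlh])
      moreover have "of_real (real_power (dv (H j) 0) (\<mu> j)) = exp (of_real (\<mu> j) * loc_log (H j) 0 0)"
      proof (rule real_power_exp)
        have H: "real_diag (H j) R" "\<forall>z\<in>ball 0 R. power_defined (dv (H j) z) (\<mu> j)" using JI j by (auto simp: pdata_def)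
        show "power_defined (dv (H j) 0) (\<mu> j)" using bspec[OF H(2), of 0] R by simp
        have "\<forall>z\<in>ball 0 r. dv (H j) z > 0 --> loc_log (H j) z (cnj z) = of_real (ln (dv (H j) z))"
          using dl by (simp add: diag_log_def)
        from bspec[OF this, of 0] show "dv (H j) 0 > 0 ==> loc_log (H j) 0 0 = of_real (ln (dv (H j) 0))" using r(1) by simp
        have "exp (loc_log (H j) 0 0) = H j 0 (cnj 0)" using dl r(1) by (simp add: diag_log_def)
        also have "\<dots> = of_real (dv (H j) 0)" by (rule real_diagD[OF H(1)]) (use R in simp)
        finally show "exp (loc_log (H j) 0 0) = of_real (dv (H j) 0)" .
      qed
      ultimately have "((\<lambda>\<tau>. exp (of_real (\<mu> j) * loc_log (H j) a (\<phi> \<tau> * b))) \<longlongrightarrow> of_real (real_power (dv (H j) 0) (\<mu> j))) F"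
        by (simp add: a0)
      moreover have "\<forall>\<^sub>F \<tau> in F. exp (of_real (\<mu> j) * loc_log (H j) a (\<phi> \<tau> * b)) = exp (of_real (\<mu> j) * l j (\<phi> \<tau>))"
        by (rule eventually_mono[OF evD]) (simp add: lD)
      ultimately show ?thesis by (rule Lim_transform_eventually)
    qed
    hence Xlim: "((\<lambda>\<tau>. X J (\<phi> \<tau>)) \<longlongrightarrow> of_real (upow J H \<mu> 0)) F" if "J \<subseteq> I" for J
      unfolding X_def upow_def of_real_prod by (rule tendsto_prod) (use that in blast)
    have lim1: "((\<lambda>\<tau>. W a (\<phi> \<tau> * b) * poly (cpoly Q') (X A (\<phi> \<tau>)) - poly (cpoly P') (X A (\<phi> \<tau>)) * X B (\<phi> \<tau>)) \<longlongrightarrow>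
       W a (0 * b) * poly (cpoly Q') (of_real (upow A H \<mu> 0)) - poly (cpoly P') (of_real (upow A H \<mu> 0)) * of_real (upow B H \<mu> 0)) F"
      by (intro tendsto_intros Xlim AI lim[OF Wh])
    have "W a (0 * b) * poly (cpoly Q') (of_real (upow A H \<mu> 0)) - poly (cpoly P') (of_real (upow A H \<mu> 0)) * of_real (upow B H \<mu> 0) = 0"
    proof (rule tendsto_unique[OF _ lim1])
      show "F ~= bot" by (simp add: F_def)
      show "((\<lambda>\<tau>. W a (\<phi> \<tau> * b) * poly (cpoly Q') (X A (\<phi> \<tau>)) - poly (cpoly P') (X A (\<phi> \<tau>)) * X B (\<phi> \<tau>)) \<longlongrightarrow> 0) F"
        by (rule tendsto_eventually, rule eventually_mono[OF evD], rule id)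
    qed
    hence "W a 0 * of_real (poly Q' (upow A H \<mu> 0)) = of_real (poly P' (upow A H \<mu> 0) * upow B H \<mu> 0)"
      by (simp add: poly_of_real)
    moreover have "W 0 0 = of_real (poly P' (upow A H \<mu> 0) / poly Q' (upow A H \<mu> 0) * upow B H \<mu> 0)"
      using W(2)[of 0] AB(5)[of 0] R by (simp add: ratp_def)
    moreover have "poly Q' (upow A H \<mu> 0) ~= 0" using AB(4) R by simp
    ultimately have "W a 0 * of_real (poly Q' (upow A H \<mu> 0)) = W 0 0 * of_real (poly Q' (upow A H \<mu> 0))"
      "complex_of_real (poly Q' (upow A H \<mu> 0)) ~= 0" by simp_all
    thus ?thesis by (metis mult_right_cancel)
  qed simp
  have hz: "(\<lambda>z. W z 0) holomorphic_on ball 0 R" using hol2_slice(2)[OF W(1)] R by simp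
  obtain a where a: "a \<in> V" using V by blast
  obtain \<epsilon> where \<epsilon>: "\<epsilon> > 0" "ball a \<epsilon> \<subseteq> V" using V(1) a open_contains_ball by blast
  have "W z 0 - W 0 0 = 0"
  proof (rule holomorphic_zero_on_convex[of "\<lambda>z. W z 0 - W 0 0" "ball 0 R" a \<epsilon> z])
    show "(\<lambda>z. W z 0 - W 0 0) holomorphic_on ball 0 R" by (intro holomorphic_intros hz)
    show "a \<in> ball 0 R" using subsetD[OF V(3) a] r by simp
  qed (use a V r z \<epsilon> key in \<open>auto simp: subset_iff\<close>)
  thus ?thesis by simp
qed

text \<open>Since \<open>W\<close> is real on the diagonal, its values on the two axes are conjugate to each other.\<close>

lemma constant_if_separated:
  assumes W: "hol2 W (bidisc R)" "real_diag W R" and axis: "!!z. z \<in> ball 0 R ==> W z 0 = W 0 0"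
    and sep: "W z (cnj z) = W z 0 + W 0 (cnj z) - W 0 0" and z: "z \<in> ball 0 R"
  shows "dv W z = dv W 0"
proof -
  have R: "0 \<in> ball (0::complex) R" using z by (auto intro: le_less_trans[OF norm_ge_zero])
  have r: "W z (cnj z) \<in> \<real>" if "z \<in> ball 0 R" for z using W(2) that by (simp add: real_diag_def)
  have "W 0 (cnj z) = cnj (W (cnj (cnj z)) (cnj 0))" by (rule hermitian_axis[OF W(1) r]) (use z R in auto)
  also have "W (cnj (cnj z)) (cnj 0) = W 0 0" using axis[OF z] by simp
  also have "cnj (W 0 0) = W 0 0" using r[OF R] by (simp add: Reals_cnj_iff)
  finally show ?thesis using sep axis[OF z] by simp
qed

text \<open>The axis condition on \<open>h\<close> also suffices, because it makes \<open>exp (W z 0)\<close> constant.\<close>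

theorem exp_on_disc:
  fixes J1 J2 J3 :: "nat set"
  assumes R: "R > 0" and J: "pdata J1 H \<mu> R" "pdata J2 H \<mu> R" "pdata J3 h \<nu> R"
    and nash: "!!j. j \<in> J1 \<union> J2 ==> nash2 (H j) R" "!!j. j \<in> J3 ==> nash2 (h j) R"
    and Q: "!!z. z \<in> ball 0 R ==> poly Q (upow J1 H \<mu> z) ~= 0"
    and W: "hol2 W (bidisc R)" "!!z. z \<in> ball 0 R ==> W z (cnj z) = of_real (ratp P Q J1 J2 H \<mu> z)"
    and E: "!!z. z \<in> ball 0 R ==> exp (ratp P Q J1 J2 H \<mu> z) = upow J3 h \<nu> z"
    and axis: "(\<forall>j\<in>J1 \<union> J2. \<forall>z\<in>ball 0 R. H j z 0 = H j 0 0) \<or> (\<forall>j\<in>J3. \<forall>z\<in>ball 0 R. h j z 0 = h j 0 0)"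
    and z: "z \<in> ball 0 R"
  shows "ratp P Q J1 J2 H \<mu> z = ratp P Q J1 J2 H \<mu> 0"
proof -
  have ax: "W z 0 = W 0 0" if z: "z \<in> ball 0 R" for z
    using axis
  proof
    assume "\<forall>j\<in>J1 \<union> J2. \<forall>z\<in>ball 0 R. H j z 0 = H j 0 0"
    thus ?thesis by (intro constant_on_axis[OF R J(1,2) Q W _ z]) auto
  next
    assume ax3: "\<forall>j\<in>J3. \<forall>z\<in>ball 0 R. h j z 0 = h j 0 0"
    have e: "exp (W z 0) = exp (W 0 0)" if z: "z \<in> ball 0 R" for z
    proof (rule constant_on_axis[where ?J1.0 = "{}" and ?J2.0 = J3 and H = h and \<mu> = \<nu> and P = "[:1:]" and Q = "[:1:]" and W = "\<lambda>z w. exp (W z w)", OF R _ J(3)])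
      show "pdata {} h \<nu> R" by (simp add: pdata_def)
      show "exp (W z (cnj z)) = of_real (ratp [:1:] [:1:] {} J3 h \<nu> z)" if "z \<in> ball 0 R" for z
      proof -
        have "exp (W z (cnj z)) = of_real (upow J3 h \<nu> z)" unfolding W(2)[OF that] E[OF that, symmetric] by (rule exp_of_real)
        thus ?thesis by (simp add: ratp_def upow_def[of "{}"])
      qed
    qed (use ax3 z W(1) in \<open>auto intro: hol2_exp\<close>)
    have "(\<lambda>z. W z 0) holomorphic_on ball 0 R" using hol2_slice(2)[OF W(1)] R by simp
    hence "W z 0 - W 0 0 = W 0 0 - W 0 0"
      by (rule exp_eq_imp_diff_const[OF _ holomorphic_on_const open_ball convex_ball e z]) (use R in simp_all)
    thus ?thesis by simp
  qed
  have rd: "real_diag W R" using W(2) by (simp add: real_diag_def)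
  have "dv W z = dv W 0"
    by (rule constant_if_separated[OF W(1) rd ax separated_on_disc[OF R J nash Q W(1) rd] z]) (use W(2) E z in auto)
  thus ?thesis using W(2)[OF z] W(2)[of 0] R by simp
qed

theorem log_on_disc:
  fixes J1 J2 J3 :: "nat set"
  assumes R: "R > 0" and J: "pdata J1 H \<mu> R" "pdata J2 H \<mu> R" "pdata J3 h \<nu> R"
    and nash: "!!j. j \<in> J1 \<union> J2 ==> nash2 (H j) R" "!!j. j \<in> J3 ==> nash2 (h j) R"
    and Q: "!!z. z \<in> ball 0 R ==> poly Q (upow J1 H \<mu> z) ~= 0"
    and W: "hol2 W (bidisc R)" "!!z. z \<in> ball 0 R ==> W z (cnj z) = of_real (upow J3 h \<nu> z)"
    and E: "!!z. z \<in> ball 0 R ==> exp (upow J3 h \<nu> z) = ratp P Q J1 J2 H \<mu> z"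
    and axis: "!!j z. j \<in> J3 ==> z \<in> ball 0 R ==> h j z 0 = h j 0 0"
    and z: "z \<in> ball 0 R"
  shows "upow J3 h \<nu> z = upow J3 h \<nu> 0"
proof -
  have ax: "W z 0 = W 0 0" if z: "z \<in> ball 0 R" for z
  proof (rule constant_on_axis[where ?J1.0 = "{}" and ?J2.0 = J3 and H = h and \<mu> = \<nu> and P = "[:1:]" and Q = "[:1:]", OF R _ J(3)])
    show "pdata {} h \<nu> R" by (simp add: pdata_def)
    show "W z (cnj z) = of_real (ratp [:1:] [:1:] {} J3 h \<nu> z)" if "z \<in> ball 0 R" for z
      using W(2)[OF that] by (simp add: ratp_def)
  qed (use axis z W(1) in auto)
  have rd: "real_diag W R" using W(2) by (simp add: real_diag_def)
  have "dv W z = dv W 0"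
    by (rule constant_if_separated[OF W(1) rd ax separated_on_disc[OF R J nash Q W(1) rd] z]) (use W(2) E z in auto)
  thus ?thesis using W(2)[OF z] W(2)[of 0] R by simp
qed

section \<open>Real-analytic functions along complex lines\<close>

text \<open>Osgood's lemma: the partial derivatives are continuous by Cauchy's formula.\<close>

lemma hol2_if_separately_holomorphic:
  assumes cont: "continuous_on (bidisc r) (\<lambda>q. F (fst q) (snd q))" and r: "r > 0"
    and hol: "!!w. w \<in> ball 0 r ==> (\<lambda>z. F z w) holomorphic_on ball 0 r" "!!z. z \<in> ball 0 r ==> F z holomorphic_on ball 0 r"
  shows "hol2 F (bidisc (r/2))"
  unfolding hol2_def
proof
  have swap: "continuous_on S (\<lambda>q::complex \<times> complex. (snd q, fst q))" for S by (intro continuous_intros)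
  have "continuous_on (bidisc r) (\<lambda>q. F (fst (snd q, fst q)) (snd (snd q, fst q)))"
    by (rule continuous_on_compose2[OF cont swap]) auto
  hence c: "continuous_on (bidisc r) (\<lambda>q. F (snd q) (fst q))" by simp
  have "continuous_on (ball 0 (r/2) \<times> ball 0 r) (\<lambda>(w, z). deriv (F z) w)"
    using deriv_fst_continuous[of r "\<lambda>w z. F z w", OF c hol(2) r] by simp
  hence "continuous_on (bidisc (r/2)) (\<lambda>p. case (snd p, fst p) of (w, z) => deriv (F z) w)"
    by (rule continuous_on_compose2[OF _ swap]) (use r in auto)
  hence c2: "continuous_on (bidisc (r/2)) (\<lambda>p. deriv (F (fst p)) (snd p))" by (simp add: case_prod_beta)
  have c3: "continuous_on (bidisc (r/2)) (\<lambda>(z, w). blinfun_mult_right (deriv (F z) w))"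
    using continuous_on_compose2[OF linear_continuous_on[OF bounded_linear_blinfun_mult_right] c2 subset_UNIV]
    by (simp add: case_prod_beta)
  fix p :: "complex \<times> complex" assume p: "p \<in> bidisc (r/2)"
  obtain z w where zw: "p = (z, w)" by (cases p)
  have m: "z \<in> ball 0 (r/2)" "w \<in> ball 0 (r/2)" "z \<in> ball 0 r" "w \<in> ball 0 r" using p zw r by auto
  have o: "open (bidisc (r/2))" by (simp add: open_Times)
  have "((\<lambda>(z, w). F z w) has_derivative (\<lambda>(tz, tw). deriv (\<lambda>z. F z w) z * tz + blinfun_apply (blinfun_mult_right (deriv (F z) w)) tw))
      (at (z, w) within bidisc (r/2))"
  proof (rule has_derivative_partialsI)
    have "((\<lambda>z. F z w) has_field_derivative deriv (\<lambda>z. F z w) z) (at z)"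
      by (rule holomorphic_derivI[OF hol(1)[OF m(4)] open_ball m(3)])
    thus "((\<lambda>z. F z w) has_derivative (*) (deriv (\<lambda>z. F z w) z)) (at z within ball 0 (r/2))"
      unfolding has_field_derivative_def by (rule has_derivative_at_withinI)
    fix x y :: complex assume xy: "x \<in> ball 0 (r/2)" "y \<in> ball 0 (r/2)"
    have "(F x has_field_derivative deriv (F x) y) (at y)"
      by (rule holomorphic_derivI[OF hol(2) open_ball]) (use xy r in auto)
    thus "(F x has_derivative blinfun_apply (blinfun_mult_right (deriv (F x) y))) (at y within ball 0 (r/2))"
      unfolding has_field_derivative_def blinfun_mult_right.rep_eq by (rule has_derivative_at_withinI)
  next
    show "continuous (at (z, w) within bidisc (r/2)) (\<lambda>(z, w). blinfun_mult_right (deriv (F z) w))"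
      using c3 p zw continuous_on_eq_continuous_within by blast
  qed (use m in auto)
  hence "((\<lambda>(z, w). F z w) has_derivative (\<lambda>(tz, tw). deriv (\<lambda>z. F z w) z * tz + deriv (F z) w * tw)) (at p)"
    using at_within_open[OF p o] zw by simp
  thus "\<exists>a b. ((\<lambda>q. F (fst q) (snd q)) has_derivative (\<lambda>v. a * fst v + b * snd v)) (at p)"
    by (auto simp: case_prod_beta')
qed

text \<open>The coordinates of \<open>z *s v\<close> along the real basis are \<open>Re (z * line_coord v b)\<close>, that is, polynomials in \<open>z\<close> and \<open>cnj z\<close>.\<close>

definition line_coord :: "complex ^ 'n::finite => complex ^ 'n => complex" where
  "line_coord v b = (\<Sum>i\<in>UNIV. v $ i * cnj (b $ i))"

lemma inner_line: "(z *s v) \<bullet> b = Re (z * line_coord v b)"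
  by (simp add: inner_vec_def line_coord_def sum_distrib_left inner_complex_def algebra_simps)

lemma line_coord_small:
  assumes "\<epsilon> > 0" shows "\<forall>\<^sub>F v in nhds (0 :: complex ^ 'n::finite). \<forall>b\<in>Basis. cmod (line_coord v b) < \<epsilon>"
proof (rule eventually_ball_finite[OF finite_Basis], rule ballI)
  fix b :: "complex ^ 'n"
  have "isCont (\<lambda>v. cmod (line_coord v b)) 0" unfolding line_coord_def by (intro continuous_intros)
  hence "((\<lambda>v. cmod (line_coord v b)) \<longlongrightarrow> cmod (line_coord 0 b)) (nhds 0)"
    using tendsto_at_iff_tendsto_nhds[of "\<lambda>v. cmod (line_coord v b)" 0] by (simp add: isCont_def)
  thus "\<forall>\<^sub>F v in nhds 0. cmod (line_coord v b) < \<epsilon>"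
    by (rule order_tendstoD(2)) (use assms in \<open>simp add: line_coord_def\<close>)
qed

lemma sum_finite_subsets_hol2:
  fixes f :: "'k => complex => complex => complex"
  assumes f: "!!k. hol2 (f k) UNIV" and M: "M summable_on X" and r: "r > 0"
    and le: "!!k z w. k \<in> X ==> cmod z \<le> r ==> cmod w \<le> r ==> cmod (f k z w) \<le> M k"
  shows "hol2 (\<lambda>z w. \<Sum>\<^sub>\<infinity>k\<in>X. f k z w) (bidisc (r/2))"
proof (rule hol2_if_separately_holomorphic[OF _ r])
  have hol: "(\<lambda>z. f k z w) holomorphic_on S" "f k z holomorphic_on S" for k z w S
    using hol2_slice[of "f k" UNIV UNIV] f[of k] by (auto intro: holomorphic_on_subset)
  have ul: "uniform_limit (cball 0 r \<times> cball 0 r) (\<lambda>Y q. \<Sum>k\<in>Y. f k (fst q) (snd q)) (\<lambda>q. \<Sum>\<^sub>\<infinity>k\<in>X. f k (fst q) (snd q)) (finite_subsets_at_top X)"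
    by (rule Weierstrass_m_test_general[OF _ M]) (use le in auto)
  have ct: "continuous_on (cball 0 r \<times> cball 0 r) (\<lambda>q. \<Sum>k\<in>Y. f k (fst q) (snd q))" for Y
    by (intro continuous_on_sum continuous_on_subset[OF hol2_continuous[OF f]]) auto
  have "continuous_on (cball 0 r \<times> cball 0 r) (\<lambda>q. \<Sum>\<^sub>\<infinity>k\<in>X. f k (fst q) (snd q))"
    by (rule uniform_limit_theorem[OF always_eventually[OF allI[OF ct]] ul finite_subsets_at_top_neq_bot])
  thus "continuous_on (bidisc r) (\<lambda>q. \<Sum>\<^sub>\<infinity>k\<in>X. f k (fst q) (snd q))"
    by (rule continuous_on_subset) auto
  have main: "(\<lambda>z. \<Sum>\<^sub>\<infinity>k\<in>X. g k z) holomorphic_on ball 0 r"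
    if "!!k. g k holomorphic_on UNIV" "!!k z. k \<in> X ==> cmod z \<le> r ==> cmod (g k z) \<le> M k" for g
  proof (rule holomorphic_uniform_limit[of 0 r "\<lambda>Y z. \<Sum>k\<in>Y. g k z" "finite_subsets_at_top X"])
    show "uniform_limit (cball 0 r) (\<lambda>Y z. \<Sum>k\<in>Y. g k z) (\<lambda>z. \<Sum>\<^sub>\<infinity>k\<in>X. g k z) (finite_subsets_at_top X)"
      by (rule Weierstrass_m_test_general[OF _ M]) (use that in auto)
    have "(\<lambda>z. \<Sum>k\<in>Y. g k z) holomorphic_on S" for Y S
      by (intro holomorphic_intros holomorphic_on_subset[OF that(1)]) auto
    thus "\<forall>\<^sub>F Y in finite_subsets_at_top X. continuous_on (cball 0 r) (\<lambda>z. \<Sum>k\<in>Y. g k z) \<and> (\<lambda>z. \<Sum>k\<in>Y. g k z) holomorphic_on ball 0 r"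
      by (intro always_eventually allI conjI holomorphic_on_imp_continuous_on)
  qed auto
  show "(\<lambda>z. \<Sum>\<^sub>\<infinity>k\<in>X. f k z w) holomorphic_on ball 0 r" if "w \<in> ball 0 r" for w
    by (rule main) (use hol le that in auto)
  show "(\<lambda>w. \<Sum>\<^sub>\<infinity>k\<in>X. f k z w) holomorphic_on ball 0 r" if "z \<in> ball 0 r" for z
    by (rule main) (use hol le that in auto)
qed

text \<open>Absolute convergence at the corner of a cube gives a uniform majorant on the cube.\<close>

lemma real_analytic_majorant:
  fixes a :: "'e::euclidean_space"
  assumes "real_analytic_at g a"
  shows "\<exists>c t. t > 0 \<and> (\<lambda>k. \<bar>c k * (\<Prod>b\<in>(Basis :: 'e set). t ^ k b)\<bar>) summable_on (Basis \<rightarrow>\<^sub>E UNIV) \<and>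
    (\<forall>y. (\<forall>b\<in>Basis. \<bar>y \<bullet> b\<bar> \<le> t) --> ((\<lambda>k. c k * (\<Prod>b\<in>Basis. (y \<bullet> b) ^ k b)) has_sum g (a + y)) (Basis \<rightarrow>\<^sub>E UNIV))"
proof -
  obtain c r where r: "r > 0" and sum: "!!x. x \<in> ball a r ==>
      ((\<lambda>k. c k * (\<Prod>b\<in>Basis. ((x - a) \<bullet> b) ^ k b)) has_sum g x) (Basis \<rightarrow>\<^sub>E UNIV)"
    using assms unfolding real_analytic_at_def by blast
  define t where "t = r / (2 * real DIM('e))"
  have t: "t > 0" "t * real DIM('e) < r" using r by (auto simp: t_def field_simps)
  have has: "((\<lambda>k. c k * (\<Prod>b\<in>Basis. (y \<bullet> b) ^ k b)) has_sum g (a + y)) (Basis \<rightarrow>\<^sub>E UNIV)"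
    if le: "\<forall>b\<in>Basis. \<bar>y \<bullet> b\<bar> \<le> t" for y
  proof -
    have "norm y \<le> (\<Sum>b\<in>Basis. \<bar>y \<bullet> b\<bar>)" by (rule norm_le_l1)
    also have "\<dots> \<le> (\<Sum>b\<in>(Basis :: 'e set). t)" using le by (intro sum_mono) auto
    also have "\<dots> < r" using t by (simp add: mult.commute)
    finally have "a + y \<in> ball a r" by (simp add: dist_norm)
    from sum[OF this] show ?thesis by simp
  qed
  define y where "y = (\<Sum>b\<in>(Basis :: 'e set). t *\<^sub>R b)"
  have yb: "y \<bullet> b = t" if "b \<in> Basis" for b using that by (simp add: y_def)
  have "(\<lambda>k. c k * (\<Prod>b\<in>Basis. (y \<bullet> b) ^ k b)) summable_on (Basis \<rightarrow>\<^sub>E UNIV)"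
    by (rule has_sum_imp_summable[OF has]) (use yb t in auto)
  moreover have "(\<Prod>b\<in>Basis. (y \<bullet> b) ^ k b) = (\<Prod>b\<in>(Basis :: 'e set). t ^ k b)" for k
    by (intro prod.cong) (auto simp: yb)
  ultimately have "(\<lambda>k. c k * (\<Prod>b\<in>(Basis :: 'e set). t ^ k b)) summable_on (Basis \<rightarrow>\<^sub>E UNIV)" by simp
  hence "(\<lambda>k. \<bar>c k * (\<Prod>b\<in>(Basis :: 'e set). t ^ k b)\<bar>) summable_on (Basis \<rightarrow>\<^sub>E UNIV)"
    by (rule iffD1[OF summable_on_iff_abs_summable_on_real, unfolded real_norm_def])
  thus ?thesis using t(1) has by blast
qed

lemma real_analytic_continuous:
  fixes a :: "'e::euclidean_space"
  assumes "real_analytic_at g a" shows "(g \<longlongrightarrow> g a) (nhds a)"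
proof -
  obtain c t where t: "t > 0" and M: "(\<lambda>k. \<bar>c k * (\<Prod>b\<in>(Basis :: 'e set). t ^ k b)\<bar>) summable_on (Basis \<rightarrow>\<^sub>E UNIV)"
    and sum: "!!y. (\<forall>b\<in>Basis. \<bar>y \<bullet> b\<bar> \<le> t) ==> ((\<lambda>k. c k * (\<Prod>b\<in>Basis. (y \<bullet> b) ^ k b)) has_sum g (a + y)) (Basis \<rightarrow>\<^sub>E UNIV)"
    using real_analytic_majorant[OF assms] by blast
  have small: "\<bar>(x - a) \<bullet> b\<bar> \<le> t" if "x \<in> ball a t" "b \<in> Basis" for x b
    using Basis_le_norm[OF that(2), of "x - a"] that(1) by (simp add: dist_norm norm_minus_commute)
  have ul: "uniform_limit (ball a t) (\<lambda>Y x. \<Sum>k\<in>Y. c k * (\<Prod>b\<in>Basis. ((x - a) \<bullet> b) ^ k b)) g (finite_subsets_at_top (Basis \<rightarrow>\<^sub>E UNIV))"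
  proof (rule Weierstrass_m_test_general'[OF _ _ M])
    fix k :: "'e => nat" and x assume x: "x \<in> ball a t"
    show "norm (c k * (\<Prod>b\<in>Basis. ((x - a) \<bullet> b) ^ k b)) \<le> \<bar>c k * (\<Prod>b\<in>Basis. t ^ k b)\<bar>"
      using t small[OF x] unfolding real_norm_def abs_mult abs_prod power_abs
      by (intro mult_left_mono prod_mono conjI power_mono) auto
  next
    fix x assume x: "x \<in> ball a t"
    show "((\<lambda>k. c k * (\<Prod>b\<in>Basis. ((x - a) \<bullet> b) ^ k b)) has_sum g x) (Basis \<rightarrow>\<^sub>E UNIV)"
      using sum[of "x - a"] small[OF x] by simp
  qed
  have ct: "continuous_on (ball a t) (\<lambda>x. \<Sum>k\<in>Y. c k * (\<Prod>b\<in>Basis. ((x - a) \<bullet> b) ^ k b))" for Y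
    by (intro continuous_intros)
  have "continuous_on (ball a t) g"
    by (rule uniform_limit_theorem[OF always_eventually[OF allI[OF ct]] ul finite_subsets_at_top_neq_bot])
  hence "isCont g a" using t by (simp add: continuous_on_eq_continuous_at)
  thus ?thesis using tendsto_at_iff_tendsto_nhds[of g a] by (simp add: isCont_def)
qed

text \<open>Replace \<open>cnj z\<close> by an independent variable in each term of the power series. The radius 4 at which the majorant is used is halved by Osgood's lemma.\<close>

lemma real_analytic_line:
  fixes a :: "complex ^ 'n::finite"
  assumes "real_analytic_at g a"
  shows "\<forall>\<^sub>F v in nhds 0. \<exists>G. hol2 G (bidisc 2) \<and> (\<forall>z\<in>ball 0 2. G z (cnj z) = of_real (g (a + z *s v)))"
proof -
  define M where "M c t k = \<bar>c k * (\<Prod>b\<in>(Basis :: (complex ^ 'n) set). t ^ k b)\<bar>" for c and t :: real and k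
  obtain c t where t: "t > 0" and M: "M c t summable_on (Basis \<rightarrow>\<^sub>E UNIV)"
    and sum: "!!y. (\<forall>b\<in>Basis. \<bar>y \<bullet> b\<bar> \<le> t) ==> ((\<lambda>k. c k * (\<Prod>b\<in>Basis. (y \<bullet> b) ^ k b)) has_sum g (a + y)) (Basis \<rightarrow>\<^sub>E UNIV)"
    using real_analytic_majorant[OF assms] unfolding M_def by blast
  show ?thesis using line_coord_small[of "t/8"]
  proof (rule eventually_mono)
    show "t / 8 > 0" using t by simp
    fix v :: "complex ^ 'n" assume v: "\<forall>b\<in>Basis. cmod (line_coord v b) < t / 8"
    define X where "X b z w = (z * line_coord v b + w * cnj (line_coord v b)) / 2" for b z w
    define f where "f k z w = of_real (c k) * (\<Prod>b\<in>Basis. X b z w ^ k b)" for k z w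
    have X: "hol2 (X b) UNIV" for b unfolding X_def
      by (intro hol2_divide hol2_add hol2_mult hol2_const hol2_fst hol2_snd) auto
    have "cmod (X b z w) \<le> t" if "b \<in> Basis" "cmod z \<le> 4" "cmod w \<le> 4" for b z w
    proof -
      have "cmod (X b z w) \<le> (cmod z * cmod (line_coord v b) + cmod w * cmod (line_coord v b)) / 2"
        unfolding X_def using norm_triangle_ineq[of "z * line_coord v b" "w * cnj (line_coord v b)"]
        by (simp add: norm_mult norm_divide)
      also have "\<dots> \<le> (4 * (t/8) + 4 * (t/8)) / 2"
        using v that t by (intro divide_right_mono add_mono mult_mono) (auto simp: less_imp_le)
      finally show ?thesis using t by simp
    qed
    hence le: "cmod (f k z w) \<le> M c t k" if "cmod z \<le> 4" "cmod w \<le> 4" for k z w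
      using that t unfolding f_def M_def norm_mult norm_of_real abs_mult abs_prod prod_norm[symmetric] norm_power
      by (intro mult_left_mono prod_mono conjI power_mono) (auto simp: power_abs intro!: power_mono)
    have hf: "hol2 (f k) UNIV" for k unfolding f_def by (intro hol2_mult hol2_const hol2_prod hol2_power X)
    define G where "G z w = (\<Sum>\<^sub>\<infinity>k\<in>Basis \<rightarrow>\<^sub>E UNIV. f k z w)" for z w
    have "hol2 G (bidisc (4/2))" unfolding G_def
      by (rule sum_finite_subsets_hol2[OF hf M]) (use le in auto)
    moreover have "G z (cnj z) = of_real (g (a + z *s v))" if z: "z \<in> ball 0 2" for z
    proof -
      have inn: "(z *s v) \<bullet> b = Re (z * line_coord v b)" for b by (rule inner_line)
      have Xz: "X b z (cnj z) = of_real ((z *s v) \<bullet> b)" for b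
        unfolding X_def inn using complex_add_cnj[of "z * line_coord v b"] by simp
      have "\<bar>(z *s v) \<bullet> b\<bar> \<le> t" if b: "b \<in> Basis" for b
      proof -
        have "\<bar>(z *s v) \<bullet> b\<bar> \<le> cmod z * cmod (line_coord v b)" unfolding inn using abs_Re_le_cmod norm_mult by metis
        also have "\<dots> \<le> 2 * (t/8)" using z b v by (intro mult_mono) (auto simp: less_imp_le)
        finally show ?thesis using t by simp
      qed
      hence "((\<lambda>k. c k * (\<Prod>b\<in>Basis. ((z *s v) \<bullet> b) ^ k b)) has_sum g (a + z *s v)) (Basis \<rightarrow>\<^sub>E UNIV)"
        by (intro sum) auto
      from has_sum_of_real[OF this, where ?'a = complex]
      have "((\<lambda>k. f k z (cnj z)) has_sum of_real (g (a + z *s v))) (Basis \<rightarrow>\<^sub>E UNIV)"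
        by (simp add: f_def Xz)
      thus ?thesis unfolding G_def by (rule infsumI)
    qed
    ultimately show "\<exists>G. hol2 G (bidisc 2) \<and> (\<forall>z\<in>ball 0 2. G z (cnj z) = of_real (g (a + z *s v)))" by auto
  qed
qed

section \<open>Charts, lines and germs\<close>

lemma is_chartD:
  assumes "is_chart (U, \<phi>)"
  shows "open U" "open (\<phi> ` U)" "continuous_on U \<phi>" "continuous_on (\<phi> ` U) (inv_into U \<phi>)"
    "!!x. x \<in> U ==> inv_into U \<phi> (\<phi> x) = x" "!!W. open W ==> W \<subseteq> U ==> open (\<phi> ` W)"
proof -
  have h: "homeomorphism U (\<phi> ` U) \<phi> (inv_into U \<phi>)" and o: "open U" "open (\<phi> ` U)"
    using assms by (auto simp: is_chart_def)
  show "open U" "open (\<phi> ` U)" by (rule o)+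
  show "continuous_on U \<phi>" "continuous_on (\<phi> ` U) (inv_into U \<phi>)" using h by (auto simp: homeomorphism_def)
  show "inv_into U \<phi> (\<phi> x) = x" if "x \<in> U" for x using h that by (rule homeomorphism_apply1)
  show "open (\<phi> ` W)" if "open W" "W \<subseteq> U" for W
    using homeomorphism_imp_open_map[OF h, of W] that o by (simp add: openin_open_eq)
qed

text \<open>Parametrized such that the end point \<open>z = 1\<close> runs over a neighbourhood of \<open>p\<close> as \<open>v\<close> varies near 0. It is used on the disc of radius 2, which contains both \<open>z = 0\<close> and \<open>z = 1\<close>.\<close>

definition line :: "'a set => ('a => complex ^ 'n) => 'a => complex ^ 'n => complex => 'a" where
  "line U \<phi> p v z = inv_into U \<phi> (\<phi> p + z *s v)"

lemma norm_smult_vec: "norm (z *s (v :: complex ^ 'n::finite)) = cmod z * norm v"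
  by (simp add: norm_vec_def L2_set_def norm_mult power_mult_distrib sum_distrib_left[symmetric] real_sqrt_mult)

lemma affine_eventually:
  fixes a :: "complex ^ 'n::finite"
  assumes "\<forall>\<^sub>F y in nhds a. P y"
  shows "\<forall>\<^sub>F v in nhds 0. \<forall>z\<in>ball 0 2. P (a + z *s v)"
proof -
  obtain \<delta> where d: "\<delta> > 0" "!!y. dist y a < \<delta> ==> P y" using assms by (auto simp: eventually_nhds_metric)
  have "P (a + z *s v)" if "dist v 0 < \<delta> / 2" "cmod z < 2" for v z
  proof (rule d(2))
    have "norm (z *s v) \<le> 2 * norm v" using that by (simp add: norm_smult_vec mult_right_mono)
    thus "dist (a + z *s v) a < \<delta>" using that by (simp add: dist_norm)
  qed
  thus ?thesis unfolding eventually_nhds_metric using d(1) by (intro exI[of _ "\<delta>/2"]) auto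
qed

lemma tendsto_nhds_if_continuous:
  fixes f :: "'a::t2_space => 'b::topological_space"
  shows "continuous_on S f ==> open S ==> a \<in> S ==> (f \<longlongrightarrow> f a) (nhds a)"
proof -
  assume "continuous_on S f" "open S" "a \<in> S"
  hence "isCont f a" by (simp add: continuous_on_eq_continuous_at)
  thus ?thesis unfolding isCont_def by (simp only: tendsto_at_iff_tendsto_nhds)
qed

context
  fixes U :: "'a::t2_space set" and \<phi> :: "'a => complex ^ 'n::finite" and p :: 'a
  assumes chart: "is_chart (U, \<phi>)" and pU: "p \<in> U"
begin

lemma line_0: "line U \<phi> p v 0 = p"
  using is_chartD(5)[OF chart pU] by (simp add: line_def)

lemma line_eventually:
  assumes "\<forall>\<^sub>F x in nhds p. P x"
  shows "\<forall>\<^sub>F v in nhds 0. \<forall>z\<in>ball 0 2. P (line U \<phi> p v z)"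
proof -
  have "(inv_into U \<phi> \<longlongrightarrow> inv_into U \<phi> (\<phi> p)) (nhds (\<phi> p))"
    by (rule tendsto_nhds_if_continuous[OF is_chartD(4,2)[OF chart]]) (use pU in auto)
  hence "filterlim (inv_into U \<phi>) (nhds p) (nhds (\<phi> p))" using is_chartD(5)[OF chart pU] by simp
  from filterlim_iff[THEN iffD1, OF this] assms have "\<forall>\<^sub>F y in nhds (\<phi> p). P (inv_into U \<phi> y)" by blast
  from affine_eventually[OF this] show ?thesis by (simp add: line_def)
qed

lemma line_eventually2:
  assumes "\<forall>\<^sub>F q in nhds (p, p). P (fst q) (snd q)"
  shows "\<forall>\<^sub>F v in nhds 0. \<forall>z\<in>ball 0 2. \<forall>w\<in>ball 0 2. P (line U \<phi> p v z) (line U \<phi> p v w)"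
proof -
  obtain P1 P2 where P: "\<forall>\<^sub>F x in nhds p. P1 x" "\<forall>\<^sub>F x in nhds p. P2 x" "!!x y. P1 x ==> P2 y ==> P x y"
    using assms unfolding nhds_prod eventually_prod_filter by auto
  show ?thesis using line_eventually[OF P(1)] line_eventually[OF P(2)] by eventually_elim (use P(3) in blast)
qed

lemma const_germ_if_const_on_lines:
  assumes "\<forall>\<^sub>F v in nhds 0. F (line U \<phi> p v 1) = F p" shows "germ_at p F \<in> const_germs p"
proof -
  have "((\<lambda>x. \<phi> x - \<phi> p) \<longlongrightarrow> \<phi> p - \<phi> p) (nhds p)"
    by (intro tendsto_intros tendsto_nhds_if_continuous[OF is_chartD(3,1)[OF chart] pU])
  hence "filterlim (\<lambda>x. \<phi> x - \<phi> p) (nhds 0) (nhds p)" by simp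
  from filterlim_iff[THEN iffD1, OF this] assms have "\<forall>\<^sub>F x in nhds p. F (line U \<phi> p (\<phi> x - \<phi> p) 1) = F p" by blast
  moreover have "\<forall>\<^sub>F x in nhds p. x \<in> U" by (rule eventually_nhds_in_open[OF is_chartD(1)[OF chart] pU])
  ultimately have "\<forall>\<^sub>F x in nhds p. F x = F p"
    by eventually_elim (simp add: line_def is_chartD(5)[OF chart])
  hence "germ_at p F = germ_at p (\<lambda>x. F p)" by (simp add: germ_at_eq_iff)
  thus ?thesis unfolding const_germs_def by blast
qed

end

lemma cholomorphic_imp_continuous_on: "f cholomorphic_on S ==> continuous_on S f"
  unfolding cholomorphic_on_def continuous_on_eq_continuous_within using has_derivative_continuous by blast

lemma holomorphic_on_line:
  fixes f :: "complex ^ 'n::finite => complex"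
  assumes "f cholomorphic_on D" "open D" "!!z. z \<in> ball 0 2 ==> a + z *s v \<in> D"
  shows "hol2 (\<lambda>z w. f (a + z *s v)) (bidisc 2)"
proof -
  have e: "a + z *s v = (\<chi> k. a $ k + z * v $ k)" for z by (simp add: Finite_Cartesian_Product.vec_eq_iff)
  have "hol2 (\<lambda>z w. f (\<chi> k. a $ k + z * v $ k)) (bidisc 2)"
    by (rule hol2_cholomorphic[OF assms(1,2)])
      (use assms(3) in \<open>auto simp flip: e intro!: hol2_add hol2_mult hol2_const hol2_fst\<close>)
  thus ?thesis by (simp add: e)
qed

lemma holomorphic_near_line:
  fixes A :: "('a::t2_space, 'n::finite) chart set"
  assumes charts: "\<forall>c\<in>A. is_chart c" and loc: "local_coordinates A p (U, \<phi>)" and f: "holomorphic_near A p f"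
  shows "\<forall>\<^sub>F v in nhds 0. (\<lambda>z. f (line U \<phi> p v z)) holomorphic_on ball 0 2" "(f \<longlongrightarrow> f p) (nhds p)"
proof -
  obtain U' \<phi>' V where V: "(U', \<phi>') \<in> A" "open V" "p \<in> V" "V \<subseteq> U'" "(f \<circ> inv_into U' \<phi>') cholomorphic_on (\<phi>' ` V)"
    using f unfolding holomorphic_near_def by blast
  have c': "is_chart (U', \<phi>')" using charts V(1) by blast
  have c: "is_chart (U, \<phi>)" "p \<in> U" "holomorphic_transition (U, \<phi>) (U', \<phi>')" using loc V(1) by (auto simp: local_coordinates_def)
  have oV: "open (\<phi>' ` V)" by (rule is_chartD(6)[OF c' V(2,4)])
  show "(f \<longlongrightarrow> f p) (nhds p)"
  proof (rule tendsto_nhds_if_continuous[OF _ V(2,3)])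
    have "continuous_on V (\<lambda>x. (f \<circ> inv_into U' \<phi>') (\<phi>' x))"
      by (rule continuous_on_compose2[OF cholomorphic_imp_continuous_on[OF V(5)] continuous_on_subset[OF is_chartD(3)[OF c'] V(4)]]) simp
    thus "continuous_on V f" by (rule continuous_on_eq) (use V(4) is_chartD(5)[OF c'] in auto)
  qed
  define \<tau> where "\<tau> i y = \<phi>' (inv_into U \<phi> y) $ i" for i y
  have \<tau>: "\<tau> i cholomorphic_on (\<phi> ` (U \<inter> U'))" for i
    using c(3) by (simp add: holomorphic_transition_def \<tau>_def[abs_def])
  have o1: "open (\<phi> ` (U \<inter> U'))" by (rule is_chartD(6)[OF c(1)]) (use is_chartD(1)[OF c(1)] is_chartD(1)[OF c'] in auto)
  have o2: "open (\<phi> ` (U \<inter> V))" by (rule is_chartD(6)[OF c(1)]) (use is_chartD(1)[OF c(1)] V(2) in auto)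
  have "\<forall>\<^sub>F y in nhds (\<phi> p). y \<in> \<phi> ` (U \<inter> V)" by (rule eventually_nhds_in_open[OF o2]) (use c V in auto)
  from affine_eventually[OF this] show "\<forall>\<^sub>F v in nhds 0. (\<lambda>z. f (line U \<phi> p v z)) holomorphic_on ball 0 2"
  proof eventually_elim
    case (elim v)
    have mem: "\<phi> p + z *s v \<in> \<phi> ` (U \<inter> U')" if z: "z \<in> ball 0 2" for z
      using bspec[OF elim z] V(4) by blast
    have lV: "line U \<phi> p v z \<in> V" if z: "z \<in> ball 0 2" for z
    proof -
      obtain x where "x \<in> U \<inter> V" "\<phi> p + z *s v = \<phi> x" using bspec[OF elim z] by (rule imageE)
      thus ?thesis by (simp add: line_def is_chartD(5)[OF c(1)])
    qed
    have e: "(\<chi> i. \<tau> i (\<phi> p + z *s v)) = \<phi>' (line U \<phi> p v z)" for z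
      by (simp add: \<tau>_def line_def Finite_Cartesian_Product.vec_eq_iff)
    have "hol2 (\<lambda>z w. (f \<circ> inv_into U' \<phi>') (\<chi> i. \<tau> i (\<phi> p + z *s v))) (bidisc 2)"
      by (rule hol2_cholomorphic[OF V(5) oV holomorphic_on_line[OF \<tau> o1 mem]]) (use e lV in auto)
    from hol2_slice(2)[OF this, of 0]
    have "(\<lambda>z. (f \<circ> inv_into U' \<phi>') (\<chi> i. \<tau> i (\<phi> p + z *s v))) holomorphic_on ball 0 2" by simp
    moreover have "inv_into U' \<phi>' (\<phi>' (line U \<phi> p v z)) = line U \<phi> p v z" if "z \<in> ball 0 2" for z
      by (rule is_chartD(5)[OF c' subsetD[OF V(4) lV[OF that]]])
    ultimately show ?case by (elim holomorphic_transform) (simp add: e)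
  qed
qed

lemma hol_germs_line:
  fixes A :: "('a::t2_space, 'n::finite) chart set"
  assumes charts: "\<forall>c\<in>A. is_chart c" and loc: "local_coordinates A p (U, \<phi>)" and f: "germ_at p f \<in> hol_germs A p"
  shows "\<forall>\<^sub>F v in nhds 0. (\<lambda>z. f (line U \<phi> p v z)) holomorphic_on ball 0 2" "(f \<longlongrightarrow> f p) (nhds p)"
proof -
  obtain g where g: "germ_at p f = germ_at p g" "holomorphic_near A p g" using f by (auto simp: hol_germs_def)
  have eq: "\<forall>\<^sub>F x in nhds p. f x = g x" using g(1) by (simp add: germ_at_eq_iff)
  have c: "is_chart (U, \<phi>)" "p \<in> U" using loc by (auto simp: local_coordinates_def)
  note G = holomorphic_near_line[OF charts loc g(2)]
  show "\<forall>\<^sub>F v in nhds 0. (\<lambda>z. f (line U \<phi> p v z)) holomorphic_on ball 0 2"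
    using line_eventually[OF c eq] G(1)
  proof eventually_elim
    case (elim v)
    show ?case by (rule holomorphic_transform[OF elim(2)]) (use elim(1) in simp)
  qed
  show "(f \<longlongrightarrow> f p) (nhds p)"
    using G(2) tendsto_cong[OF eq] eventually_nhds_x_imp_x[OF eq] by simp
qed

text \<open>The value of \<open>H (\<chi> z, cnj (\<chi> w))\<close> with \<open>cnj w\<close> as the independent variable.\<close>

definition lineH :: "(complex ^ ('m + 'm) => complex) => (complex => complex ^ 'm) => complex => complex => complex" where
  "lineH H c z w = H (join (c z) (cnj_vec (c (cnj w))))"

lemma lineH_dv: "dv (lineH H c) z = diag_value H (c z)"
  by (simp add: lineH_def diag_value_def)

lemma cnj_ball: "cnj ` ball 0 r = ball 0 r"
proof (intro equalityI subsetI)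
  fix x :: complex assume "x \<in> ball 0 r"
  hence "cnj (cnj x) \<in> cnj ` ball 0 r" by (intro imageI) simp
  thus "x \<in> cnj ` ball 0 r" by simp
qed auto

lemma holomorphic_cnj_cnj: "f holomorphic_on ball 0 r ==> (\<lambda>w. cnj (f (cnj w))) holomorphic_on ball 0 r"
  using holomorphic_on_compose_cnj_cnj[of f "ball 0 r"] by (simp add: cnj_ball o_def)

lemma holomorphic_shift:
  assumes f: "f holomorphic_on ball 0 R" and a: "cmod a + \<rho> \<le> R"
  shows "(\<lambda>z. f (a + z)) holomorphic_on ball 0 \<rho>"
proof -
  have "(f \<circ> (\<lambda>z. a + z)) holomorphic_on ball 0 \<rho>"
  proof (rule holomorphic_on_compose_gen[OF _ f])
    show "(\<lambda>z. a + z) holomorphic_on ball 0 \<rho>" by (intro holomorphic_intros)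
    show "(+) a ` ball 0 \<rho> \<subseteq> ball 0 R" using shift_in_disc[OF a] by blast
  qed
  thus ?thesis by (simp add: o_def)
qed

lemma lineH_nash:
  fixes c :: "complex => complex ^ 'm::finite"
  assumes H: "nash_algebraic_on H D" and D: "open D" and c: "!!i. (\<lambda>z. c z $ i) holomorphic_on ball 0 2"
    and mem: "!!z w. z \<in> ball 0 2 ==> w \<in> ball 0 2 ==> join (c z) (cnj_vec (c w)) \<in> D"
  shows "hol2 (lineH H c) (bidisc 2)" "nash2 (lineH H c) 2"
proof -
  define \<gamma> where "\<gamma> s = (case s of Inl i => \<lambda>z w. c z $ i | Inr i => \<lambda>z w. cnj (c (cnj w) $ i))" for s
  have j: "join (c z) (cnj_vec (c (cnj w))) = (\<chi> s. \<gamma> s z w)" for z w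
    unfolding Defs.join_def by (rule arg_cong[of _ _ vec_lambda]) (auto simp: \<gamma>_def cnj_vec_def fun_eq_iff split: sum.splits)
  have hc: "(\<lambda>z. cnj (c (cnj z) $ i)) holomorphic_on ball 0 2" for i using holomorphic_cnj_cnj[OF c[of i]] .
  have "hol2 (\<gamma> s) (bidisc 2)" for s
    by (cases s) (auto simp: \<gamma>_def intro: hol2_fun_fst[OF c open_ball] hol2_fun_snd[OF hc open_ball])
  thus "hol2 (lineH H c) (bidisc 2)" unfolding lineH_def j
    by (intro hol2_cholomorphic[OF _ D]) (use H mem in \<open>auto simp: nash_algebraic_on_def simp flip: j\<close>)
  show "nash2 (lineH H c) 2" unfolding nash2_def
  proof (intro ballI)
    fix a b :: complex assume ab: "a \<in> ball 0 2" "b \<in> ball 0 2"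
    define \<rho> where "\<rho> = min (2 - cmod a) (2 - cmod b)"
    have \<rho>: "\<rho> > 0" "cmod a + \<rho> \<le> 2" "cmod b + \<rho> \<le> 2" using ab by (auto simp: \<rho>_def)
    have "sep2 (\<lambda>z w. \<gamma> s (a + z) (b + w)) \<rho>" for s
    proof (cases s)
      case (Inl i) thus ?thesis using sep2_fun_fst[OF holomorphic_shift[OF c[of i] \<rho>(2)]] by (simp add: \<gamma>_def)
    next
      case (Inr i) thus ?thesis using sep2_fun_snd[OF holomorphic_shift[OF hc[of i] \<rho>(3)]] by (simp add: \<gamma>_def)
    qed
    hence "alg2 (\<lambda>z w. H (\<chi> s. \<gamma> s (a + z) (b + w))) \<rho>"
    proof (rule nash_algebraic_composition[OF H D \<rho>(1)])
      fix z w assume "(z, w) \<in> bidisc \<rho>"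
      hence az: "a + z \<in> ball 0 2" "b + w \<in> ball 0 2" using shift_in_disc[OF \<rho>(2), of z] shift_in_disc[OF \<rho>(3), of w] by auto
      hence "cnj (b + w) \<in> ball 0 2" by (simp only: mem_ball_0 complex_mod_cnj)
      from mem[OF az(1) this] show "(\<chi> s. \<gamma> s (a + z) (b + w)) \<in> D" unfolding j .
    qed
    thus "\<exists>\<rho>>0. alg2 (shift2 a b (lineH H c)) \<rho>" unfolding lineH_def j using \<rho>(1) by blast
  qed
qed

lemma alg2_if_sep2: "sep2 F r ==> alg2 F r"
  unfolding sep2_def alg2_def separated_algebraic_def using algebraic_over_self[OF separated_field(1)[THEN sub_fieldD(1)]] by blast

definition hermitian_sum :: "nat => real => (nat => real) => (nat => complex => complex) => complex => complex => complex" where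
  "hermitian_sum k a0 a f z w = of_real a0 + (\<Sum>j<k. of_real (a j) * (f j z * cnj (f j (cnj w))))"

lemma hermitian_sum_dv: "hermitian_sum k a0 a f z (cnj z) = of_real (a0 + (\<Sum>j<k. a j * (cmod (f j z))\<^sup>2))"
  by (simp add: hermitian_sum_def flip: complex_norm_square)

lemma hermitian_sum_nash:
  assumes f: "!!j. j < k ==> f j holomorphic_on ball 0 2"
  shows "hol2 (hermitian_sum k a0 a f) (bidisc 2)" "nash2 (hermitian_sum k a0 a f) 2"
proof -
  have hc: "(\<lambda>z. cnj (f j (cnj z))) holomorphic_on ball 0 2" if "j < k" for j using holomorphic_cnj_cnj[OF f[OF that]] .
  show "hol2 (hermitian_sum k a0 a f) (bidisc 2)" unfolding hermitian_sum_def
    by (intro hol2_add hol2_const hol2_sum hol2_mult) (auto intro: hol2_fun_fst[OF f open_ball] hol2_fun_snd[OF hc open_ball])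
  show "nash2 (hermitian_sum k a0 a f) 2" unfolding nash2_def
  proof (intro ballI)
    fix x y :: complex assume ab: "x \<in> ball 0 2" "y \<in> ball 0 2"
    define \<rho> where "\<rho> = min (2 - cmod x) (2 - cmod y)"
    have \<rho>: "\<rho> > 0" "cmod x + \<rho> \<le> 2" "cmod y + \<rho> \<le> 2" using ab by (auto simp: \<rho>_def)
    have "sep2 (shift2 x y (hermitian_sum k a0 a f)) \<rho>" unfolding hermitian_sum_def
      by (intro sep2_ops(1) sep2_sum sep2_ops(2) sep2_const \<rho>(1) sep2_fun_fst[OF holomorphic_shift[OF f \<rho>(2)]] sep2_fun_snd[OF holomorphic_shift[OF hc \<rho>(3)]]) auto
    thus "\<exists>\<rho>>0. alg2 (shift2 x y (hermitian_sum k a0 a f)) \<rho>" using alg2_if_sep2 \<rho>(1) by blast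
  qed
qed

section \<open>Negative powers of Hermitian polynomials\<close>

text \<open>Columns of finite support that span a space of finite dimension have a common bound on their support. Elimination of the last factor with the help of one column reduces the rank.\<close>

lemma finite_rank_columns:
  fixes A B :: "nat => nat => complex"
  assumes "!!k. \<exists>L. \<forall>l>L. (\<Sum>j<n. A j l * B j k) = 0"
  shows "\<exists>L. \<forall>l>L. \<forall>k. (\<Sum>j<n. A j l * B j k) = 0"
  using assms
proof (induction n arbitrary: A B)
  case (Suc n)
  show ?case
  proof (cases "\<forall>k. B n k = 0")
    case True
    thus ?thesis using Suc.IH[of A B] Suc.prems by simp
  next
    case False
    then obtain k0 where k0: "B n k0 ~= 0" by blast
    obtain L0 where L0: "!!l. l > L0 ==> (\<Sum>j<Suc n. A j l * B j k0) = 0" using Suc.prems by blast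
    define A' where "A' j l = (if l > L0 then A j l else 0)" for j l
    define B' where "B' j k = B j k - B j k0 * B n k / B n k0" for j k
    have eq: "(\<Sum>j<Suc n. A j l * B j k) = (\<Sum>j<n. A' j l * B' j k)" if "l > L0" for l k
    proof -
      have "A n l * B n k0 = - (\<Sum>j<n. A j l * B j k0)" using L0[OF that] by (simp add: add_eq_0_iff)
      hence An: "A n l = - (\<Sum>j<n. A j l * B j k0) / B n k0" using k0 by (simp add: field_simps)
      have "(\<Sum>j<n. A' j l * B' j k) = (\<Sum>j<n. A j l * B j k) - (\<Sum>j<n. A j l * B j k0) * (B n k / B n k0)"
        unfolding sum_distrib_right sum_subtractf[symmetric]
        by (intro sum.cong) (use that in \<open>auto simp: A'_def B'_def algebra_simps\<close>)
      thus ?thesis by (simp add: An)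
    qed
    have "\<exists>L. \<forall>l>L. (\<Sum>j<n. A' j l * B' j k) = 0" for k
    proof -
      obtain L where "\<forall>l>L. (\<Sum>j<Suc n. A j l * B j k) = 0" using Suc.prems by blast
      thus ?thesis using eq by (intro exI[of _ "max L L0"]) auto
    qed
    from Suc.IH[of A' B', OF this] obtain L where "\<forall>l>L. \<forall>k. (\<Sum>j<n. A' j l * B' j k) = 0" by blast
    thus ?thesis using eq by (intro exI[of _ "max L L0"]) auto
  qed
qed simp

lemma poly_cnj_cnj: "cnj (poly p (cnj w)) = poly (map_poly cnj p) w"
  by (induction p) (simp_all add: map_poly_pCons)

text \<open>Comparison of leading coefficients gives \<open>degree g = \<alpha> * degree H\<close>.\<close>

lemma degree_of_power_solution:
  fixes g H :: "complex poly"
  assumes eq: "pderiv g * H = smult (of_real \<alpha>) (pderiv H * g)" and nz: "g ~= 0" "H ~= 0" and \<alpha>: "\<alpha> < 0"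
  shows "degree H = 0"
proof (rule ccontr)
  assume d: "degree H ~= 0"
  hence pH: "pderiv H ~= 0" by (simp add: pderiv_eq_0_iff)
  hence "smult (of_real \<alpha>) (pderiv H * g) ~= 0" using nz \<alpha> by simp
  hence pg: "pderiv g ~= 0" using eq by auto
  have lc: "lead_coeff (pderiv p) = of_nat (degree p) * lead_coeff p" if "pderiv p ~= 0" for p :: "complex poly"
  proof -
    have "degree p ~= 0" using that by (simp add: pderiv_eq_0_iff)
    thus ?thesis by (simp add: degree_pderiv coeff_pderiv)
  qed
  have "of_nat (degree g) * lead_coeff g * lead_coeff H = of_real \<alpha> * (of_nat (degree H) * lead_coeff H * lead_coeff g)"
    using arg_cong[OF eq, of lead_coeff] by (simp only: lead_coeff_mult lead_coeff_smult lc[OF pg] lc[OF pH])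
  hence "of_nat (degree g) = of_real \<alpha> * (of_nat (degree H) :: complex)" using nz by simp
  hence "complex_of_real (real (degree g)) = of_real (\<alpha> * real (degree H))" by simp
  hence "real (degree g) = \<alpha> * real (degree H)" by (simp only: of_real_eq_iff)
  moreover have "\<alpha> * real (degree H) < 0" using \<alpha> d by (simp add: mult_neg_pos)
  ultimately show False by simp
qed

lemma fps_expansion_poly: "fps_expansion (poly p) 0 = fps_of_poly (p :: complex poly)"
proof (induction p)
  case (pCons a p)
  have X: "fps_expansion (\<lambda>x. x :: complex) 0 = fps_X" by (intro fps_expansion_eqI) (rule has_fps_expansion_fps_X)
  have h: "poly p holomorphic_on ball 0 1" "(\<lambda>x. x * poly p x) holomorphic_on ball 0 1" "(\<lambda>x. x) holomorphic_on ball 0 1" "(\<lambda>x. a) holomorphic_on ball 0 1"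
    by (intro holomorphic_intros)+
  have "fps_expansion (poly (pCons a p)) 0 = fps_expansion (\<lambda>x. a + x * poly p x) 0"
    by (rule arg_cong[of _ _ "\<lambda>f. fps_expansion f 0"]) auto
  also have "\<dots> = fps_const a + fps_X * fps_expansion (poly p) 0"
    by (simp add: fps_expansion_ring(1)[OF h(4,2)] fps_expansion_ring(2)[OF h(3,1)] fps_expansion_of_const X)
  also have "\<dots> = fps_of_poly (pCons a p)" by (simp add: pCons.IH fps_of_poly_pCons mult.commute)
  finally show ?case .
qed (simp add: fps_expansion_of_const)

text \<open>The differential equation \<open>g' h = c h' g\<close> with \<open>h = 1 + \<dots>\<close> determines the coefficients of \<open>g\<close> recursively as polynomials in those of \<open>h\<close>.\<close>

lemma polynomial_power_recursion:
  fixes g :: "nat => complex => complex" and q :: "nat => complex poly"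
  assumes g0: "!!z. z \<in> S ==> g 0 z = 1" and q0: "q 0 = 1"
    and rec: "!!z k. z \<in> S ==> (\<Sum>i\<le>k. of_nat (Suc i) * g (Suc i) z * poly (q (k - i)) z) =
      c * (\<Sum>i\<le>k. of_nat (Suc i) * poly (q (Suc i)) z * g (k - i) z)"
  shows "\<exists>p. \<forall>z\<in>S. g k z = poly p z"
proof (induction k rule: less_induct)
  case (less k)
  show ?case
  proof (cases k)
    case 0
    thus ?thesis using g0 by (intro exI[of _ 1]) simp
  next
    case (Suc n)
    obtain p where p: "!!i z. i < k ==> z \<in> S ==> g i z = poly (p i) z" using less by metis
    define P where "P = smult (inverse (of_nat k)) (smult c (\<Sum>i\<le>n. smult (of_nat (Suc i)) (q (Suc i) * p (n - i)))
      - (\<Sum>i<n. smult (of_nat (Suc i)) (p (Suc i) * q (n - i))))"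
    have "g k z = poly P z" if z: "z \<in> S" for z
    proof -
      have "(\<Sum>i\<le>n. of_nat (Suc i) * g (Suc i) z * poly (q (n - i)) z) =
          (\<Sum>i<n. of_nat (Suc i) * g (Suc i) z * poly (q (n - i)) z) + of_nat k * g k z"
        by (simp add: Suc q0 lessThan_Suc_atMost[symmetric])
      hence "of_nat k * g k z = c * (\<Sum>i\<le>n. of_nat (Suc i) * poly (q (Suc i)) z * g (n - i) z) -
          (\<Sum>i<n. of_nat (Suc i) * g (Suc i) z * poly (q (n - i)) z)"
        using rec[OF z, of n] by (simp add: algebra_simps)
      also have "(\<Sum>i\<le>n. of_nat (Suc i) * poly (q (Suc i)) z * g (n - i) z) =
          poly (\<Sum>i\<le>n. smult (of_nat (Suc i)) (q (Suc i) * p (n - i))) z"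
        unfolding poly_sum by (intro sum.cong) (use p[OF _ z] Suc in auto)
      also have "(\<Sum>i<n. of_nat (Suc i) * g (Suc i) z * poly (q (n - i)) z) =
          poly (\<Sum>i<n. smult (of_nat (Suc i)) (p (Suc i) * q (n - i))) z"
        unfolding poly_sum by (intro sum.cong) (use p[OF _ z] Suc in auto)
      finally have e: "of_nat k * g k z = c * poly (\<Sum>i\<le>n. smult (of_nat (Suc i)) (q (Suc i) * p (n - i))) z
        - poly (\<Sum>i<n. smult (of_nat (Suc i)) (p (Suc i) * q (n - i))) z" .
      have "poly P z = inverse (of_nat k) * (of_nat k * g k z)" unfolding e P_def by (simp only: poly_smult poly_diff)
      moreover have "(of_nat k :: complex) ~= 0" unfolding of_nat_eq_0_iff using Suc by simp
      ultimately show ?thesis by simp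
    qed
    thus ?thesis by blast
  qed
qed

text \<open>The coefficients of \<open>w\<^sup>k\<close> in \<open>G = h\<^sup>\<alpha>\<close> are polynomials in \<open>z\<close> by the recursion, and of bounded degree by finite rank. So \<open>G\<close> is a polynomial in \<open>z\<close> for each small \<open>w\<close>, which leaves only the possibility that \<open>h\<close> does not depend on \<open>z\<close>.\<close>

theorem negative_power_on_disc:
  fixes X :: "'i => complex poly" and \<psi> :: "nat => complex => complex"
  assumes I: "finite I" and X0: "!!i. i \<in> I ==> poly (X i) 0 = 0" and \<psi>: "!!j. j < n ==> \<psi> j holomorphic_on ball 0 2"
    and \<alpha>: "\<alpha> < 0"
    and eq: "!!z. z \<in> ball 0 2 ==> (1 + (\<Sum>i\<in>I. a i * (cmod (poly (X i) z))\<^sup>2)) powr \<alpha> = (\<Sum>j<n. b j * (cmod (\<psi> j z))\<^sup>2)"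
    and z: "z \<in> ball 0 2"
  shows "(\<Sum>i\<in>I. a i * (cmod (poly (X i) z))\<^sup>2) = 0"
proof -
  define Y where "Y i = map_poly cnj (X i)" for i
  define \<psi>' where "\<psi>' j w = cnj (\<psi> j (cnj w))" for j w
  have \<psi>': "\<psi>' j holomorphic_on ball 0 2" if "j < n" for j
    using holomorphic_cnj_cnj[OF \<psi>[OF that]] by (simp add: \<psi>'_def[abs_def])
  define h where "h z w = 1 + (\<Sum>i\<in>I. of_real (a i) * poly (X i) z * poly (Y i) w)" for z w
  define G where "G z w = (\<Sum>j<n. of_real (b j) * \<psi> j z * \<psi>' j w)" for z w
  have hh: "hol2 h S" for S unfolding h_def
    by (intro hol2_add hol2_const hol2_sum hol2_mult hol2_poly[OF hol2_fst] hol2_poly[OF hol2_snd])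
  have hG: "hol2 G (bidisc 2)" unfolding G_def
    by (intro hol2_sum hol2_mult hol2_const) (auto intro: hol2_fun_fst[OF \<psi> open_ball] hol2_fun_snd[OF \<psi>' open_ball])
  have h_diag: "h z (cnj z) = of_real (1 + (\<Sum>i\<in>I. a i * (cmod (poly (X i) z))\<^sup>2))" for z
    by (simp add: h_def Y_def poly_cnj_cnj[symmetric] mult.assoc flip: complex_norm_square)
  have G_diag: "G z (cnj z) = of_real (\<Sum>j<n. b j * (cmod (\<psi> j z))\<^sup>2)" for z
    by (simp add: G_def \<psi>'_def mult.assoc flip: complex_norm_square)
  have Y0: "poly (Y i) 0 = 0" if "i \<in> I" for i using X0[OF that] poly_cnj_cnj[of "X i" 0] by (simp add: Y_def)
  have h0: "h z 0 = 1" "h 0 w = 1" for z w using X0 Y0 by (simp_all add: h_def)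
  have rd: "real_diag h r" for r unfolding real_diag_def h_diag by simp
  have "\<exists>\<rho>>0. \<rho> \<le> 2 \<and> (\<forall>j\<in>{()}. \<forall>z\<in>ball 0 \<rho>. \<forall>w\<in>ball 0 \<rho>. Re (h z w / h 0 0) > 0)"
    by (rule positive_bidisc) (use hh h0 in auto)
  then obtain \<rho> where \<rho>: "\<rho> > 0" "\<rho> \<le> 2" "!!z w. z \<in> ball 0 \<rho> ==> w \<in> ball 0 \<rho> ==> Re (h z w / h 0 0) > 0" by auto
  have L: "diag_log (loc_log h) h \<rho>" by (rule diag_log_loc_log[OF hh rd _ \<rho>(1,3)]) (use h0 in auto)
  have hL: "hol2 (loc_log h) (bidisc \<rho>)" using L by (simp add: diag_log_def)
  have GE: "G z w = exp (of_real \<alpha> * loc_log h z w)" if zw: "z \<in> ball 0 \<rho>" "w \<in> ball 0 \<rho>" for z w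
  proof -
    have "G z w - exp (of_real \<alpha> * loc_log h z w) = 0"
    proof (rule polarization[where F = "\<lambda>z w. G z w - exp (of_real \<alpha> * loc_log h z w)" and r = \<rho>, OF _ _ zw])
      have "bidisc \<rho> \<subseteq> bidisc 2" using \<rho>(2) by auto
      thus "hol2 (\<lambda>z w. G z w - exp (of_real \<alpha> * loc_log h z w)) (bidisc \<rho>)"
        by (intro hol2_diff hol2_exp hol2_mult hol2_const hL hol2_subset[OF hG])
      fix z :: complex assume z: "z \<in> ball 0 \<rho>"
      define x where "x = 1 + (\<Sum>i\<in>I. a i * (cmod (poly (X i) z))\<^sup>2)"
      have dv: "dv h z = x" unfolding h_diag x_def by simp
      have "Re (h z (cnj z) / h 0 0) > 0" by (rule \<rho>(3)) (use z in auto)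
      hence x: "x > 0" using dv h0 by simp
      have "loc_log h z (cnj z) = of_real (ln x)" using L z x dv unfolding diag_log_def by metis
      hence "exp (of_real \<alpha> * loc_log h z (cnj z)) = of_real (x powr \<alpha>)"
        using x by (simp add: powr_def exp_of_real[symmetric])
      also have "x powr \<alpha> = (\<Sum>j<n. b j * (cmod (\<psi> j z))\<^sup>2)" unfolding x_def by (rule eq) (use z \<rho> in auto)
      finally show "G z (cnj z) - exp (of_real \<alpha> * loc_log h z (cnj z)) = 0" by (simp only: G_diag diff_self)
    qed
    thus ?thesis by simp
  qed
  have hE: "exp (loc_log h z w) = h z w" if "z \<in> ball 0 \<rho>" "w \<in> ball 0 \<rho>" for z w using L that by (simp add: diag_log_def)
  \<comment> \<open>along \<open>(z, w)\<close> with \<open>z\<close> fixed for the recursion, and with \<open>w\<close> fixed for the comparison of degrees\<close>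
  have rel: "deriv (\<lambda>t. G (x t) (y t)) t * h (x t) (y t) = of_real \<alpha> * deriv (\<lambda>t. h (x t) (y t)) t * G (x t) (y t)"
    if xy: "x holomorphic_on ball 0 \<rho>" "y holomorphic_on ball 0 \<rho>" "!!t. t \<in> ball 0 \<rho> ==> x t \<in> ball 0 \<rho> \<and> y t \<in> ball 0 \<rho>" and t: "t \<in> ball 0 \<rho>" for x y t
  proof -
    have "(\<lambda>t. loc_log h (x t) (y t)) holomorphic_on ball 0 \<rho>"
      by (rule hol2_curve_holomorphic[OF hL xy(1,2)]) (use xy(3) in auto)
    from holomorphic_derivI[OF this open_ball t] obtain d where d: "((\<lambda>t. loc_log h (x t) (y t)) has_field_derivative d) (at t)" by blast
    have "((\<lambda>t. exp (loc_log h (x t) (y t))) has_field_derivative exp (loc_log h (x t) (y t)) * d) (at t)" by (rule DERIV_chain2[OF DERIV_exp d])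
    hence "((\<lambda>t. h (x t) (y t)) has_field_derivative exp (loc_log h (x t) (y t)) * d) (at t)"
      by (rule has_field_derivative_transform_within_open[OF _ open_ball t]) (use hE xy(3) in auto)
    hence 1: "deriv (\<lambda>t. h (x t) (y t)) t = h (x t) (y t) * d" using hE xy(3)[OF t] by (simp add: DERIV_imp_deriv)
    have "((\<lambda>t. exp (of_real \<alpha> * loc_log h (x t) (y t))) has_field_derivative exp (of_real \<alpha> * loc_log h (x t) (y t)) * (of_real \<alpha> * d)) (at t)"
      by (rule DERIV_chain2[OF DERIV_exp DERIV_cmult[OF d]])
    hence "((\<lambda>t. G (x t) (y t)) has_field_derivative exp (of_real \<alpha> * loc_log h (x t) (y t)) * (of_real \<alpha> * d)) (at t)"
      by (rule has_field_derivative_transform_within_open[OF _ open_ball t]) (use GE xy(3) in auto)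
    hence 2: "deriv (\<lambda>t. G (x t) (y t)) t = G (x t) (y t) * (of_real \<alpha> * d)" using GE xy(3)[OF t] by (simp add: DERIV_imp_deriv)
    show ?thesis unfolding 1 2 by (simp add: algebra_simps)
  qed
  define A where "A j l = of_real (b j) * fps_nth (fps_expansion (\<psi> j) 0) l" for j l
  define B where "B j k = fps_nth (fps_expansion (\<psi>' j) 0) k" for j k
  define g where "g k z = fps_nth (fps_expansion (G z) 0) k" for k z
  have lin: "fps_nth (fps_expansion (\<lambda>w. \<Sum>j<n. c j * F j w) 0) k = (\<Sum>j<n. c j * fps_nth (fps_expansion (F j) 0) k)"
    if "!!j. j < n ==> F j holomorphic_on ball 0 2" for c F k
  proof -
    have "fps_expansion (\<lambda>w. \<Sum>j<n. c j * F j w) 0 = (\<Sum>j<n. fps_expansion (\<lambda>w. c j * F j w) 0)"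
      by (rule fps_expansion_of_sum[where r = 2]) (use that in \<open>auto intro!: holomorphic_intros\<close>)
    also have "\<dots> = (\<Sum>j<n. fps_const (c j) * fps_expansion (F j) 0)"
    proof (intro sum.cong refl)
      fix j assume j: "j \<in> {..<n}"
      have "fps_expansion (\<lambda>w. c j * F j w) 0 = fps_expansion (\<lambda>w. c j) 0 * fps_expansion (F j) 0"
        by (rule fps_expansion_ring(2)[where r = 2]) (use that j in auto)
      thus "fps_expansion (\<lambda>w. c j * F j w) 0 = fps_const (c j) * fps_expansion (F j) 0" by (simp add: fps_expansion_of_const)
    qed
    finally show ?thesis by (simp add: fps_sum_nth)
  qed
  have g_eq: "g k z = (\<Sum>j<n. of_real (b j) * \<psi> j z * B j k)" for k z
    unfolding g_def G_def B_def by (rule lin[OF \<psi>'])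
  define hp where "hp z = 1 + (\<Sum>i\<in>I. smult (of_real (a i) * poly (X i) z) (Y i))" for z
  have hp: "h z = poly (hp z)" for z by (simp add: fun_eq_iff h_def hp_def poly_sum)
  define q where "q k = [:if k = 0 then 1 else 0:] + (\<Sum>i\<in>I. smult (of_real (a i) * coeff (Y i) k) (X i))" for k
  have q: "coeff (hp z) k = poly (q k) z" for z k
    by (simp add: hp_def q_def poly_sum coeff_sum algebra_simps)
  have q0: "q 0 = 1"
  proof -
    have "coeff (Y i) 0 = 0" if "i \<in> I" for i using Y0[OF that] by (simp add: poly_0_coeff_0)
    thus ?thesis by (simp add: q_def one_pCons)
  qed
  have g0: "g 0 z = 1" if "z \<in> ball 0 \<rho>" for z
    using GE[OF that, of 0] \<rho>(1) h0 by (simp add: g_def fps_expansion_def loc_log_def)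
  have rec: "(\<Sum>i\<le>k. of_nat (Suc i) * g (Suc i) z * poly (q (k - i)) z) =
      of_real \<alpha> * (\<Sum>i\<le>k. of_nat (Suc i) * poly (q (Suc i)) z * g (k - i) z)" if z: "z \<in> ball 0 \<rho>" for z k
  proof -
    have Gz: "G z holomorphic_on ball 0 \<rho>"
      using hol2_slice(1)[OF hG open_ball, of z] z \<rho> by (auto elim!: holomorphic_on_subset)
    have p: "poly p holomorphic_on ball 0 \<rho>" for p :: "complex poly" by (intro holomorphic_intros)
    have Gd: "deriv (G z) holomorphic_on ball 0 \<rho>" by (rule holomorphic_deriv[OF Gz open_ball])
    have "deriv (G z) w * poly (hp z) w = poly (smult (of_real \<alpha>) (pderiv (hp z))) w * G z w" if "w \<in> ball 0 \<rho>" for w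
      using rel[of "\<lambda>_. z" "\<lambda>w. w" w] z that unfolding hp by (auto intro!: holomorphic_intros simp: DERIV_imp_deriv[OF poly_DERIV])
    hence "fps_expansion (\<lambda>w. deriv (G z) w * poly (hp z) w) 0 = fps_expansion (\<lambda>w. poly (smult (of_real \<alpha>) (pderiv (hp z))) w * G z w) 0"
      by (intro fps_expansion_cong_ball[OF _ \<rho>(1)])
    hence "fps_deriv (fps_expansion (G z) 0) * fps_of_poly (hp z) = fps_of_poly (smult (of_real \<alpha>) (pderiv (hp z))) * fps_expansion (G z) 0"
      unfolding fps_expansion_ring(2)[OF Gd p \<rho>(1)] fps_expansion_ring(2)[OF p Gz \<rho>(1)] fps_expansion_ring(3)[OF Gz Gz \<rho>(1)] fps_expansion_poly .
    from arg_cong[OF this, of "\<lambda>f. fps_nth f k"] show ?thesis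
      by (simp add: fps_mult_nth coeff_pderiv q g_def sum_distrib_left atLeast0AtMost mult.assoc del: of_nat_Suc)
  qed
  have "\<exists>L. \<forall>l>L. (\<Sum>j<n. A j l * B j k) = 0" for k
  proof -
    obtain p where p: "\<forall>z\<in>ball 0 \<rho>. g k z = poly p z"
      using polynomial_power_recursion[of "ball 0 \<rho>" g q "of_real \<alpha>" k] g0 q0 rec by blast
    have "(\<Sum>j<n. A j l * B j k) = coeff p l" for l
    proof -
      have "(\<Sum>j<n. A j l * B j k) = (\<Sum>j<n. (of_real (b j) * B j k) * fps_nth (fps_expansion (\<psi> j) 0) l)"
        by (simp add: A_def mult_ac)
      also have "\<dots> = fps_nth (fps_expansion (\<lambda>z. \<Sum>j<n. (of_real (b j) * B j k) * \<psi> j z) 0) l" by (rule lin[OF \<psi>, symmetric])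
      also have "fps_expansion (\<lambda>z. \<Sum>j<n. (of_real (b j) * B j k) * \<psi> j z) 0 = fps_expansion (poly p) 0"
        by (rule fps_expansion_cong_ball[OF _ \<rho>(1)]) (use p g_eq in \<open>auto simp: mult_ac\<close>)
      finally show ?thesis by (simp add: fps_expansion_poly)
    qed
    thus ?thesis by (intro exI[of _ "degree p"]) (simp add: coeff_eq_0)
  qed
  from finite_rank_columns[where n = n and A = A and B = B, OF this] obtain L where L: "!!l k. l > L ==> (\<Sum>j<n. A j l * B j k) = 0" by blast
  have h1: "h z w = 1" if w: "w \<in> ball 0 \<rho>" for z w
  proof -
    have w2: "w \<in> ball 0 2" using w \<rho> by auto
    define Gw where "Gw = fps_expansion (\<lambda>z. G z w) 0"
    have hw: "(\<lambda>z. G z w) holomorphic_on ball 0 2" using hol2_slice(2)[OF hG open_ball w2] .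
    have Gl: "fps_nth Gw l = (\<Sum>j<n. A j l * \<psi>' j w)" for l
    proof -
      have "Gw = fps_expansion (\<lambda>z. \<Sum>j<n. (of_real (b j) * \<psi>' j w) * \<psi> j z) 0"
        unfolding Gw_def G_def by (rule arg_cong[of _ _ "\<lambda>f. fps_expansion f 0"]) (simp add: mult_ac)
      thus ?thesis using lin[where F = \<psi>, OF \<psi>, where c = "\<lambda>j. of_real (b j) * \<psi>' j w" and k = l] by (simp add: A_def mult_ac)
    qed
    have "fps_nth Gw l = 0" if l: "l > L" for l
    proof -
      define F where "F w = (\<Sum>j<n. A j l * \<psi>' j w)" for w
      have "fps_expansion F 0 = 0" using lin[where F = \<psi>', OF \<psi>', where c = "\<lambda>j. A j l"] L[OF l] by (intro fps_ext) (simp add: F_def[abs_def] B_def)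
      moreover have "F holomorphic_on ball 0 2" unfolding F_def using \<psi>' by (intro holomorphic_intros) auto
      ultimately have "F w = 0" using eval_fps_expansion_ball[of F 2 w] w2 by simp
      thus ?thesis by (simp add: Gl F_def)
    qed
    define gp where "gp = (\<Sum>l\<le>L. monom (fps_nth Gw l) l)"
    have "Gw = fps_of_poly gp"
      by (rule fps_ext) (use \<open>!!l. l > L ==> fps_nth Gw l = 0\<close> in \<open>auto simp: gp_def coeff_sum coeff_monom\<close>)
    hence Gp: "G z w = poly gp z" if "z \<in> ball 0 2" for z
      using eval_fps_expansion_ball[OF hw that] by (simp add: Gw_def[symmetric] eval_fps_of_poly)
    define H where "H = 1 + (\<Sum>i\<in>I. smult (of_real (a i) * poly (Y i) w) (X i))"
    have Hp: "h z w = poly H z" for z by (simp add: h_def H_def poly_sum mult_ac)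
    have "poly (pderiv gp * H) z = poly (smult (of_real \<alpha>) (pderiv H * gp)) z" if z: "z \<in> ball 0 \<rho>" for z
    proof -
      have "deriv (\<lambda>z. G z w) z = deriv (poly gp) z"
        by (rule deriv_cong_ev[OF eventually_mono[OF eventually_nhds_in_open[OF open_ball z]] refl]) (use Gp \<rho> in auto)
      hence "deriv (\<lambda>z. G z w) z = poly (pderiv gp) z" by (simp add: DERIV_imp_deriv[OF poly_DERIV])
      moreover have "deriv (\<lambda>z. h z w) z = poly (pderiv H) z" unfolding Hp by (rule DERIV_imp_deriv[OF poly_DERIV])
      moreover have "deriv (\<lambda>z. G z w) z * h z w = of_real \<alpha> * deriv (\<lambda>z. h z w) z * G z w"
        by (rule rel[of "\<lambda>z. z" "\<lambda>_. w" z]) (use z w in \<open>auto intro!: holomorphic_intros\<close>)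
      moreover have "G z w = poly gp z" using z \<rho> by (intro Gp) auto
      ultimately show ?thesis by (simp add: Hp mult.assoc)
    qed
    hence "ball 0 \<rho> \<subseteq> {z. poly (pderiv gp * H - smult (of_real \<alpha>) (pderiv H * gp)) z = 0}" by auto
    moreover have "infinite (ball (0::complex) \<rho>)" using uncountable_ball[OF \<rho>(1), of 0] countable_finite by blast
    ultimately have "pderiv gp * H - smult (of_real \<alpha>) (pderiv H * gp) = 0"
      using poly_roots_finite finite_subset by metis
    hence e: "pderiv gp * H = smult (of_real \<alpha>) (pderiv H * gp)" by simp
    have "poly gp 0 ~= 0" using Gp[of 0] GE[of 0 w] w \<rho> by simp
    moreover have "poly H 0 = 1" using Hp[of 0] h0 by simp
    ultimately have "degree H = 0" by (intro degree_of_power_solution[OF e _ _ \<alpha>]) auto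
    then obtain c where "H = [:c:]" by (rule degree_eq_zeroE)
    thus ?thesis using Hp[of z] \<open>poly H 0 = 1\<close> by simp
  qed
  have "h z (cnj z) - 1 = 0"
  proof (rule hol2_zero_extension[where F = "\<lambda>z w. h z w - 1" and T = "ball 0 2" and V = "ball 0 2" and a = 0 and b = 0 and \<epsilon> = \<rho>])
    show "hol2 (\<lambda>z w. h z w - 1) (bidisc 2)" by (intro hol2_diff hh hol2_const)
  qed (use h1 \<rho> z in auto)
  hence "complex_of_real (\<Sum>i\<in>I. a i * (cmod (poly (X i) z))\<^sup>2) = 0" unfolding h_diag by simp
  thus ?thesis by (simp only: of_real_eq_0_iff)
qed

section \<open>Exponentials and logarithms along lines\<close>

text \<open>The flag \<open>b\<close> records that the holomorphic functions vanish at \<open>p\<close>, that is, the difference between the two sets of germs; constants can be absorbed into \<open>a0\<close> in both.\<close>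

definition hermitian_rank :: "('a::topological_space, 'n::finite) chart set => 'a => bool => ('a => real) => bool" where
  "hermitian_rank A p b h \<longleftrightarrow> (\<exists>k a0 a f. (\<forall>j<k. germ_at p (f j) \<in> hol_germs A p \<and> (b --> f j p = 0)) \<and>
     (\<forall>\<^sub>F x in nhds p. h x = a0 + (\<Sum>j<(k::nat). a j * (cmod (f j x))\<^sup>2)))"

lemma LambdaD:
  assumes "germ_at p h \<in> Lambda A p"
  shows "\<exists>k a f. (\<forall>j<k. germ_at p (f j) \<in> hol_germs A p) \<and> (\<forall>\<^sub>F x in nhds p. h x = (\<Sum>j<(k::nat). a j * (cmod (f j x))\<^sup>2))"
proof -
  obtain k a f where "germ_at p h = germ_at p (\<lambda>x. \<Sum>j<(k::nat). a j * (cmod (f j x))\<^sup>2)" "\<forall>j<k. germ_at p (f j) \<in> hol_germs A p"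
    using assms unfolding Lambda_def mem_Collect_eq by (elim exE conjE) (rule that)
  thus ?thesis unfolding germ_at_eq_iff by blast
qed

lemma hermitian_rank_Lambda:
  assumes "germ_at p h \<in> Lambda A p" shows "hermitian_rank A p False h"
proof -
  obtain k a f where f: "\<forall>j<k. germ_at p (f j) \<in> hol_germs A p" "\<forall>\<^sub>F x in nhds p. h x = (\<Sum>j<(k::nat). a j * (cmod (f j x))\<^sup>2)"
    using LambdaD[OF assms] by (elim exE conjE) (rule that)
  show ?thesis unfolding hermitian_rank_def
    by (rule exI[of _ k], rule exI[of _ 0], rule exI[of _ a], rule exI[of _ f]) (use f in simp)
qed

lemma hol_germs0D:
  assumes "germ_at p f \<in> hol_germs0 A p" shows "germ_at p f \<in> hol_germs A p" "f p = 0"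
proof -
  obtain g where g: "germ_at p f = germ_at p g" "holomorphic_near A p g" "g p = 0"
    using assms unfolding hol_germs0_def mem_Collect_eq by (elim exE conjE) (rule that)
  show "germ_at p f \<in> hol_germs A p" using g by (auto simp: hol_germs_def)
  have "\<forall>\<^sub>F x in nhds p. f x = g x" using g(1) by (simp add: germ_at_eq_iff)
  thus "f p = 0" using eventually_nhds_x_imp_x g(3) by fastforce
qed

lemma hermitian_rank_Lambda0:
  assumes "germ_at p h \<in> Lambda0 A p" shows "hermitian_rank A p b h"
proof -
  obtain k a0 a f where f: "germ_at p h = germ_at p (\<lambda>x. a0 + (\<Sum>j<(k::nat). a j * (cmod (f j x))\<^sup>2))" "\<forall>j<k. germ_at p (f j) \<in> hol_germs0 A p"
    using assms unfolding Lambda0_def mem_Collect_eq by (elim exE conjE) (rule that)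
  have "germ_at p (f j) \<in> hol_germs A p \<and> f j p = 0" if "j < k" for j using hol_germs0D f(2) that by blast
  thus ?thesis unfolding hermitian_rank_def using f(1) unfolding germ_at_eq_iff by blast
qed

lemma power_productsD:
  assumes "germ_at p F \<in> power_products A p L \<kappa> \<nu>"
  shows "\<exists>h. (\<forall>\<^sub>F x in nhds p. F x = (\<Prod>j<\<kappa>. real_power (h j x) (\<nu> j))) \<and>
    (\<forall>j<\<kappa>. germ_at p (h j) \<in> L \<and> (\<forall>\<^sub>F x in nhds p. power_defined (h j x) (\<nu> j))) \<and>
    real_analytic_near A p (\<lambda>x. \<Prod>j<\<kappa>. real_power (h j x) (\<nu> j))"
proof -
  obtain h where "germ_at p F = germ_at p (\<lambda>x. \<Prod>j<\<kappa>. real_power (h j x) (\<nu> j))"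
    "\<forall>j<\<kappa>. germ_at p (h j) \<in> L \<and> (\<forall>\<^sub>F x in nhds p. power_defined (h j x) (\<nu> j))"
    "real_analytic_near A p (\<lambda>x. \<Prod>j<\<kappa>. real_power (h j x) (\<nu> j))"
    using assms unfolding power_products_def mem_Collect_eq by (elim exE conjE) (rule that)
  thus ?thesis unfolding germ_at_eq_iff by blast
qed

lemma cnj_vec_0: "cnj_vec 0 = 0"
  by (simp add: cnj_vec_def Finite_Cartesian_Product.vec_eq_iff)

text \<open>The chart is a parameter, since it has to be the one in which the function to be polarized is real-analytic, or the given local coordinates in which the germs are polynomials.\<close>

locale germs_along_lines =
  fixes A :: "('a::{second_countable_topology,t2_space}, 'n::finite) chart set" and p :: 'a
    and U :: "'a set" and \<phi> :: "'a => complex ^ 'n" and chi :: "'a => complex ^ 'm::finite"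
  assumes charts: "\<forall>c\<in>A. is_chart c" and loc: "local_coordinates A p (U, \<phi>)"
    and chi: "!!i. germ_at p (\<lambda>x. chi x $ i) \<in> hol_germs A p"
begin

abbreviation "lin v \<equiv> line U \<phi> p v"

lemma chart: "is_chart (U, \<phi>)" "p \<in> U" using loc by (auto simp: local_coordinates_def)

lemma chi_tendsto: "(chi \<longlongrightarrow> chi p) (nhds p)"
  by (rule vec_tendstoI) (rule hol_germs_line(2)[OF charts loc chi])

lemma chi_line: "\<forall>\<^sub>F v in nhds 0. \<forall>i\<in>UNIV. (\<lambda>z. chi (lin v z) $ i) holomorphic_on ball 0 2"
  by (rule eventually_ball_finite[OF finite]) (use hol_germs_line(1)[OF charts loc chi] in blast)

lemma join_tendsto:
  "((\<lambda>q. join (chi (fst q)) (cnj_vec (chi (snd q)))) \<longlongrightarrow> join (chi p) (cnj_vec (chi p))) (nhds (p, p))"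
proof (rule vec_tendstoI)
  fix s :: "'m + 'm"
  have fs: "filterlim fst (nhds p) (nhds (p, p))" "filterlim snd (nhds p) (nhds (p, p))"
    using tendsto_fst[OF filterlim_ident, of "(p, p)"] tendsto_snd[OF filterlim_ident, of "(p, p)"] by simp_all
  have c: "((\<lambda>q. chi (fst q) $ i) \<longlongrightarrow> chi p $ i) (nhds (p, p))" "((\<lambda>q. chi (snd q) $ i) \<longlongrightarrow> chi p $ i) (nhds (p, p))" for i
    using filterlim_compose[OF tendsto_vec_nth[OF chi_tendsto] fs(1)] filterlim_compose[OF tendsto_vec_nth[OF chi_tendsto] fs(2)] by auto
  show "((\<lambda>q. join (chi (fst q)) (cnj_vec (chi (snd q))) $ s) \<longlongrightarrow> join (chi p) (cnj_vec (chi p)) $ s) (nhds (p, p))"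
    by (cases s) (simp_all add: Defs.join_def cnj_vec_def c tendsto_cnj)
qed

lemma H_line:
  assumes H: "hermitian_symmetric_at H (chi p)" "nash_algebraic_at H (join (chi p) (cnj_vec (chi p)))"
  shows "\<forall>\<^sub>F v in nhds 0. hol2 (lineH H (\<lambda>z. chi (lin v z))) (bidisc 2) \<and> nash2 (lineH H (\<lambda>z. chi (lin v z))) 2 \<and>
    real_diag (lineH H (\<lambda>z. chi (lin v z))) 2"
    "((\<lambda>x. diag_value H (chi x)) \<longlongrightarrow> diag_value H (chi p)) (nhds p)"
proof -
  obtain D where D: "open D" "join (chi p) (cnj_vec (chi p)) \<in> D" "nash_algebraic_on H D"
    using H(2) unfolding nash_algebraic_at_def by blast
  have "\<forall>\<^sub>F q in nhds (p, p). join (chi (fst q)) (cnj_vec (chi (snd q))) \<in> D"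
    by (rule topological_tendstoD[OF join_tendsto D(1,2)])
  note inD = line_eventually2[OF chart this]
  have "filterlim (\<lambda>x. (chi x, chi x)) (nhds (chi p, chi p)) (nhds p)" by (intro tendsto_Pair chi_tendsto)
  from filterlim_iff[THEN iffD1, OF this] H(1)[unfolded hermitian_symmetric_at_def]
  have "\<forall>\<^sub>F x in nhds p. cnj (H (join (chi x) (cnj_vec (chi x)))) = H (join (chi x) (cnj_vec (chi x)))" by fastforce
  from inD line_eventually[OF chart this] chi_line
  show "\<forall>\<^sub>F v in nhds 0. hol2 (lineH H (\<lambda>z. chi (lin v z))) (bidisc 2) \<and> nash2 (lineH H (\<lambda>z. chi (lin v z))) 2 \<and>
    real_diag (lineH H (\<lambda>z. chi (lin v z))) 2"
  proof eventually_elim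
    case (elim v)
    have "real_diag (lineH H (\<lambda>z. chi (lin v z))) 2"
      using elim(2) unfolding real_diag_def lineH_def by (simp add: Reals_cnj_iff)
    thus ?case using lineH_nash[OF D(3,1), of "\<lambda>z. chi (lin v z)"] elim(1,3) by blast
  qed
  have "continuous_on D H" using D(3) cholomorphic_imp_continuous_on by (auto simp: nash_algebraic_on_def)
  hence "(H \<longlongrightarrow> H (join (chi p) (cnj_vec (chi p)))) (nhds (join (chi p) (cnj_vec (chi p))))"
    by (rule tendsto_nhds_if_continuous[OF _ D(1,2)])
  moreover have "((\<lambda>x. join (chi x) (cnj_vec (chi x))) \<longlongrightarrow> join (chi p) (cnj_vec (chi p))) (nhds p)"
    using filterlim_compose[OF join_tendsto, of "\<lambda>x. (x, x)" "nhds p"] tendsto_Pair[OF filterlim_ident filterlim_ident, of p] by simp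
  ultimately have "((\<lambda>x. H (join (chi x) (cnj_vec (chi x)))) \<longlongrightarrow> H (join (chi p) (cnj_vec (chi p)))) (nhds p)"
    by (rule filterlim_compose)
  thus "((\<lambda>x. diag_value H (chi x)) \<longlongrightarrow> diag_value H (chi p)) (nhds p)" unfolding diag_value_def by (rule tendsto_Re)
qed

lemma H_axis:
  assumes H: "no_pluriharmonic_terms H" and 0: "chi p = 0"
  shows "\<forall>\<^sub>F v in nhds 0. \<forall>z\<in>ball 0 2. lineH H (\<lambda>z. chi (lin v z)) z 0 = lineH H (\<lambda>z. chi (lin v z)) 0 0"
proof -
  have "\<forall>\<^sub>F z in nhds (chi p). H (join z 0) = H (join 0 0)" using H 0 by (simp add: no_pluriharmonic_terms_def)
  with filterlim_iff[THEN iffD1, OF chi_tendsto] have "\<forall>\<^sub>F x in nhds p. H (join (chi x) 0) = H (join 0 0)" by blast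
  from line_eventually[OF chart this] show ?thesis
    by eventually_elim (simp add: lineH_def line_0[OF chart] 0 cnj_vec_0)
qed

lemma hermitian_rank_line:
  assumes "hermitian_rank A p b h"
  shows "\<forall>\<^sub>F v in nhds 0. \<exists>h'. hol2 h' (bidisc 2) \<and> nash2 h' 2 \<and> (\<forall>z\<in>ball 0 2. h' z (cnj z) = of_real (h (lin v z))) \<and>
    (b --> (\<forall>z. h' z 0 = h' 0 0))"
proof -
  obtain k a0 a f where f: "\<forall>j<k. germ_at p (f j) \<in> hol_germs A p \<and> (b --> f j p = 0)"
    "\<forall>\<^sub>F x in nhds p. h x = a0 + (\<Sum>j<(k::nat). a j * (cmod (f j x))\<^sup>2)"
    using assms unfolding hermitian_rank_def by (elim exE conjE) (rule that)
  have "\<forall>\<^sub>F v in nhds 0. \<forall>j\<in>{..<k}. (\<lambda>z. f j (lin v z)) holomorphic_on ball 0 2"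
    by (rule eventually_ball_finite) (use f(1) hol_germs_line(1)[OF charts loc] in auto)
  with line_eventually[OF chart f(2)] show ?thesis
  proof eventually_elim
    case (elim v)
    define h' where "h' = hermitian_sum k a0 a (\<lambda>j z. f j (lin v z))"
    have "hol2 h' (bidisc 2)" "nash2 h' 2" unfolding h'_def using elim(2) by (auto intro!: hermitian_sum_nash)
    moreover have "h' z (cnj z) = of_real (h (lin v z))" if "z \<in> ball 0 2" for z
      unfolding h'_def hermitian_sum_dv using elim(1) that by simp
    moreover have "h' z 0 = h' 0 0" if b for z
      using f(1) that unfolding h'_def hermitian_sum_def by (simp add: line_0[OF chart])
    ultimately show ?case by blast
  qed
qed

lemma lineH_upow: "upow J (\<lambda>j. lineH (H j) c) \<mu> z = (\<Prod>j\<in>J. real_power (diag_value (H j) (c z)) (\<mu> j))"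
  by (simp add: upow_def lineH_def diag_value_def)

lemma lineH_ratp: "ratp P Q {0..<k1} {k1..<k1 + k2} (\<lambda>j. lineH (H j) c) \<mu> z = ratpow P Q k1 k2 \<mu> H (c z)"
  by (simp add: ratp_def ratpow_def lineH_upow Let_def)

context
  fixes P Q :: "real poly" and k1 k2 :: nat and \<mu> :: "nat => real" and H :: "nat => complex ^ ('m + 'm) => complex"
    and \<kappa> :: nat and \<nu> :: "nat => real" and h :: "nat => 'a => real" and b :: bool
  assumes H: "!!j. j < k1 + k2 ==> hermitian_symmetric_at (H j) (chi p) \<and> nash_algebraic_at (H j) (join (chi p) (cnj_vec (chi p)))"
    and defined: "\<forall>\<^sub>F x in nhds p. ratpow_defined Q k1 k2 \<mu> H (chi x)"
    and h: "!!j. j < \<kappa> ==> hermitian_rank A p b (h j) \<and> (\<forall>\<^sub>F x in nhds p. power_defined (h j x) (\<nu> j))"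
begin

text \<open>What a short line provides to the theorems on the disc: \<open>F\<close> and \<open>h'\<close> are the extensions of the \<open>H j\<close> and \<open>h j\<close>, and \<open>y\<close> is the power product.\<close>

definition disc_datum where
  "disc_datum F h' y \<longleftrightarrow> pdata {0..<k1} F \<mu> 2 \<and> pdata {k1..<k1 + k2} F \<mu> 2 \<and> pdata {..<\<kappa>} h' \<nu> 2 \<and>
     (\<forall>j\<in>{0..<k1} \<union> {k1..<k1 + k2}. nash2 (F j) 2) \<and> (\<forall>j\<in>{..<\<kappa>}. nash2 (h' j) 2) \<and>
     (\<forall>z\<in>ball 0 2. poly Q (upow {0..<k1} F \<mu> z) ~= 0) \<and>
     (\<forall>z\<in>ball 0 2. upow {..<\<kappa>} h' \<nu> z = y z) \<and> (b --> (\<forall>j\<in>{..<\<kappa>}. \<forall>z\<in>ball 0 2. h' j z 0 = h' j 0 0))"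

lemma disc_datumD:
  assumes "disc_datum F h' y"
  shows "pdata {0..<k1} F \<mu> 2" "pdata {k1..<k1 + k2} F \<mu> 2" "pdata {..<\<kappa>} h' \<nu> 2"
    "\<forall>j\<in>{0..<k1} \<union> {k1..<k1 + k2}. nash2 (F j) 2" "\<forall>j\<in>{..<\<kappa>}. nash2 (h' j) 2"
    "\<forall>z\<in>ball 0 2. poly Q (upow {0..<k1} F \<mu> z) ~= 0" "\<forall>z\<in>ball 0 2. upow {..<\<kappa>} h' \<nu> z = y z"
    "b --> (\<forall>j\<in>{..<\<kappa>}. \<forall>z\<in>ball 0 2. h' j z 0 = h' j 0 0)"
  using assms unfolding disc_datum_def by blast+

lemma disc_data:
  "\<forall>\<^sub>F v in nhds 0. \<exists>h'. disc_datum (\<lambda>j. lineH (H j) (\<lambda>z. chi (lin v z))) h' (\<lambda>z. \<Prod>j<\<kappa>. real_power (h j (lin v z)) (\<nu> j))"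
proof -
  have "\<forall>\<^sub>F v in nhds 0. \<forall>j\<in>{..<k1 + k2}. hol2 (lineH (H j) (\<lambda>z. chi (lin v z))) (bidisc 2) \<and>
      nash2 (lineH (H j) (\<lambda>z. chi (lin v z))) 2 \<and> real_diag (lineH (H j) (\<lambda>z. chi (lin v z))) 2"
    by (rule eventually_ball_finite) (use H_line(1) H in auto)
  moreover have "\<forall>\<^sub>F v in nhds 0. \<forall>j\<in>{..<\<kappa>}. \<exists>h'. hol2 h' (bidisc 2) \<and> nash2 h' 2 \<and>
      (\<forall>z\<in>ball 0 2. h' z (cnj z) = of_real (h j (lin v z))) \<and> (b --> (\<forall>z. h' z 0 = h' 0 0))"
    by (rule eventually_ball_finite) (use hermitian_rank_line h in auto)
  moreover have "\<forall>\<^sub>F v in nhds 0. \<forall>j\<in>{..<\<kappa>}. \<forall>z\<in>ball 0 2. power_defined (h j (lin v z)) (\<nu> j)"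
    by (rule eventually_ball_finite) (use line_eventually[OF chart] h in auto)
  moreover note line_eventually[OF chart defined]
  ultimately show ?thesis
  proof eventually_elim
    case (elim v)
    define F where "F = (\<lambda>j. lineH (H j) (\<lambda>z. chi (lin v z)))"
    obtain h' where h': "\<forall>j\<in>{..<\<kappa>}. hol2 (h' j) (bidisc 2) \<and> nash2 (h' j) 2 \<and>
      (\<forall>z\<in>ball 0 2. h' j z (cnj z) = of_real (h j (lin v z))) \<and> (b --> (\<forall>z. h' j z 0 = h' j 0 0))"
      using bchoice[OF elim(2)] by (elim exE) (rule that)
    have pd: "power_defined (dv (F j) z) (\<mu> j)" if "j < k1 + k2" "z \<in> ball 0 2" for j z
      unfolding F_def lineH_dv using elim(4) that by (simp add: ratpow_defined_def)
    have F: "hol2 (F j) (bidisc 2) \<and> real_diag (F j) 2" "nash2 (F j) 2" if "j < k1 + k2" for j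
      using elim(1) that by (auto simp: F_def)
    have 1: "pdata {0..<k1} F \<mu> 2" "pdata {k1..<k1 + k2} F \<mu> 2" using F pd unfolding pdata_def by auto
    have "pdata {..<\<kappa>} h' \<nu> 2" unfolding pdata_def real_diag_def using h' elim(3) by auto
    moreover have "\<forall>j\<in>{0..<k1} \<union> {k1..<k1 + k2}. nash2 (F j) 2" using F(2) by auto
    moreover have "\<forall>j\<in>{..<\<kappa>}. nash2 (h' j) 2" using h' by blast
    moreover have "\<forall>z\<in>ball 0 2. poly Q (upow {0..<k1} F \<mu> z) ~= 0"
      unfolding F_def lineH_upow using elim(4) by (simp add: ratpow_defined_def)
    moreover have "\<forall>z\<in>ball 0 2. upow {..<\<kappa>} h' \<nu> z = (\<Prod>j<\<kappa>. real_power (h j (lin v z)) (\<nu> j))"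
    proof
      fix z :: complex assume z: "z \<in> ball 0 2"
      have "dv (h' j) z = h j (lin v z)" if "j < \<kappa>" for j using h' that z by simp
      thus "upow {..<\<kappa>} h' \<nu> z = (\<Prod>j<\<kappa>. real_power (h j (lin v z)) (\<nu> j))" by (simp add: upow_def)
    qed
    moreover have "b --> (\<forall>j\<in>{..<\<kappa>}. \<forall>z\<in>ball 0 2. h' j z 0 = h' j 0 0)" using h' by blast
    ultimately have "disc_datum F h' (\<lambda>z. \<Prod>j<\<kappa>. real_power (h j (lin v z)) (\<nu> j))" using 1 unfolding disc_datum_def by (intro conjI)
    thus ?case unfolding F_def by blast
  qed
qed

lemma exp_germ:
  assumes ext: "\<forall>\<^sub>F v in nhds 0. \<exists>W. hol2 W (bidisc 2) \<and> (\<forall>z\<in>ball 0 2. W z (cnj z) = of_real (ratpow P Q k1 k2 \<mu> H (chi (lin v z))))"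
    and eq: "\<forall>\<^sub>F x in nhds p. exp (ratpow P Q k1 k2 \<mu> H (chi x)) = (\<Prod>j<\<kappa>. real_power (h j x) (\<nu> j))"
    and axis: "b \<or> (chi p = 0 \<and> (\<forall>j<k1 + k2. no_pluriharmonic_terms (H j)))"
  shows "germ_at p (\<lambda>x. exp (ratpow P Q k1 k2 \<mu> H (chi x))) \<in> const_germs p"
proof (rule const_germ_if_const_on_lines[OF chart])
  have "\<forall>\<^sub>F v in nhds 0. b \<or> (\<forall>j\<in>{..<k1 + k2}. \<forall>z\<in>ball 0 2. lineH (H j) (\<lambda>z. chi (lin v z)) z 0 = lineH (H j) (\<lambda>z. chi (lin v z)) 0 0)"
  proof (cases b)
    case False
    have "\<forall>\<^sub>F v in nhds 0. \<forall>j\<in>{..<k1 + k2}. \<forall>z\<in>ball 0 2. lineH (H j) (\<lambda>z. chi (lin v z)) z 0 = lineH (H j) (\<lambda>z. chi (lin v z)) 0 0"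
      by (rule eventually_ball_finite) (use H_axis axis False in auto)
    thus ?thesis by eventually_elim blast
  qed simp
  with disc_data ext line_eventually[OF chart eq]
  show "\<forall>\<^sub>F v in nhds 0. exp (ratpow P Q k1 k2 \<mu> H (chi (lin v 1))) = exp (ratpow P Q k1 k2 \<mu> H (chi p))"
  proof eventually_elim
    case (elim v)
    define F where "F = (\<lambda>j. lineH (H j) (\<lambda>z. chi (lin v z)))"
    obtain h' where "disc_datum F h' (\<lambda>z. \<Prod>j<\<kappa>. real_power (h j (lin v z)) (\<nu> j))" using elim(1) F_def by blast
    note h' = disc_datumD[OF this]
    obtain W where W: "hol2 W (bidisc 2)" "\<forall>z\<in>ball 0 2. W z (cnj z) = of_real (ratpow P Q k1 k2 \<mu> H (chi (lin v z)))"
      using elim(2) by blast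
    have rp: "ratp P Q {0..<k1} {k1..<k1 + k2} F \<mu> z = ratpow P Q k1 k2 \<mu> H (chi (lin v z))" for z
      unfolding F_def by (rule lineH_ratp)
    have ax: "(\<forall>j\<in>{0..<k1} \<union> {k1..<k1 + k2}. \<forall>z\<in>ball 0 2. F j z 0 = F j 0 0) \<or> (\<forall>j\<in>{..<\<kappa>}. \<forall>z\<in>ball 0 2. h' j z 0 = h' j 0 0)"
      using elim(4)
    proof
      assume b thus ?thesis using h'(8) by blast
    next
      assume "\<forall>j\<in>{..<k1 + k2}. \<forall>z\<in>ball 0 2. lineH (H j) (\<lambda>z. chi (lin v z)) z 0 = lineH (H j) (\<lambda>z. chi (lin v z)) 0 0"
      hence "\<forall>j\<in>{..<k1 + k2}. \<forall>z\<in>ball 0 2. F j z 0 = F j 0 0" unfolding F_def .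
      moreover have "{0..<k1} \<union> {k1..<k1 + k2} \<subseteq> {..<k1 + k2}" by auto
      ultimately show ?thesis by blast
    qed
    have "ratp P Q {0..<k1} {k1..<k1 + k2} F \<mu> 1 = ratp P Q {0..<k1} {k1..<k1 + k2} F \<mu> 0"
      by (rule exp_on_disc[OF _ h'(1-3) _ _ _ W(1) _ _ ax]) (use h'(4-7) W(2) elim(3) rp in auto)
    thus ?case unfolding rp line_0[OF chart] by simp
  qed
qed

lemma log_germ:
  assumes ext: "\<forall>\<^sub>F v in nhds 0. \<exists>W. hol2 W (bidisc 2) \<and> (\<forall>z\<in>ball 0 2. W z (cnj z) = of_real (\<Prod>j<\<kappa>. real_power (h j (lin v z)) (\<nu> j)))"
    and eq: "\<forall>\<^sub>F x in nhds p. ln (ratpow P Q k1 k2 \<mu> H (chi x)) = (\<Prod>j<\<kappa>. real_power (h j x) (\<nu> j))"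
    and pos: "\<forall>\<^sub>F x in nhds p. ratpow P Q k1 k2 \<mu> H (chi x) > 0" and axis: b
  shows "germ_at p (\<lambda>x. ln (ratpow P Q k1 k2 \<mu> H (chi x))) \<in> const_germs p"
proof (rule const_germ_if_const_on_lines[OF chart])
  from disc_data ext line_eventually[OF chart eq] line_eventually[OF chart pos]
  show "\<forall>\<^sub>F v in nhds 0. ln (ratpow P Q k1 k2 \<mu> H (chi (lin v 1))) = ln (ratpow P Q k1 k2 \<mu> H (chi p))"
  proof eventually_elim
    case (elim v)
    define F where "F = (\<lambda>j. lineH (H j) (\<lambda>z. chi (lin v z)))"
    obtain h' where "disc_datum F h' (\<lambda>z. \<Prod>j<\<kappa>. real_power (h j (lin v z)) (\<nu> j))" using elim(1) F_def by blast
    note h' = disc_datumD[OF this]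
    obtain W where W: "hol2 W (bidisc 2)" "\<forall>z\<in>ball 0 2. W z (cnj z) = of_real (\<Prod>j<\<kappa>. real_power (h j (lin v z)) (\<nu> j))"
      using elim(2) by blast
    have rp: "ratp P Q {0..<k1} {k1..<k1 + k2} F \<mu> z = ratpow P Q k1 k2 \<mu> H (chi (lin v z))" for z
      unfolding F_def by (rule lineH_ratp)
    have y: "upow {..<\<kappa>} h' \<nu> z = ln (ratpow P Q k1 k2 \<mu> H (chi (lin v z)))" if "z \<in> ball 0 2" for z
      using h'(7) elim(3) that by simp
    have "upow {..<\<kappa>} h' \<nu> 1 = upow {..<\<kappa>} h' \<nu> 0"
    proof (rule log_on_disc[OF _ h'(1-3) _ _ _ W(1)])
      show "exp (upow {..<\<kappa>} h' \<nu> z) = ratp P Q {0..<k1} {k1..<k1 + k2} F \<mu> z" if "z \<in> ball 0 2" for z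
        unfolding y[OF that] rp using elim(4) that by simp
      show "h' j z 0 = h' j 0 0" if "j \<in> {..<\<kappa>}" "z \<in> ball 0 2" for j z using h'(8) axis that by blast
    qed (use h'(4-7) W(2) in auto)
    thus ?case using y[of 1] y[of 0] line_0[OF chart] by simp
  qed
qed

end

end

lemma real_analytic_near_tendsto:
  fixes A :: "('a::{second_countable_topology,t2_space}, 'n::finite) chart set"
  assumes charts: "\<forall>c\<in>A. is_chart c" and g: "real_analytic_near A p g"
  shows "(g \<longlongrightarrow> g p) (nhds p)"
proof -
  obtain U \<phi> where U: "(U, \<phi>) \<in> A" "p \<in> U" "real_analytic_at (g \<circ> inv_into U \<phi>) (\<phi> p)"
    using g unfolding real_analytic_near_def by blast
  have c: "is_chart (U, \<phi>)" using charts U(1) by blast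
  have "((\<lambda>x. (g \<circ> inv_into U \<phi>) (\<phi> x)) \<longlongrightarrow> (g \<circ> inv_into U \<phi>) (\<phi> p)) (nhds p)"
    by (rule filterlim_compose[OF real_analytic_continuous[OF U(3)] tendsto_nhds_if_continuous[OF is_chartD(3,1)[OF c] U(2)]])
  moreover have "\<forall>\<^sub>F x in nhds p. (g \<circ> inv_into U \<phi>) (\<phi> x) = g x"
    by (rule eventually_mono[OF eventually_nhds_in_open[OF is_chartD(1)[OF c] U(2)]]) (simp add: is_chartD(5)[OF c])
  ultimately show ?thesis using tendsto_cong is_chartD(5)[OF c U(2)] by fastforce
qed

lemma real_analytic_near_lines:
  fixes A :: "('a::{second_countable_topology,t2_space}, 'n::finite) chart set"
  assumes A: "complex_manifold A" and g: "real_analytic_near A p g"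
  shows "\<exists>U \<phi>. local_coordinates A p (U, \<phi>) \<and>
    (\<forall>\<^sub>F v in nhds 0. \<exists>W. hol2 W (bidisc 2) \<and> (\<forall>z\<in>ball 0 2. W z (cnj z) = of_real (g (line U \<phi> p v z))))"
proof -
  obtain U \<phi> where U: "(U, \<phi>) \<in> A" "p \<in> U" "real_analytic_at (g \<circ> inv_into U \<phi>) (\<phi> p)"
    using g unfolding real_analytic_near_def by blast
  have "local_coordinates A p (U, \<phi>)" using A U(1,2) by (auto simp: local_coordinates_def complex_manifold_def)
  thus ?thesis using real_analytic_line[OF U(3)] by (auto simp: line_def)
qed

section \<open>Non-existence of the relations\<close>

lemma holomorphic_polynomial_line:
  assumes "holomorphic_polynomial f" shows "\<exists>X. \<forall>z. f (a + z *s v) = poly X z"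
proof -
  obtain S c where f: "!!z. f z = (\<Sum>k\<in>S. c k * monomial_fun k z)" using assms unfolding holomorphic_polynomial_def by blast
  show ?thesis
    by (rule exI[of _ "\<Sum>k\<in>S. smult (c k) (\<Prod>i\<in>UNIV. [:a $ i, v $ i:] ^ k i)"])
      (simp add: f poly_sum poly_prod monomial_fun_def)
qed

lemma ratpow_diag: "ratpow [:1:] [:1:] 0 1 (\<lambda>_. 1) (\<lambda>_. H) z = diag_value H z"
  by (simp add: ratpow_def Let_def real_power_def)

lemma ratpow_defined_diag: "ratpow_defined [:1:] 0 1 (\<lambda>_. 1) (\<lambda>_. H) z"
  by (auto simp: ratpow_defined_def power_defined_def)

context germs_along_lines
begin

lemma negative_power_germ:
  assumes chi0: "chi p = 0" and f: "!!i. holomorphic_polynomial (f i)" "!!i. \<forall>\<^sub>F x in nhds p. chi x $ i = f i (\<phi> x)" and \<alpha>: "\<alpha> < 0"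
    and \<psi>: "!!j. j < k ==> germ_at p (\<psi> j) \<in> hol_germs A p"
    and eq: "\<forall>\<^sub>F x in nhds p. (1 + (\<Sum>i\<in>UNIV. a i * (cmod (chi x $ i))\<^sup>2)) powr \<alpha> = (\<Sum>j<(k::nat). b j * (cmod (\<psi> j x))\<^sup>2)"
  shows "germ_at p (\<lambda>x. (1 + (\<Sum>i\<in>UNIV. a i * (cmod (chi x $ i))\<^sup>2)) powr \<alpha>) \<in> const_germs p"
proof (rule const_germ_if_const_on_lines[OF chart])
  have 1: "\<forall>\<^sub>F v in nhds 0. \<forall>j\<in>{..<k}. (\<lambda>z. \<psi> j (lin v z)) holomorphic_on ball 0 2"
    by (rule eventually_ball_finite) (use \<psi> hol_germs_line(1)[OF charts loc] in auto)
  have 2: "\<forall>\<^sub>F v in nhds 0. \<forall>i\<in>UNIV. \<forall>z\<in>ball 0 2. chi (lin v z) $ i = f i (\<phi> (lin v z))"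
    by (rule eventually_ball_finite[OF finite]) (use line_eventually[OF chart f(2)] in blast)
  have 3: "\<forall>\<^sub>F v in nhds 0. \<forall>z\<in>ball 0 2. \<phi> p + z *s v \<in> \<phi> ` U"
    by (rule affine_eventually[OF eventually_nhds_in_open[OF is_chartD(2)[OF chart(1)]]]) (use chart(2) in blast)
  from 1 2 3 line_eventually[OF chart eq]
  show "\<forall>\<^sub>F v in nhds 0. (1 + (\<Sum>i\<in>UNIV. a i * (cmod (chi (lin v 1) $ i))\<^sup>2)) powr \<alpha> =
    (1 + (\<Sum>i\<in>UNIV. a i * (cmod (chi p $ i))\<^sup>2)) powr \<alpha>"
  proof eventually_elim
    case (elim v)
    have "\<forall>i. \<exists>X. \<forall>z. f i (\<phi> p + z *s v) = poly X z" using holomorphic_polynomial_line[OF f(1)] by blast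
    from choice[OF this] obtain X where X: "\<forall>i. \<forall>z. f i (\<phi> p + z *s v) = poly (X i) z" by (elim exE) (rule that)
    have cX: "chi (lin v z) $ i = poly (X i) z" if z: "z \<in> ball 0 2" for z i
    proof -
      have "\<phi> (lin v z) = \<phi> p + z *s v" unfolding line_def by (rule f_inv_into_f[OF bspec[OF elim(3) z]])
      thus ?thesis using elim(2) z X by simp
    qed
    have "(\<Sum>i\<in>UNIV. a i * (cmod (poly (X i) 1))\<^sup>2) = 0"
    proof (rule negative_power_on_disc[where \<psi> = "\<lambda>j z. \<psi> j (lin v z)" and n = k and b = b and \<alpha> = \<alpha>])
      show "poly (X i) 0 = 0" for i using cX[of 0 i] chi0 line_0[OF chart] by simp
      show "(\<lambda>z. \<psi> j (lin v z)) holomorphic_on ball 0 2" if "j < k" for j using elim(1) that by simp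
      show "(1 + (\<Sum>i\<in>UNIV. a i * (cmod (poly (X i) z))\<^sup>2)) powr \<alpha> = (\<Sum>j<k. b j * (cmod (\<psi> j (lin v z)))\<^sup>2)" if "z \<in> ball 0 2" for z
        using bspec[OF elim(4) that] unfolding cX[OF that] .
    qed (use \<alpha> in auto)
    thus ?case using cX[of 1] chi0 by simp
  qed
qed

lemma exp_power_product_germ:
  assumes H: "!!j. j < k1 + k2 ==> hermitian_symmetric_at (H j) (chi p) \<and> nash_algebraic_at (H j) (join (chi p) (cnj_vec (chi p)))"
    and defined: "\<forall>\<^sub>F x in nhds p. ratpow_defined Q k1 k2 \<mu> H (chi x)"
    and ext: "\<forall>\<^sub>F v in nhds 0. \<exists>W. hol2 W (bidisc 2) \<and> (\<forall>z\<in>ball 0 2. W z (cnj z) = of_real (ratpow P Q k1 k2 \<mu> H (chi (lin v z))))"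
    and mem: "germ_at p (\<lambda>x. exp (ratpow P Q k1 k2 \<mu> H (chi x))) \<in> power_products A p L \<kappa> \<nu>"
    and rank: "!!h. germ_at p h \<in> L ==> hermitian_rank A p b h"
    and axis: "b \<or> (chi p = 0 \<and> (\<forall>j<k1 + k2. no_pluriharmonic_terms (H j)))"
  shows "germ_at p (\<lambda>x. exp (ratpow P Q k1 k2 \<mu> H (chi x))) \<in> const_germs p"
proof -
  obtain h where h: "\<forall>\<^sub>F x in nhds p. exp (ratpow P Q k1 k2 \<mu> H (chi x)) = (\<Prod>j<\<kappa>. real_power (h j x) (\<nu> j))"
    "\<forall>j<\<kappa>. germ_at p (h j) \<in> L \<and> (\<forall>\<^sub>F x in nhds p. power_defined (h j x) (\<nu> j))"
    using power_productsD[OF mem] by (elim exE conjE) (rule that)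
  show ?thesis by (rule exp_germ[OF H defined _ ext h(1) axis]) (use h(2) rank in auto)
qed

lemma diag_value_ext:
  assumes H: "hermitian_symmetric_at H (chi p)" "nash_algebraic_at H (join (chi p) (cnj_vec (chi p)))"
  shows "\<forall>\<^sub>F v in nhds 0. \<exists>W. hol2 W (bidisc 2) \<and> (\<forall>z\<in>ball 0 2. W z (cnj z) = of_real (diag_value H (chi (lin v z))))"
  using H_line(1)[OF H]
proof eventually_elim
  case (elim v)
  have "lineH H (\<lambda>z. chi (lin v z)) z (cnj z) = of_real (diag_value H (chi (lin v z)))" if "z \<in> ball 0 2" for z
  proof -
    have "lineH H (\<lambda>z. chi (lin v z)) z (cnj z) = of_real (dv (lineH H (\<lambda>z. chi (lin v z))) z)"
      by (rule real_diagD[of _ 2]) (use elim that in auto)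
    thus ?thesis unfolding lineH_dv .
  qed
  thus ?case using elim by blast
qed

end

text \<open>The real-analyticity of the power product is what extends \<open>log T\<close> holomorphically off the diagonal, so its chart is used.\<close>

lemma log_power_product_germ:
  fixes A :: "('a::{second_countable_topology,t2_space}, 'n::finite) chart set" and chi :: "'a => complex ^ 'm::finite"
  assumes A: "complex_manifold A" and chi: "!!i. germ_at p (\<lambda>x. chi x $ i) \<in> hol_germs A p"
    and H: "!!j. j < k1 + k2 ==> hermitian_symmetric_at (H j) (chi p) \<and> nash_algebraic_at (H j) (join (chi p) (cnj_vec (chi p)))"
    and defined: "\<forall>\<^sub>F x in nhds p. ratpow_defined Q k1 k2 \<mu> H (chi x)"
    and pos: "\<forall>\<^sub>F x in nhds p. ratpow P Q k1 k2 \<mu> H (chi x) > 0"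
    and mem: "germ_at p (\<lambda>x. ln (ratpow P Q k1 k2 \<mu> H (chi x))) \<in> power_products A p (Lambda0 A p) \<kappa> \<nu>"
  shows "germ_at p (\<lambda>x. ln (ratpow P Q k1 k2 \<mu> H (chi x))) \<in> const_germs p"
proof -
  obtain h where h: "\<forall>\<^sub>F x in nhds p. ln (ratpow P Q k1 k2 \<mu> H (chi x)) = (\<Prod>j<\<kappa>. real_power (h j x) (\<nu> j))"
    "\<forall>j<\<kappa>. germ_at p (h j) \<in> Lambda0 A p \<and> (\<forall>\<^sub>F x in nhds p. power_defined (h j x) (\<nu> j))"
    "real_analytic_near A p (\<lambda>x. \<Prod>j<\<kappa>. real_power (h j x) (\<nu> j))"
    using power_productsD[OF mem] by (elim exE conjE) (rule that)
  obtain U \<phi> where U: "local_coordinates A p (U, \<phi>)"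
    "\<forall>\<^sub>F v in nhds 0. \<exists>W. hol2 W (bidisc 2) \<and> (\<forall>z\<in>ball 0 2. W z (cnj z) = of_real (\<Prod>j<\<kappa>. real_power (h j (line U \<phi> p v z)) (\<nu> j)))"
    using real_analytic_near_lines[OF A h(3)] by (elim exE conjE) (rule that)
  interpret germs_along_lines A p U \<phi> chi
    by unfold_locales (use A U(1) chi in \<open>auto simp: complex_manifold_def\<close>)
  show ?thesis
  proof (rule log_germ[where b = True, OF H defined _ U(2) h(1) pos])
    show "hermitian_rank A p True (h j) \<and> (\<forall>\<^sub>F x in nhds p. power_defined (h j x) (\<nu> j))" if "j < \<kappa>" for j
      using h(2) that hermitian_rank_Lambda0 by blast
  qed auto
qed

theorem theorem2p1:
  fixes A :: "('a::{second_countable_topology,t2_space}, 'n::finite) chart set"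
    and p :: 'a
    and chi :: "'a \<Rightarrow> complex ^ 'm::finite"
  assumes manifold: "complex_manifold A"
    and point: "p \<in> manifold_points A"
    and holomorphic: "\<And>i. germ_at p (\<lambda>x. chi x $ i) \<in> hol_germs A p"
    and nonconstant: "\<And>i. germ_at p (\<lambda>x. chi x $ i) \<notin> const_germs p"
  shows
    "(\<forall>U \<phi> (a :: 'm \<Rightarrow> real) (\<alpha> :: real).
        (\<forall>i. germ_at p (\<lambda>x. chi x $ i) \<in> hol_germs0 A p) \<and>
        local_coordinates A p (U, \<phi>) \<and>
        (\<forall>i. \<exists>f. holomorphic_polynomial f \<and>
                 germ_at p (\<lambda>x. chi x $ i) = germ_at p (\<lambda>x. f (\<phi> x))) \<and>
        (\<forall>i. a i \<noteq> 0) \<and> \<alpha> < 0 \<longrightarrow>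
        germ_at p (\<lambda>x. (1 + (\<Sum>i\<in>UNIV. a i * (cmod (chi x $ i))\<^sup>2)) powr \<alpha>)
          \<notin> Lambda A p - const_germs p)
     \<and>
     (\<forall>\<kappa>\<^sub>1 \<kappa>\<^sub>2 (H :: nat \<Rightarrow> complex ^ ('m + 'm) \<Rightarrow> complex) (\<mu>s :: nat \<Rightarrow> real) P Q.
        (\<forall>i. germ_at p (\<lambda>x. chi x $ i) \<in> hol_germs0 A p) \<and>
        (\<forall>j<\<kappa>\<^sub>1 + \<kappa>\<^sub>2. hermitian_symmetric_at (H j) 0 \<and> nash_algebraic_at (H j) (join 0 0) \<and>
                       no_pluriharmonic_terms (H j)) \<and>
        Q \<noteq> 0 \<and>
        (\<forall>\<^sub>F x in nhds p. ratpow_defined Q \<kappa>\<^sub>1 \<kappa>\<^sub>2 \<mu>s H (chi x)) \<and>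
        real_analytic_near A p (\<lambda>x. ratpow P Q \<kappa>\<^sub>1 \<kappa>\<^sub>2 \<mu>s H (chi x)) \<longrightarrow>
        (\<forall>\<mu>.
           germ_at p (\<lambda>x. exp (ratpow P Q \<kappa>\<^sub>1 \<kappa>\<^sub>2 \<mu>s H (chi x)))
             \<notin> powers A p (Lambda A p) \<mu> - const_germs p \<and>
           (ratpow P Q \<kappa>\<^sub>1 \<kappa>\<^sub>2 \<mu>s H (chi p) > 0 \<longrightarrow>
            germ_at p (\<lambda>x. ln (ratpow P Q \<kappa>\<^sub>1 \<kappa>\<^sub>2 \<mu>s H (chi x)))
              \<notin> powers A p (Lambda0 A p) \<mu> - const_germs p)))
     \<and>
     (\<forall>H :: complex ^ ('m + 'm) \<Rightarrow> complex.
        hermitian_symmetric_at H (chi p) \<and>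
        nash_algebraic_at H (join (chi p) (cnj_vec (chi p))) \<longrightarrow>
        (\<forall>\<mu>.
           germ_at p (\<lambda>x. exp (diag_value H (chi x)))
             \<notin> powers A p (Lambda0 A p) \<mu> - const_germs p \<and>
           (diag_value H (chi p) > 0 \<longrightarrow>
            germ_at p (\<lambda>x. ln (diag_value H (chi x)))
              \<notin> powers A p (Lambda0 A p) \<mu> - const_germs p)) \<and>
        (no_pluriharmonic_terms H \<and> (\<forall>i. germ_at p (\<lambda>x. chi x $ i) \<in> hol_germs0 A p) \<longrightarrow>
         (\<forall>\<kappa>\<ge>1. \<forall>\<nu> :: nat \<Rightarrow> real.
            germ_at p (\<lambda>x. exp (diag_value H (chi x)))
              \<notin> power_products A p (Lambda A p) \<kappa> \<nu> - const_germs p \<and>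
            (diag_value H (chi p) > 0 \<longrightarrow>
             germ_at p (\<lambda>x. ln (diag_value H (chi x)))
               \<notin> power_products A p (Lambda0 A p) \<kappa> \<nu> - const_germs p))))"
proof -
  have chartA: "\<forall>c\<in>A. is_chart c" using manifold by (simp add: complex_manifold_def)
  have chi0: "chi p = 0" if "\<forall>i. germ_at p (\<lambda>x. chi x $ i) \<in> hol_germs0 A p"
  proof -
    have "chi p $ i = 0" for i using hol_germs0D(2)[OF that[rule_format, of i]] .
    thus ?thesis by (simp add: Finite_Cartesian_Product.vec_eq_iff)
  qed
  show ?thesis
  proof (rule conjI[OF _ conjI], goal_cases)
    case 1 show ?case
    proof (intro allI impI notI, elim conjE DiffE)
      fix U \<phi> and a :: "'m => real" and \<alpha> :: real
      assume tilde: "\<forall>i. germ_at p (\<lambda>x. chi x $ i) \<in> hol_germs0 A p" and loc: "local_coordinates A p (U, \<phi>)"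
        and polys: "\<forall>i. \<exists>f. holomorphic_polynomial f \<and> germ_at p (\<lambda>x. chi x $ i) = germ_at p (\<lambda>x. f (\<phi> x))"
        and \<alpha>: "\<alpha> < 0"
        and mem: "germ_at p (\<lambda>x. (1 + (\<Sum>i\<in>UNIV. a i * (cmod (chi x $ i))\<^sup>2)) powr \<alpha>) \<in> Lambda A p"
        and nc: "germ_at p (\<lambda>x. (1 + (\<Sum>i\<in>UNIV. a i * (cmod (chi x $ i))\<^sup>2)) powr \<alpha>) \<notin> const_germs p"
      interpret germs_along_lines A p U \<phi> chi by unfold_locales (use chartA loc holomorphic in auto)
      obtain f where f: "\<forall>i. holomorphic_polynomial (f i) \<and> germ_at p (\<lambda>x. chi x $ i) = germ_at p (\<lambda>x. f i (\<phi> x))"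
        using choice[OF polys] by (elim exE) (rule that)
      obtain k b \<psi> where \<psi>: "\<forall>j<k. germ_at p (\<psi> j) \<in> hol_germs A p"
        "\<forall>\<^sub>F x in nhds p. (1 + (\<Sum>i\<in>UNIV. a i * (cmod (chi x $ i))\<^sup>2)) powr \<alpha> = (\<Sum>j<(k::nat). b j * (cmod (\<psi> j x))\<^sup>2)"
        using LambdaD[OF mem] by (elim exE conjE) (rule that)
      show False
        using nc negative_power_germ[OF chi0[OF tilde] _ _ \<alpha> _ \<psi>(2), of f] f \<psi>(1) by (auto simp: germ_at_eq_iff)
    qed
  next
    case 2 show ?case
    proof (intro allI impI, elim conjE)
      fix k1 k2 :: nat and H :: "nat => complex ^ ('m + 'm) => complex" and \<mu>s :: "nat => real" and P Q :: "real poly" and \<mu> :: real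
      assume tilde: "\<forall>i. germ_at p (\<lambda>x. chi x $ i) \<in> hol_germs0 A p"
        and H: "\<forall>j<k1 + k2. hermitian_symmetric_at (H j) 0 \<and> nash_algebraic_at (H j) (join 0 0) \<and> no_pluriharmonic_terms (H j)"
        and defined: "\<forall>\<^sub>F x in nhds p. ratpow_defined Q k1 k2 \<mu>s H (chi x)"
        and ra: "real_analytic_near A p (\<lambda>x. ratpow P Q k1 k2 \<mu>s H (chi x))"
      have H': "hermitian_symmetric_at (H j) (chi p) \<and> nash_algebraic_at (H j) (join (chi p) (cnj_vec (chi p)))" if "j < k1 + k2" for j
        using H that chi0[OF tilde] by (simp add: cnj_vec_0)
      obtain U \<phi> where U: "local_coordinates A p (U, \<phi>)"
        "\<forall>\<^sub>F v in nhds 0. \<exists>W. hol2 W (bidisc 2) \<and> (\<forall>z\<in>ball 0 2. W z (cnj z) = of_real (ratpow P Q k1 k2 \<mu>s H (chi (line U \<phi> p v z))))"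
        using real_analytic_near_lines[OF manifold ra] by (elim exE conjE) (rule that)
      interpret germs_along_lines A p U \<phi> chi by unfold_locales (use chartA U(1) holomorphic in auto)
      have "germ_at p (\<lambda>x. exp (ratpow P Q k1 k2 \<mu>s H (chi x))) \<notin> powers A p (Lambda A p) \<mu> - const_germs p"
        using exp_power_product_germ[OF H' defined U(2), of "Lambda A p" 1 "\<lambda>_. \<mu>" False] hermitian_rank_Lambda H chi0[OF tilde]
        by (auto simp: powers_def)
      moreover have "germ_at p (\<lambda>x. ln (ratpow P Q k1 k2 \<mu>s H (chi x))) \<notin> powers A p (Lambda0 A p) \<mu> - const_germs p"
        if "ratpow P Q k1 k2 \<mu>s H (chi p) > 0"
        using log_power_product_germ[OF manifold holomorphic H' defined order_tendstoD(1)[OF real_analytic_near_tendsto[OF chartA ra] that], of 1 "\<lambda>_. \<mu>"]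
        by (auto simp: powers_def)
      ultimately show "germ_at p (\<lambda>x. exp (ratpow P Q k1 k2 \<mu>s H (chi x))) \<notin> powers A p (Lambda A p) \<mu> - const_germs p \<and>
             (ratpow P Q k1 k2 \<mu>s H (chi p) > 0 -->
              germ_at p (\<lambda>x. ln (ratpow P Q k1 k2 \<mu>s H (chi x))) \<notin> powers A p (Lambda0 A p) \<mu> - const_germs p)" by blast
    qed
  next
    case 3 show ?case
    proof (intro allI impI, elim conjE, goal_cases)
      case (1 H)
      note H = 1
      obtain U \<phi> where U: "(U, \<phi>) \<in> A" "p \<in> U" using point by (auto simp: manifold_points_def)
      interpret germs_along_lines A p U \<phi> chi
        by unfold_locales (use manifold U holomorphic in \<open>auto simp: local_coordinates_def complex_manifold_def\<close>)
      have exp: "germ_at p (\<lambda>x. exp (diag_value H (chi x))) \<in> const_germs p"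
        if "germ_at p (\<lambda>x. exp (diag_value H (chi x))) \<in> power_products A p L \<kappa> \<nu>"
          "!!h. germ_at p h \<in> L ==> hermitian_rank A p b h" "b \<or> (chi p = 0 \<and> no_pluriharmonic_terms H)" for L \<kappa> \<nu> b
        by (rule exp_power_product_germ[where P = "[:1:]" and Q = "[:1:]" and ?k1.0 = 0 and ?k2.0 = 1 and \<mu> = "\<lambda>_. 1" and H = "\<lambda>_. H" and L = L and \<kappa> = \<kappa> and \<nu> = \<nu> and b = b, unfolded ratpow_diag])
          (use H that diag_value_ext[OF H] in \<open>auto simp: ratpow_defined_diag[unfolded One_nat_def]\<close>)
      have log: "germ_at p (\<lambda>x. ln (diag_value H (chi x))) \<in> const_germs p"
        if "germ_at p (\<lambda>x. ln (diag_value H (chi x))) \<in> power_products A p (Lambda0 A p) \<kappa> \<nu>" "diag_value H (chi p) > 0" for \<kappa> \<nu>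
        by (rule log_power_product_germ[where P = "[:1:]" and Q = "[:1:]" and ?k1.0 = 0 and ?k2.0 = 1 and \<mu> = "\<lambda>_. 1" and H = "\<lambda>_. H" and \<kappa> = \<kappa> and \<nu> = \<nu>, OF manifold holomorphic, unfolded ratpow_diag])
          (use H that order_tendstoD(1)[OF H_line(2)[OF H] that(2)] in \<open>auto simp: ratpow_defined_diag[unfolded One_nat_def]\<close>)
      show ?case
      proof (intro conjI allI impI notI; elim conjE DiffE)
        fix \<mu>
        assume "germ_at p (\<lambda>x. exp (diag_value H (chi x))) \<in> powers A p (Lambda0 A p) \<mu>" "germ_at p (\<lambda>x. exp (diag_value H (chi x))) \<notin> const_germs p"
        thus False using exp[of "Lambda0 A p" 1 "\<lambda>_. \<mu>" True] hermitian_rank_Lambda0 by (auto simp: powers_def)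
      next
        fix \<mu>
        assume "diag_value H (chi p) > 0" "germ_at p (\<lambda>x. ln (diag_value H (chi x))) \<in> powers A p (Lambda0 A p) \<mu>" "germ_at p (\<lambda>x. ln (diag_value H (chi x))) \<notin> const_germs p"
        thus False using log[of 1 "\<lambda>_. \<mu>"] by (auto simp: powers_def)
      next
        fix \<kappa> \<nu>
        assume "no_pluriharmonic_terms H" "\<forall>i. germ_at p (\<lambda>x. chi x $ i) \<in> hol_germs0 A p"
          "germ_at p (\<lambda>x. exp (diag_value H (chi x))) \<in> power_products A p (Lambda A p) \<kappa> \<nu>" "germ_at p (\<lambda>x. exp (diag_value H (chi x))) \<notin> const_germs p"
        thus False using exp[of "Lambda A p" \<kappa> \<nu> False] hermitian_rank_Lambda chi0 by auto
      next
        fix \<kappa> \<nu>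
        assume "diag_value H (chi p) > 0" "germ_at p (\<lambda>x. ln (diag_value H (chi x))) \<in> power_products A p (Lambda0 A p) \<kappa> \<nu>" "germ_at p (\<lambda>x. ln (diag_value H (chi x))) \<notin> const_germs p"
        thus False using log[of \<kappa> \<nu>] by auto
      qed
    qed
  qed
qed

end
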